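(* Let $\Sigma^+$ be a topologically mixing one-sided countable Markov shift with finite Gurevich entropy, let $\phi$ be a $\theta$-weakly H\"older continuous SPR potential with $\sup\phi<\infty$, and let $m$ be the unique equilibrium measure of $\phi$. Let $\beta>0$ with $e^{-\beta}\le\theta$. (1) For every $\psi\in\mathcal H_\beta$, $\sigma_m(\psi)=0$ if and only if $\psi=r-r\circ\sigma+c$ with $c\in\mathbb R$ and $r$ continuous (possibly unbounded). (2) If $\psi,\varphi\in\mathcal H_\beta$ and $\psi-\varphi=r-r\circ\sigma+c$ with $r$ continuous and $c\in\mathbb R$, then $\sigma_m(\psi)=\sigma_m(\varphi)$. (3) There is a constant $M=M_\theta(\phi)>1$ depending only on $\theta$ and $\phi$ such that $\sigma_m(\psi)\le M\|\psi\|_\beta$ for all $\psi\in\mathcal H_\beta$.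
   Context: One-sided TMS over a countable directed graph: $\Sigma^+=\{(x_0,x_1,\dots):x_i\to x_{i+1}\}$, left shift $\sigma$, metric $e^{-t(\underline x,\underline y)}$, $t=\min\{i:x_i\ne y_i\}$; mixing: strongly connected, gcd of loop lengths 1. $\theta$-weakly H\"older: $\sup\{|\phi(\underline x)-\phi(\underline y)|:x_i=y_i,i<n\}\le A\theta^n$ for $n\ge2$. $\phi_n=\sum_{k<n}\phi\circ\sigma^k$; $P_G(\phi)=\lim\frac1n\log\sum_{\sigma^n\underline x=\underline x}e^{\phi_n(\underline x)}1_{[a]}(\underline x)$; Gurevich entropy $P_G(0)$. Equilibrium measure: invariant probability maximizing $h_\mu(\sigma)+\int\phi d\mu$. SPR: $\limsup\frac1n\log Z_n^\ast(\phi,a)<P_G(\phi)$ for some (every) state $a$, with $Z_n^\ast(\phi,a)=\sum_{\sigma^n\underline x=\underline x}e^{\phi_n(\underline x)}1_{[\tau_a=n]}(\underline x)$, $\tau_a$ the first return time to $[a]$ (equivalent to the paper's discriminant definition). $\mathcal H_\beta$: $\|\psi\|_\beta=\|\psi\|_\infty+\sup_{\underline x\ne\underline y}|\psi(\underline x)-\psi(\underline y)|e^{\beta t(\underline x,\underline y)}<\infty$. Asymptotic variance: $\sigma_m^2(\psi)=\lim_n\frac1n\int(\psi_n-\int\psi_ndm)^2dm$, $\psi_n=\sum_{k<n}\psi\circ\sigma^k$, $\sigma_m(\psi)\ge0$. *)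

theory Defs
  imports "HOL-Probability.Probability"
begin

text \<open>The states form the countable type 'a; the edge relation is E.\<close>

definition sigma_plus :: "('a \<Rightarrow> 'a \<Rightarrow> bool) \<Rightarrow> (nat \<Rightarrow> 'a) set" where
  "sigma_plus E = {x. \<forall>i. E (x i) (x (Suc i))}"

definition shift :: "(nat \<Rightarrow> 'a) \<Rightarrow> (nat \<Rightarrow> 'a)" where
  "shift x = (\<lambda>i. x (Suc i))"

definition mixing :: "('a \<Rightarrow> 'a \<Rightarrow> bool) \<Rightarrow> bool" where
  "mixing E \<longleftrightarrow> (\<forall>a b. E\<^sup>+\<^sup>+ a b) \<and>
     Gcd {n::nat. 0 < n \<and> (\<exists>a. (E ^^ n) a a)} = 1"

definition birkhoff :: "((nat \<Rightarrow> 'a) \<Rightarrow> real) \<Rightarrow> nat \<Rightarrow> (nat \<Rightarrow> 'a) \<Rightarrow> real" where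
  "birkhoff f n x = (\<Sum>k<n. f ((shift ^^ k) x))"

text \<open>Separation time t(x,y) = min{i. x_i \<noteq> y_i} (for x \<noteq> y).\<close>
definition sep_time :: "(nat \<Rightarrow> 'a) \<Rightarrow> (nat \<Rightarrow> 'a) \<Rightarrow> nat" where
  "sep_time x y = (LEAST i. x i \<noteq> y i)"

definition shift_continuous :: "('a \<Rightarrow> 'a \<Rightarrow> bool) \<Rightarrow> ((nat \<Rightarrow> 'a) \<Rightarrow> real) \<Rightarrow> bool" where
  "shift_continuous E r \<longleftrightarrow>
     (\<forall>x\<in>sigma_plus E. \<forall>\<epsilon>>0. \<exists>\<delta>>0. \<forall>y\<in>sigma_plus E.
        (x = y \<or> exp (- real (sep_time x y)) < \<delta>) \<longrightarrow> \<bar>r x - r y\<bar> < \<epsilon>)"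

definition weakly_holder :: "('a \<Rightarrow> 'a \<Rightarrow> bool) \<Rightarrow> real \<Rightarrow> ((nat \<Rightarrow> 'a) \<Rightarrow> real) \<Rightarrow> bool" where
  "weakly_holder E \<theta> f \<longleftrightarrow> (\<exists>A. \<forall>n\<ge>2. \<forall>x\<in>sigma_plus E. \<forall>y\<in>sigma_plus E.
      (\<forall>i<n. x i = y i) \<longrightarrow> \<bar>f x - f y\<bar> \<le> A * \<theta> ^ n)"

definition eln :: "ennreal \<Rightarrow> ereal" where
  "eln z = (if z = \<infinity> then \<infinity> else if z = 0 then - \<infinity> else ereal (ln (enn2real z)))"

definition Zn :: "('a \<Rightarrow> 'a \<Rightarrow> bool) \<Rightarrow> ((nat \<Rightarrow> 'a) \<Rightarrow> real) \<Rightarrow> 'a \<Rightarrow> nat \<Rightarrow> ennreal" where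
  "Zn E f a n = infsum (\<lambda>x. ennreal (exp (birkhoff f n x)))
      {x \<in> sigma_plus E. (shift ^^ n) x = x \<and> x 0 = a}"

definition Zn_star :: "('a \<Rightarrow> 'a \<Rightarrow> bool) \<Rightarrow> ((nat \<Rightarrow> 'a) \<Rightarrow> real) \<Rightarrow> 'a \<Rightarrow> nat \<Rightarrow> ennreal" where
  "Zn_star E f a n = infsum (\<lambda>x. ennreal (exp (birkhoff f n x)))
      {x \<in> sigma_plus E. (shift ^^ n) x = x \<and> x 0 = a \<and>
          0 < n \<and> (\<forall>k. 0 < k \<and> k < n \<longrightarrow> x k \<noteq> a)}"

definition gurevich_pressure :: "('a \<Rightarrow> 'a \<Rightarrow> bool) \<Rightarrow> ((nat \<Rightarrow> 'a) \<Rightarrow> real) \<Rightarrow> 'a \<Rightarrow> ereal" where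
  "gurevich_pressure E f a = limsup (\<lambda>n. eln (Zn E f a n) / ereal (real n))"

definition SPR :: "('a \<Rightarrow> 'a \<Rightarrow> bool) \<Rightarrow> ((nat \<Rightarrow> 'a) \<Rightarrow> real) \<Rightarrow> bool" where
  "SPR E f \<longleftrightarrow> (\<exists>a. limsup (\<lambda>n. eln (Zn_star E f a n) / ereal (real n))
                        < gurevich_pressure E f a)"

definition shift_space :: "('a \<Rightarrow> 'a \<Rightarrow> bool) \<Rightarrow> (nat \<Rightarrow> 'a) measure" where
  "shift_space E = sigma (sigma_plus E)
     {{x \<in> sigma_plus E. \<forall>i<n. x i = w i} | n w. True}"

definition invariant_prob :: "('a \<Rightarrow> 'a \<Rightarrow> bool) \<Rightarrow> (nat \<Rightarrow> 'a) measure \<Rightarrow> bool" where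
  "invariant_prob E \<mu> \<longleftrightarrow> sets \<mu> = sets (shift_space E) \<and> prob_space \<mu> \<and>
     (\<forall>A\<in>sets \<mu>. emeasure \<mu> (shift -` A \<inter> space \<mu>) = emeasure \<mu> A)"

definition finite_partition :: "'b measure \<Rightarrow> 'b set set \<Rightarrow> bool" where
  "finite_partition \<mu> P \<longleftrightarrow> finite P \<and> P \<subseteq> sets \<mu> \<and> \<Union>P = space \<mu> \<and> disjoint P"

definition part_entropy :: "'b measure \<Rightarrow> 'b set set \<Rightarrow> real" where
  "part_entropy \<mu> P = - (\<Sum>A\<in>P. measure \<mu> A * ln (measure \<mu> A))"

definition refine :: "(nat \<Rightarrow> 'a) measure \<Rightarrow> (nat \<Rightarrow> 'a) set set \<Rightarrow> nat \<Rightarrow> (nat \<Rightarrow> 'a) set set" where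
  "refine \<mu> P n = {space \<mu> \<inter> (\<Inter>k<n. (shift ^^ k) -` F k) | F. \<forall>k<n. F k \<in> P}"

definition entropy_wrt :: "(nat \<Rightarrow> 'a) measure \<Rightarrow> (nat \<Rightarrow> 'a) set set \<Rightarrow> real" where
  "entropy_wrt \<mu> P = lim (\<lambda>n. part_entropy \<mu> (refine \<mu> P n) / real n)"

definition ks_entropy :: "(nat \<Rightarrow> 'a) measure \<Rightarrow> ereal" where
  "ks_entropy \<mu> = (SUP P\<in>{P. finite_partition \<mu> P}. ereal (entropy_wrt \<mu> P))"

definition ext_integral :: "'b measure \<Rightarrow> ('b \<Rightarrow> real) \<Rightarrow> ereal" where
  "ext_integral \<mu> f = enn2ereal (\<integral>\<^sup>+x. ennreal (f x) \<partial>\<mu>) - enn2ereal (\<integral>\<^sup>+x. ennreal (- f x) \<partial>\<mu>)"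

definition equilibrium_measure :: "('a \<Rightarrow> 'a \<Rightarrow> bool) \<Rightarrow> ((nat \<Rightarrow> 'a) \<Rightarrow> real) \<Rightarrow> (nat \<Rightarrow> 'a) measure \<Rightarrow> bool" where
  "equilibrium_measure E f m \<longleftrightarrow> invariant_prob E m \<and>
     (\<forall>\<nu>. invariant_prob E \<nu> \<longrightarrow> ks_entropy \<nu> + ext_integral \<nu> f \<le> ks_entropy m + ext_integral m f)"

definition sup_part :: "('a \<Rightarrow> 'a \<Rightarrow> bool) \<Rightarrow> ((nat \<Rightarrow> 'a) \<Rightarrow> real) \<Rightarrow> real set" where
  "sup_part E f = (\<lambda>x. \<bar>f x\<bar>) ` sigma_plus E"

definition hol_part :: "('a \<Rightarrow> 'a \<Rightarrow> bool) \<Rightarrow> real \<Rightarrow> ((nat \<Rightarrow> 'a) \<Rightarrow> real) \<Rightarrow> real set" where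
  "hol_part E \<beta> f = {\<bar>f x - f y\<bar> * exp (\<beta> * real (sep_time x y)) | x y.
       x \<in> sigma_plus E \<and> y \<in> sigma_plus E \<and> x \<noteq> y}"

definition in_H :: "('a \<Rightarrow> 'a \<Rightarrow> bool) \<Rightarrow> real \<Rightarrow> ((nat \<Rightarrow> 'a) \<Rightarrow> real) \<Rightarrow> bool" where
  "in_H E \<beta> f \<longleftrightarrow> bdd_above (sup_part E f) \<and> bdd_above (hol_part E \<beta> f)"

definition H_norm :: "('a \<Rightarrow> 'a \<Rightarrow> bool) \<Rightarrow> real \<Rightarrow> ((nat \<Rightarrow> 'a) \<Rightarrow> real) \<Rightarrow> real" where
  "H_norm E \<beta> f = Sup (insert 0 (sup_part E f)) + Sup (insert 0 (hol_part E \<beta> f))"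

definition asymp_var :: "(nat \<Rightarrow> 'a) measure \<Rightarrow> ((nat \<Rightarrow> 'a) \<Rightarrow> real) \<Rightarrow> real" where
  "asymp_var m f = lim (\<lambda>n. (1 / real n) *
      (\<integral>x. (birkhoff f n x - (\<integral>y. birkhoff f n y \<partial>m))\<^sup>2 \<partial>m))"

definition asymp_sd :: "(nat \<Rightarrow> 'a) measure \<Rightarrow> ((nat \<Rightarrow> 'a) \<Rightarrow> real) \<Rightarrow> real" where
  "asymp_sd m f = sqrt (asymp_var m f)"

end

theory Submission
  imports Defs
begin

text \<open>
  Normalising the potential by a positive harmonic function \<open>h\<close> of the transfer operator turns it into
  a Markov operator \<open>T\<close> with \<open>T 1 = 1\<close>; strong positive recurrence enters through the exponential decay
  of the weights of first returns to a state \<open>a\<close>, which also yields \<open>h\<close> from a cone contraction for the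
  operator induced on \<open>[a]\<close>.  The variational principle, applied to small perturbations of the
  potential, shows that an equilibrium measure \<open>m\<close> satisfies \<open>\<integral> T u dm = \<integral> u dm\<close>.  The Green function
  \<open>\<Sum> B\<^sup>k 1\<close> of excursions away from \<open>a\<close> is square integrable and dominates both a continuous solution
  \<open>v\<close> of the Poisson equation \<open>T v = v - (\<psi> - \<integral> \<psi> dm)\<close> and every continuous \<open>r\<close> with bounded
  \<open>r - r \<circ> shift\<close>.  With \<open>u = \<psi> - \<integral> \<psi> dm - v\<close> one gets \<open>\<psi> - \<integral> \<psi> dm = M + u - u \<circ> shift\<close>, where
  \<open>M = v + u \<circ> shift\<close> is a sequence of orthogonal increments along the shift, so the asymptotic
  variance of \<open>\<psi>\<close> is \<open>\<integral> M\<^sup>2 dm\<close>.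
\<close>

section \<open>Symbolic sequences\<close>

lemma funpow_shift: "(shift ^^ k) x = (\<lambda>i. x (i + k))"
  by (induction k) (auto simp: shift_def)

lemma funpow_shift_add: "(shift ^^ j) ((shift ^^ k) x) = (shift ^^ (j + k)) x"
  by (simp add: funpow_shift add.assoc)

lemma shift_case_nat [simp]: "shift (case_nat b x) = x"
  by (simp add: shift_def)

lemma case_nat_shift [simp]: "case_nat (x 0) (shift x) = x"
  by (auto simp: shift_def split: nat.splits)

lemma case_nat_in_sigma [simp]: "case_nat b x \<in> sigma_plus E \<longleftrightarrow> E b (x 0) \<and> x \<in> sigma_plus E"
  unfolding sigma_plus_def by (auto split: nat.splits)

lemma shift_in_sigma [intro]: "x \<in> sigma_plus E \<Longrightarrow> shift x \<in> sigma_plus E"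
  by (simp add: sigma_plus_def shift_def)

lemma funpow_shift_in_sigma [intro]: "x \<in> sigma_plus E \<Longrightarrow> (shift ^^ k) x \<in> sigma_plus E"
  by (simp add: sigma_plus_def funpow_shift)

lemma birkhoff_0 [simp]: "birkhoff f 0 x = 0"
  by (simp add: birkhoff_def)

lemma birkhoff_Suc: "birkhoff f (Suc n) x = birkhoff f n x + f ((shift ^^ n) x)"
  by (simp add: birkhoff_def)

lemma birkhoff_Suc_shift: "birkhoff f (Suc n) x = f x + birkhoff f n (shift x)"
  unfolding birkhoff_def sum.lessThan_Suc_shift by (simp add: funpow_swap1)

definition agree :: "nat \<Rightarrow> (nat \<Rightarrow> 'a) \<Rightarrow> (nat \<Rightarrow> 'a) \<Rightarrow> bool" where
  "agree n x y \<longleftrightarrow> (\<forall>i<n. x i = y i)"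

lemma agree_sym: "agree n x y \<Longrightarrow> agree n y x"
  by (simp add: agree_def)

lemma agree_mono: "agree n x y \<Longrightarrow> k \<le> n \<Longrightarrow> agree k x y"
  by (simp add: agree_def)

lemma agree_case_nat [simp]: "agree (Suc n) (case_nat b x) (case_nat b y) \<longleftrightarrow> agree n x y"
  unfolding agree_def by (auto split: nat.splits)

lemma agree_shift: "agree (Suc n) x y \<Longrightarrow> agree n (shift x) (shift y)"
  by (simp add: agree_def shift_def)

lemma agree_funpow_shift: "agree n x y \<Longrightarrow> agree (n - k) ((shift ^^ k) x) ((shift ^^ k) y)"
  by (simp add: agree_def funpow_shift)

lemma agree_trivial [simp]: "agree n x x" "agree 0 x y"
  by (simp_all add: agree_def)

lemma agree_1 [simp]: "agree (Suc 0) x y \<longleftrightarrow> x 0 = y 0"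
  by (simp add: agree_def)

lemma sigma_plus_step: "y \<in> sigma_plus E \<Longrightarrow> E (y 0) (shift y 0)"
  by (simp add: sigma_plus_def shift_def)

definition splice :: "nat \<Rightarrow> (nat \<Rightarrow> 'a) \<Rightarrow> (nat \<Rightarrow> 'a) \<Rightarrow> nat \<Rightarrow> 'a" where
  "splice n y x = (\<lambda>i. if i < n then y i else x (i - n))"

lemma funpow_shift_splice [simp]: "(shift ^^ n) (splice n y x) = x"
  by (simp add: funpow_shift splice_def)

lemma agree_splice: "agree n y (splice n y x)"
  by (simp add: agree_def splice_def)

lemma agree_Suc_splice: "y n = x 0 \<Longrightarrow> agree (Suc n) y (splice n y x)"
  by (auto simp: agree_def splice_def less_Suc_eq)

lemma splice_in_sigma:
  assumes "y \<in> sigma_plus E" "x \<in> sigma_plus E" "y n = x 0"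
  shows "splice n y x \<in> sigma_plus E"
proof -
  have "E (splice n y x i) (splice n y x (Suc i))" for i
  proof -
    consider "Suc i < n" | "n = Suc i" | "n \<le> i" by linarith
    then show ?thesis
    proof cases
      case 2
      then have "E (y i) (x 0)" unfolding assms(3)[symmetric] using assms(1) by (simp add: sigma_plus_def)
      then show ?thesis using 2 by (simp add: splice_def)
    qed (use assms in \<open>auto simp: splice_def sigma_plus_def Suc_diff_le\<close>)
  qed
  then show ?thesis by (simp add: sigma_plus_def)
qed

definition periodise :: "nat \<Rightarrow> (nat \<Rightarrow> 'a) \<Rightarrow> nat \<Rightarrow> 'a" where
  "periodise n y = (\<lambda>i. y (i mod n))"

lemma funpow_shift_periodise [simp]: "(shift ^^ n) (periodise n y) = periodise n y"
  by (simp add: funpow_shift periodise_def)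

lemma agree_periodise: "agree n y (periodise n y)"
  by (simp add: agree_def periodise_def)

lemma agree_Suc_periodise: "y n = y 0 \<Longrightarrow> agree (Suc n) y (periodise n y)"
  by (auto simp: agree_def periodise_def less_Suc_eq)

lemma periodise_in_sigma:
  assumes "y \<in> sigma_plus E" "y n = y 0"
  shows "periodise n y \<in> sigma_plus E"
proof -
  have "E (y (i mod n)) (y (Suc i mod n))" for i
  proof (cases "Suc (i mod n) = n")
    case True
    have "E (y (i mod n)) (y (Suc (i mod n)))" using assms(1) by (simp add: sigma_plus_def)
    then show ?thesis using True assms(2) by (simp add: mod_Suc)
  next
    case False
    then show ?thesis using assms(1) by (simp add: mod_Suc sigma_plus_def)
  qed
  then show ?thesis by (simp add: sigma_plus_def periodise_def)
qed

lemma periodise_cong: "0 < n \<Longrightarrow> agree n x y \<Longrightarrow> periodise n x = periodise n y"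
  by (simp add: periodise_def agree_def)

lemma periodic_eq_periodise:
  assumes "(shift ^^ n) x = x"
  shows "periodise n x = x"
proof
  fix i
  have "x (j + n * k) = x j" for j k
  proof (induction k)
    case (Suc k)
    have "x (j + n * k + n) = x (j + n * k)"
      using fun_cong[OF assms, of "j + n * k"] by (simp add: funpow_shift)
    then show ?case using Suc by (simp add: algebra_simps)
  qed simp
  from this[of "i mod n" "i div n"] show "periodise n x i = x i" by (simp add: periodise_def)
qed

lemma periodic_eqI:
  assumes "0 < n" "(shift ^^ n) x = x" "(shift ^^ n) y = y" "agree n x y"
  shows "x = y"
  using periodise_cong[OF assms(1,4)] periodic_eq_periodise[OF assms(2)] periodic_eq_periodise[OF assms(3)] by simp

section \<open>Continuity and measurability on the shift space\<close>

definition cyl_nhds :: "('a \<Rightarrow> 'a \<Rightarrow> bool) \<Rightarrow> (nat \<Rightarrow> 'a) \<Rightarrow> (nat \<Rightarrow> 'a) filter" where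
  "cyl_nhds E x = (INF n. principal {y \<in> sigma_plus E. agree n x y})"

lemma eventually_cyl_nhds:
  "eventually P (cyl_nhds E x) \<longleftrightarrow> (\<exists>n. \<forall>y\<in>sigma_plus E. agree n x y \<longrightarrow> P y)"
proof -
  have "eventually P (cyl_nhds E x) \<longleftrightarrow> (\<exists>n\<in>UNIV. eventually P (principal {y \<in> sigma_plus E. agree n x y}))"
    unfolding cyl_nhds_def
  proof (rule eventually_INF_base)
    fix j k :: nat
    show "\<exists>n\<in>UNIV. principal {y \<in> sigma_plus E. agree n x y} \<le>
        inf (principal {y \<in> sigma_plus E. agree j x y}) (principal {y \<in> sigma_plus E. agree k x y})"
      by (intro bexI[of _ "max j k"]) (auto simp: agree_def)
  qed simp
  then show ?thesis by (auto simp: eventually_principal)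
qed

lemma eventually_cyl_nhds_in_sigma: "eventually (\<lambda>y. y \<in> sigma_plus E) (cyl_nhds E x)"
  unfolding eventually_cyl_nhds by blast

lemma agree_of_sep_time:
  assumes "n \<le> sep_time x y" shows "agree n x y"
  using assms not_less_Least[of _ "\<lambda>i. x i \<noteq> y i"] unfolding agree_def sep_time_def by (meson less_le_trans)

lemma le_sep_time_of_agree:
  assumes "x \<noteq> y" "agree n x y" shows "n \<le> sep_time x y"
proof -
  obtain i where "x i \<noteq> y i" using assms(1) by blast
  then have "x (sep_time x y) \<noteq> y (sep_time x y)"
    unfolding sep_time_def by (rule LeastI)
  then show ?thesis using assms(2) unfolding agree_def by (meson not_le)
qed

lemma eventually_cyl_nhds_metric:
  assumes "P x"
  shows "(\<exists>\<delta>>0. \<forall>y\<in>sigma_plus E. (x = y \<or> exp (- real (sep_time x y)) < \<delta>) \<longrightarrow> P y) \<longleftrightarrow>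
    eventually P (cyl_nhds E x)"
proof
  assume "\<exists>\<delta>>0. \<forall>y\<in>sigma_plus E. (x = y \<or> exp (- real (sep_time x y)) < \<delta>) \<longrightarrow> P y"
  then obtain \<delta> where \<delta>: "\<delta> > 0" "\<And>y. y \<in> sigma_plus E \<Longrightarrow> exp (- real (sep_time x y)) < \<delta> \<Longrightarrow> P y"
    by blast
  obtain n :: nat where n: "real n > - ln \<delta>" using reals_Archimedean2 by blast
  have "P y" if y: "y \<in> sigma_plus E" "agree n x y" for y
  proof (cases "x = y")
    case False
    then have "- real (sep_time x y) < ln \<delta>" using le_sep_time_of_agree[OF False y(2)] n by linarith
    then have "exp (- real (sep_time x y)) < \<delta>" using \<delta>(1) by (metis exp_less_mono exp_ln)
    then show ?thesis using \<delta> y by blast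
  qed (use assms in auto)
  then show "eventually P (cyl_nhds E x)" unfolding eventually_cyl_nhds by blast
next
  assume "eventually P (cyl_nhds E x)"
  then obtain n where "\<And>y. y \<in> sigma_plus E \<Longrightarrow> agree n x y \<Longrightarrow> P y" unfolding eventually_cyl_nhds by blast
  then have "P y" if "y \<in> sigma_plus E" "x = y \<or> exp (- real (sep_time x y)) < exp (- real n)" for y
    using that assms agree_of_sep_time[of n x y] by auto
  then show "\<exists>\<delta>>0. \<forall>y\<in>sigma_plus E. (x = y \<or> exp (- real (sep_time x y)) < \<delta>) \<longrightarrow> P y"
    by (intro exI[of _ "exp (- real n)"]) auto
qed

lemma shift_continuous_iff_tendsto:
  "shift_continuous E r \<longleftrightarrow> (\<forall>x\<in>sigma_plus E. (r \<longlongrightarrow> r x) (cyl_nhds E x))"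
  unfolding shift_continuous_def tendsto_iff
  by (intro ball_cong all_cong1 imp_cong refl)
    (simp add: eventually_cyl_nhds_metric[symmetric] dist_real_def abs_minus_commute)

lemma filterlim_shift_cyl_nhds: "filterlim shift (cyl_nhds E (shift x)) (cyl_nhds E x)"
  unfolding filterlim_iff eventually_cyl_nhds
  using agree_shift[of _ x] shift_in_sigma by blast

lemma shift_continuous_shift: "shift_continuous E f \<Longrightarrow> shift_continuous E (\<lambda>x. f (shift x))"
  unfolding shift_continuous_iff_tendsto
  using filterlim_compose[OF _ filterlim_shift_cyl_nhds] by blast

lemma shift_continuous_uniform_limit:
  assumes f: "\<And>n. shift_continuous E (f n)" and lim: "uniform_limit (sigma_plus E) f v sequentially"
  shows "shift_continuous E v"
  unfolding shift_continuous_iff_tendsto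
proof (intro ballI tendstoI)
  fix x and \<epsilon> :: real assume x: "x \<in> sigma_plus E" and "0 < \<epsilon>"
  then have \<epsilon>: "0 < \<epsilon> / 3" by simp
  obtain N where N: "\<And>y. y \<in> sigma_plus E \<Longrightarrow> dist (f N y) (v y) < \<epsilon> / 3"
    using uniform_limitD[OF lim \<epsilon>] by (auto simp: eventually_sequentially)
  have "eventually (\<lambda>y. dist (f N y) (f N x) < \<epsilon> / 3) (cyl_nhds E x)"
    using f[of N] x \<epsilon> unfolding shift_continuous_iff_tendsto by (blast dest: tendstoD)
  then show "eventually (\<lambda>y. dist (v y) (v x) < \<epsilon>) (cyl_nhds E x)"
    using eventually_cyl_nhds_in_sigma
  proof eventually_elim
    case (elim y)
    then show ?case using N[OF elim(2)] N[OF x] unfolding dist_real_def by linarith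
  qed
qed

lemma space_shift_space [simp]: "space (shift_space E) = sigma_plus E"
  by (simp add: shift_space_def space_measure_of_conv)

lemma cylinder_in_sets:
  "{x \<in> sigma_plus E. \<forall>i<n. x i = w i} \<in> sets (shift_space E)"
  unfolding shift_space_def by (subst sets_measure_of) (auto intro!: sigma_sets.Basic)

lemma measurable_to_shift_space:
  assumes "\<And>x. x \<in> space M \<Longrightarrow> f x \<in> sigma_plus E"
    and "\<And>n w. {x \<in> space M. \<forall>i<n. f x i = w i} \<in> sets M"
  shows "f \<in> measurable M (shift_space E)"
  unfolding shift_space_def
proof (rule measurable_sigma_sets[where \<Omega>="sigma_plus E" and A="{{x \<in> sigma_plus E. \<forall>i<n. x i = w i} |n w. True}"])
  let ?cylinders = "{{x \<in> sigma_plus E. \<forall>i<n. x i = w i} |n w. True}"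
  show "sets (sigma (sigma_plus E) ?cylinders) = sigma_sets (sigma_plus E) ?cylinders"
    by (subst sets_measure_of) auto
  show "f \<in> space M \<rightarrow> sigma_plus E" using assms(1) by auto
  fix C assume "C \<in> ?cylinders"
  then obtain n w where C: "C = {x \<in> sigma_plus E. \<forall>i<n. x i = w i}" by auto
  have eq: "f -` C \<inter> space M = {x \<in> space M. \<forall>i<n. f x i = w i}" using assms(1) C by auto
  show "f -` C \<inter> space M \<in> sets M" unfolding eq by (rule assms(2))
qed auto

lemma cyl_open_in_sets:
  fixes E :: "'a::countable \<Rightarrow> 'a \<Rightarrow> bool"
  assumes "U \<subseteq> sigma_plus E" and "\<And>x. x \<in> U \<Longrightarrow> eventually (\<lambda>y. y \<in> U) (cyl_nhds E x)"
  shows "U \<in> sets (shift_space E)"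
proof -
  define C where "C w = {y \<in> sigma_plus E. \<forall>i<length w. y i = w ! i}" for w :: "'a list"
  have "U = (\<Union>w\<in>{w. C w \<subseteq> U}. C w)"
  proof (intro equalityI subsetI)
    fix x assume x: "x \<in> U"
    then obtain n where n: "\<forall>y\<in>sigma_plus E. agree n x y \<longrightarrow> y \<in> U"
      using assms(2) unfolding eventually_cyl_nhds by blast
    have "C (map x [0..<n]) = {y \<in> sigma_plus E. agree n x y}" by (auto simp: C_def agree_def)
    then show "x \<in> (\<Union>w\<in>{w. C w \<subseteq> U}. C w)"
      using n x assms(1) by (intro UN_I[of "map x [0..<n]"]) auto
  qed auto
  also have "... \<in> sets (shift_space E)"
    by (rule sets.countable_UN') (auto simp: C_def intro: cylinder_in_sets)
  finally show ?thesis .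
qed

lemma finitely_determined_in_sets:
  fixes E :: "'a::countable \<Rightarrow> 'a \<Rightarrow> bool"
  assumes "\<And>x y. agree n x y \<Longrightarrow> P x \<Longrightarrow> P y"
  shows "{x \<in> sigma_plus E. P x} \<in> sets (shift_space E)"
  by (rule cyl_open_in_sets) (use assms in \<open>auto simp: eventually_cyl_nhds\<close>)

lemma measurable_coord [measurable]:
  fixes E :: "'a::countable \<Rightarrow> 'a \<Rightarrow> bool"
  shows "(\<lambda>x. x i) \<in> measurable (shift_space E) (count_space UNIV)"
proof (rule measurableI)
  fix A :: "'a set"
  have "{x \<in> sigma_plus E. x i \<in> A} \<in> sets (shift_space E)"
    by (rule finitely_determined_in_sets[of "Suc i"]) (simp add: agree_def)
  then show "(\<lambda>x. x i) -` A \<inter> space (shift_space E) \<in> sets (shift_space E)"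
    by (simp add: vimage_def Int_def conj_commute)
qed simp

lemma measurable_shift [measurable]:
  fixes E :: "'a::countable \<Rightarrow> 'a \<Rightarrow> bool"
  shows "shift \<in> measurable (shift_space E) (shift_space E)"
proof (rule measurable_to_shift_space)
  show "{x \<in> space (shift_space E). \<forall>i<n. shift x i = w i} \<in> sets (shift_space E)" for n and w :: "nat \<Rightarrow> 'a"
    unfolding space_shift_space
    by (rule finitely_determined_in_sets[of "Suc n"]) (simp add: agree_def shift_def)
qed auto

lemma measurable_funpow_shift [measurable]:
  fixes E :: "'a::countable \<Rightarrow> 'a \<Rightarrow> bool"
  shows "(shift ^^ k) \<in> measurable (shift_space E) (shift_space E)"
proof (induction k)
  case (Suc k)
  then show ?case using measurable_comp[OF Suc measurable_shift[of E]] by simp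
qed simp

lemma measurable_case_nat:
  fixes E :: "'a::countable \<Rightarrow> 'a \<Rightarrow> bool"
  shows "(\<lambda>x. if E b (x 0) then case_nat b x else x) \<in> measurable (shift_space E) (shift_space E)"
proof (rule measurable_to_shift_space)
  show "{x \<in> space (shift_space E). \<forall>i<n. (if E b (x 0) then case_nat b x else x) i = w i} \<in> sets (shift_space E)"
    for n and w :: "nat \<Rightarrow> 'a"
    unfolding space_shift_space
    by (rule finitely_determined_in_sets[of "Suc n"]) (auto simp: agree_def split: nat.splits if_splits)
qed auto

lemma borel_measurable_cyl_continuous:
  fixes E :: "'a::countable \<Rightarrow> 'a \<Rightarrow> bool" and u :: "_ \<Rightarrow> 'b::second_countable_topology"
  assumes "\<And>x. x \<in> sigma_plus E \<Longrightarrow> (u \<longlongrightarrow> u x) (cyl_nhds E x)"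
  shows "u \<in> borel_measurable (shift_space E)"
proof (rule borel_measurableI)
  fix S :: "'b set" assume S: "open S"
  show "u -` S \<inter> space (shift_space E) \<in> sets (shift_space E)"
  proof (rule cyl_open_in_sets)
    fix x assume "x \<in> u -` S \<inter> space (shift_space E)"
    then have "eventually (\<lambda>y. u y \<in> S) (cyl_nhds E x)" using assms S by (auto dest: topological_tendstoD)
    then show "eventually (\<lambda>y. y \<in> u -` S \<inter> space (shift_space E)) (cyl_nhds E x)"
      using eventually_cyl_nhds_in_sigma by eventually_elim simp
  qed auto
qed

lemma borel_measurable_shift_continuous:
  fixes E :: "'a::countable \<Rightarrow> 'a \<Rightarrow> bool"
  assumes "shift_continuous E r" shows "r \<in> borel_measurable (shift_space E)"
  using assms unfolding shift_continuous_iff_tendsto by (intro borel_measurable_cyl_continuous) blast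

lemma infsum_ennreal_eq_nn_integral:
  "infsum f A = (\<integral>\<^sup>+x. f x \<partial>count_space A)" for f :: "'b \<Rightarrow> ennreal"
proof (rule antisym)
  show "infsum f A \<le> (\<integral>\<^sup>+x. f x \<partial>count_space A)"
  proof (rule infsum_le_finite_sums)
    fix F assume F: "finite F" "F \<subseteq> A"
    have "sum f F = (\<integral>\<^sup>+x. f x * indicator F x \<partial>count_space A)"
      using F by (subst nn_integral_count_space'[where A=F]) (auto intro!: sum.cong)
    also have "... \<le> (\<integral>\<^sup>+x. f x \<partial>count_space A)"
      by (intro nn_integral_mono) (auto simp: indicator_def)
    finally show "sum f F \<le> (\<integral>\<^sup>+x. f x \<partial>count_space A)" .
  qed (simp add: nonneg_summable_on_complete)
next
  have "integral\<^sup>S (count_space A) g \<le> infsum f A" if g: "simple_function (count_space A) g" "g \<le> f" for g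
  proof (cases "finite {x\<in>A. g x \<noteq> 0}")
    case True
    have "integral\<^sup>S (count_space A) g = (\<integral>\<^sup>+x. g x \<partial>count_space A)"
      using g(1) by (rule nn_integral_eq_simple_integral[symmetric])
    also have "... = sum g {x\<in>A. g x \<noteq> 0}" using True by (intro nn_integral_count_space') auto
    also have "... \<le> sum f {x\<in>A. g x \<noteq> 0}" using g(2) by (intro sum_mono) (auto simp: le_fun_def)
    also have "... \<le> infsum f A"
      by (intro order_trans[OF eq_refl[OF infsum_finite[OF True, symmetric]] infsum_mono_neutral])
        (auto intro: nonneg_summable_on_complete)
    finally show ?thesis .
  next
    case False
    have "{x\<in>A. g x \<noteq> 0} = (\<Union>c\<in>g ` A - {0}. {x\<in>A. g x = c})" by auto
    moreover have "finite (g ` A)" using g(1) by (auto simp: simple_function_def)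
    ultimately obtain c where c: "c \<noteq> 0" "infinite {x\<in>A. g x = c}"
      using False by (metis (no_types, lifting) DiffD2 finite_Diff finite_UN singletonI)
    have "\<infinity> = infsum f {x\<in>A. g x = c}"
      using g(2) c by (intro infsum_superconst_infinite_ennreal[of _ c, symmetric])
        (auto simp: le_fun_def zero_less_iff_neq_zero)
    also have "... \<le> infsum f A" by (rule infsum_mono_neutral) (auto intro: nonneg_summable_on_complete)
    finally show ?thesis by (simp add: top_unique)
  qed
  then show "(\<integral>\<^sup>+x. f x \<partial>count_space A) \<le> infsum f A"
    unfolding nn_integral_def by (intro SUP_least) auto
qed

section \<open>The transfer operator\<close>

text \<open>Values in the extended nonnegative reals make every manipulation of sums unconditional.  The set
  \<open>S\<close> restricts the prepended letter, so that visits to a state can be told apart from excursions.\<close>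

definition ruelle :: "('a \<Rightarrow> 'a \<Rightarrow> bool) \<Rightarrow> ((nat \<Rightarrow> 'a) \<Rightarrow> real) \<Rightarrow> 'a set \<Rightarrow>
    ((nat \<Rightarrow> 'a) \<Rightarrow> ennreal) \<Rightarrow> (nat \<Rightarrow> 'a) \<Rightarrow> ennreal" where
  "ruelle E f S u x = (\<integral>\<^sup>+b. (if b \<in> S \<and> E b (x 0)
    then ennreal (exp (f (case_nat b x))) * u (case_nat b x) else 0) \<partial>count_space UNIV)"

lemma ruelle_mono:
  assumes "\<And>y. y \<in> sigma_plus E \<Longrightarrow> y 0 \<in> S \<Longrightarrow> u y \<le> v y" "x \<in> sigma_plus E"
  shows "ruelle E f S u x \<le> ruelle E f S v x"
  unfolding ruelle_def by (intro nn_integral_mono) (use assms in \<open>auto intro!: mult_left_mono\<close>)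

lemma ruelle_cong:
  assumes "\<And>y. y \<in> sigma_plus E \<Longrightarrow> y 0 \<in> S \<Longrightarrow> u y = v y" "x \<in> sigma_plus E"
  shows "ruelle E f S u x = ruelle E f S v x"
  by (rule antisym) (use assms in \<open>auto intro!: ruelle_mono\<close>)

lemma ruelle_add: "ruelle E f S (\<lambda>y. u y + v y) x = ruelle E f S u x + ruelle E f S v x"
  unfolding ruelle_def by (subst nn_integral_add[symmetric]) (auto intro!: nn_integral_cong simp: distrib_left)

lemma ruelle_cmult: "ruelle E f S (\<lambda>y. c * u y) x = c * ruelle E f S u x"
  unfolding ruelle_def by (subst nn_integral_cmult[symmetric]) (auto intro!: nn_integral_cong simp: ac_simps)

lemma ruelle_zero [simp]: "ruelle E f S (\<lambda>y. 0) x = 0"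
  unfolding ruelle_def by (simp cong: if_cong)

lemma ruelle_suminf: "ruelle E f S (\<lambda>y. \<Sum>k. u k y) x = (\<Sum>k. ruelle E f S (u k) x)"
  unfolding ruelle_def
  by (subst nn_integral_suminf[symmetric]) (auto intro!: nn_integral_cong simp: ennreal_suminf_cmult)

lemma ruelle_sum: "ruelle E f S (\<lambda>y. \<Sum>k\<in>I. u k y) x = (\<Sum>k\<in>I. ruelle E f S (u k) x)"
  by (induction I rule: infinite_finite_induct) (auto simp: ruelle_add)

lemma ruelle_restrict: "ruelle E f S u x = ruelle E f UNIV (\<lambda>y. indicator S (y 0) * u y) x"
  unfolding ruelle_def by (intro nn_integral_cong) (auto simp: indicator_def)

lemma ruelle_split: "ruelle E f UNIV u x = ruelle E f S u x + ruelle E f (- S) u x"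
  unfolding ruelle_def by (subst nn_integral_add[symmetric]) (auto intro!: nn_integral_cong)

lemma ruelle_singleton:
  "ruelle E f {a} u x = (if E a (x 0) then ennreal (exp (f (case_nat a x))) * u (case_nat a x) else 0)"
  unfolding ruelle_def by (subst nn_integral_count_space'[where A="{a}"]) auto

lemma ruelle_ge_point:
  assumes "b \<in> S" "E b (x 0)"
  shows "ennreal (exp (f (case_nat b x))) * u (case_nat b x) \<le> ruelle E f S u x"
  unfolding ruelle_def using assms by (intro order_trans[OF _ nn_integral_ge_point[of b]]) auto

lemma ruelle_shift_ge:
  assumes "y \<in> sigma_plus E" "y 0 \<in> S"
  shows "ennreal (exp (f y)) * u y \<le> ruelle E f S u (shift y)"
  using ruelle_ge_point[of "y 0" S E "shift y" f u] assms sigma_plus_step[OF assms(1)] by simp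

lemma ruelle_add_const: "ruelle E (\<lambda>x. f x + c) S u x = ennreal (exp c) * ruelle E f S u x"
  unfolding ruelle_def
  by (subst nn_integral_cmult[symmetric])
    (auto intro!: nn_integral_cong simp: exp_add ennreal_mult ac_simps)

lemma ruelle_measurable [measurable]:
  fixes E :: "'a::countable \<Rightarrow> 'a \<Rightarrow> bool"
  assumes [measurable]: "f \<in> borel_measurable (shift_space E)" "u \<in> borel_measurable (shift_space E)"
  shows "ruelle E f S u \<in> borel_measurable (shift_space E)"
proof -
  have [measurable]: "(\<lambda>x. (if b \<in> S \<and> E b (x 0)
      then ennreal (exp (f (case_nat b x))) * u (case_nat b x) else 0)) \<in> borel_measurable (shift_space E)" for b
  proof -
    have "(\<lambda>x. (if b \<in> S \<and> E b (x 0) then ennreal (exp (f (case_nat b x))) * u (case_nat b x) else 0)) =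
      (\<lambda>x. of_bool (b \<in> S \<and> E b (x 0)) * (ennreal (exp (f (if E b (x 0) then case_nat b x else x))) *
          u (if E b (x 0) then case_nat b x else x)))"
      by auto
    also have "... \<in> borel_measurable (shift_space E)"
    proof (intro borel_measurable_times_ennreal)
      show "(\<lambda>x. of_bool (b \<in> S \<and> E b (x 0)) :: ennreal) \<in> borel_measurable (shift_space E)"
        by (rule measurable_compose[OF measurable_coord[of 0]]) simp
      show "(\<lambda>x. ennreal (exp (f (if E b (x 0) then case_nat b x else x)))) \<in> borel_measurable (shift_space E)"
        using measurable_compose[OF measurable_case_nat[of E b] assms(1)] by measurable
      show "(\<lambda>x. u (if E b (x 0) then case_nat b x else x)) \<in> borel_measurable (shift_space E)"
        using measurable_compose[OF measurable_case_nat[of E b] assms(2)] by measurable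
    qed
    finally show ?thesis .
  qed
  have "(\<lambda>(x, b). (if b \<in> S \<and> E b (x 0) then ennreal (exp (f (case_nat b x))) * u (case_nat b x) else 0))
      \<in> borel_measurable (shift_space E \<Otimes>\<^sub>M count_space UNIV)"
    unfolding case_prod_beta
    by (rule measurable_compose_countable'[where I=UNIV and g=snd and
        f="\<lambda>b p. (if b \<in> S \<and> E b (fst p 0) then ennreal (exp (f (case_nat b (fst p)))) * u (case_nat b (fst p)) else 0)"])
      (auto intro: measurable_compose[OF measurable_fst])
  then show ?thesis
    unfolding ruelle_def
    by (rule sigma_finite_measure.borel_measurable_nn_integral[OF sigma_finite_measure_count_space])
qed

lemma ruelle_funpow_mono:
  assumes "\<And>y. y \<in> sigma_plus E \<Longrightarrow> u y \<le> v y" "x \<in> sigma_plus E"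
  shows "(ruelle E f S ^^ n) u x \<le> (ruelle E f S ^^ n) v x"
  using assms(2) by (induction n arbitrary: x) (use assms(1) in \<open>auto intro: ruelle_mono\<close>)

lemma ruelle_funpow_cong:
  assumes "\<And>y. y \<in> sigma_plus E \<Longrightarrow> u y = v y" "x \<in> sigma_plus E"
  shows "(ruelle E f S ^^ n) u x = (ruelle E f S ^^ n) v x"
  by (rule antisym) (use assms in \<open>auto intro!: ruelle_funpow_mono\<close>)

lemma ruelle_funpow_add:
  "(ruelle E f S ^^ n) (\<lambda>y. u y + v y) = (\<lambda>x. (ruelle E f S ^^ n) u x + (ruelle E f S ^^ n) v x)"
  by (induction n) (simp_all add: ruelle_add)

lemma ruelle_funpow_cmult: "(ruelle E f S ^^ n) (\<lambda>y. c * u y) = (\<lambda>x. c * (ruelle E f S ^^ n) u x)"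
  by (induction n) (simp_all add: ruelle_cmult)

lemma ruelle_funpow_measurable [measurable]:
  fixes E :: "'a::countable \<Rightarrow> 'a \<Rightarrow> bool"
  assumes [measurable]: "f \<in> borel_measurable (shift_space E)" "u \<in> borel_measurable (shift_space E)"
  shows "(ruelle E f S ^^ n) u \<in> borel_measurable (shift_space E)"
  by (induction n) (auto intro: ruelle_measurable simp: assms)

lemma ruelle_funpow_add_const:
  "(ruelle E (\<lambda>x. f x + c) S ^^ n) u x = ennreal (exp (real n * c)) * (ruelle E f S ^^ n) u x"
proof (induction n arbitrary: x)
  case (Suc n)
  have "(ruelle E (\<lambda>x. f x + c) S ^^ Suc n) u x =
      ennreal (exp c) * ruelle E f S ((ruelle E (\<lambda>x. f x + c) S ^^ n) u) x"
    by (simp add: ruelle_add_const)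
  also have "(ruelle E (\<lambda>x. f x + c) S ^^ n) u = (\<lambda>x. ennreal (exp (real n * c)) * (ruelle E f S ^^ n) u x)"
    using Suc by blast
  also have "ennreal (exp c) * ruelle E f S ... x = ennreal (exp (real (Suc n) * c)) * (ruelle E f S ^^ Suc n) u x"
    by (simp add: ruelle_cmult mult.assoc[symmetric] ennreal_mult[symmetric] exp_add[symmetric] distrib_right add.commute)
  finally show ?case .
qed simp

lemma ruelle_funpow_pos:
  assumes "u y \<noteq> 0" "y \<in> sigma_plus E" "\<forall>i<k. y i \<in> S"
  shows "(ruelle E f S ^^ k) u ((shift ^^ k) y) \<noteq> 0"
  using assms(3)
proof (induction k)
  case (Suc k)
  define z where "z = (shift ^^ k) y"
  have z: "z \<in> sigma_plus E" "z 0 \<in> S"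
    using assms(2) Suc.prems by (auto simp: z_def funpow_shift_in_sigma) (simp add: funpow_shift)
  have "(ruelle E f S ^^ k) u z \<noteq> 0" using Suc by (auto simp: z_def)
  then show ?case using ruelle_shift_ge[OF z, of f "(ruelle E f S ^^ k) u"] by (auto simp: z_def)
qed (simp add: assms)

definition preimages :: "('a \<Rightarrow> 'a \<Rightarrow> bool) \<Rightarrow> 'a set \<Rightarrow> nat \<Rightarrow> (nat \<Rightarrow> 'a) \<Rightarrow> (nat \<Rightarrow> 'a) set" where
  "preimages E S n x = {y \<in> sigma_plus E. (shift ^^ n) y = x \<and> (\<forall>i<n. y i \<in> S)}"

lemma preimages_0: "x \<in> sigma_plus E \<Longrightarrow> preimages E S 0 x = {x}"
  by (auto simp: preimages_def)

lemma preimages_Suc_iff: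
  "b \<in> S \<and> E b (x 0) \<and> y \<in> preimages E S n (case_nat b x) \<longleftrightarrow> y \<in> preimages E S (Suc n) x \<and> b = y n"
proof
  assume *: "b \<in> S \<and> E b (x 0) \<and> y \<in> preimages E S n (case_nat b x)"
  then have y: "(shift ^^ n) y = case_nat b x" by (simp add: preimages_def)
  have "y n = b" using fun_cong[OF y, of 0] by (simp add: funpow_shift del: funpow.simps)
  moreover have "(shift ^^ Suc n) y = x" using y by simp
  ultimately show "y \<in> preimages E S (Suc n) x \<and> b = y n"
    using * by (auto simp: preimages_def less_Suc_eq)
next
  assume *: "y \<in> preimages E S (Suc n) x \<and> b = y n"
  then have y: "y \<in> sigma_plus E" "shift ((shift ^^ n) y) = x" "b = ((shift ^^ n) y) 0"
    by (auto simp: preimages_def) (simp add: funpow_shift)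
  have eq: "(shift ^^ n) y = case_nat b x" unfolding y(2)[symmetric] y(3) by simp
  have "case_nat b x \<in> sigma_plus E" unfolding eq[symmetric] using y(1) by auto
  then show "b \<in> S \<and> E b (x 0) \<and> y \<in> preimages E S n (case_nat b x)"
    using * eq by (auto simp: preimages_def)
qed

lemma ruelle_sum_over_preimages:
  assumes u: "\<And>b. b \<in> S \<Longrightarrow> E b (x 0) \<Longrightarrow>
    u (case_nat b x) = (\<integral>\<^sup>+y. g y \<partial>count_space (preimages E S n (case_nat b x)))"
  shows "ruelle E f S u x =
    (\<integral>\<^sup>+y. ennreal (exp (f ((shift ^^ n) y))) * g y \<partial>count_space (preimages E S (Suc n) x))"
proof -
  define w where "w b y = (if y \<in> preimages E S (Suc n) x \<and> b = y n
    then ennreal (exp (f ((shift ^^ n) y))) * g y else 0)" for b y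
  have "(if b \<in> S \<and> E b (x 0) then ennreal (exp (f (case_nat b x))) * u (case_nat b x) else 0) =
      (\<integral>\<^sup>+y. w b y \<partial>count_space UNIV)" for b
  proof (cases "b \<in> S \<and> E b (x 0)")
    case True
    then have "ennreal (exp (f (case_nat b x))) * u (case_nat b x) =
        (\<integral>\<^sup>+y. ennreal (exp (f (case_nat b x))) * (g y * indicator (preimages E S n (case_nat b x)) y) \<partial>count_space UNIV)"
      by (simp add: u nn_integral_count_space_indicator nn_integral_cmult)
    also have "... = (\<integral>\<^sup>+y. w b y \<partial>count_space UNIV)"
      unfolding w_def preimages_Suc_iff[symmetric] using True
      by (intro nn_integral_cong) (auto simp: indicator_def preimages_def)
    finally show ?thesis using True by simp
  next
    case False
    then show ?thesis unfolding w_def preimages_Suc_iff[symmetric] by auto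
  qed
  then have "ruelle E f S u x = (\<integral>\<^sup>+b. (\<integral>\<^sup>+y. w b y \<partial>count_space UNIV) \<partial>count_space UNIV)"
    by (simp add: ruelle_def)
  also have "... = (\<integral>\<^sup>+y. (\<integral>\<^sup>+b. w b y \<partial>count_space UNIV) \<partial>count_space UNIV)"
    using nn_integral_fst_count_space[of "\<lambda>(b, y). w b y"] nn_integral_snd_count_space[of "\<lambda>(b, y). w b y"] by simp
  also have "... = (\<integral>\<^sup>+y. (ennreal (exp (f ((shift ^^ n) y))) * g y) * indicator (preimages E S (Suc n) x) y \<partial>count_space UNIV)"
  proof (intro nn_integral_cong)
    fix y
    show "(\<integral>\<^sup>+b. w b y \<partial>count_space UNIV) =
        (ennreal (exp (f ((shift ^^ n) y))) * g y) * indicator (preimages E S (Suc n) x) y"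
      unfolding w_def by (subst nn_integral_count_space'[where A="{y n}"]) auto
  qed
  finally show ?thesis by (simp add: nn_integral_count_space_indicator)
qed

lemma ruelle_funpow_preimages:
  assumes "x \<in> sigma_plus E"
  shows "(ruelle E f S ^^ n) u x = (\<integral>\<^sup>+y. ennreal (exp (birkhoff f n y)) * u y \<partial>count_space (preimages E S n x))"
  using assms
proof (induction n arbitrary: x)
  case 0
  then show ?case by (simp add: preimages_0 nn_integral_count_space_finite)
next
  case (Suc n)
  have "ruelle E f S ((ruelle E f S ^^ n) u) x = (\<integral>\<^sup>+y. ennreal (exp (f ((shift ^^ n) y))) *
      (ennreal (exp (birkhoff f n y)) * u y) \<partial>count_space (preimages E S (Suc n) x))"
    by (rule ruelle_sum_over_preimages) (simp add: Suc)
  then show ?case by (simp add: birkhoff_Suc exp_add ennreal_mult ac_simps)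
qed

section \<open>Green functions and superharmonic functions\<close>

definition green :: "('a \<Rightarrow> 'a \<Rightarrow> bool) \<Rightarrow> ((nat \<Rightarrow> 'a) \<Rightarrow> real) \<Rightarrow> 'a set \<Rightarrow>
    ((nat \<Rightarrow> 'a) \<Rightarrow> ennreal) \<Rightarrow> (nat \<Rightarrow> 'a) \<Rightarrow> ennreal" where
  "green E f S u x = (\<Sum>k. (ruelle E f S ^^ k) u x)"

lemma green_mono:
  assumes "\<And>y. y \<in> sigma_plus E \<Longrightarrow> u y \<le> v y" "x \<in> sigma_plus E"
  shows "green E f S u x \<le> green E f S v x"
  unfolding green_def by (intro suminf_le ruelle_funpow_mono assms) auto

lemma green_add: "green E f S (\<lambda>x. u x + v x) x = green E f S u x + green E f S v x"
  unfolding green_def ruelle_funpow_add by (rule suminf_add[symmetric]) auto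

lemma green_cmult: "green E f S (\<lambda>x. c * u x) x = c * green E f S u x"
  unfolding green_def ruelle_funpow_cmult by (rule ennreal_suminf_cmult)

lemma green_unfold: "green E f S u x = u x + ruelle E f S (green E f S u) x"
proof -
  have "green E f S u x = (ruelle E f S ^^ 0) u x + (\<Sum>k. (ruelle E f S ^^ Suc k) u x)"
    unfolding green_def by (subst suminf_offset[of _ 1]) auto
  also have "(\<Sum>k. (ruelle E f S ^^ Suc k) u x) = ruelle E f S (green E f S u) x"
    unfolding green_def ruelle_suminf by simp
  finally show ?thesis by simp
qed

lemma green_ge: "u x \<le> green E f S u x" "ruelle E f S (green E f S u) x \<le> green E f S u x"
  using green_unfold[of E f S u x] by (metis le_iff_add add.commute)+

lemma green_ge_funpow: "(ruelle E f S ^^ k) u x \<le> green E f S u x"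
  unfolding green_def using sum_le_suminf[of "\<lambda>k. (ruelle E f S ^^ k) u x" "{k}"] by simp

lemma green_least:
  assumes U: "\<And>x. x \<in> sigma_plus E \<Longrightarrow> w x + ruelle E f S U x \<le> U x" and x: "x \<in> sigma_plus E"
  shows "green E f S w x \<le> U x"
proof -
  have "(\<Sum>k<n. (ruelle E f S ^^ k) w x) \<le> U x" if "x \<in> sigma_plus E" for n x
    using that
  proof (induction n arbitrary: x)
    case (Suc n)
    have "(\<Sum>k<Suc n. (ruelle E f S ^^ k) w x) =
        w x + ruelle E f S (\<lambda>x. \<Sum>k<n. (ruelle E f S ^^ k) w x) x"
      by (simp add: sum.lessThan_Suc_shift ruelle_sum del: sum.lessThan_Suc)
    also have "... \<le> w x + ruelle E f S U x"
      using Suc by (intro add_left_mono ruelle_mono) auto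
    also have "... \<le> U x" using U Suc by blast
    finally show ?case .
  qed simp
  then show ?thesis unfolding green_def by (auto simp: suminf_eq_SUP intro!: SUP_least x)
qed

definition superharmonic :: "('a \<Rightarrow> 'a \<Rightarrow> bool) \<Rightarrow> ((nat \<Rightarrow> 'a) \<Rightarrow> real) \<Rightarrow> ((nat \<Rightarrow> 'a) \<Rightarrow> ennreal) \<Rightarrow> bool" where
  "superharmonic E f H \<longleftrightarrow> (\<forall>x\<in>sigma_plus E. ruelle E f UNIV H x \<le> H x)"

lemma superharmonicD: "superharmonic E f H \<Longrightarrow> x \<in> sigma_plus E \<Longrightarrow> ruelle E f UNIV H x \<le> H x"
  by (simp add: superharmonic_def)

lemma superharmonic_green: "superharmonic E f (green E f UNIV u)"
  by (simp add: superharmonic_def green_ge(2))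

lemma superharmonic_le_potential:
  assumes H: "superharmonic E f H" and le: "\<And>x. x \<in> sigma_plus E \<Longrightarrow> g x \<le> f x"
  shows "superharmonic E g H"
  unfolding superharmonic_def
proof
  fix x assume x: "x \<in> sigma_plus E"
  have "ruelle E g UNIV H x \<le> ruelle E f UNIV H x"
    unfolding ruelle_def using le x by (intro nn_integral_mono) (auto intro!: mult_right_mono ennreal_leI)
  then show "ruelle E g UNIV H x \<le> H x" using superharmonicD[OF H x] by order
qed

lemma superharmonic_funpow:
  assumes H: "superharmonic E f H" and "x \<in> sigma_plus E"
  shows "(ruelle E f UNIV ^^ n) H x \<le> H x"
  using assms(2)
proof (induction n arbitrary: x)
  case (Suc n)
  have "ruelle E f UNIV ((ruelle E f UNIV ^^ n) H) x \<le> ruelle E f UNIV H x" using Suc by (intro ruelle_mono) auto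
  then show ?case using superharmonicD[OF H Suc.prems] by simp
qed simp

lemma superharmonic_path:
  assumes H: "superharmonic E f H" and y: "y \<in> sigma_plus E"
  shows "ennreal (exp (birkhoff f n y)) * H y \<le> H ((shift ^^ n) y)"
proof (induction n)
  case (Suc n)
  define z where "z = (shift ^^ n) y"
  have z: "z \<in> sigma_plus E" using y by (auto simp: z_def)
  have "ennreal (exp (birkhoff f (Suc n) y)) * H y = ennreal (exp (f z)) * (ennreal (exp (birkhoff f n y)) * H y)"
    by (simp add: birkhoff_Suc z_def exp_add ennreal_mult ac_simps)
  also have "... \<le> ennreal (exp (f z)) * H z"
    using Suc by (auto simp: z_def intro!: mult_left_mono)
  also have "... \<le> ruelle E f UNIV H (shift z)" using z by (intro ruelle_shift_ge) auto
  also have "... \<le> H (shift z)" using z by (intro superharmonicD[OF H]) auto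
  finally show ?case by (simp add: z_def)
qed simp

section \<open>Log-Lipschitz cones\<close>

lemma tendsto_exp_geometric_mult:
  fixes c :: ennreal
  assumes "0 \<le> \<gamma>" "\<gamma> < 1"
  shows "(\<lambda>n. ennreal (exp (C * \<gamma> ^ n)) * c) \<longlonglongrightarrow> c"
proof (cases "c = top")
  case True
  then show ?thesis by (simp add: ennreal_mult_top)
next
  case False
  have "(\<lambda>n. exp (C * \<gamma> ^ n)) \<longlonglongrightarrow> exp (C * 0)"
    using assms by (intro tendsto_intros LIMSEQ_power_zero) auto
  then have "(\<lambda>n. ennreal (exp (C * \<gamma> ^ n)) * c) \<longlonglongrightarrow> ennreal (exp (C * 0)) * c"
    using False by (intro tendsto_mult_ennreal tendsto_ennrealI tendsto_const) auto
  then show ?thesis by simp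
qed

lemma ennreal_le_of_exp_geometric:
  fixes u v :: ennreal
  assumes "0 \<le> \<gamma>" "\<gamma> < 1" "\<And>n. u \<le> ennreal (exp (C * \<gamma> ^ n)) * v"
  shows "u \<le> v"
  by (rule LIMSEQ_le_const[OF tendsto_exp_geometric_mult[OF assms(1,2), of C]]) (use assms(3) in auto)

lemma ennreal_nonzero_finite_cases:
  assumes "z \<noteq> 0" "z \<noteq> top"
  obtains r where "z = ennreal r" "0 < r"
  using assms by (metis ennreal_cases ennreal_eq_0_iff not_le)

locale markov_shift =
  fixes E :: "'a::countable \<Rightarrow> 'a \<Rightarrow> bool" and \<theta> :: real
  assumes theta: "0 < \<theta>" "\<theta> < 1" and irr: "\<And>a b. E\<^sup>+\<^sup>+ a b"
begin

abbreviation X :: "(nat \<Rightarrow> 'a) set" where "X \<equiv> sigma_plus E"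

abbreviation cyl :: "'a \<Rightarrow> (nat \<Rightarrow> 'a) set" where "cyl a \<equiv> {x \<in> X. x 0 = a}"

definition wholder :: "real \<Rightarrow> ((nat \<Rightarrow> 'a) \<Rightarrow> real) \<Rightarrow> bool" where
  "wholder B f \<longleftrightarrow> (\<forall>n\<ge>2. \<forall>x\<in>X. \<forall>y\<in>X. agree n x y \<longrightarrow> \<bar>f x - f y\<bar> \<le> B * \<theta> ^ n)"

definition log_lip :: "(nat \<Rightarrow> 'a) set \<Rightarrow> real \<Rightarrow> ((nat \<Rightarrow> 'a) \<Rightarrow> ennreal) \<Rightarrow> bool" where
  "log_lip Y D u \<longleftrightarrow> (\<forall>n\<ge>1. \<forall>x\<in>Y. \<forall>y\<in>Y. agree n x y \<longrightarrow> u x \<le> ennreal (exp (D * \<theta> ^ n)) * u y)"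

lemma log_lipI:
  assumes "\<And>n x y. n \<ge> 1 \<Longrightarrow> x \<in> Y \<Longrightarrow> y \<in> Y \<Longrightarrow> agree n x y \<Longrightarrow> u x \<le> ennreal (exp (D * \<theta> ^ n)) * u y"
  shows "log_lip Y D u"
  using assms unfolding log_lip_def by blast

lemma log_lipD:
  assumes "log_lip Y D u" "n \<ge> 1" "x \<in> Y" "y \<in> Y" "agree n x y"
  shows "u x \<le> ennreal (exp (D * \<theta> ^ n)) * u y"
  using assms unfolding log_lip_def by blast

lemma log_lip_same_letter:
  assumes "log_lip Y D u" "x \<in> Y" "y \<in> Y" "x 0 = y 0" "0 \<le> D"
  shows "u x \<le> ennreal (exp D) * u y"
proof -
  have "u x \<le> ennreal (exp (D * \<theta> ^ 1)) * u y" using log_lipD[OF assms(1), of 1 x y] assms by simp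
  also have "... \<le> ennreal (exp D) * u y"
    using assms(5) theta by (intro mult_right_mono ennreal_leI) (auto intro: mult_left_le)
  finally show ?thesis .
qed

lemma theta_pow: "0 < \<theta> ^ n" "\<theta> ^ n \<le> 1"
  using theta by (auto simp: power_le_one)

lemma log_lip_mono: "log_lip Y D u \<Longrightarrow> D \<le> D' \<Longrightarrow> log_lip Y D' u"
  unfolding log_lip_def
  by (meson dual_order.trans ennreal_leI exp_le_cancel_iff mult_right_mono theta_pow(1) less_imp_le zero_le)

lemma log_lip_subset: "log_lip Y D u \<Longrightarrow> Z \<subseteq> Y \<Longrightarrow> log_lip Z D u"
  unfolding log_lip_def by blast

lemma log_lip_cong: "log_lip Y D u \<Longrightarrow> (\<And>x. x \<in> Y \<Longrightarrow> u x = v x) \<Longrightarrow> log_lip Y D v"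
  unfolding log_lip_def by auto

lemma log_lip_const: "0 \<le> D \<Longrightarrow> log_lip Y D (\<lambda>_. c)"
  by (rule log_lip_mono[of _ 0]) (auto simp: log_lip_def)

lemma log_lip_mult:
  assumes u: "log_lip Y D u" and v: "log_lip Y D' v"
  shows "log_lip Y (D + D') (\<lambda>x. u x * v x)"
proof (rule log_lipI)
  fix n x y assume xy: "1 \<le> n" "x \<in> Y" "y \<in> Y" "agree n x y"
  have "u x * v x \<le> (ennreal (exp (D * \<theta> ^ n)) * u y) * (ennreal (exp (D' * \<theta> ^ n)) * v y)"
    using log_lipD[OF u xy] log_lipD[OF v xy] by (intro mult_mono) auto
  also have "... = ennreal (exp ((D + D') * \<theta> ^ n)) * (u y * v y)"
    by (simp add: distrib_right exp_add ennreal_mult ac_simps)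
  finally show "u x * v x \<le> ennreal (exp ((D + D') * \<theta> ^ n)) * (u y * v y)" .
qed

lemma log_lip_suminf: "(\<And>k. log_lip Y D (u k)) \<Longrightarrow> log_lip Y D (\<lambda>x. \<Sum>k. u k x)"
  unfolding log_lip_def by (auto simp flip: ennreal_suminf_cmult intro!: suminf_le)

lemma log_lip_inverse:
  assumes u: "log_lip Y D u" and fin: "\<And>x. x \<in> Y \<Longrightarrow> u x \<noteq> 0 \<and> u x \<noteq> top"
  shows "log_lip Y D (\<lambda>x. inverse (u x))"
proof (rule log_lipI)
  fix n x y assume xy: "1 \<le> n" "x \<in> Y" "y \<in> Y" "agree n x y"
  obtain r where r: "u x = ennreal r" "0 < r" using fin[OF xy(2)] by (auto elim: ennreal_nonzero_finite_cases)
  obtain s where s: "u y = ennreal s" "0 < s" using fin[OF xy(3)] by (auto elim: ennreal_nonzero_finite_cases)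
  have "s \<le> exp (D * \<theta> ^ n) * r"
    using log_lipD[OF u xy(1,3,2) agree_sym[OF xy(4)]] r s by (simp add: ennreal_mult[symmetric])
  then have "inverse r \<le> exp (D * \<theta> ^ n) * inverse s" using r s by (simp add: field_simps)
  then show "inverse (u x) \<le> ennreal (exp (D * \<theta> ^ n)) * inverse (u y)"
    using r s by (simp add: inverse_ennreal ennreal_mult[symmetric])
qed

lemma log_lip_of_lipschitz:
  assumes K: "0 < K" "\<And>x. x \<in> Y \<Longrightarrow> K \<le> u x"
    and lip: "\<And>n x y. n \<ge> 1 \<Longrightarrow> x \<in> Y \<Longrightarrow> y \<in> Y \<Longrightarrow> agree n x y \<Longrightarrow> \<bar>u x - u y\<bar> \<le> K * (C * \<theta> ^ n)"
  shows "log_lip Y C (\<lambda>x. ennreal (u x))"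
proof (rule log_lipI)
  fix n x y assume xy: "1 \<le> n" "x \<in> Y" "y \<in> Y" "agree n x y"
  have "0 \<le> K * (C * \<theta> ^ n)" using lip[OF xy] by linarith
  then have "0 \<le> C * \<theta> ^ n" using K(1) by (simp add: zero_le_mult_iff)
  then have "K * (C * \<theta> ^ n) \<le> u y * (C * \<theta> ^ n)" using K(2)[OF xy(3)] by (rule mult_right_mono[rotated])
  then have "u x \<le> (1 + C * \<theta> ^ n) * u y" using lip[OF xy] by (simp add: algebra_simps abs_le_iff)
  also have "... \<le> exp (C * \<theta> ^ n) * u y"
    using K(1) K(2)[OF xy(3)] by (intro mult_right_mono exp_ge_add_one_self) auto
  finally show "ennreal (u x) \<le> ennreal (exp (C * \<theta> ^ n)) * ennreal (u y)"
    using K(1) K(2)[OF xy(3)] by (simp add: ennreal_mult[symmetric] ennreal_leI)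
qed

lemma log_lip_ruelle:
  assumes f: "wholder B f" and u: "log_lip Y D u"
    and Y: "\<And>x b. x \<in> X \<Longrightarrow> b \<in> S \<Longrightarrow> E b (x 0) \<Longrightarrow> case_nat b x \<in> Y"
  shows "log_lip X (\<theta> * (B + D)) (ruelle E f S u)"
proof (rule log_lipI)
  fix n x y assume xy: "1 \<le> n" "x \<in> X" "y \<in> X" "agree n x y"
  then have x0: "x 0 = y 0" by (auto simp: agree_def)
  have "ennreal (exp (f (case_nat b x))) * u (case_nat b x) \<le>
      ennreal (exp (\<theta> * (B + D) * \<theta> ^ n)) * (ennreal (exp (f (case_nat b y))) * u (case_nat b y))"
    if b: "b \<in> S" "E b (x 0)" for b
  proof -
    have agr: "agree (Suc n) (case_nat b x) (case_nat b y)" using xy by simp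
    have "\<bar>f (case_nat b x) - f (case_nat b y)\<bar> \<le> B * \<theta> ^ Suc n"
      using f[unfolded wholder_def, rule_format, OF _ _ _ agr] b xy x0 by simp
    then have "exp (f (case_nat b x)) \<le> exp (B * \<theta> ^ Suc n) * exp (f (case_nat b y))"
      unfolding exp_add[symmetric] exp_le_cancel_iff by linarith
    moreover have "u (case_nat b x) \<le> ennreal (exp (D * \<theta> ^ Suc n)) * u (case_nat b y)"
      using log_lipD[OF u _ _ _ agr] Y b xy x0 by simp
    ultimately have "ennreal (exp (f (case_nat b x))) * u (case_nat b x) \<le>
        ennreal (exp (B * \<theta> ^ Suc n) * exp (f (case_nat b y))) * (ennreal (exp (D * \<theta> ^ Suc n)) * u (case_nat b y))"
      by (intro mult_mono ennreal_leI) auto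
    also have "... = (ennreal (exp (B * \<theta> ^ Suc n)) * ennreal (exp (D * \<theta> ^ Suc n))) *
        (ennreal (exp (f (case_nat b y))) * u (case_nat b y))"
      by (simp add: ennreal_mult ac_simps)
    also have "ennreal (exp (B * \<theta> ^ Suc n)) * ennreal (exp (D * \<theta> ^ Suc n)) = ennreal (exp (\<theta> * (B + D) * \<theta> ^ n))"
      by (simp add: ennreal_mult[symmetric] exp_add[symmetric] algebra_simps)
    finally show ?thesis .
  qed
  then show "ruelle E f S u x \<le> ennreal (exp (\<theta> * (B + D) * \<theta> ^ n)) * ruelle E f S u y"
    unfolding ruelle_def x0[symmetric]
    by (subst nn_integral_cmult[symmetric]) (auto intro!: nn_integral_mono)
qed

lemma log_lip_ruelle_funpow:
  assumes f: "wholder B f" and u: "log_lip X D u" and D: "\<theta> * (B + D) \<le> D"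
  shows "log_lip X D ((ruelle E f S ^^ n) u)"
proof (induction n)
  case (Suc n)
  have "log_lip X (\<theta> * (B + D)) (ruelle E f S ((ruelle E f S ^^ n) u))"
    by (rule log_lip_ruelle[OF f Suc]) auto
  then show ?case using D by (auto intro: log_lip_mono)
qed (simp add: u)

lemma log_lip_green:
  assumes "wholder B f" "log_lip X D u" "\<theta> * (B + D) \<le> D"
  shows "log_lip X D (green E f S u)"
  unfolding green_def[abs_def] by (intro log_lip_suminf log_lip_ruelle_funpow[OF assms])

definition invariant_const :: "real \<Rightarrow> real" where
  "invariant_const B = B * \<theta> / (1 - \<theta>)"

lemma invariant_const: "\<theta> * (B + invariant_const B) = invariant_const B"
  using theta by (simp add: invariant_const_def field_simps)

lemma invariant_const_nonneg: "0 \<le> B \<Longrightarrow> 0 \<le> invariant_const B"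
  using theta by (simp add: invariant_const_def)

lemma log_lip_tendsto:
  assumes u: "log_lip X D u" and x: "x \<in> X"
  shows "(u \<longlongrightarrow> u x) (cyl_nhds E x)"
proof (rule order_tendstoI)
  have lim: "(\<lambda>n. ennreal (exp (C * \<theta> ^ n)) * u x) \<longlonglongrightarrow> u x" for C
    using theta by (intro tendsto_exp_geometric_mult) auto
  fix c
  show "\<forall>\<^sub>F y in cyl_nhds E x. c < u y" if "c < u x"
  proof -
    obtain N where N: "\<And>n. n \<ge> N \<Longrightarrow> c < ennreal (exp (- D * \<theta> ^ n)) * u x"
      using order_tendstoD(1)[OF lim \<open>c < u x\<close>] unfolding eventually_sequentially by blast
    have "c < u y" if y: "y \<in> X" "agree (max N 1) x y" for y
    proof -
      define q where "q = D * \<theta> ^ max N 1"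
      have "c < ennreal (exp (- q)) * u x" using N[of "max N 1"] by (simp add: q_def)
      also have "... \<le> ennreal (exp (- q)) * (ennreal (exp q) * u y)"
        unfolding q_def using u x y by (intro mult_left_mono log_lipD) auto
      also have "... = u y"
        by (simp add: mult.assoc[symmetric] ennreal_mult[symmetric] exp_add[symmetric])
      finally show ?thesis .
    qed
    then show ?thesis unfolding eventually_cyl_nhds by blast
  qed
  show "\<forall>\<^sub>F y in cyl_nhds E x. u y < c" if "u x < c"
  proof -
    obtain N where N: "\<And>n. n \<ge> N \<Longrightarrow> ennreal (exp (D * \<theta> ^ n)) * u x < c"
      using order_tendstoD(2)[OF lim \<open>u x < c\<close>] unfolding eventually_sequentially by blast
    have "u y < c" if y: "y \<in> X" "agree (max N 1) x y" for y
      using log_lipD[OF u _ y(1) x agree_sym[OF y(2)]] N[of "max N 1"] le_less_trans by simp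
    then show ?thesis unfolding eventually_cyl_nhds by blast
  qed
qed

lemma log_lip_measurable: "log_lip X D u \<Longrightarrow> u \<in> borel_measurable (shift_space E)"
  by (intro borel_measurable_cyl_continuous log_lip_tendsto)

lemma log_lip_continuous:
  assumes u: "log_lip X D (\<lambda>x. ennreal (f x))" and f: "\<And>x. x \<in> X \<Longrightarrow> 0 \<le> f x"
  shows "shift_continuous E f"
  unfolding shift_continuous_iff_tendsto
proof
  fix x assume x: "x \<in> X"
  have "\<forall>\<^sub>F y in cyl_nhds E x. 0 \<le> f y"
    using eventually_cyl_nhds_in_sigma by eventually_elim (rule f)
  then show "(f \<longlongrightarrow> f x) (cyl_nhds E x)"
    using log_lip_tendsto[OF u x] f[OF x] by (simp add: tendsto_ennreal_iff)
qed

section \<open>Weakly Hoelder functions\<close>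

lemma wholder_continuous:
  assumes f: "wholder B f" shows "shift_continuous E f"
  unfolding shift_continuous_iff_tendsto
proof (intro ballI tendstoI)
  fix x and \<epsilon> :: real assume x: "x \<in> X" and \<epsilon>: "\<epsilon> > 0"
  have "(\<lambda>n. B * \<theta> ^ n) \<longlonglongrightarrow> B * 0" using theta by (intro tendsto_intros LIMSEQ_power_zero) auto
  then have "\<forall>\<^sub>F n in sequentially. B * \<theta> ^ n < \<epsilon>" using \<epsilon> by (intro order_tendstoD) auto
  then obtain N where N: "\<And>n. n \<ge> N \<Longrightarrow> B * \<theta> ^ n < \<epsilon>" by (auto simp: eventually_sequentially)
  have "dist (f y) (f x) < \<epsilon>" if "y \<in> X" "agree (max N 2) x y" for y
    using f[unfolded wholder_def, rule_format, of "max N 2" x y] x that N[of "max N 2"]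
    by (simp add: dist_real_def abs_minus_commute)
  then show "\<forall>\<^sub>F y in cyl_nhds E x. dist (f y) (f x) < \<epsilon>" unfolding eventually_cyl_nhds by blast
qed

lemma wholder_measurable: "wholder B f \<Longrightarrow> f \<in> borel_measurable (shift_space E)"
  by (intro borel_measurable_shift_continuous wholder_continuous)

lemma wholder_mono: "wholder B f \<Longrightarrow> B \<le> C \<Longrightarrow> wholder C f"
  unfolding wholder_def using theta by (meson mult_right_mono order_trans zero_le_power less_imp_le)

lemma wholder_add:
  assumes f: "wholder B f" and g: "wholder C g"
  shows "wholder (B + C) (\<lambda>x. f x + g x)"
  unfolding wholder_def
proof (intro allI impI ballI)
  fix n :: nat and x y assume "2 \<le> n" "x \<in> X" "y \<in> X" "agree n x y"
  then have "\<bar>f x - f y\<bar> \<le> B * \<theta> ^ n" "\<bar>g x - g y\<bar> \<le> C * \<theta> ^ n" using f g unfolding wholder_def by blast+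
  then show "\<bar>f x + g x - (f y + g y)\<bar> \<le> (B + C) * \<theta> ^ n" by (simp add: algebra_simps abs_le_iff)
qed

lemma wholder_const: "wholder 0 (\<lambda>_. c)"
  by (simp add: wholder_def)

lemma wholder_add_const: "wholder B f \<Longrightarrow> wholder B (\<lambda>x. f x + c)"
  by (simp add: wholder_def)

lemma log_lip_ln:
  assumes u: "log_lip X D (\<lambda>x. ennreal (u x))" and pos: "\<And>x. x \<in> X \<Longrightarrow> u x > 0"
    and xy: "n \<ge> 1" "x \<in> X" "y \<in> X" "agree n x y"
  shows "\<bar>ln (u x) - ln (u y)\<bar> \<le> D * \<theta> ^ n"
proof -
  have "ln (u x) \<le> D * \<theta> ^ n + ln (u y)" if xy: "x \<in> X" "y \<in> X" "agree n x y" for x y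
  proof -
    have "ennreal (u x) \<le> ennreal (exp (D * \<theta> ^ n)) * ennreal (u y)"
      using log_lipD[OF u \<open>n \<ge> 1\<close>] xy by blast
    then have "u x \<le> exp (D * \<theta> ^ n) * u y"
      using pos xy by (simp add: ennreal_mult[symmetric] less_imp_le)
    then have "ln (u x) \<le> ln (exp (D * \<theta> ^ n) * u y)" using pos xy by (subst ln_le_cancel_iff) auto
    then show ?thesis using pos[OF xy(2)] by (simp add: ln_mult)
  qed
  from this[of x y] this[of y x] show ?thesis using xy agree_sym[OF xy(4)] by fastforce
qed

lemma wholder_ln:
  assumes "log_lip X D (\<lambda>x. ennreal (u x))" "\<And>x. x \<in> X \<Longrightarrow> u x > 0"
  shows "wholder D (\<lambda>x. ln (u x))"
  using log_lip_ln[OF assms] unfolding wholder_def by simp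

lemma wholder_ln_shift:
  assumes "log_lip X D (\<lambda>x. ennreal (u x))" "\<And>x. x \<in> X \<Longrightarrow> u x > 0"
  shows "wholder (D / \<theta>) (\<lambda>x. - ln (u (shift x)))"
  unfolding wholder_def
proof (intro allI impI ballI)
  fix n :: nat and x y assume xy: "2 \<le> n" "x \<in> X" "y \<in> X" "agree n x y"
  obtain k where k: "n = Suc k" "k \<ge> 1" using xy(1) by (cases n) auto
  have "\<bar>ln (u (shift x)) - ln (u (shift y))\<bar> \<le> D * \<theta> ^ k"
    using log_lip_ln[OF assms, of k "shift x" "shift y"] agree_shift[of k x y] xy k by auto
  also have "D * \<theta> ^ k = D / \<theta> * \<theta> ^ n" using k theta by simp
  finally show "\<bar>- ln (u (shift x)) - - ln (u (shift y))\<bar> \<le> D / \<theta> * \<theta> ^ n" by linarith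
qed

lemma wholder_birkhoff:
  assumes f: "wholder B f" "B \<ge> 0" and xy: "x \<in> X" "y \<in> X" "agree (Suc n) x y"
  shows "\<bar>birkhoff f n x - birkhoff f n y\<bar> \<le> B / (1 - \<theta>)"
proof -
  have "\<bar>birkhoff f n x - birkhoff f n y\<bar> \<le> B * (\<Sum>i<n. \<theta> ^ i)"
    using xy
  proof (induction n arbitrary: x y)
    case (Suc n)
    have "\<bar>f x - f y\<bar> \<le> B * \<theta> ^ Suc (Suc n)"
      using f(1)[unfolded wholder_def, rule_format, of "Suc (Suc n)" x y] Suc.prems by simp
    also have "... \<le> B * \<theta> ^ n" using theta f(2) by (intro mult_left_mono power_decreasing) auto
    finally have "\<bar>f x - f y\<bar> \<le> B * \<theta> ^ n" .
    moreover have "\<bar>birkhoff f n (shift x) - birkhoff f n (shift y)\<bar> \<le> B * (\<Sum>i<n. \<theta> ^ i)"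
      using Suc.IH[of "shift x" "shift y"] Suc.prems agree_shift[of "Suc n" x y] by auto
    ultimately show ?case by (simp add: birkhoff_Suc_shift distrib_left)
  qed simp
  also have "... \<le> B * (1 / (1 - \<theta>))"
    using theta f(2) by (intro mult_left_mono) (auto simp: sum_gp_strict divide_right_mono)
  finally show ?thesis by simp
qed

end

section \<open>Exponential growth rates\<close>

lemma eln_le:
  assumes "z \<le> ennreal (exp t)" shows "eln z \<le> ereal t"
proof -
  obtain r where r: "z = ennreal r" "0 \<le> r" using assms by (metis ennreal_cases ennreal_neq_top top.extremum_uniqueI)
  then have "r \<le> exp t" using assms by simp
  then have "ln r \<le> t" if "r \<noteq> 0"
    using that r by (metis exp_gt_zero less_eq_real_def ln_exp ln_le_cancel_iff order_le_less_trans)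
  then show ?thesis using r by (auto simp: eln_def ennreal_eq_0_iff)
qed

lemma le_of_eln_less:
  assumes "eln z < ereal t" shows "z \<le> ennreal (exp t)"
proof -
  have "z \<noteq> top" using assms by (auto simp: eln_def split: if_splits)
  then obtain r where r: "z = ennreal r" "0 \<le> r" by (metis ennreal_cases)
  show ?thesis
  proof (cases "r = 0")
    case False
    then have "ln r < t" using assms r by (auto simp: eln_def ennreal_eq_0_iff split: if_splits)
    then have "r \<le> exp t" using False r by (metis exp_less_mono exp_ln less_eq_real_def)
    then show ?thesis using r by (simp add: ennreal_leI)
  qed (use r in auto)
qed

lemma limsup_eln_le:
  assumes "\<And>n. n \<ge> 1 \<Longrightarrow> Z n \<le> ennreal (C * exp (real n * q))" "C > 0"
  shows "limsup (\<lambda>n. eln (Z n) / ereal (real n)) \<le> ereal q"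
proof -
  have "limsup (\<lambda>n. eln (Z n) / ereal (real n)) \<le> limsup (\<lambda>n. ereal (ln C / real n + q))"
  proof (rule Limsup_mono, rule eventually_sequentiallyI[of 1])
    fix n :: nat assume n: "1 \<le> n"
    have "C * exp (real n * q) = exp (ln C + real n * q)" using assms(2) by (simp add: exp_add)
    then have "eln (Z n) \<le> ereal (ln C + real n * q)" using assms(1)[OF n] by (intro eln_le) simp
    then have "eln (Z n) / ereal (real n) \<le> ereal (ln C + real n * q) / ereal (real n)"
      using n by (intro ereal_divide_right_mono) auto
    also have "... = ereal (ln C / real n + q)" using n by (simp add: add_divide_distrib)
    finally show "eln (Z n) / ereal (real n) \<le> ereal (ln C / real n + q)" .
  qed
  also have "... = ereal q"
  proof (rule lim_imp_Limsup)
    have "(\<lambda>n. ln C / real n + q) \<longlonglongrightarrow> 0 + q"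
      by (intro tendsto_intros lim_const_over_n)
    then show "(\<lambda>n. ereal (ln C / real n + q)) \<longlonglongrightarrow> ereal q" by simp
  qed simp
  finally show ?thesis .
qed

lemma limsup_eln_lessD:
  assumes "limsup (\<lambda>n. eln (Z n) / ereal (real n)) < ereal q"
  shows "\<exists>N. \<forall>n\<ge>N. Z n \<le> ennreal (exp (real n * q))"
proof -
  have "\<forall>\<^sub>F n in sequentially. eln (Z n) / ereal (real n) < ereal q"
    by (rule Limsup_lessD[OF assms])
  then obtain N where N: "\<And>n. n \<ge> N \<Longrightarrow> eln (Z n) / ereal (real n) < ereal q"
    by (auto simp: eventually_sequentially)
  have "Z n \<le> ennreal (exp (real n * q))" if n: "n \<ge> max N 1" for n
  proof (rule le_of_eln_less)
    have "eln (Z n) / ereal (real n) < ereal q" using N n by simp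
    moreover have "0 < ereal (real n)" "ereal (real n) < \<infinity>" using n by auto
    ultimately have "eln (Z n) < ereal q * ereal (real n)"
      by (subst (asm) ereal_divide_less_pos) (auto simp: mult.commute)
    then show "eln (Z n) < ereal (real n * q)" by (simp add: mult.commute)
  qed
  then show ?thesis by blast
qed

lemma limsup_eln_frequently:
  assumes "ereal q < limsup (\<lambda>n. eln (Z n) / ereal (real n))"
  shows "\<exists>n\<ge>N. n \<ge> 1 \<and> ennreal (exp (real n * q)) < Z n"
proof (rule ccontr)
  assume "\<not> ?thesis"
  then have *: "\<And>n. n \<ge> max N 1 \<Longrightarrow> Z n \<le> ennreal (exp (real n * q))" by (force simp: not_less)
  have "limsup (\<lambda>n. eln (Z n) / ereal (real n)) \<le> ereal q"
  proof (rule Limsup_bounded, rule eventually_sequentiallyI[of "max N 1"])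
    fix n assume n: "max N 1 \<le> n"
    have "eln (Z n) / ereal (real n) \<le> ereal (real n * q) / ereal (real n)"
      using n eln_le[OF *[OF n]] by (intro ereal_divide_right_mono) auto
    also have "... = ereal q" using n by simp
    finally show "eln (Z n) / ereal (real n) \<le> ereal q" .
  qed
  then show False using assms by simp
qed

definition exp_decay :: "'b set \<Rightarrow> (nat \<Rightarrow> 'b \<Rightarrow> ennreal) \<Rightarrow> bool" where
  "exp_decay A u \<longleftrightarrow> (\<exists>C \<rho>. 0 < C \<and> 0 < \<rho> \<and> \<rho> < 1 \<and> (\<forall>k. \<forall>x\<in>A. u k x \<le> ennreal (C * \<rho> ^ k)))"

lemma exp_decay_eventually:
  assumes \<rho>: "0 < \<rho>" "\<rho> < 1" and M: "0 < M" and fin: "\<And>k x. x \<in> A \<Longrightarrow> u k x \<le> c k" "\<And>k. c k \<noteq> top"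
    and ev: "\<And>k x. k \<ge> N \<Longrightarrow> x \<in> A \<Longrightarrow> u k x \<le> ennreal (M * \<rho> ^ k)"
  shows "exp_decay A u"
proof -
  define d where "d k = enn2real (c k)" for k
  define C where "C = M + (\<Sum>k<N. d k / \<rho> ^ k)"
  have d: "0 \<le> d k" "u k x \<le> ennreal (d k)" if "x \<in> A" for k x
    using fin(1)[OF that, of k] fin(2)[of k] by (auto simp: d_def less_top)
  have d0: "0 \<le> d k" for k by (simp add: d_def)
  have "u k x \<le> ennreal (C * \<rho> ^ k)" if x: "x \<in> A" for k x
  proof (cases "k < N")
    case True
    have "d k / \<rho> ^ k \<le> (\<Sum>k<N. d k / \<rho> ^ k)"
      using True \<rho> d0 by (intro member_le_sum) auto
    then have "d k / \<rho> ^ k \<le> C" using M by (simp add: C_def)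
    then have "d k \<le> C * \<rho> ^ k" using \<rho> by (simp add: field_simps)
    then show ?thesis using d(2)[OF x, of k] by (meson ennreal_leI order_trans)
  next
    case False
    have "M * \<rho> ^ k \<le> C * \<rho> ^ k"
      using d0 \<rho> by (intro mult_right_mono) (auto simp: C_def intro!: sum_nonneg)
    then show ?thesis using ev[of k x] False x by (meson ennreal_leI order_trans not_less)
  qed
  moreover have "0 < C" using d0 \<rho> M by (auto simp: C_def intro!: add_pos_nonneg sum_nonneg)
  ultimately show ?thesis using \<rho> unfolding exp_decay_def by blast
qed

lemma suminf_geometric_ennreal:
  fixes C \<rho> :: real
  assumes "0 \<le> C" "0 \<le> \<rho>" "\<rho> < 1"
  shows "(\<Sum>k. ennreal (C * \<rho> ^ k)) = ennreal (C / (1 - \<rho>))"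
proof -
  have "(\<lambda>k. C * \<rho> ^ k) sums (C * (1 / (1 - \<rho>)))" using assms by (intro sums_mult geometric_sums) auto
  then show ?thesis using assms by (subst suminf_ennreal_eq[of _ "C * (1 / (1 - \<rho>))"]) auto
qed

lemma exp_decay_tail:
  assumes "exp_decay A u"
  shows "exp_decay A (\<lambda>k x. \<Sum>j. u (j + k) x)"
proof -
  obtain C \<rho> where u: "0 < C" "0 < \<rho>" "\<rho> < 1" "\<And>k x. x \<in> A \<Longrightarrow> u k x \<le> ennreal (C * \<rho> ^ k)"
    using assms unfolding exp_decay_def by blast
  have "(\<Sum>j. u (j + k) x) \<le> ennreal (C / (1 - \<rho>) * \<rho> ^ k)" if x: "x \<in> A" for k x
  proof -
    have "u (j + k) x \<le> ennreal ((C * \<rho> ^ k) * \<rho> ^ j)" for j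
      using u(4)[OF x, of "j + k"] by (simp add: power_add mult.assoc mult.commute[of "\<rho> ^ j"])
    then have "(\<Sum>j. u (j + k) x) \<le> (\<Sum>j. ennreal ((C * \<rho> ^ k) * \<rho> ^ j))" by (intro suminf_le) auto
    also have "... = ennreal (C * \<rho> ^ k / (1 - \<rho>))" using u by (intro suminf_geometric_ennreal) auto
    finally show ?thesis by (simp add: ac_simps)
  qed
  then show ?thesis using u unfolding exp_decay_def by (intro exI[of _ "C / (1 - \<rho>)"] exI[of _ \<rho>]) auto
qed

lemma exp_decay_suminf_bounded:
  assumes "exp_decay A u" shows "\<exists>C\<ge>0. \<forall>x\<in>A. (\<Sum>k. u k x) \<le> ennreal C"
proof -
  obtain C \<rho> where u: "0 < C" "\<And>k x. x \<in> A \<Longrightarrow> (\<Sum>j. u (j + k) x) \<le> ennreal (C * \<rho> ^ k)"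
    using exp_decay_tail[OF assms] unfolding exp_decay_def by blast
  then have "\<forall>x\<in>A. (\<Sum>k. u k x) \<le> ennreal C" using u(2)[of _ 0] by simp
  then show ?thesis using u(1) by (meson less_imp_le)
qed

context markov_shift
begin

section \<open>Irreducibility\<close>

lemma path_to:
  assumes "x \<in> X" obtains n y where "n \<ge> 1" "y \<in> X" "y 0 = b" "(shift ^^ n) y = x"
proof -
  have "\<exists>n y. n \<ge> 1 \<and> y \<in> X \<and> y 0 = b \<and> (shift ^^ n) y = x" if "E\<^sup>+\<^sup>+ b c" "x \<in> X" "x 0 = c" for c x
    using that
  proof (induction arbitrary: x rule: tranclp_induct)
    case (base c)
    then show ?case by (intro exI[of _ 1] exI[of _ "case_nat b x"]) auto
  next
    case (step c d)
    have "case_nat c x \<in> X" using step by simp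
    then obtain n y where "n \<ge> 1 \<and> y \<in> X \<and> y 0 = b \<and> (shift ^^ n) y = case_nat c x"
      using step.IH[of "case_nat c x"] by auto
    then show ?case by (intro exI[of _ "Suc n"] exI[of _ y]) auto
  qed
  from this[OF irr assms refl]
  have "\<exists>n y. n \<ge> 1 \<and> y \<in> X \<and> y 0 = b \<and> (shift ^^ n) y = x" .
  then show thesis using that by blast
qed

lemma cylinder_path:
  assumes x: "x \<in> X" and z: "z \<in> X"
  shows "\<exists>k y. Suc n \<le> k \<and> y \<in> X \<and> agree (Suc n) z y \<and> (shift ^^ k) y = x"
  using z
proof (induction n arbitrary: z)
  case 0
  obtain k y where "k \<ge> 1" "y \<in> X" "y 0 = z 0" "(shift ^^ k) y = x" using path_to[OF x, of "z 0"] by blast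
  then show ?case by (intro exI[of _ k] exI[of _ y]) simp
next
  case (Suc n)
  then obtain k y where y: "Suc n \<le> k" "y \<in> X" "agree (Suc n) (shift z) y" "(shift ^^ k) y = x"
    using shift_in_sigma by blast
  define w where "w = case_nat (z 0) y"
  have "y 0 = shift z 0" using y(3) by (simp add: agree_def)
  then have "w \<in> X" using y(2) sigma_plus_step[OF Suc.prems] by (simp add: w_def)
  moreover have "agree (Suc (Suc n)) z w"
    using y(3) agree_case_nat[of "Suc n" "z 0" "shift z" y] by (simp only: w_def case_nat_shift)
  moreover have "(shift ^^ Suc k) w = x" using y(4) by (simp add: w_def funpow_Suc_right del: funpow.simps)
  ultimately show ?case using y(1) by (intro exI[of _ "Suc k"] exI[of _ w]) simp
qed

lemma cyl_nonempty: "cyl a \<noteq> {}"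
proof -
  have "\<exists>c. E b c" for b using irr[of b b] by (metis tranclpD)
  then obtain s where s: "\<And>b. E b (s b)" by metis
  have "(\<lambda>i. (s ^^ i) a) \<in> cyl a" using s by (auto simp: sigma_plus_def)
  then show ?thesis by blast
qed

lemma superharmonic_finite:
  assumes H: "superharmonic E f H" and lip: "log_lip X D H"
    and x0: "x0 \<in> X" "H x0 \<noteq> top" and x: "x \<in> X"
  shows "H x \<noteq> top"
proof -
  obtain n y where y: "y \<in> X" "y 0 = x 0" "(shift ^^ n) y = x0" using path_to[OF x0(1), of "x 0"] by blast
  have "ennreal (exp (birkhoff f n y)) * H y \<le> H x0" using superharmonic_path[OF H y(1), of n] y by simp
  then have "H y \<noteq> top" using x0(2) by (auto simp: ennreal_mult_top top_unique)
  moreover have "H x \<le> ennreal (exp (D * \<theta> ^ 1)) * H y" using log_lipD[OF lip, of 1 x y] x y by simp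
  ultimately show ?thesis by (metis ennreal_mult_eq_top_iff ennreal_neq_top top.extremum_uniqueI)
qed

lemma superharmonic_pos:
  assumes H: "superharmonic E f H" and lip: "log_lip X D H"
    and x0: "x0 \<in> X" "H x0 \<noteq> 0" and x: "x \<in> X"
  shows "H x \<noteq> 0"
proof -
  obtain n y where y: "y \<in> X" "y 0 = x0 0" "(shift ^^ n) y = x" using path_to[OF x, of "x0 0"] by blast
  have "H x0 \<le> ennreal (exp (D * \<theta> ^ 1)) * H y" using log_lipD[OF lip, of 1 x0 y] x0 y by simp
  then have "H y \<noteq> 0" using x0(2) by auto
  then show ?thesis using superharmonic_path[OF H y(1), of n] y(3) by auto
qed

definition regular_superharmonic :: "((nat \<Rightarrow> 'a) \<Rightarrow> real) \<Rightarrow> ((nat \<Rightarrow> 'a) \<Rightarrow> ennreal) \<Rightarrow> bool" where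
  "regular_superharmonic f H \<longleftrightarrow> superharmonic E f H \<and> (\<exists>D\<ge>0. log_lip X D H) \<and> (\<forall>x\<in>X. H x \<noteq> top \<and> H x \<noteq> 0)"

lemma regular_superharmonicI:
  assumes "superharmonic E f H" "log_lip X D H" "0 \<le> D" "x0 \<in> X" "H x0 \<noteq> top" "H x0 \<noteq> 0"
  shows "regular_superharmonic f H"
  unfolding regular_superharmonic_def
  using superharmonic_finite[OF assms(1,2,4,5)] superharmonic_pos[OF assms(1,2,4,6)] assms(1-3) by blast

abbreviation starts_in :: "'a set \<Rightarrow> (nat \<Rightarrow> 'a) \<Rightarrow> ennreal" where
  "starts_in F \<equiv> (\<lambda>y. indicator F (y 0))"

lemma log_lip_starts_in: "log_lip X 0 (starts_in F)"
  by (rule log_lipI) (auto simp: agree_def indicator_def)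

lemma regular_superharmonic_letter_bounds:
  assumes H: "regular_superharmonic f H"
  shows "\<exists>c\<ge>0. \<forall>y\<in>cyl b. 1 \<le> ennreal c * H y \<and> H y \<le> ennreal c"
proof -
  obtain D where D: "0 \<le> D" "log_lip X D H" using H by (auto simp: regular_superharmonic_def)
  obtain z where z: "z \<in> cyl b" using cyl_nonempty by blast
  then have "H z \<noteq> top" "H z \<noteq> 0" using H by (auto simp: regular_superharmonic_def)
  then obtain h where h: "H z = ennreal h" "0 < h" by (auto elim: ennreal_nonzero_finite_cases)
  define c where "c = exp D * max h (1 / h)"
  have "1 \<le> ennreal c * H y \<and> H y \<le> ennreal c" if y: "y \<in> cyl b" for y
  proof
    have "H y \<le> ennreal (exp D) * H z" using log_lip_same_letter[OF D(2), of y z] y z D(1) by auto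
    also have "... \<le> ennreal c" using h by (simp add: c_def ennreal_mult[symmetric] ennreal_leI)
    finally show "H y \<le> ennreal c" .
    have "1 = ennreal (1 / h) * H z" using h by (simp add: ennreal_mult[symmetric])
    also have "... \<le> ennreal (1 / h) * (ennreal (exp D) * H y)"
      using log_lip_same_letter[OF D(2), of z y] y z D(1) by (intro mult_left_mono) auto
    also have "... = ennreal (exp D * (1 / h)) * H y"
      using h by (subst ennreal_mult) (auto simp: ac_simps)
    also have "... \<le> ennreal c * H y"
      unfolding c_def by (intro mult_right_mono ennreal_leI mult_left_mono) auto
    finally show "1 \<le> ennreal c * H y" .
  qed
  moreover have "0 \<le> c" using h by (simp add: c_def le_max_iff_disj)
  ultimately show ?thesis by blast
qed

lemma regular_superharmonic_finite_letter_bounds: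
  assumes H: "regular_superharmonic f H" and F: "finite F"
  shows "\<exists>c\<ge>0. \<forall>y\<in>X. y 0 \<in> F \<longrightarrow> 1 \<le> ennreal c * H y \<and> H y \<le> ennreal c"
  using F
proof (induction F rule: finite_induct)
  case (insert b F)
  obtain c where c: "0 \<le> c" "\<And>y. y \<in> X \<Longrightarrow> y 0 \<in> F \<Longrightarrow> 1 \<le> ennreal c * H y \<and> H y \<le> ennreal c"
    using insert.IH by blast
  obtain d where d: "0 \<le> d" "\<And>y. y \<in> cyl b \<Longrightarrow> 1 \<le> ennreal d * H y \<and> H y \<le> ennreal d"
    using regular_superharmonic_letter_bounds[OF H] by blast
  have le: "ennreal c \<le> ennreal (max c d)" "ennreal d \<le> ennreal (max c d)" by (auto intro: ennreal_leI)
  have "1 \<le> ennreal (max c d) * H y \<and> H y \<le> ennreal (max c d)" if "y \<in> X" "y 0 \<in> insert b F" for y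
    using c(2)[of y] d(2)[of y] that le mult_right_mono[OF le(1), of "H y"] mult_right_mono[OF le(2), of "H y"]
    by (auto intro: order_trans)
  then show ?case using c(1) by (intro exI[of _ "max c d"]) (auto simp: le_max_iff_disj)
qed auto

lemma ruelle_funpow_starts_in_bounded:
  assumes H: "regular_superharmonic f H" and F: "finite F"
  shows "\<exists>C\<ge>0. \<forall>n. \<forall>z\<in>X. z 0 \<in> F \<longrightarrow> (ruelle E f UNIV ^^ n) (starts_in F) z \<le> ennreal C"
proof -
  obtain c where c: "0 \<le> c" "\<And>y. y \<in> X \<Longrightarrow> y 0 \<in> F \<Longrightarrow> 1 \<le> ennreal c * H y \<and> H y \<le> ennreal c"
    using regular_superharmonic_finite_letter_bounds[OF H F] by blast
  have "(ruelle E f UNIV ^^ n) (starts_in F) z \<le> ennreal (c * c)" if z: "z \<in> X" "z 0 \<in> F" for n z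
  proof -
    have "(ruelle E f UNIV ^^ n) (starts_in F) z \<le> (ruelle E f UNIV ^^ n) (\<lambda>y. ennreal c * H y) z"
      using c(2) z(1) by (intro ruelle_funpow_mono) (auto simp: indicator_def)
    also have "... \<le> ennreal c * H z"
      unfolding ruelle_funpow_cmult using superharmonic_funpow[OF _ z(1)] H
      by (intro mult_left_mono) (auto simp: regular_superharmonic_def)
    also have "... \<le> ennreal c * ennreal c" using c(2)[OF z] by (intro mult_left_mono) auto
    also have "... = ennreal (c * c)" using c(1) by (simp add: ennreal_mult)
    finally show ?thesis .
  qed
  then show ?thesis using c(1) by (intro exI[of _ "c * c"]) auto
qed

section \<open>Partition functions and pressure\<close>

lemma nn_integral_exp_bij_betw:
  fixes g h :: "_ \<Rightarrow> real"
  assumes p: "bij_betw p A A'" and close: "\<And>y. y \<in> A \<Longrightarrow> \<bar>g y - h (p y)\<bar> \<le> c"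
  shows "(\<integral>\<^sup>+y. ennreal (exp (g y)) \<partial>count_space A) \<le> ennreal (exp c) * (\<integral>\<^sup>+z. ennreal (exp (h z)) \<partial>count_space A')"
    and "(\<integral>\<^sup>+z. ennreal (exp (h z)) \<partial>count_space A') \<le> ennreal (exp c) * (\<integral>\<^sup>+y. ennreal (exp (g y)) \<partial>count_space A)"
proof -
  have le: "exp s \<le> exp c * exp t" if "\<bar>s - t\<bar> \<le> c" for s t :: real
    unfolding exp_add[symmetric] exp_le_cancel_iff using that by linarith
  have eq: "(\<integral>\<^sup>+z. ennreal (exp (h z)) \<partial>count_space A') = (\<integral>\<^sup>+y. ennreal (exp (h (p y))) \<partial>count_space A)"
    by (rule nn_integral_bij_count_space[OF p, symmetric])
  show "(\<integral>\<^sup>+y. ennreal (exp (g y)) \<partial>count_space A) \<le> ennreal (exp c) * (\<integral>\<^sup>+z. ennreal (exp (h z)) \<partial>count_space A')"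
    and "(\<integral>\<^sup>+z. ennreal (exp (h z)) \<partial>count_space A') \<le> ennreal (exp c) * (\<integral>\<^sup>+y. ennreal (exp (g y)) \<partial>count_space A)"
    unfolding eq by (subst nn_integral_cmult[symmetric];
      auto intro!: nn_integral_mono simp: ennreal_mult[symmetric] le close abs_minus_commute)+
qed

lemma bij_betw_periodise:
  assumes x: "x \<in> cyl a" and n: "n \<ge> 1" and R: "\<And>y z. agree n y z \<Longrightarrow> R y = R z"
  shows "bij_betw (periodise n) {y \<in> X. (shift ^^ n) y = x \<and> y 0 = a \<and> R y}
    {z \<in> X. (shift ^^ n) z = z \<and> z 0 = a \<and> R z}"
proof (rule bij_betw_byWitness[where f'="\<lambda>z. splice n z x"])
  have at_n: "y n = a" if "(shift ^^ n) y = x" for y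
    using fun_cong[OF that, of 0] x by (simp add: funpow_shift)
  have at_n': "z n = z 0" if "(shift ^^ n) z = z" for z :: "nat \<Rightarrow> 'a"
    using fun_cong[OF that, of 0] by (simp add: funpow_shift)
  show "\<forall>y\<in>{y \<in> X. (shift ^^ n) y = x \<and> y 0 = a \<and> R y}. splice n (periodise n y) x = y"
  proof clarify
    fix y assume "x = (shift ^^ n) y"
    then show "splice n (periodise n y) ((shift ^^ n) y) = y"
      by (auto simp: splice_def periodise_def funpow_shift)
  qed
  show "\<forall>z\<in>{z \<in> X. (shift ^^ n) z = z \<and> z 0 = a \<and> R z}. periodise n (splice n z x) = z"
  proof clarify
    fix z :: "nat \<Rightarrow> 'a" assume z: "(shift ^^ n) z = z"
    have "periodise n (splice n z x) = periodise n z"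
      using n by (auto intro!: periodise_cong simp: agree_def splice_def)
    then show "periodise n (splice n z x) = z" by (simp only: periodic_eq_periodise[OF z])
  qed
  show "periodise n ` {y \<in> X. (shift ^^ n) y = x \<and> y 0 = a \<and> R y} \<subseteq> {z \<in> X. (shift ^^ n) z = z \<and> z 0 = a \<and> R z}"
  proof clarify
    fix y assume y: "y \<in> X" "a = y 0" "x = (shift ^^ n) y" "R y"
    have "periodise n y \<in> X" using at_n[of y] y by (intro periodise_in_sigma) auto
    moreover have "periodise n y 0 = y 0" by (simp add: periodise_def)
    moreover have "R (periodise n y)" using R[OF agree_periodise] y(4) by simp
    ultimately show "periodise n y \<in> X \<and> (shift ^^ n) (periodise n y) = periodise n y \<and>
        periodise n y 0 = y 0 \<and> R (periodise n y)" by simp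
  qed
  show "(\<lambda>z. splice n z x) ` {z \<in> X. (shift ^^ n) z = z \<and> z 0 = a \<and> R z} \<subseteq> {y \<in> X. (shift ^^ n) y = x \<and> y 0 = a \<and> R y}"
  proof clarify
    fix z assume z: "z \<in> X" "(shift ^^ n) z = z" "a = z 0" "R z"
    have "splice n z x \<in> X" using at_n'[OF z(2)] z(3) x by (intro splice_in_sigma z(1)) auto
    moreover have "splice n z x 0 = z 0" using n by (simp add: splice_def)
    moreover have "R (splice n z x)" using R[OF agree_splice] z(4) by simp
    ultimately show "splice n z x \<in> X \<and> (shift ^^ n) (splice n z x) = x \<and> splice n z x 0 = z 0 \<and> R (splice n z x)" by simp
  qed
qed

lemma preimage_sum_periodic_sum:
  assumes x: "x \<in> cyl a" and n: "n \<ge> 1" and R: "\<And>y z. agree n y z \<Longrightarrow> R y = R z"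
    and f: "wholder B f" "B \<ge> 0"
  defines "P \<equiv> {y \<in> X. (shift ^^ n) y = x \<and> y 0 = a \<and> R y}"
    and "Q \<equiv> {z \<in> X. (shift ^^ n) z = z \<and> z 0 = a \<and> R z}"
  shows "(\<integral>\<^sup>+y. ennreal (exp (birkhoff f n y)) \<partial>count_space P) \<le>
      ennreal (exp (B / (1 - \<theta>))) * (\<integral>\<^sup>+z. ennreal (exp (birkhoff f n z)) \<partial>count_space Q)"
    and "(\<integral>\<^sup>+z. ennreal (exp (birkhoff f n z)) \<partial>count_space Q) \<le>
      ennreal (exp (B / (1 - \<theta>))) * (\<integral>\<^sup>+y. ennreal (exp (birkhoff f n y)) \<partial>count_space P)"
proof -
  have bij: "bij_betw (periodise n) P Q" unfolding P_def Q_def by (rule bij_betw_periodise[OF x n R])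
  have dist: "\<bar>birkhoff f n y - birkhoff f n (periodise n y)\<bar> \<le> B / (1 - \<theta>)" if y: "y \<in> P" for y
  proof (rule wholder_birkhoff[OF f])
    have "y n = y 0" using y x fun_cong[of "(shift ^^ n) y" x 0] by (auto simp: P_def funpow_shift)
    then show "agree (Suc n) y (periodise n y)" by (rule agree_Suc_periodise)
    show "y \<in> X" "periodise n y \<in> X" using y bij_betwE[OF bij] by (auto simp: P_def Q_def)
  qed
  show "(\<integral>\<^sup>+y. ennreal (exp (birkhoff f n y)) \<partial>count_space P) \<le>
      ennreal (exp (B / (1 - \<theta>))) * (\<integral>\<^sup>+z. ennreal (exp (birkhoff f n z)) \<partial>count_space Q)"
    and "(\<integral>\<^sup>+z. ennreal (exp (birkhoff f n z)) \<partial>count_space Q) \<le>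
      ennreal (exp (B / (1 - \<theta>))) * (\<integral>\<^sup>+y. ennreal (exp (birkhoff f n y)) \<partial>count_space P)"
    by (rule nn_integral_exp_bij_betw[where g="birkhoff f n" and h="birkhoff f n", OF bij]; rule dist; assumption)+
qed

lemma ruelle_funpow_starts_in_le_Zn:
  assumes x: "x \<in> cyl a" and n: "n \<ge> 1" and f: "wholder B f" "B \<ge> 0"
  shows "(ruelle E f UNIV ^^ n) (starts_in {a}) x \<le> ennreal (exp (B / (1 - \<theta>))) * Zn E f a n"
    and "Zn E f a n \<le> ennreal (exp (B / (1 - \<theta>))) * (ruelle E f UNIV ^^ n) (starts_in {a}) x"
proof -
  have "x \<in> X" using x by simp
  then have eq: "(ruelle E f UNIV ^^ n) (starts_in {a}) x =
      (\<integral>\<^sup>+y. ennreal (exp (birkhoff f n y)) \<partial>count_space {y \<in> X. (shift ^^ n) y = x \<and> y 0 = a \<and> True})"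
    unfolding ruelle_funpow_preimages[OF \<open>x \<in> X\<close>] preimages_def
    by (auto simp: nn_integral_count_space_indicator intro!: nn_integral_cong split: split_indicator)
  have Z: "Zn E f a n = (\<integral>\<^sup>+z. ennreal (exp (birkhoff f n z)) \<partial>count_space {z \<in> X. (shift ^^ n) z = z \<and> z 0 = a \<and> True})"
    by (simp add: Zn_def infsum_ennreal_eq_nn_integral)
  show "(ruelle E f UNIV ^^ n) (starts_in {a}) x \<le> ennreal (exp (B / (1 - \<theta>))) * Zn E f a n"
    unfolding eq Z by (rule preimage_sum_periodic_sum(1)[OF x n _ f]) simp
  show "Zn E f a n \<le> ennreal (exp (B / (1 - \<theta>))) * (ruelle E f UNIV ^^ n) (starts_in {a}) x"
    unfolding eq Z by (rule preimage_sum_periodic_sum(2)[OF x n _ f]) simp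
qed

definition excursion_weight :: "((nat \<Rightarrow> 'a) \<Rightarrow> real) \<Rightarrow> 'a \<Rightarrow> ((nat \<Rightarrow> 'a) \<Rightarrow> ennreal) \<Rightarrow> nat \<Rightarrow> (nat \<Rightarrow> 'a) \<Rightarrow> ennreal" where
  "excursion_weight f a u k = (ruelle E f (- {a}) ^^ k) (ruelle E f {a} u)"

lemma excursion_weight_mono:
  assumes "\<And>y. y \<in> cyl a \<Longrightarrow> u y \<le> v y" "x \<in> X"
  shows "excursion_weight f a u k x \<le> excursion_weight f a v k x"
  unfolding excursion_weight_def by (intro ruelle_funpow_mono ruelle_mono) (use assms in auto)

lemma excursion_weight_cmult: "excursion_weight f a (\<lambda>x. c * u x) k x = c * excursion_weight f a u k x"
  by (simp add: excursion_weight_def ruelle_cmult[abs_def] ruelle_funpow_cmult)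

lemma excursion_weight_add_const:
  "excursion_weight (\<lambda>x. f x + c) a u k x = ennreal (exp (c * (real k + 1))) * excursion_weight f a u k x"
proof -
  have "ruelle E (\<lambda>x. f x + c) {a} u = (\<lambda>x. ennreal (exp c) * ruelle E f {a} u x)"
    by (rule ext) (rule ruelle_add_const)
  then have "excursion_weight (\<lambda>x. f x + c) a u k x = ennreal (exp (real k * c)) * ennreal (exp c) * excursion_weight f a u k x"
    by (simp only: excursion_weight_def ruelle_funpow_cmult ruelle_funpow_add_const
        mult.left_commute[of "ennreal (exp c)"] mult.assoc)
  also have "ennreal (exp (real k * c)) * ennreal (exp c) = ennreal (exp (c * (real k + 1)))"
    by (simp add: ennreal_mult[symmetric] exp_add[symmetric] algebra_simps)
  finally show ?thesis .
qed

lemma excursion_weight_le_Zn_star: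
  assumes x: "x \<in> cyl a" and f: "wholder B f" "B \<ge> 0"
  shows "excursion_weight f a (\<lambda>_. 1) k x \<le> ennreal (exp (B / (1 - \<theta>))) * Zn_star E f a (Suc k)"
proof -
  define R where "R y \<longleftrightarrow> (\<forall>j. 0 < j \<and> j < Suc k \<longrightarrow> y j \<noteq> a)" for y :: "nat \<Rightarrow> 'a"
  define P where "P = {y \<in> X. (shift ^^ Suc k) y = x \<and> y 0 = a \<and> R y}"
  define P0 where "P0 = {y \<in> preimages E (- {a}) k x. E a (y 0)}"
  have "x \<in> X" using x by simp
  have bij: "bij_betw (case_nat a) P0 P"
  proof (rule bij_betw_byWitness[where f'=shift])
    show "\<forall>y\<in>P. case_nat a (shift y) = y" by (auto simp: P_def simp del: case_nat_shift) (metis case_nat_shift)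
    show "case_nat a ` P0 \<subseteq> P"
      by (auto simp: P0_def P_def R_def preimages_def funpow_swap1 split: nat.splits)
    have "shift y \<in> P0" if "y \<in> P" for y
      using that sigma_plus_step[of y E] by (auto simp: P_def P0_def R_def preimages_def funpow_swap1) (simp add: shift_def)
    then show "shift ` P \<subseteq> P0" by blast
  qed simp
  have "excursion_weight f a (\<lambda>_. 1) k x =
      (\<integral>\<^sup>+y. ennreal (exp (birkhoff f (Suc k) (case_nat a y))) \<partial>count_space P0)"
    unfolding excursion_weight_def ruelle_funpow_preimages[OF \<open>x \<in> X\<close>] ruelle_singleton
    by (auto simp: nn_integral_count_space_indicator P0_def birkhoff_Suc_shift exp_add ennreal_mult ac_simps
        intro!: nn_integral_cong split: split_indicator)
  also have "... = (\<integral>\<^sup>+y. ennreal (exp (birkhoff f (Suc k) y)) \<partial>count_space P)"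
    by (rule nn_integral_bij_count_space[OF bij])
  also have "... \<le> ennreal (exp (B / (1 - \<theta>))) *
      (\<integral>\<^sup>+z. ennreal (exp (birkhoff f (Suc k) z)) \<partial>count_space {z \<in> X. (shift ^^ Suc k) z = z \<and> z 0 = a \<and> R z})"
    unfolding P_def by (rule preimage_sum_periodic_sum(1)[OF x _ _ f]) (auto simp: R_def agree_def)
  finally show ?thesis unfolding Zn_star_def infsum_ennreal_eq_nn_integral R_def by simp
qed

lemma ruelle_funpow_starts_in_infinite:
  assumes f: "wholder B f" "0 \<le> B" and x: "x \<in> cyl a" and inf: "(ruelle E f UNIV ^^ n) (starts_in {a}) x = top"
    and x': "x' \<in> cyl a"
  shows "(ruelle E f UNIV ^^ (n * Suc j)) (starts_in {a}) x' = top"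
  using x'
proof (induction j arbitrary: x')
  let ?I = "starts_in {a}" and ?R = "ruelle E f UNIV"
  have top1: "(?R ^^ n) ?I y = top" if "y \<in> cyl a" for y
  proof -
    have "log_lip X (invariant_const B) ((?R ^^ n) ?I)"
      using log_lip_ruelle_funpow[OF f(1) log_lip_mono[OF log_lip_starts_in invariant_const_nonneg[OF f(2)]]]
      by (simp add: invariant_const)
    from log_lipD[OF this, of 1 x y] x that inf show ?thesis by (auto simp: top_unique ennreal_mult_eq_top_iff)
  qed
  {
    case 0
    then show ?case using top1 by simp
  next
    case (Suc j)
    have "top = top * (?R ^^ n) ?I x'" using top1[OF Suc.prems] by simp
    also have "... = (?R ^^ n) (\<lambda>y. top * ?I y) x'" by (simp add: ruelle_funpow_cmult)
    also have "... \<le> (?R ^^ n) ((?R ^^ (n * Suc j)) ?I) x'"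
      using Suc by (intro ruelle_funpow_mono) (auto simp: indicator_def)
    also have "... = (?R ^^ (n * Suc (Suc j))) ?I x'" by (simp add: funpow_add)
    finally show ?case by (simp add: top_unique)
  }
qed

lemma Zn_finite:
  assumes f: "wholder B f" "0 \<le> B" and press: "gurevich_pressure E f a < ereal q" and n: "n \<ge> 1"
  shows "Zn E f a n \<noteq> top"
proof
  assume Z: "Zn E f a n = top"
  obtain x where x: "x \<in> cyl a" using cyl_nonempty by blast
  have "(ruelle E f UNIV ^^ n) (starts_in {a}) x = top"
    using ruelle_funpow_starts_in_le_Zn(2)[OF x n f] Z by (auto simp: top_unique ennreal_mult_eq_top_iff)
  then have inf: "(ruelle E f UNIV ^^ (n * Suc j)) (starts_in {a}) x = top" for j
    using ruelle_funpow_starts_in_infinite[OF f x] x by blast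
  have top: "Zn E f a (n * Suc j) = top" for j
    using ruelle_funpow_starts_in_le_Zn(1)[OF x _ f, of "n * Suc j"] n inf
    by (auto simp: top_unique ennreal_mult_eq_top_iff)
  obtain N where N: "\<And>n. n \<ge> N \<Longrightarrow> Zn E f a n \<le> ennreal (exp (real n * q))"
    using limsup_eln_lessD press unfolding gurevich_pressure_def by blast
  have "N \<le> n * Suc N" using n by (simp add: trans_le_add2)
  from N[OF this] show False using top[of N] by (simp add: top_unique)
qed

lemma green_starts_in_finite:
  assumes f: "wholder B f" "0 \<le> B" and press: "gurevich_pressure E f a < ereal q" and x: "x \<in> cyl a"
  shows "green E (\<lambda>x. f x + - q) UNIV (starts_in {a}) x \<noteq> top"
proof -
  obtain p where p: "gurevich_pressure E f a < ereal p" "p < q"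
    using ereal_dense2[OF press] by auto
  obtain N where N: "\<And>n. n \<ge> N \<Longrightarrow> Zn E f a n \<le> ennreal (exp (real n * p))"
    using limsup_eln_lessD p(1) unfolding gurevich_pressure_def by blast
  define u where "u n y = (ruelle E (\<lambda>x. f x + - q) UNIV ^^ n) (starts_in {a}) y" for n y
  define C where "C = exp (B / (1 - \<theta>))"
  have u_le: "u n x \<le> ennreal (exp (real n * - q)) * (ennreal C * Zn E f a n)" if "n \<ge> 1" for n
    unfolding u_def C_def ruelle_funpow_add_const
    using ruelle_funpow_starts_in_le_Zn(1)[OF x that f] by (intro mult_left_mono) auto
  have fin: "u n x \<noteq> top" for n
  proof (cases "n = 0")
    case False
    then show ?thesis using u_le[of n] Zn_finite[OF f press, of n]
      by (auto simp: ennreal_mult_less_top less_top intro: le_less_trans)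
  qed (simp add: u_def indicator_def)
  have tail: "u n x \<le> ennreal (C * exp (p - q) ^ n)" if n: "n \<ge> max N 1" for n
  proof -
    have "u n x \<le> ennreal (exp (real n * - q)) * (ennreal C * ennreal (exp (real n * p)))"
      using u_le[of n] N[of n] n by (intro order_trans[OF u_le] mult_left_mono) auto
    also have "... = ennreal (C * exp (p - q) ^ n)"
      by (simp add: C_def ennreal_mult[symmetric] exp_of_nat_mult[symmetric] exp_add[symmetric] algebra_simps)
    finally show ?thesis .
  qed
  have "exp_decay {x} u"
    using p(2) fin tail
    by (intro exp_decay_eventually[where c="\<lambda>n. u n x" and M=C and \<rho>="exp (p - q)" and N="max N 1"]) (auto simp: C_def)
  then show ?thesis
    using exp_decay_suminf_bounded[of "{x}" u] unfolding green_def u_def by (auto simp: top_unique)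
qed

lemma regular_superharmonic_green:
  assumes f: "wholder B f" "0 \<le> B" and press: "gurevich_pressure E f a < ereal q"
  shows "regular_superharmonic (\<lambda>x. f x + - q) (green E (\<lambda>x. f x + - q) UNIV (starts_in {a}))"
proof -
  obtain x where x: "x \<in> cyl a" using cyl_nonempty by blast
  show ?thesis
  proof (rule regular_superharmonicI[OF superharmonic_green])
    show "log_lip X (invariant_const B) (green E (\<lambda>x. f x + - q) UNIV (starts_in {a}))"
      using log_lip_mono[OF log_lip_starts_in invariant_const_nonneg[OF f(2)]]
      by (intro log_lip_green[OF wholder_add_const[OF f(1)]]) (auto simp: invariant_const)
    show "green E (\<lambda>x. f x + - q) UNIV (starts_in {a}) x \<noteq> top"
      by (rule green_starts_in_finite[OF f press x])
    show "green E (\<lambda>x. f x + - q) UNIV (starts_in {a}) x \<noteq> 0"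
      using green_ge(1)[of "starts_in {a}" x E "\<lambda>x. f x + - q" UNIV] x by auto
  qed (use x invariant_const_nonneg[OF f(2)] in auto)
qed

lemma pressure_le_of_superharmonic:
  assumes f: "wholder B f" "0 \<le> B" and H: "regular_superharmonic (\<lambda>x. f x + - q) H"
  shows "gurevich_pressure E f a \<le> ereal q"
proof -
  obtain C where C: "0 \<le> C" "\<And>n z. z \<in> X \<Longrightarrow> z 0 \<in> {a} \<Longrightarrow>
      (ruelle E (\<lambda>x. f x + - q) UNIV ^^ n) (starts_in {a}) z \<le> ennreal C"
    using ruelle_funpow_starts_in_bounded[OF H, of "{a}"] by auto
  obtain x where x: "x \<in> cyl a" using cyl_nonempty by blast
  define K where "K = exp (B / (1 - \<theta>))"
  have "Zn E f a n \<le> ennreal (K * (C + 1) * exp (real n * q))" if n: "n \<ge> 1" for n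
  proof -
    have "ennreal (exp (real n * - q)) * (ruelle E f UNIV ^^ n) (starts_in {a}) x \<le> ennreal (C + 1)"
      using C(2)[of x n] x unfolding ruelle_funpow_add_const
      by (intro order_trans[OF _ ennreal_leI[of C "C + 1"]]) auto
    then have "ennreal (exp (real n * q)) * (ennreal (exp (real n * - q)) * (ruelle E f UNIV ^^ n) (starts_in {a}) x) \<le>
        ennreal (exp (real n * q)) * ennreal (C + 1)" by (intro mult_left_mono) auto
    then have "(ruelle E f UNIV ^^ n) (starts_in {a}) x \<le> ennreal (exp (real n * q)) * ennreal (C + 1)"
      by (simp add: mult.assoc[symmetric] ennreal_mult[symmetric] exp_add[symmetric])
    then have "Zn E f a n \<le> ennreal K * (ennreal (exp (real n * q)) * ennreal (C + 1))"
      using ruelle_funpow_starts_in_le_Zn(2)[OF x n f] unfolding K_def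
      by (meson mult_left_mono order_trans zero_le)
    also have "... = ennreal (K * (C + 1) * exp (real n * q))"
      using C(1) by (simp add: K_def ennreal_mult ac_simps del: ennreal_plus)
    finally show ?thesis .
  qed
  then show ?thesis unfolding gurevich_pressure_def
    by (rule limsup_eln_le) (use C(1) in \<open>auto simp: K_def intro!: mult_pos_pos\<close>)
qed

lemma finite_entropy_regular_superharmonic:
  assumes "gurevich_pressure E (\<lambda>_. 0) c < \<infinity>"
  obtains g H where "0 \<le> g" "regular_superharmonic (\<lambda>_. - g) H"
proof -
  obtain n :: nat where "gurevich_pressure E (\<lambda>_. 0) c < ereal (real n)"
    using assms less_PInf_Ex_of_nat[of "gurevich_pressure E (\<lambda>_. 0) c"] by auto
  from regular_superharmonic_green[OF wholder_const order_refl this] show thesis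
    using that[of "real n"] by simp
qed

lemma gurevich_pressure_less_infinity:
  assumes phi: "wholder B \<phi>" "0 \<le> B" and up: "\<And>x. x \<in> X \<Longrightarrow> \<phi> x \<le> K"
    and fin: "gurevich_pressure E (\<lambda>_. 0) c < \<infinity>"
  shows "gurevich_pressure E \<phi> a < \<infinity>"
proof -
  obtain g H where H: "0 \<le> g" "regular_superharmonic (\<lambda>_. - g) H"
    using finite_entropy_regular_superharmonic[OF fin] .
  have "superharmonic E (\<lambda>_. - g) H" using H(2) by (simp add: regular_superharmonic_def)
  then have "superharmonic E (\<lambda>x. \<phi> x + - (K + g)) H"
    by (rule superharmonic_le_potential) (use up in force)
  then have "regular_superharmonic (\<lambda>x. \<phi> x + - (K + g)) H"
    using H(2) by (simp add: regular_superharmonic_def)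
  then show ?thesis using pressure_le_of_superharmonic[OF phi, of "K + g" H a] by (auto intro: le_less_trans)
qed

end

section \<open>Averaging operators contract the cone\<close>

lemma exp_diff_le: "exp t - 1 \<le> t * exp t" for t :: real
proof -
  have "(1 - t) * exp t \<le> exp (- t) * exp t"
    using exp_ge_add_one_self[of "- t"] by (intro mult_right_mono) auto
  then show ?thesis by (simp add: exp_add[symmetric] algebra_simps)
qed

lemma exp_gap:
  fixes t D D' :: real
  assumes "0 \<le> D'" "D' < D" "0 \<le> t" "t \<le> 1"
  shows "(D - D') / D * exp (- D) * (exp (D * t) - 1) \<le> exp (D * t) - exp (D' * t)"
proof -
  define s where "s = (D - D') * t"
  have "exp (D * t) - 1 \<le> D * t * exp (D * t)" by (rule exp_diff_le)
  also have "... \<le> D * t * exp D" using assms by (intro mult_left_mono) (auto intro: mult_left_le)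
  finally have "(D - D') / D * exp (- D) * (exp (D * t) - 1) \<le> (D - D') / D * exp (- D) * (D * t * exp D)"
    using assms by (intro mult_left_mono) auto
  also have "... = s" using assms by (simp add: s_def exp_minus field_simps)
  also have "s \<le> 1 * (exp s - 1)" by (metis exp_ge_add_one_self le_diff_eq add.commute mult_1)
  also have "... \<le> exp (D' * t) * (exp s - 1)" using assms by (intro mult_right_mono) (auto simp: s_def)
  also have "... = exp (D * t) - exp (D' * t)"
    by (simp add: s_def right_diff_distrib left_diff_distrib exp_add[symmetric])
  finally show ?thesis .
qed

lemma nested_intervals_limit:
  fixes t :: "nat \<Rightarrow> 'b \<Rightarrow> real"
  assumes ne: "A \<noteq> {}" and low: "\<And>n k x. x \<in> A \<Longrightarrow> c n \<le> t (n + k) x"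
    and upp: "\<And>n k x. x \<in> A \<Longrightarrow> t (n + k) x \<le> c n + r n"
  shows "\<exists>l. (\<forall>n. c n \<le> l) \<and> (\<forall>n. \<forall>x\<in>A. \<bar>t n x - l\<bar> \<le> r n)"
proof -
  obtain x0 where x0: "x0 \<in> A" using ne by blast
  have le: "c n \<le> c k + r k" for n k
    using low[OF x0, of n k] upp[OF x0, of k n] by (simp add: add.commute)
  then have bdd: "bdd_above (range c)" by (intro bdd_aboveI[of _ "c 0 + r 0"]) auto
  have low_l: "c n \<le> (SUP n. c n)" for n by (rule cSUP_upper[OF _ bdd]) simp
  have l_upp: "(SUP n. c n) \<le> c n + r n" for n by (rule cSUP_least) (auto intro: le)
  have "\<bar>t n x - (SUP n. c n)\<bar> \<le> r n" if "x \<in> A" for n x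
    using low[OF that, of n 0] upp[OF that, of n 0] low_l[of n] l_upp[of n] by (simp add: abs_le_iff)
  then show ?thesis using low_l by blast
qed

context markov_shift
begin

definition contraction_rate :: "real \<Rightarrow> real \<Rightarrow> real" where
  "contraction_rate D D' = 1 - (D - D') / D * exp (- (2 * D))"

lemma contraction_rate_bounds:
  assumes "0 \<le> D'" "D' < D" shows "0 \<le> contraction_rate D D'" "contraction_rate D D' < 1"
proof -
  have "(D - D') / D \<le> 1" "0 < (D - D') / D" using assms by (auto simp: field_simps)
  moreover have "exp (- (2 * D)) \<le> 1" "0 < exp (- (2 * D))" using assms by auto
  ultimately have "(D - D') / D * exp (- (2 * D)) \<le> 1" "0 < (D - D') / D * exp (- (2 * D))"
    by (auto intro: mult_le_one mult_pos_pos simp del: times_divide_eq_left)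
  then show "0 \<le> contraction_rate D D'" "contraction_rate D D' < 1" unfolding contraction_rate_def by linarith+
qed

lemma log_lip_lower_bound:
  assumes w: "\<And>x. 0 \<le> w x" and lip: "log_lip (cyl a) D (\<lambda>x. ennreal (w x))" and D: "0 \<le> D"
  shows "\<exists>\<iota>\<ge>0. \<forall>x\<in>cyl a. \<iota> \<le> w x \<and> exp (- D) * w x \<le> \<iota>"
proof -
  have "exp (- D) * w x \<le> w y" if "x \<in> cyl a" "y \<in> cyl a" for x y
  proof -
    have "ennreal (w x) \<le> ennreal (exp D * w y)"
      using log_lip_same_letter[OF lip that(1,2)] that D w by (simp add: ennreal_mult)
    then show ?thesis using w by (simp add: exp_minus field_simps)
  qed
  then have "exp (- D) * w x \<le> (INF y\<in>cyl a. w y)" if "x \<in> cyl a" for x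
    using that by (intro cINF_greatest cyl_nonempty)
  moreover have "(INF y\<in>cyl a. w y) \<le> w x" if "x \<in> cyl a" for x
    using that w by (intro cINF_lower bdd_belowI2[of _ 0]) auto
  moreover have "0 \<le> (INF y\<in>cyl a. w y)" using w by (intro cINF_greatest cyl_nonempty)
  ultimately show ?thesis by blast
qed

text \<open>A function in the smaller cone stays in the larger one after subtracting a fixed fraction
  of its infimum. Since constants are fixed by an averaging operator, each step therefore shrinks the
  nonconstant part by a definite factor.\<close>

lemma log_lip_subtract_const:
  assumes w: "\<And>x. 0 \<le> w x" and lip: "log_lip (cyl a) D' (\<lambda>x. ennreal (w x))" and D: "0 \<le> D'" "D' < D"
  shows "\<exists>i\<ge>0. (\<forall>x\<in>cyl a. i \<le> w x \<and> w x - i \<le> contraction_rate D D' * w x) \<and>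
    log_lip (cyl a) D (\<lambda>x. ennreal (w x - i))"
proof -
  define \<eta> where "\<eta> = (D - D') / D * exp (- D)"
  have "0 \<le> (D - D') / D" "(D - D') / D \<le> 1" using D by (auto simp: field_simps)
  then have \<eta>: "0 \<le> \<eta>" "\<eta> \<le> 1"
    unfolding \<eta>_def using D by (auto intro!: mult_nonneg_nonneg mult_le_one simp del: times_divide_eq_left)
  obtain \<iota> where \<iota>: "\<iota> \<ge> 0" "\<And>x. x \<in> cyl a \<Longrightarrow> \<iota> \<le> w x" "\<And>x. x \<in> cyl a \<Longrightarrow> exp (- D) * w x \<le> \<iota>"
    using log_lip_lower_bound[OF w log_lip_mono[OF lip less_imp_le[OF D(2)]]] D by auto
  have below: "\<eta> * \<iota> \<le> w x" if "x \<in> cyl a" for x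
    using \<iota>(1) \<iota>(2)[OF that] \<eta> mult_left_le_one_le[of \<iota> \<eta>] by simp
  have "w x - \<eta> * \<iota> \<le> contraction_rate D D' * w x" if x: "x \<in> cyl a" for x
  proof -
    have "\<eta> * (exp (- D) * w x) \<le> \<eta> * \<iota>" using \<iota>(3)[OF x] \<eta> by (intro mult_left_mono) auto
    moreover have "\<eta> * (exp (- D) * w x) = (1 - contraction_rate D D') * w x"
      by (simp add: contraction_rate_def \<eta>_def mult.assoc[symmetric] exp_add[symmetric])
    ultimately show ?thesis by (simp add: left_diff_distrib)
  qed
  moreover have "log_lip (cyl a) D (\<lambda>x. ennreal (w x - \<eta> * \<iota>))"
  proof (rule log_lipI)
    fix k x y assume xy: "1 \<le> k" "x \<in> cyl a" "y \<in> cyl a" "agree k x y"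
    define t where "t = \<theta> ^ k"
    have t: "0 \<le> t" "t \<le> 1" using theta_pow[of k] by (auto simp: t_def)
    have "\<eta> * \<iota> * (exp (D * t) - 1) \<le> \<eta> * w y * (exp (D * t) - 1)"
      using \<iota>(2)[OF xy(3)] \<eta> D t by (intro mult_right_mono mult_left_mono) auto
    also have "... \<le> w y * (exp (D * t) - exp (D' * t))"
      using mult_left_mono[OF exp_gap[OF D t] w[of y]] by (simp add: \<eta>_def ac_simps)
    finally have "\<eta> * \<iota> * (exp (D * t) - 1) \<le> w y * (exp (D * t) - exp (D' * t))" .
    moreover have "w x \<le> exp (D' * t) * w y"
      using log_lipD[OF lip xy] w by (simp add: t_def ennreal_mult[symmetric])
    ultimately have "w x - \<eta> * \<iota> \<le> exp (D * t) * (w y - \<eta> * \<iota>)" by (simp add: algebra_simps)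
    then show "ennreal (w x - \<eta> * \<iota>) \<le> ennreal (exp (D * \<theta> ^ k)) * ennreal (w y - \<eta> * \<iota>)"
      using below[OF xy(3)] by (simp add: t_def ennreal_mult[symmetric] ennreal_leI)
  qed
  ultimately show ?thesis using below \<iota>(1) \<eta>(1) by (intro exI[of _ "\<eta> * \<iota>"]) auto
qed

definition averaging :: "'a \<Rightarrow> (((nat \<Rightarrow> 'a) \<Rightarrow> ennreal) \<Rightarrow> (nat \<Rightarrow> 'a) \<Rightarrow> ennreal) \<Rightarrow> bool" where
  "averaging a K \<longleftrightarrow> (\<forall>x\<in>cyl a. K (\<lambda>_. 0) x = 0 \<and>
    (\<forall>c\<ge>0. \<forall>u. K (\<lambda>y. ennreal c + u y) x = ennreal c + K u x) \<and>
    (\<forall>u v. (\<forall>y\<in>cyl a. u y \<le> v y) \<longrightarrow> K u x \<le> K v x))"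

lemma averaging_mono:
  "averaging a K \<Longrightarrow> x \<in> cyl a \<Longrightarrow> (\<And>y. y \<in> cyl a \<Longrightarrow> u y \<le> v y) \<Longrightarrow> K u x \<le> K v x"
  by (simp add: averaging_def)

lemma averaging_cong:
  "averaging a K \<Longrightarrow> x \<in> cyl a \<Longrightarrow> (\<And>y. y \<in> cyl a \<Longrightarrow> u y = v y) \<Longrightarrow> K u x = K v x"
  using averaging_mono[of a K x u v] averaging_mono[of a K x v u] by (simp add: antisym)

lemma averaging_add_const:
  "averaging a K \<Longrightarrow> x \<in> cyl a \<Longrightarrow> 0 \<le> c \<Longrightarrow> K (\<lambda>y. ennreal c + u y) x = ennreal c + K u x"
  by (simp add: averaging_def)

lemma averaging_const: "averaging a K \<Longrightarrow> x \<in> cyl a \<Longrightarrow> 0 \<le> c \<Longrightarrow> K (\<lambda>_. ennreal c) x = ennreal c"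
  using averaging_add_const[of a K x c "\<lambda>_. 0"] by (simp add: averaging_def)

lemma averaging_bounds:
  assumes K: "averaging a K" and x: "x \<in> cyl a" and "0 \<le> \<alpha>" "0 \<le> \<beta>"
    and u: "\<And>y. y \<in> cyl a \<Longrightarrow> ennreal \<alpha> \<le> u y" "\<And>y. y \<in> cyl a \<Longrightarrow> u y \<le> ennreal \<beta>"
  shows "ennreal \<alpha> \<le> K u x" "K u x \<le> ennreal \<beta>"
  using averaging_mono[OF K x, of "\<lambda>_. ennreal \<alpha>" u] averaging_mono[OF K x, of u "\<lambda>_. ennreal \<beta>"]
    averaging_const[OF K x] assms by auto

lemma averaging_iterates_bounds:
  assumes K: "\<And>n. averaging a (K n)" and U: "\<And>n x. x \<in> cyl a \<Longrightarrow> U (Suc n) x = K n (U n) x"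
    and "0 \<le> \<alpha>" "0 \<le> \<beta>"
    and le: "\<And>y. y \<in> cyl a \<Longrightarrow> ennreal \<alpha> \<le> U n y" "\<And>y. y \<in> cyl a \<Longrightarrow> U n y \<le> ennreal \<beta>" and x: "x \<in> cyl a"
  shows "ennreal \<alpha> \<le> U (n + k) x \<and> U (n + k) x \<le> ennreal \<beta>"
  using x
proof (induction k arbitrary: x)
  case (Suc k)
  then show ?case using averaging_bounds[OF K Suc.prems, of \<alpha> \<beta> "U (n + k)"] assms(3,4) by (simp add: U)
qed (use le in auto)

definition oscillation_le :: "'a \<Rightarrow> real \<Rightarrow> real \<Rightarrow> ((nat \<Rightarrow> 'a) \<Rightarrow> ennreal) \<Rightarrow> bool" where
  "oscillation_le a D r u \<longleftrightarrow> (\<exists>c\<ge>0. \<exists>w. log_lip (cyl a) D (\<lambda>x. ennreal (w x)) \<and>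
    (\<forall>x\<in>cyl a. 0 \<le> w x \<and> w x \<le> r \<and> u x = ennreal (c + w x)))"

lemma oscillation_le_averaging:
  assumes K: "averaging a K" and cone: "\<And>u. log_lip (cyl a) D u \<Longrightarrow> log_lip (cyl a) D' (K u)"
    and D: "0 \<le> D'" "D' < D" and r: "0 \<le> r" and u: "oscillation_le a D r u"
  shows "oscillation_le a D (contraction_rate D D' * r) (K u)"
proof -
  obtain c w where c: "c \<ge> 0" and lip: "log_lip (cyl a) D (\<lambda>x. ennreal (w x))"
    and w: "\<And>x. x \<in> cyl a \<Longrightarrow> 0 \<le> w x \<and> w x \<le> r" and uw: "\<And>x. x \<in> cyl a \<Longrightarrow> u x = ennreal (c + w x)"
    using u unfolding oscillation_le_def by blast
  define w' where "w' x = enn2real (K (\<lambda>x. ennreal (w x)) x)" for x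
  have Kle: "K (\<lambda>x. ennreal (w x)) x \<le> ennreal r" if x: "x \<in> cyl a" for x
    using averaging_bounds(2)[OF K x order_refl r] w by (simp add: ennreal_leI)
  have Kw: "K (\<lambda>x. ennreal (w x)) x = ennreal (w' x)" if "x \<in> cyl a" for x
    unfolding w'_def using le_less_trans[OF Kle[OF that] ennreal_less_top] by simp
  have w'_le: "w' x \<le> r" if "x \<in> cyl a" for x
    using Kle[OF that] r unfolding w'_def by (simp add: enn2real_leI)
  have lip': "log_lip (cyl a) D' (\<lambda>x. ennreal (w' x))"
    by (rule log_lip_cong[OF cone[OF lip]]) (simp add: Kw)
  have w'0: "0 \<le> w' x" for x by (simp add: w'_def)
  from log_lip_subtract_const[OF w'0 lip' D] obtain i where i: "i \<ge> 0"
    "\<And>x. x \<in> cyl a \<Longrightarrow> i \<le> w' x \<and> w' x - i \<le> contraction_rate D D' * w' x"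
    "log_lip (cyl a) D (\<lambda>x. ennreal (w' x - i))" by blast
  have "K u x = ennreal ((c + i) + (w' x - i))" if x: "x \<in> cyl a" for x
  proof -
    have "K u x = K (\<lambda>y. ennreal c + ennreal (w y)) x"
      using c w uw by (intro averaging_cong[OF K x]) auto
    then show ?thesis using averaging_add_const[OF K x c] Kw[OF x] c w'0 by simp
  qed
  moreover have "w' x - i \<le> contraction_rate D D' * r" if "x \<in> cyl a" for x
    using i(2)[OF that] mult_left_mono[OF w'_le[OF that] contraction_rate_bounds(1)[OF D]] by linarith
  ultimately show ?thesis unfolding oscillation_le_def
    using i c by (intro exI[of _ "c + i"] conjI exI[of _ "\<lambda>x. w' x - i"]) auto
qed

lemma oscillation_le_averaging_iterates:
  assumes K: "\<And>n. averaging a (K n)" and cone: "\<And>n u. log_lip (cyl a) D u \<Longrightarrow> log_lip (cyl a) D' (K n u)"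
    and D: "0 \<le> D'" "D' < D" and U0: "log_lip (cyl a) D (U 0)" "\<And>x. x \<in> cyl a \<Longrightarrow> U 0 x \<le> ennreal S" "0 \<le> S"
    and U: "\<And>n x. x \<in> cyl a \<Longrightarrow> U (Suc n) x = K n (U n) x"
  shows "oscillation_le a D (contraction_rate D D' ^ n * S) (U n)"
proof (induction n)
  case 0
  have "U 0 x = ennreal (enn2real (U 0 x))" "enn2real (U 0 x) \<le> S" if "x \<in> cyl a" for x
    using U0(2)[OF that] U0(3)
    by (auto simp: enn2real_leI less_top[symmetric] dest: neq_top_trans[rotated] intro!: ennreal_enn2real[symmetric])
  then show ?case using U0 unfolding oscillation_le_def
    by (intro exI[of _ 0] conjI exI[of _ "\<lambda>x. enn2real (U 0 x)"]) (auto intro: log_lip_cong)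
next
  case (Suc n)
  have "oscillation_le a D (contraction_rate D D' * (contraction_rate D D' ^ n * S)) (K n (U n))"
    using contraction_rate_bounds[OF D] U0(3) by (intro oscillation_le_averaging[OF K cone D _ Suc]) auto
  then show ?case unfolding oscillation_le_def by (simp add: U mult.assoc)
qed

lemma averaging_iterates_converge:
  assumes K: "\<And>n. averaging a (K n)" and cone: "\<And>n u. log_lip (cyl a) D u \<Longrightarrow> log_lip (cyl a) D' (K n u)"
    and D: "0 \<le> D'" "D' < D" and U0: "log_lip (cyl a) D (U 0)" "\<And>x. x \<in> cyl a \<Longrightarrow> U 0 x \<le> ennreal S" "0 \<le> S"
    and U: "\<And>n x. x \<in> cyl a \<Longrightarrow> U (Suc n) x = K n (U n) x"
  shows "\<exists>c\<ge>0. \<forall>n. \<forall>x\<in>cyl a. U n x \<noteq> top \<and> \<bar>enn2real (U n x) - c\<bar> \<le> contraction_rate D D' ^ n * S"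
proof -
  define \<gamma> where "\<gamma> = contraction_rate D D'"
  have \<gamma>: "0 \<le> \<gamma>" using contraction_rate_bounds[OF D] by (simp add: \<gamma>_def)
  have osc: "oscillation_le a D (\<gamma> ^ n * S) (U n)" for n
    unfolding \<gamma>_def by (rule oscillation_le_averaging_iterates[where K=K and U=U, OF K cone D U0 U])
  have "\<exists>c\<ge>0. \<forall>x\<in>cyl a. ennreal c \<le> U n x \<and> U n x \<le> ennreal (c + \<gamma> ^ n * S)" for n
    using osc[of n] unfolding oscillation_le_def by (force intro: ennreal_leI)
  then have "\<exists>c. \<forall>n. 0 \<le> c n \<and> (\<forall>x\<in>cyl a. ennreal (c n) \<le> U n x \<and> U n x \<le> ennreal (c n + \<gamma> ^ n * S))"
    by (intro choice) blast
  then obtain c where c: "\<And>n. 0 \<le> c n"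
    "\<And>n x. x \<in> cyl a \<Longrightarrow> ennreal (c n) \<le> U n x" "\<And>n x. x \<in> cyl a \<Longrightarrow> U n x \<le> ennreal (c n + \<gamma> ^ n * S)" by blast
  have r0: "0 \<le> c n + \<gamma> ^ n * S" for n using c(1)[of n] \<gamma> U0(3) by simp
  have b: "ennreal (c n) \<le> U (n + k) x \<and> U (n + k) x \<le> ennreal (c n + \<gamma> ^ n * S)" if "x \<in> cyl a" for n k x
    by (rule averaging_iterates_bounds[of a K U, OF K U c(1) r0 c(2,3) that])
  have fin: "U n x \<noteq> top" if "x \<in> cyl a" for n x
    using b[OF that, of n 0] by (auto simp: top_unique)
  define t where "t n x = enn2real (U n x)" for n x
  have t: "U n x = ennreal (t n x)" "0 \<le> t n x" if "x \<in> cyl a" for n x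
    using fin[OF that] by (auto simp: t_def less_top)
  have "c n \<le> t (n + k) x" "t (n + k) x \<le> c n + \<gamma> ^ n * S" if "x \<in> cyl a" for n k x
    using b[OF that, of n k] t[OF that, of "n + k"] r0[of n] by (auto simp: ennreal_le_iff)
  from nested_intervals_limit[of "cyl a" c t "\<lambda>n. \<gamma> ^ n * S", OF cyl_nonempty this]
  obtain l where "\<forall>n. c n \<le> l" "\<forall>n. \<forall>x\<in>cyl a. \<bar>t n x - l\<bar> \<le> \<gamma> ^ n * S" by blast
  then show ?thesis using fin c(1)[of 0] unfolding t_def \<gamma>_def
    by (intro exI[of _ l]) (auto intro: order_trans)
qed

section \<open>The induced operator\<close>

text \<open>The transfer operator of the first return map to the cylinder of \<open>a\<close>, extended to all of \<open>X\<close>,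
  without any reference to words.\<close>

definition induced :: "((nat \<Rightarrow> 'a) \<Rightarrow> real) \<Rightarrow> 'a \<Rightarrow> ((nat \<Rightarrow> 'a) \<Rightarrow> ennreal) \<Rightarrow> (nat \<Rightarrow> 'a) \<Rightarrow> ennreal" where
  "induced f a u = green E f (- {a}) (ruelle E f {a} u)"

lemma induced_eq_suminf: "induced f a u x = (\<Sum>k. excursion_weight f a u k x)"
  by (simp add: induced_def green_def excursion_weight_def)

lemma induced_mono:
  assumes "\<And>y. y \<in> cyl a \<Longrightarrow> u y \<le> v y" "x \<in> X" shows "induced f a u x \<le> induced f a v x"
  unfolding induced_def by (intro green_mono ruelle_mono) (use assms in auto)

lemma induced_cong:
  assumes "\<And>y. y \<in> cyl a \<Longrightarrow> u y = v y" "x \<in> X" shows "induced f a u x = induced f a v x"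
  by (rule antisym) (use assms in \<open>auto intro!: induced_mono\<close>)

lemma induced_add: "induced f a (\<lambda>x. u x + v x) x = induced f a u x + induced f a v x"
  unfolding induced_def green_add[symmetric] by (simp add: ruelle_add[abs_def])

lemma induced_cmult: "induced f a (\<lambda>x. c * u x) x = c * induced f a u x"
  unfolding induced_def green_cmult[symmetric] by (simp add: ruelle_cmult[abs_def])

lemma induced_zero [simp]: "induced f a (\<lambda>x. 0) x = 0"
  using induced_cmult[of f a 0 "\<lambda>_. 1" x] by simp

lemma induced_unfold: "induced f a u x = ruelle E f {a} u x + ruelle E f (- {a}) (induced f a u) x"
  unfolding induced_def by (rule green_unfold)

lemma induced_add_const:
  "induced (\<lambda>x. f x + c) a u x = (\<Sum>k. ennreal (exp (c * (real k + 1))) * excursion_weight f a u k x)"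
  unfolding induced_eq_suminf excursion_weight_add_const ..

lemma log_lip_induced:
  assumes f: "wholder B f" and u: "log_lip (cyl a) D u" and D: "\<theta> * (B + D) \<le> D"
  shows "log_lip X (\<theta> * (B + D)) (induced f a u)"
  unfolding induced_def
proof (rule log_lip_green[OF f])
  show "log_lip X (\<theta> * (B + D)) (ruelle E f {a} u)" by (rule log_lip_ruelle[OF f u]) auto
  show "\<theta> * (B + \<theta> * (B + D)) \<le> \<theta> * (B + D)" using D theta by (intro mult_left_mono) auto
qed

lemma log_lip_induced_funpow:
  assumes f: "wholder B f" and u: "log_lip X D u" and D: "\<theta> * (B + D) \<le> D"
  shows "log_lip X D ((induced f a ^^ n) u)"
proof (induction n)
  case (Suc n)
  have "log_lip X (\<theta> * (B + D)) (induced f a ((induced f a ^^ n) u))"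
    by (rule log_lip_induced[OF f log_lip_subset[OF Suc] D]) auto
  then show ?case using log_lip_mono[OF _ D] by simp
qed (use u in simp)

lemma induced_1_pos:
  assumes x: "x \<in> X" shows "induced f a (\<lambda>_. 1) x \<noteq> 0"
proof -
  obtain n y where y: "n \<ge> 1" "y \<in> X" "y 0 = a" "(shift ^^ n) y = x" using path_to[OF x, of a] .
  define i where "i = Max {i. i < n \<and> y i = a}"
  have "0 \<in> {i. i < n \<and> y i = a}" using y by simp
  then have "i \<in> {i. i < n \<and> y i = a}" unfolding i_def by (intro Max_in) auto
  then have i: "i < n" "y i = a" by auto
  have last: "j \<le> i" if "j < n" "y j = a" for j unfolding i_def using that by (intro Max_ge) auto
  define w where "w = (shift ^^ Suc i) y"
  define k where "k = n - Suc i"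
  have "(shift ^^ i) y 0 = a" using i(2) by (simp add: funpow_shift)
  then have "case_nat a w = (shift ^^ i) y" unfolding w_def by auto
  then have w: "w \<in> X" "case_nat a w \<in> X"
    using y(2) funpow_shift_in_sigma[of y E] by (simp_all only: w_def)
  have "\<forall>j<k. w j \<in> - {a}"
  proof (intro allI impI)
    fix j assume "j < k"
    then have "Suc (j + i) < n" using i by (simp add: k_def less_diff_conv)
    then show "w j \<in> - {a}" using last[of "Suc (j + i)"] by (auto simp: w_def funpow_shift simp del: funpow.simps)
  qed
  then have "(ruelle E f (- {a}) ^^ k) (ruelle E f {a} (\<lambda>_. 1)) ((shift ^^ k) w) \<noteq> 0"
    using w by (intro ruelle_funpow_pos) (auto simp: ruelle_singleton)
  moreover have "(shift ^^ k) w = x"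
    unfolding y(4)[symmetric] w_def k_def using i by (simp only: funpow_shift_add) simp
  ultimately show ?thesis using green_ge_funpow[where E=E and f=f and S="- {a}" and k=k and x=x]
    unfolding induced_def by (metis le_zero_eq)
qed

end

section \<open>The eigenfunction of the induced operator\<close>

lemma abs_ln_divide_le:
  fixes s t m :: real
  assumes "0 < m" "m \<le> s" "m \<le> t"
  shows "\<bar>ln (s / t)\<bar> \<le> \<bar>s - t\<bar> / m"
proof -
  have le: "ln (s / t) \<le> \<bar>s - t\<bar> / m" if "m \<le> s" "m \<le> t" for s t
  proof -
    have "ln (s / t) \<le> s / t - 1" using that assms(1) by (intro ln_le_minus_one) auto
    also have "... = (s - t) / t" using that assms(1) by (simp add: diff_divide_distrib)
    also have "... \<le> \<bar>s - t\<bar> / t" using that assms(1) by (intro divide_right_mono) auto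
    also have "... \<le> \<bar>s - t\<bar> / m" using that assms(1) by (intro divide_left_mono) auto
    finally show ?thesis .
  qed
  have "- ln (s / t) = ln (t / s)" using assms by (simp add: ln_div)
  then show ?thesis using le[of s t] le[of t s] assms by (simp add: abs_le_iff abs_minus_commute)
qed

lemma geometric_product_limit:
  fixes r :: "nat \<Rightarrow> real"
  assumes \<gamma>: "0 \<le> \<gamma>" "\<gamma> < 1" and m: "0 < m" "m \<le> l" "\<And>n. m \<le> r n"
    and close: "\<And>n. \<bar>r n - l\<bar> \<le> S * \<gamma> ^ n"
  shows "\<exists>h>0. \<forall>n. h \<le> exp (S / m / (1 - \<gamma>) * \<gamma> ^ n) * (\<Prod>k<n. r k / l) \<and>
    (\<Prod>k<n. r k / l) \<le> exp (S / m / (1 - \<gamma>) * \<gamma> ^ n) * h"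
proof -
  define d where "d k = ln (r k / l)" for k
  have d_le: "\<bar>d k\<bar> \<le> S / m * \<gamma> ^ k" for k
    using abs_ln_divide_le[OF m(1) m(3) m(2), of k] divide_right_mono[OF close[of k] less_imp_le[OF m(1)]]
    by (simp add: d_def)
  have sums: "(\<lambda>k. (S / m * \<gamma> ^ n) * \<gamma> ^ k) sums ((S / m * \<gamma> ^ n) * (1 / (1 - \<gamma>)))" for n
    using \<gamma> by (intro sums_mult geometric_sums) auto
  have "summable d" using d_le by (intro summable_comparison_test'[OF sums_summable[OF sums[of 0]], of 0]) auto
  have tail: "\<bar>(\<Sum>k. d k) - (\<Sum>k<n. d k)\<bar> \<le> S / m / (1 - \<gamma>) * \<gamma> ^ n" for n
  proof -
    have "norm (\<Sum>k. d (k + n)) \<le> (\<Sum>k. (S / m * \<gamma> ^ n) * \<gamma> ^ k)"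
    proof (rule norm_suminf_le[OF _ sums_summable[OF sums]])
      show "norm (d (k + n)) \<le> (S / m * \<gamma> ^ n) * \<gamma> ^ k" for k
        using d_le[of "k + n"] by (simp add: power_add ac_simps)
    qed
    also have "... = S / m / (1 - \<gamma>) * \<gamma> ^ n" using sums_unique[OF sums[of n]] by simp
    finally show ?thesis using suminf_minus_initial_segment[OF \<open>summable d\<close>, of n] by simp
  qed
  have prod: "(\<Prod>k<n. r k / l) = exp (\<Sum>k<n. d k)" for n
  proof -
    have "exp (d k) = r k / l" for k using m(1,2) m(3)[of k] by (simp add: d_def)
    then show ?thesis by (simp add: exp_sum)
  qed
  have "exp (\<Sum>k. d k) \<le> exp (S / m / (1 - \<gamma>) * \<gamma> ^ n) * (\<Prod>k<n. r k / l) \<and>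
      (\<Prod>k<n. r k / l) \<le> exp (S / m / (1 - \<gamma>) * \<gamma> ^ n) * exp (\<Sum>k. d k)" for n
    using tail[of n] unfolding prod exp_add[symmetric] exp_le_cancel_iff abs_le_iff by linarith
  then show ?thesis by (intro exI[of _ "exp (\<Sum>k. d k)"]) auto
qed

context markov_shift
begin

context
  fixes f a B
  assumes f: "wholder B f" "0 \<le> B"
    and fin: "\<And>x. x \<in> cyl a \<Longrightarrow> induced f a (\<lambda>_. 1) x \<noteq> top"
begin

abbreviation iterate :: "nat \<Rightarrow> (nat \<Rightarrow> 'a) \<Rightarrow> ennreal" where
  "iterate n \<equiv> (induced f a ^^ n) (\<lambda>_. 1)"

lemma log_lip_iterate: "log_lip X (invariant_const B) (iterate n)"
  using invariant_const_nonneg[OF f(2)]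
  by (intro log_lip_induced_funpow[OF f(1)]) (auto simp: invariant_const log_lip_const)

lemma iterate_le_const_mult:
  "x \<in> cyl a \<Longrightarrow> y \<in> cyl a \<Longrightarrow> iterate n x \<le> ennreal (exp (invariant_const B)) * iterate n y"
  using log_lip_same_letter[OF log_lip_iterate] invariant_const_nonneg[OF f(2)] by simp

lemma iterate_nonzero_finite: "x \<in> cyl a \<Longrightarrow> iterate n x \<noteq> 0 \<and> iterate n x \<noteq> top"
proof (induction n arbitrary: x)
  case (Suc n)
  let ?e = "ennreal (exp (invariant_const B))"
  have "induced f a (iterate n) x \<le> induced f a (\<lambda>y. ?e * iterate n x * 1) x"
    using iterate_le_const_mult Suc.prems by (intro induced_mono) auto
  also have "... = ?e * iterate n x * induced f a (\<lambda>_. 1) x" by (rule induced_cmult)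
  also have "... < top" using Suc fin[OF Suc.prems] by (simp add: ennreal_mult_less_top less_top)
  finally have "iterate (Suc n) x \<noteq> top" by simp
  have "induced f a (\<lambda>y. iterate n x * 1) x \<le> induced f a (\<lambda>y. ?e * iterate n y) x"
    using iterate_le_const_mult Suc.prems by (intro induced_mono) auto
  then have "iterate n x * induced f a (\<lambda>_. 1) x \<le> ?e * iterate (Suc n) x"
    unfolding induced_cmult by simp
  moreover have "iterate n x * induced f a (\<lambda>_. 1) x \<noteq> 0" using Suc induced_1_pos[of x f a] by simp
  ultimately show ?case using \<open>iterate (Suc n) x \<noteq> top\<close> by auto
qed simp

lemma iterate_mult_inverse: "x \<in> cyl a \<Longrightarrow> iterate n x * inverse (iterate n x) = 1"
  using iterate_nonzero_finite[of x n]
  by (auto elim!: ennreal_nonzero_finite_cases simp: inverse_ennreal ennreal_mult[symmetric])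

abbreviation normalised_induced :: "nat \<Rightarrow> ((nat \<Rightarrow> 'a) \<Rightarrow> ennreal) \<Rightarrow> (nat \<Rightarrow> 'a) \<Rightarrow> ennreal" where
  "normalised_induced n u x \<equiv> induced f a (\<lambda>y. iterate n y * u y) x * inverse (iterate (Suc n) x)"

lemma averaging_normalised_induced: "averaging a (normalised_induced n)"
  unfolding averaging_def
proof (intro ballI conjI allI impI)
  fix x assume x: "x \<in> cyl a"
  show "normalised_induced n (\<lambda>_. 0) x = 0" by simp
  show "normalised_induced n (\<lambda>y. ennreal c + u y) x = ennreal c + normalised_induced n u x" for c u
  proof -
    have "induced f a (\<lambda>y. iterate n y * (ennreal c + u y)) x =
        induced f a (\<lambda>y. ennreal c * iterate n y + iterate n y * u y) x"
      by (simp add: distrib_right mult.commute[of "iterate n _"])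
    also have "... = ennreal c * iterate (Suc n) x + induced f a (\<lambda>y. iterate n y * u y) x"
      by (simp add: induced_add induced_cmult)
    finally have "induced f a (\<lambda>y. iterate n y * (ennreal c + u y)) x =
        ennreal c * iterate (Suc n) x + induced f a (\<lambda>y. iterate n y * u y) x" .
    then show ?thesis using iterate_mult_inverse[OF x, of "Suc n"]
      by (simp add: distrib_right mult.assoc del: funpow.simps)
  qed
  show "normalised_induced n u x \<le> normalised_induced n v x" if "\<forall>y\<in>cyl a. u y \<le> v y" for u v
    using that x by (intro mult_right_mono induced_mono mult_left_mono) auto
qed

lemma log_lip_normalised_induced:
  assumes u: "log_lip (cyl a) D u" and D: "0 \<le> D"
  shows "log_lip (cyl a) (\<theta> * D + 2 * invariant_const B) (normalised_induced n u)"
proof -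
  let ?C = "invariant_const B"
  have "log_lip (cyl a) (?C + D) (\<lambda>y. iterate n y * u y)"
    by (intro log_lip_mult log_lip_subset[OF log_lip_iterate] u) auto
  moreover have "\<theta> * (B + (?C + D)) = ?C + \<theta> * D" using invariant_const[of B] by (simp add: algebra_simps)
  moreover have "?C + \<theta> * D \<le> ?C + D" using theta D by (simp add: mult_left_le_one_le)
  ultimately have "log_lip X (?C + \<theta> * D) (induced f a (\<lambda>y. iterate n y * u y))"
    using log_lip_induced[OF f(1), of a "?C + D"] by simp
  moreover have "log_lip (cyl a) ?C (\<lambda>x. inverse (iterate (Suc n) x))"
    by (intro log_lip_inverse log_lip_subset[OF log_lip_iterate] iterate_nonzero_finite) auto
  ultimately have "log_lip (cyl a) ((?C + \<theta> * D) + ?C) (normalised_induced n u)"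
    by (intro log_lip_mult) (auto intro: log_lip_subset)
  then show ?thesis by (simp add: algebra_simps)
qed

definition growth :: "nat \<Rightarrow> (nat \<Rightarrow> 'a) \<Rightarrow> real" where
  "growth n x = enn2real (iterate (Suc n) x * inverse (iterate n x))"

lemma growth: "x \<in> cyl a \<Longrightarrow> iterate (Suc n) x * inverse (iterate n x) = ennreal (growth n x)"
  using iterate_nonzero_finite[of x n] iterate_nonzero_finite[of x "Suc n"] unfolding growth_def
  by (auto elim!: ennreal_nonzero_finite_cases simp: inverse_ennreal ennreal_mult[symmetric] simp del: funpow.simps)

lemma iterate_eq_prod_growth: "x \<in> cyl a \<Longrightarrow> iterate n x = ennreal (\<Prod>k<n. growth k x)"
proof (induction n)
  case (Suc n)
  have "iterate (Suc n) x = iterate n x * (iterate (Suc n) x * inverse (iterate n x))"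
    by (simp only: mult.left_commute[of "iterate n x"] iterate_mult_inverse[OF Suc.prems] mult_1_right)
  also have "... = ennreal (\<Prod>k<n. growth k x) * ennreal (growth n x)"
    unfolding growth[OF Suc.prems] by (simp only: Suc)
  finally show ?case by (simp add: ennreal_mult growth_def prod_nonneg del: funpow.simps)
qed simp

lemma first_iterate_bounds:
  obtains s where "0 < s" "\<And>x. x \<in> cyl a \<Longrightarrow> ennreal (exp (- invariant_const B) * s) \<le> iterate 1 x"
    "\<And>x. x \<in> cyl a \<Longrightarrow> iterate 1 x \<le> ennreal (exp (invariant_const B) * s)"
proof -
  let ?C = "invariant_const B"
  obtain x0 where x0: "x0 \<in> cyl a" using cyl_nonempty by blast
  obtain s where s: "iterate 1 x0 = ennreal s" "0 < s"
    using iterate_nonzero_finite[OF x0, of 1] by (auto elim: ennreal_nonzero_finite_cases simp del: funpow.simps)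
  have "ennreal (exp (- ?C) * s) \<le> iterate 1 x" "iterate 1 x \<le> ennreal (exp ?C * s)" if x: "x \<in> cyl a" for x
  proof -
    have "iterate 1 x \<le> ennreal (exp ?C) * iterate 1 x0" "iterate 1 x0 \<le> ennreal (exp ?C) * iterate 1 x"
      using iterate_le_const_mult[of _ _ 1] x x0 by auto
    moreover have "ennreal (exp (- ?C)) * (ennreal (exp ?C) * iterate 1 x) = iterate 1 x"
      by (simp add: mult.assoc[symmetric] ennreal_mult[symmetric] exp_add[symmetric])
    ultimately show "ennreal (exp (- ?C) * s) \<le> iterate 1 x" "iterate 1 x \<le> ennreal (exp ?C * s)"
      using s mult_left_mono[of "iterate 1 x0" "ennreal (exp ?C) * iterate 1 x" "ennreal (exp (- ?C))"]
      by (auto simp: ennreal_mult)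
  qed
  then show thesis using that[OF s(2)] by blast
qed

lemma growth_Suc:
  assumes x: "x \<in> cyl a"
  shows "ennreal (growth (Suc n) x) = normalised_induced n (\<lambda>y. ennreal (growth n y)) x"
proof -
  have "induced f a (\<lambda>y. iterate n y * ennreal (growth n y)) x = induced f a (iterate (Suc n)) x"
    using x by (intro induced_cong)
      (simp_all only: growth[symmetric] mult.left_commute[of "iterate n _"] iterate_mult_inverse mult_1_right mem_Collect_eq)
  then show ?thesis using growth[OF x, of "Suc n"] by simp
qed

lemma growth_0_bounds:
  "\<exists>m S. 0 < m \<and> 0 \<le> S \<and> (\<forall>x\<in>cyl a. ennreal m \<le> ennreal (growth 0 x) \<and> ennreal (growth 0 x) \<le> ennreal S)"
proof -
  obtain s where s: "0 < s" and bounds: "\<And>x. x \<in> cyl a \<Longrightarrow> ennreal (exp (- invariant_const B) * s) \<le> iterate 1 x"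
    "\<And>x. x \<in> cyl a \<Longrightarrow> iterate 1 x \<le> ennreal (exp (invariant_const B) * s)"
    using first_iterate_bounds by blast
  have "iterate 1 x = ennreal (growth 0 x)" if "x \<in> cyl a" for x using growth[OF that, of 0] by simp
  then show ?thesis using s bounds
    by (intro exI[of _ "exp (- invariant_const B) * s"] exI[of _ "exp (invariant_const B) * s"]) auto
qed

lemma growth_ge:
  assumes bounds: "0 \<le> m" "0 \<le> S" "\<And>y. y \<in> cyl a \<Longrightarrow> ennreal m \<le> ennreal (growth 0 y)"
      "\<And>y. y \<in> cyl a \<Longrightarrow> ennreal (growth 0 y) \<le> ennreal S"
    and x: "x \<in> cyl a"
  shows "m \<le> growth n x"
proof -
  have "ennreal m \<le> ennreal (growth (0 + n) x)"
    by (rule averaging_iterates_bounds[where a=a and K=normalised_induced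
          and U="\<lambda>n x. ennreal (growth n x)" and \<beta>=S, THEN conjunct1])
      (use averaging_normalised_induced growth_Suc bounds x in blast)+
  then show ?thesis by (simp add: growth_def)
qed

lemma growth_converges:
  "\<exists>l m \<gamma> S. 0 < m \<and> m \<le> l \<and> 0 \<le> \<gamma> \<and> \<gamma> < 1 \<and> 0 \<le> S \<and>
    (\<forall>n. \<forall>x\<in>cyl a. m \<le> growth n x \<and> \<bar>growth n x - l\<bar> \<le> S * \<gamma> ^ n)"
proof -
  define C where "C = invariant_const B"
  define D where "D = 2 * C / (1 - \<theta>) + 1"
  define D' where "D' = \<theta> * D + 2 * C"
  have C: "0 \<le> C" unfolding C_def using f(2) by (rule invariant_const_nonneg)
  have "(1 - \<theta>) * D = 2 * C + (1 - \<theta>)" using theta by (simp add: D_def field_simps)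
  then have D': "D' < D" unfolding D'_def using theta by (simp add: algebra_simps)
  have "C * (1 - \<theta>) \<le> 2 * C" using theta C mult_left_le[of "1 - \<theta>" C] by simp
  then have D: "C \<le> D" "0 \<le> D" "0 \<le> D'"
    using theta C by (auto simp: D_def D'_def pos_le_divide_eq add_increasing2)
  have \<gamma>: "0 \<le> contraction_rate D D'" "contraction_rate D D' < 1" using contraction_rate_bounds[OF D(3) D'] .
  obtain m S where m: "0 < m" and S: "0 \<le> S"
    and bounds: "\<And>x. x \<in> cyl a \<Longrightarrow> ennreal m \<le> ennreal (growth 0 x)" "\<And>x. x \<in> cyl a \<Longrightarrow> ennreal (growth 0 x) \<le> ennreal S"
    using growth_0_bounds by blast
  have ge: "m \<le> growth n x" if "x \<in> cyl a" for n x
    using m S bounds that by (intro growth_ge[of m S]) auto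
  have "log_lip (cyl a) C (\<lambda>x. ennreal (growth 0 x))"
    unfolding C_def by (rule log_lip_cong[OF log_lip_subset[OF log_lip_iterate[of 1]]]) (blast, use growth[of _ 0] in simp)
  then have lip0: "log_lip (cyl a) D (\<lambda>x. ennreal (growth 0 x))" using D(1) by (auto intro: log_lip_mono)
  have cone: "log_lip (cyl a) D' (normalised_induced n u)" if "log_lip (cyl a) D u" for n u
    unfolding D'_def C_def by (rule log_lip_normalised_induced[OF that D(2)])
  obtain l where l: "\<And>n x. x \<in> cyl a \<Longrightarrow> \<bar>enn2real (ennreal (growth n x)) - l\<bar> \<le> contraction_rate D D' ^ n * S"
    using averaging_iterates_converge[where K=normalised_induced and U="\<lambda>n x. ennreal (growth n x)" and S=S,
        OF averaging_normalised_induced cone D(3) D' lip0 bounds(2) S growth_Suc] by blast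
  then have close: "\<bar>growth n x - l\<bar> \<le> S * contraction_rate D D' ^ n" if "x \<in> cyl a" for n x
    using l[OF that, of n] by (simp add: growth_def mult.commute)
  obtain z where z: "z \<in> cyl a" using cyl_nonempty by blast
  have "(\<lambda>n. l + S * contraction_rate D D' ^ n) \<longlonglongrightarrow> l + S * 0"
    using \<gamma> by (intro tendsto_intros LIMSEQ_power_zero) auto
  moreover have "m \<le> l + S * contraction_rate D D' ^ n" for n
    using ge[OF z, of n] close[OF z, of n] by linarith
  ultimately have "m \<le> l" by (intro LIMSEQ_le_const) auto
  then show ?thesis using m ge close \<gamma> S
    by (intro exI[of _ l] exI[of _ m] exI[of _ "contraction_rate D D'"] exI[of _ S]) auto
qed

definition scaled_iterate :: "real \<Rightarrow> nat \<Rightarrow> (nat \<Rightarrow> 'a) \<Rightarrow> ennreal" where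
  "scaled_iterate l n x = ennreal (1 / l ^ n) * iterate n x"

lemma iterates_approximate_eigenfunction:
  "\<exists>l C \<gamma> h. 0 < l \<and> 0 \<le> C \<and> 0 \<le> \<gamma> \<and> \<gamma> < 1 \<and> (\<forall>x. 0 < h x) \<and>
    (\<forall>n. \<forall>x\<in>cyl a. ennreal (h x) \<le> ennreal (exp (C * \<gamma> ^ n)) * scaled_iterate l n x \<and>
      scaled_iterate l n x \<le> ennreal (exp (C * \<gamma> ^ n)) * ennreal (h x))"
proof -
  obtain l m \<gamma> S where m: "0 < m" "m \<le> l" and \<gamma>: "0 \<le> \<gamma>" "\<gamma> < 1" and S: "0 \<le> S"
    and growth: "\<And>n x. x \<in> cyl a \<Longrightarrow> m \<le> growth n x" "\<And>n x. x \<in> cyl a \<Longrightarrow> \<bar>growth n x - l\<bar> \<le> S * \<gamma> ^ n"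
    using growth_converges by blast
  define C where "C = S / m / (1 - \<gamma>)"
  have "\<exists>h>0. x \<in> cyl a \<longrightarrow> (\<forall>n. h \<le> exp (C * \<gamma> ^ n) * (\<Prod>k<n. growth k x / l) \<and>
      (\<Prod>k<n. growth k x / l) \<le> exp (C * \<gamma> ^ n) * h)" for x
    using geometric_product_limit[OF \<gamma> m, of "\<lambda>n. growth n x" S] growth[of x]
    unfolding C_def by (cases "x \<in> cyl a") (blast, meson zero_less_one)
  then have "\<exists>h. \<forall>x. 0 < h x \<and> (x \<in> cyl a \<longrightarrow> (\<forall>n. h x \<le> exp (C * \<gamma> ^ n) * (\<Prod>k<n. growth k x / l) \<and>
      (\<Prod>k<n. growth k x / l) \<le> exp (C * \<gamma> ^ n) * h x))" by (intro choice) blast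
  then obtain h where h: "\<And>x. 0 < h x"
    "\<And>n x. x \<in> cyl a \<Longrightarrow> h x \<le> exp (C * \<gamma> ^ n) * (\<Prod>k<n. growth k x / l) \<and>
      (\<Prod>k<n. growth k x / l) \<le> exp (C * \<gamma> ^ n) * h x" by blast
  have prod: "scaled_iterate l n x = ennreal (\<Prod>k<n. growth k x / l)"
    and prod0: "0 \<le> (\<Prod>k<n. growth k x / l)" if "x \<in> cyl a" for n x
  proof -
    have "0 \<le> (\<Prod>k<n. growth k x)" using m growth(1)[OF that] by (intro prod_nonneg) (meson order_trans less_imp_le)
    then show "scaled_iterate l n x = ennreal (\<Prod>k<n. growth k x / l)" "0 \<le> (\<Prod>k<n. growth k x / l)"
      unfolding scaled_iterate_def iterate_eq_prod_growth[OF that] prod_dividef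
      using m by (auto simp: ennreal_mult[symmetric])
  qed
  have "ennreal (h x) \<le> ennreal (exp (C * \<gamma> ^ n)) * scaled_iterate l n x \<and>
      scaled_iterate l n x \<le> ennreal (exp (C * \<gamma> ^ n)) * ennreal (h x)" if "x \<in> cyl a" for n x
    unfolding prod[OF that] using h(1)[of x] h(2)[OF that, of n] prod0[OF that, of n]
    by (simp add: ennreal_mult[symmetric] ennreal_leI)
  moreover have "0 \<le> C" "0 < l" using S m \<gamma> by (auto simp: C_def)
  ultimately show ?thesis using \<gamma> h(1)
    by (intro exI[of _ l] exI[of _ C] exI[of _ \<gamma>] exI[of _ h] conjI allI ballI) simp_all
qed

lemma exp_geometric_squared:
  "ennreal (exp (C * \<gamma> ^ n)) * ennreal (exp (C * \<gamma> ^ n)) = ennreal (exp (2 * C * \<gamma> ^ n))" for C \<gamma> :: real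
  by (simp add: ennreal_mult[symmetric] exp_add[symmetric])

context
  fixes l C \<gamma> :: real and h :: "(nat \<Rightarrow> 'a) \<Rightarrow> ennreal"
  assumes l: "0 < l" and C: "0 \<le> C" and \<gamma>: "0 \<le> \<gamma>" "\<gamma> < 1"
    and h_le: "\<And>n x. x \<in> cyl a \<Longrightarrow> h x \<le> ennreal (exp (C * \<gamma> ^ n)) * scaled_iterate l n x"
    and le_h: "\<And>n x. x \<in> cyl a \<Longrightarrow> scaled_iterate l n x \<le> ennreal (exp (C * \<gamma> ^ n)) * h x"
begin

lemma induced_approximated:
  assumes x: "x \<in> cyl a"
  shows "induced f a h x = ennreal l * h x"
proof (rule antisym)
  define e where "e n = ennreal (exp (C * \<gamma> ^ n))" for n
  have e_Suc: "e (Suc n) \<le> e n" for n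
    unfolding e_def using C \<gamma> by (intro ennreal_leI) (auto intro!: mult_left_mono simp: mult_left_le_one_le)
  have induced_scaled: "induced f a (scaled_iterate l n) x = ennreal l * scaled_iterate l (Suc n) x" for n
    unfolding scaled_iterate_def induced_cmult using l by (simp add: mult.assoc[symmetric] ennreal_mult[symmetric])
  have "induced f a h x \<le> ennreal (exp (2 * C * \<gamma> ^ n)) * (ennreal l * h x)" for n
  proof -
    have "induced f a h x \<le> induced f a (\<lambda>x. e n * scaled_iterate l n x) x"
      using h_le x by (intro induced_mono) (auto simp: e_def)
    also have "... = e n * (ennreal l * scaled_iterate l (Suc n) x)" by (simp add: induced_cmult induced_scaled)
    also have "... \<le> e n * (ennreal l * (e n * h x))"
      using le_h[OF x, of "Suc n"] mult_right_mono[OF e_Suc[of n], of "h x"]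
      by (intro mult_left_mono) (auto simp: e_def intro: order_trans)
    also have "... = (e n * e n) * (ennreal l * h x)" by (simp add: ac_simps)
    finally show ?thesis unfolding e_def exp_geometric_squared .
  qed
  then show "induced f a h x \<le> ennreal l * h x" by (rule ennreal_le_of_exp_geometric[OF \<gamma>])
  have "ennreal l * h x \<le> ennreal (exp (2 * C * \<gamma> ^ n)) * induced f a h x" for n
  proof -
    have "ennreal l * h x \<le> ennreal l * (e n * scaled_iterate l (Suc n) x)"
      using h_le[OF x, of "Suc n"] mult_right_mono[OF e_Suc[of n], of "scaled_iterate l (Suc n) x"]
      by (intro mult_left_mono) (auto simp: e_def intro: order_trans)
    also have "... = e n * induced f a (scaled_iterate l n) x" by (simp add: induced_scaled ac_simps)
    also have "... \<le> e n * induced f a (\<lambda>x. e n * h x) x"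
      using le_h x by (intro mult_left_mono induced_mono) (auto simp: e_def)
    also have "... = (e n * e n) * induced f a h x" by (simp add: induced_cmult ac_simps)
    finally show ?thesis unfolding e_def exp_geometric_squared .
  qed
  then show "ennreal l * h x \<le> induced f a h x" by (rule ennreal_le_of_exp_geometric[OF \<gamma>])
qed

lemma log_lip_approximated: "log_lip (cyl a) (invariant_const B) h"
proof (rule log_lipI)
  fix k x y assume xy: "1 \<le> k" "x \<in> cyl a" "y \<in> cyl a" "agree k x y"
  define K where "K = ennreal (exp (invariant_const B * \<theta> ^ k))"
  have "h x \<le> ennreal (exp (2 * C * \<gamma> ^ n)) * (K * h y)" for n
  proof -
    define e where "e = ennreal (exp (C * \<gamma> ^ n))"
    have "h x \<le> e * (ennreal (1 / l ^ n) * iterate n x)"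
      using h_le[OF xy(2)] by (simp add: e_def scaled_iterate_def)
    also have "... \<le> e * (ennreal (1 / l ^ n) * (K * iterate n y))"
      unfolding K_def using log_lipD[OF log_lip_iterate xy(1) _ _ xy(4)] xy by (intro mult_left_mono) auto
    also have "... = e * (K * scaled_iterate l n y)" by (simp add: scaled_iterate_def ac_simps)
    also have "... \<le> e * (K * (e * h y))"
      using le_h[OF xy(3)] by (intro mult_left_mono) (auto simp: e_def)
    also have "... = (e * e) * (K * h y)" by (simp add: ac_simps)
    finally show ?thesis unfolding e_def exp_geometric_squared .
  qed
  then show "h x \<le> ennreal (exp (invariant_const B * \<theta> ^ k)) * h y"
    unfolding K_def by (rule ennreal_le_of_exp_geometric[OF \<gamma>])
qed

end

lemma induced_eigenfunction:
  obtains l h C where "0 < l" "0 < C" "\<And>x. x \<in> cyl a \<Longrightarrow> 1 \<le> C * h x \<and> h x \<le> C"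
    "log_lip (cyl a) (invariant_const B) (\<lambda>x. ennreal (h x))"
    "\<And>x. x \<in> cyl a \<Longrightarrow> induced f a (\<lambda>x. ennreal (h x)) x = ennreal (l * h x)"
proof -
  obtain l C \<gamma> h where l: "0 < l" and C: "0 \<le> C" and \<gamma>: "0 \<le> \<gamma>" "\<gamma> < 1" and h: "\<And>x. 0 < h x"
    and approx: "\<And>n x. x \<in> cyl a \<Longrightarrow> ennreal (h x) \<le> ennreal (exp (C * \<gamma> ^ n)) * scaled_iterate l n x"
      "\<And>n x. x \<in> cyl a \<Longrightarrow> scaled_iterate l n x \<le> ennreal (exp (C * \<gamma> ^ n)) * ennreal (h x)"
    using iterates_approximate_eigenfunction by blast
  have "1 \<le> exp C * h x \<and> h x \<le> exp C" if x: "x \<in> cyl a" for x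
    using approx[OF x, of 0] h[of x]
    by (simp add: scaled_iterate_def ennreal_mult[symmetric] less_imp_le flip: ennreal_1)
  moreover have "induced f a (\<lambda>x. ennreal (h x)) x = ennreal (l * h x)" if "x \<in> cyl a" for x
    using induced_approximated[OF l C \<gamma> approx that] l h[of x] by (simp add: ennreal_mult)
  ultimately show thesis
    using that[of l "exp C" h] l log_lip_approximated[OF l C \<gamma> approx] by simp
qed

end

end

section \<open>The harmonic function of a strongly positive recurrent potential\<close>

lemma small_perturbation:
  fixes C \<rho> \<epsilon> :: real
  assumes \<rho>: "0 \<le> \<rho>" "\<rho> < 1" and \<epsilon>: "0 < \<epsilon>"
  obtains \<delta> where "\<delta> > 0" "\<rho> * exp \<delta> < 1"
    "summable (\<lambda>k. C * \<rho> ^ k * (exp (\<delta> * (real k + 1)) - 1))"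
    "(\<Sum>k. C * \<rho> ^ k * (exp (\<delta> * (real k + 1)) - 1)) < \<epsilon>"
proof -
  define s where "s \<delta> = C * (exp \<delta> / (1 - \<rho> * exp \<delta>) - 1 / (1 - \<rho>))" for \<delta> :: real
  have "isCont s 0" unfolding s_def using \<rho> by (intro continuous_intros) auto
  then have "s \<midarrow>0\<rightarrow> 0" using \<rho> by (simp add: isCont_def s_def)
  then have s_small: "\<forall>\<^sub>F \<delta> in at_right 0. s \<delta> < \<epsilon>"
    using \<epsilon> by (intro order_tendstoD(2)[of s 0]) (auto intro: tendsto_within_subset)
  have "isCont (\<lambda>\<delta>. \<rho> * exp \<delta>) 0" by (intro continuous_intros)
  then have "(\<lambda>\<delta>. \<rho> * exp \<delta>) \<midarrow>0\<rightarrow> \<rho>" by (simp add: isCont_def)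
  then have ratio: "\<forall>\<^sub>F \<delta> in at_right 0. \<rho> * exp \<delta> < 1"
    using \<rho> by (intro order_tendstoD(2)[of _ \<rho>]) (auto intro: tendsto_within_subset)
  have "\<forall>\<^sub>F \<delta> in at_right (0::real). 0 < \<delta> \<and> s \<delta> < \<epsilon> \<and> \<rho> * exp \<delta> < 1"
    using s_small ratio eventually_at_right_less[of 0] by eventually_elim auto
  then obtain \<delta> where \<delta>: "0 < \<delta>" "s \<delta> < \<epsilon>" "\<rho> * exp \<delta> < 1"
    using eventually_happens[of _ "at_right (0::real)"] by (auto simp: trivial_limit_at_right_real)
  have eq: "C * \<rho> ^ k * (exp (\<delta> * (real k + 1)) - 1) = C * exp \<delta> * (\<rho> * exp \<delta>) ^ k - C * \<rho> ^ k" for k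
    by (simp add: power_mult_distrib exp_of_nat_mult[symmetric] distrib_left exp_add algebra_simps)
  have "(\<lambda>k. C * exp \<delta> * (\<rho> * exp \<delta>) ^ k - C * \<rho> ^ k) sums (C * exp \<delta> * (1 / (1 - \<rho> * exp \<delta>)) - C * (1 / (1 - \<rho>)))"
    using \<rho> \<delta> by (intro sums_diff sums_mult geometric_sums) auto
  then have sums: "(\<lambda>k. C * \<rho> ^ k * (exp (\<delta> * (real k + 1)) - 1)) sums s \<delta>"
    unfolding eq by (simp add: s_def algebra_simps)
  show thesis using that[of \<delta>] \<delta> sums_summable[OF sums] sums_unique[OF sums] by simp
qed

context markov_shift
begin

lemma suminf_perturbation_le:
  fixes w :: "nat \<Rightarrow> ennreal"
  assumes w: "\<And>k. w k \<le> ennreal (C * \<rho> ^ k) * z" and C: "0 \<le> C" "0 \<le> \<rho>" and \<delta>: "0 \<le> \<delta>"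
    and sm: "summable (\<lambda>k. C * \<rho> ^ k * (exp (\<delta> * (real k + 1)) - 1))"
    and le: "(\<Sum>k. C * \<rho> ^ k * (exp (\<delta> * (real k + 1)) - 1)) \<le> \<epsilon>"
  shows "(\<Sum>k. ennreal (exp (\<delta> * (real k + 1)) - 1) * w k) \<le> ennreal \<epsilon> * z"
proof -
  define e where "e k = exp (\<delta> * (real k + 1)) - 1" for k
  have e: "0 \<le> e k" for k using \<delta> by (simp add: e_def)
  have "(\<Sum>k. ennreal (e k) * w k) \<le> (\<Sum>k. z * ennreal (C * \<rho> ^ k * e k))"
  proof (intro suminf_le allI summableI)
    fix k
    have "ennreal (e k) * w k \<le> ennreal (e k) * (ennreal (C * \<rho> ^ k) * z)" by (intro mult_left_mono w) auto
    also have "... = z * ennreal (C * \<rho> ^ k * e k)"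
      using C e[of k] by (subst ennreal_mult) (auto simp: ac_simps)
    finally show "ennreal (e k) * w k \<le> z * ennreal (C * \<rho> ^ k * e k)" .
  qed
  also have "... = z * ennreal (\<Sum>k. C * \<rho> ^ k * e k)"
    unfolding ennreal_suminf_cmult using C e sm[folded e_def]
    by (intro arg_cong[of _ _ "\<lambda>c. z * c"] suminf_ennreal2 mult_nonneg_nonneg) auto
  also have "... \<le> z * ennreal \<epsilon>" using le[folded e_def] by (intro mult_left_mono ennreal_leI) auto
  finally show ?thesis by (simp add: e_def mult.commute)
qed

text \<open>Exponential decay leaves room to change the potential by a small constant: the effect on an
  excursion of length \<open>k\<close> is a factor \<open>exp (\<plusminus>\<delta> (k + 1))\<close>.\<close>

lemma induced_perturbation:
  assumes w: "\<And>k x. x \<in> cyl a \<Longrightarrow> excursion_weight f a u k x \<le> ennreal (C * \<rho> ^ k) * u x"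
    and C: "0 \<le> C" "0 \<le> \<rho>" "\<rho> < 1" and \<epsilon>: "0 < \<epsilon>"
  shows "\<exists>\<delta>>0. \<forall>x\<in>cyl a. induced (\<lambda>x. f x + \<delta>) a u x \<le> induced f a u x + ennreal \<epsilon> * u x \<and>
    induced f a u x \<le> induced (\<lambda>x. f x + - \<delta>) a u x + ennreal \<epsilon> * u x"
proof -
  obtain \<delta> where \<delta>: "\<delta> > 0" and small: "summable (\<lambda>k. C * \<rho> ^ k * (exp (\<delta> * (real k + 1)) - 1))"
    "(\<Sum>k. C * \<rho> ^ k * (exp (\<delta> * (real k + 1)) - 1)) < \<epsilon>"
    using small_perturbation[OF C(2,3) \<epsilon>] by blast
  define e where "e k = ennreal (exp (\<delta> * (real k + 1)) - 1)" for k
  have error: "(\<Sum>k. e k * excursion_weight f a u k x) \<le> ennreal \<epsilon> * u x" if "x \<in> cyl a" for x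
    unfolding e_def
    by (rule suminf_perturbation_le[OF w[OF that] C(1,2) _ small(1) less_imp_le[OF small(2)]]) (use \<delta> in simp)
  have grow: "ennreal (exp (\<delta> * (real k + 1))) = 1 + e k"
    and shrink: "1 \<le> ennreal (exp (- \<delta> * (real k + 1))) + e k" for k
  proof -
    define s where "s = \<delta> * (real k + 1)"
    have "0 \<le> exp s - 1" using \<delta> by (simp add: s_def)
    moreover have "1 \<le> exp (- s) + (exp s - 1)"
      using exp_ge_add_one_self[of s] exp_ge_add_one_self[of "- s"] by linarith
    ultimately show "ennreal (exp (\<delta> * (real k + 1))) = 1 + e k" "1 \<le> ennreal (exp (- \<delta> * (real k + 1))) + e k"
      unfolding e_def mult_minus_left s_def[symmetric]
      by (simp_all add: ennreal_plus[symmetric] flip: ennreal_1 del: ennreal_plus)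
  qed
  have upper: "induced (\<lambda>x. f x + \<delta>) a u x = induced f a u x + (\<Sum>k. e k * excursion_weight f a u k x)" for x
    unfolding induced_add_const grow distrib_right mult_1_left induced_eq_suminf by (rule suminf_add[symmetric]) auto
  have lower: "induced f a u x \<le> induced (\<lambda>x. f x + - \<delta>) a u x + (\<Sum>k. e k * excursion_weight f a u k x)" for x
  proof -
    have "induced f a u x \<le>
        (\<Sum>k. ennreal (exp (- \<delta> * (real k + 1))) * excursion_weight f a u k x + e k * excursion_weight f a u k x)"
      unfolding induced_eq_suminf distrib_right[symmetric]
      using mult_right_mono[OF shrink] by (intro suminf_le) auto
    also have "... = induced (\<lambda>x. f x + - \<delta>) a u x + (\<Sum>k. e k * excursion_weight f a u k x)"
      unfolding induced_add_const by (rule suminf_add[symmetric]) auto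
    finally show ?thesis .
  qed
  have "induced (\<lambda>x. f x + \<delta>) a u x \<le> induced f a u x + ennreal \<epsilon> * u x \<and>
      induced f a u x \<le> induced (\<lambda>x. f x + - \<delta>) a u x + ennreal \<epsilon> * u x" if x: "x \<in> cyl a" for x
    unfolding upper using add_left_mono[OF error[OF x]] order_trans[OF lower add_left_mono[OF error[OF x]]] by blast
  then show ?thesis using \<delta> by blast
qed

lemma ruelle_induced:
  assumes "\<And>y. y \<in> cyl a \<Longrightarrow> induced f a u y = u y" "x \<in> X"
  shows "ruelle E f UNIV (induced f a u) x = induced f a u x"
proof -
  have "ruelle E f {a} (induced f a u) x = ruelle E f {a} u x" using assms by (intro ruelle_cong) auto
  then show ?thesis
    unfolding ruelle_split[of E f "induced f a u" x "{a}"] by (simp add: induced_unfold[symmetric])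
qed

lemma superharmonic_induced:
  assumes "\<And>y. y \<in> cyl a \<Longrightarrow> induced f a u y \<le> u y"
  shows "superharmonic E f (induced f a u)"
  unfolding superharmonic_def
proof
  fix x assume x: "x \<in> X"
  have "ruelle E f {a} (induced f a u) x \<le> ruelle E f {a} u x" using assms x by (intro ruelle_mono) auto
  then show "ruelle E f UNIV (induced f a u) x \<le> induced f a u x"
    unfolding ruelle_split[of E f "induced f a u" x "{a}"] induced_unfold[of f a u x] by (rule add_right_mono)
qed

lemma regular_superharmonic_induced:
  assumes f: "wholder B f" "0 \<le> B" and u: "log_lip (cyl a) (invariant_const B) u"
    and bounds: "\<And>x. x \<in> cyl a \<Longrightarrow> 1 \<le> ennreal C * u x \<and> u x \<noteq> top"
    and sub: "\<And>x. x \<in> cyl a \<Longrightarrow> induced f a u x \<le> u x"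
  shows "regular_superharmonic f (induced f a u)"
proof -
  obtain x where x: "x \<in> cyl a" using cyl_nonempty by blast
  have "induced f a (\<lambda>_. 1) x \<le> induced f a (\<lambda>x. ennreal C * u x) x"
    using bounds x by (intro induced_mono) auto
  then have "induced f a u x \<noteq> 0" using induced_1_pos[of x f a] x by (auto simp: induced_cmult)
  moreover have "log_lip X (invariant_const B) (induced f a u)"
    using log_lip_induced[OF f(1) u] by (simp add: invariant_const)
  moreover have "induced f a u x \<noteq> top" using sub[OF x] bounds[OF x] by (auto simp: top_unique)
  ultimately show ?thesis
    using x by (intro regular_superharmonicI[OF superharmonic_induced[OF sub] _ invariant_const_nonneg[OF f(2)]]) auto
qed

lemma green_starts_in_ge:
  assumes "x \<in> cyl a"
  shows "1 + induced f a (green E f UNIV (starts_in {a})) x \<le> green E f UNIV (starts_in {a}) x"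
proof -
  define U where "U = green E f UNIV (starts_in {a})"
  have x: "x \<in> X" using assms by simp
  have "starts_in {a} y + ruelle E f {a} U y + ruelle E f (- {a}) U y = U y" for y
    unfolding U_def add.assoc ruelle_split[symmetric] by (rule green_unfold[symmetric])
  then have "green E f (- {a}) (\<lambda>y. starts_in {a} y + ruelle E f {a} U y) x \<le> U x"
    by (intro green_least[OF _ x] eq_refl)
  moreover have "1 \<le> green E f (- {a}) (starts_in {a}) x"
    using green_ge(1)[of "starts_in {a}" x E f "- {a}"] assms by auto
  ultimately show ?thesis
    unfolding green_add induced_def U_def by (meson add_right_mono order_trans)
qed

lemma green_starts_in_infinite:
  assumes u: "\<And>x. x \<in> cyl a \<Longrightarrow> 0 < u x \<and> u x \<le> C"
    and sub: "\<And>x. x \<in> cyl a \<Longrightarrow> ennreal (u x) \<le> induced f a (\<lambda>x. ennreal (u x)) x" and x: "x \<in> cyl a"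
  shows "green E f UNIV (starts_in {a}) x = top"
proof (rule ccontr)
  define U where "U = green E f UNIV (starts_in {a})"
  have C: "0 < C" using u[OF x] by linarith
  have lower: "ennreal (real j / C * u y) \<le> U y" if "y \<in> cyl a" for j y
    using that
  proof (induction j arbitrary: y)
    case (Suc j)
    have cmult: "ennreal (real j / C * u z) = ennreal (real j / C) * ennreal (u z)" if "z \<in> cyl a" for z
      using u[OF that] C by (intro ennreal_mult) auto
    have "ennreal (real j / C) * ennreal (u y) \<le> ennreal (real j / C) * induced f a (\<lambda>x. ennreal (u x)) y"
      using sub[OF Suc.prems] by (rule mult_left_mono) simp
    also have "... \<le> induced f a U y"
      unfolding induced_cmult[symmetric] using Suc cmult by (intro induced_mono) auto
    finally have "1 + ennreal (real j / C * u y) \<le> 1 + induced f a U y"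
      unfolding cmult[OF Suc.prems] by (rule add_left_mono)
    also have "... \<le> U y" unfolding U_def by (rule green_starts_in_ge[OF Suc.prems])
    finally have "1 + ennreal (real j / C * u y) \<le> U y" .
    moreover have "ennreal (1 + real j / C * u y) = 1 + ennreal (real j / C * u y)"
      using u[OF Suc.prems] C by (subst ennreal_plus) auto
    moreover have "ennreal (real (Suc j) / C * u y) \<le> ennreal (1 + real j / C * u y)"
      using u[OF Suc.prems] C by (intro ennreal_leI) (simp add: field_simps)
    ultimately show ?case by order
  qed simp
  assume "green E f UNIV (starts_in {a}) x \<noteq> top"
  then obtain r where r: "U x = ennreal r" "0 \<le> r" unfolding U_def by (metis ennreal_cases)
  obtain j :: nat where "real j > r / (u x / C)" using reals_Archimedean2 by blast
  then have "r < real j / C * u x" using u[OF x] C by (simp add: field_simps)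
  then show False using lower[OF x, of j] r by simp
qed

end

locale spr_shift = markov_shift E \<theta> for E :: "'a::countable \<Rightarrow> 'a \<Rightarrow> bool" and \<theta> +
  fixes \<phi> :: "(nat \<Rightarrow> 'a) \<Rightarrow> real" and a :: 'a and B P :: real
  assumes phi: "wholder B \<phi>" "0 \<le> B"
    and press: "gurevich_pressure E \<phi> a = ereal P"
    and spr: "limsup (\<lambda>n. eln (Zn_star E \<phi> a n) / ereal (real n)) < ereal P"
begin

abbreviation \<phi>\<^sub>0 :: "(nat \<Rightarrow> 'a) \<Rightarrow> real" where "\<phi>\<^sub>0 \<equiv> \<lambda>x. \<phi> x + - P"

lemma wholder_phi0: "wholder B \<phi>\<^sub>0"
  using phi(1) by (rule wholder_add_const)

lemma excursion_weight_exp_decay: "exp_decay (cyl a) (excursion_weight \<phi>\<^sub>0 a (\<lambda>_. 1))"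
proof -
  define M where "M = exp (B / (1 - \<theta>))"
  define c where "c k = ennreal (exp (- P * (real k + 1))) * (ennreal M * Zn_star E \<phi> a (Suc k))" for k
  have le: "excursion_weight \<phi>\<^sub>0 a (\<lambda>_. 1) k x \<le> c k" if "x \<in> cyl a" for k x
    unfolding c_def M_def excursion_weight_add_const
    by (intro mult_left_mono excursion_weight_le_Zn_star that phi) auto
  have "Zn_star E \<phi> a (Suc k) \<le> Zn E \<phi> a (Suc k)" for k
    unfolding Zn_star_def Zn_def infsum_ennreal_eq_nn_integral
    by (auto simp: nn_integral_count_space_indicator intro!: nn_integral_mono split: split_indicator)
  moreover have "Zn E \<phi> a (Suc k) \<noteq> top" for k
    using press by (intro Zn_finite[OF phi, of a "P + 1"]) auto
  ultimately have "Zn_star E \<phi> a (Suc k) \<noteq> top" for k by (metis top.extremum_uniqueI)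
  then have fin: "c k \<noteq> top" for k by (simp add: c_def ennreal_mult_eq_top_iff)
  obtain q where q: "limsup (\<lambda>n. eln (Zn_star E \<phi> a n) / ereal (real n)) < ereal q" "q < P"
    using ereal_dense2[OF spr] by auto
  obtain N where N: "\<And>n. n \<ge> N \<Longrightarrow> Zn_star E \<phi> a n \<le> ennreal (exp (real n * q))"
    using limsup_eln_lessD[OF q(1)] by blast
  define \<rho> where "\<rho> = exp (q - P)"
  have \<rho>: "0 < \<rho>" "\<rho> < 1" using q by (auto simp: \<rho>_def)
  have "c k \<le> ennreal (M * \<rho> ^ k)" if k: "k \<ge> N" for k
  proof -
    have "c k \<le> ennreal (exp (- P * (real k + 1))) * (ennreal M * ennreal (exp (real (Suc k) * q)))"
      unfolding c_def using N[of "Suc k"] k by (intro mult_left_mono) auto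
    also have "... = ennreal (M * \<rho> ^ Suc k)"
      by (simp add: ennreal_mult[symmetric] M_def \<rho>_def exp_of_nat_mult[symmetric] exp_add[symmetric] algebra_simps)
    also have "... \<le> ennreal (M * \<rho> ^ k)"
      using \<rho> by (intro ennreal_leI mult_left_mono) (auto simp: M_def mult_left_le_one_le)
    finally show ?thesis .
  qed
  then show ?thesis
    using le by (intro exp_decay_eventually[where c=c and M=M, OF \<rho> _ le fin]) (auto simp: M_def intro: order_trans)
qed

lemma induced_1_finite:
  assumes x: "x \<in> cyl a" shows "induced \<phi>\<^sub>0 a (\<lambda>_. 1) x \<noteq> top"
proof -
  obtain C where "\<forall>x\<in>cyl a. (\<Sum>k. excursion_weight \<phi>\<^sub>0 a (\<lambda>_. 1) k x) \<le> ennreal C"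
    using exp_decay_suminf_bounded[OF excursion_weight_exp_decay] by blast
  then have "induced \<phi>\<^sub>0 a (\<lambda>_. 1) x \<le> ennreal C" using x unfolding induced_eq_suminf by blast
  then show ?thesis by (metis ennreal_neq_top top_unique)
qed

context
  fixes C l h
  assumes C: "0 < C" and l: "0 < l"
    and bounds: "\<And>x. x \<in> cyl a \<Longrightarrow> 1 \<le> C * h x \<and> h x \<le> C"
    and lip: "log_lip (cyl a) (invariant_const B) (\<lambda>x. ennreal (h x))"
    and eigen: "\<And>x. x \<in> cyl a \<Longrightarrow> induced \<phi>\<^sub>0 a (\<lambda>x. ennreal (h x)) x = ennreal (l * h x)"
begin

lemma eigenfunction_pos: "x \<in> cyl a \<Longrightarrow> 0 < h x"
  using bounds[of x] C by (smt (verit) mult_nonneg_nonpos)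

lemma excursion_weight_eigenfunction:
  "\<exists>M \<rho>. 0 \<le> M \<and> 0 \<le> \<rho> \<and> \<rho> < 1 \<and> (\<forall>k. \<forall>x\<in>cyl a.
    excursion_weight \<phi>\<^sub>0 a (\<lambda>x. ennreal (h x)) k x \<le> ennreal (M * \<rho> ^ k) * ennreal (h x))"
proof -
  obtain K \<rho> where K: "0 < K" "0 < \<rho>" "\<rho> < 1"
    "\<And>k x. x \<in> cyl a \<Longrightarrow> excursion_weight \<phi>\<^sub>0 a (\<lambda>_. 1) k x \<le> ennreal (K * \<rho> ^ k)"
    using excursion_weight_exp_decay unfolding exp_decay_def by blast
  have "excursion_weight \<phi>\<^sub>0 a (\<lambda>x. ennreal (h x)) k x \<le> ennreal (C * C * K * \<rho> ^ k) * ennreal (h x)"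
    if x: "x \<in> cyl a" for k x
  proof -
    have "excursion_weight \<phi>\<^sub>0 a (\<lambda>x. ennreal (h x)) k x \<le> ennreal C * excursion_weight \<phi>\<^sub>0 a (\<lambda>_. 1) k x"
      unfolding excursion_weight_cmult[symmetric] using bounds x by (intro excursion_weight_mono) (auto intro: ennreal_leI)
    also have "... \<le> ennreal C * ennreal (K * \<rho> ^ k)" using K x by (intro mult_left_mono) auto
    also have "... = ennreal (C * K * \<rho> ^ k)" using C K by (simp add: ennreal_mult[symmetric] mult.assoc)
    also have "... \<le> ennreal (C * C * K * \<rho> ^ k * h x)"
    proof (rule ennreal_leI)
      have "C * K * \<rho> ^ k * 1 \<le> C * K * \<rho> ^ k * (C * h x)" using bounds[OF x] C K by (intro mult_left_mono) auto
      then show "C * K * \<rho> ^ k \<le> C * C * K * \<rho> ^ k * h x" by (simp add: ac_simps)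
    qed
    also have "... = ennreal (C * C * K * \<rho> ^ k) * ennreal (h x)"
      using C K eigenfunction_pos[OF x] by (simp add: ennreal_mult)
    finally show ?thesis .
  qed
  then show ?thesis using C K by (intro exI[of _ "C * C * K"] exI[of _ \<rho>]) auto
qed

lemma perturbed_eigenfunction:
  assumes "0 < \<epsilon>"
  shows "\<exists>\<delta>>0. \<forall>x\<in>cyl a. induced (\<lambda>x. \<phi> x + - (P - \<delta>)) a (\<lambda>x. ennreal (h x)) x \<le> ennreal ((l + \<epsilon>) * h x) \<and>
    ennreal ((l - \<epsilon>) * h x) \<le> induced (\<lambda>x. \<phi> x + - (P + \<delta>)) a (\<lambda>x. ennreal (h x)) x"
proof -
  have eq: "(\<lambda>x. \<phi> x + - P + \<delta>) = (\<lambda>x. \<phi> x + - (P - \<delta>))" "(\<lambda>x. \<phi> x + - P + - \<delta>) = (\<lambda>x. \<phi> x + - (P + \<delta>))" for \<delta>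
    by auto
  obtain M \<rho> where M: "0 \<le> M" "0 \<le> \<rho>" "\<rho> < 1" and weight: "\<And>k x. x \<in> cyl a \<Longrightarrow>
      excursion_weight \<phi>\<^sub>0 a (\<lambda>x. ennreal (h x)) k x \<le> ennreal (M * \<rho> ^ k) * ennreal (h x)"
    using excursion_weight_eigenfunction by blast
  obtain \<delta> where \<delta>: "\<delta> > 0" and perturbed: "\<And>x. x \<in> cyl a \<Longrightarrow>
      induced (\<lambda>x. \<phi> x + - (P - \<delta>)) a (\<lambda>x. ennreal (h x)) x \<le>
        induced \<phi>\<^sub>0 a (\<lambda>x. ennreal (h x)) x + ennreal \<epsilon> * ennreal (h x)"
    "\<And>x. x \<in> cyl a \<Longrightarrow> induced \<phi>\<^sub>0 a (\<lambda>x. ennreal (h x)) x \<le>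
      induced (\<lambda>x. \<phi> x + - (P + \<delta>)) a (\<lambda>x. ennreal (h x)) x + ennreal \<epsilon> * ennreal (h x)"
    using induced_perturbation[OF weight M assms] unfolding eq(2) eq(1) by blast
  have eps: "ennreal \<epsilon> * ennreal (h x) = ennreal (\<epsilon> * h x)" if "x \<in> cyl a" for x
    using assms eigenfunction_pos[OF that] by (simp add: ennreal_mult)
  have "ennreal (l * h x) + ennreal \<epsilon> * ennreal (h x) = ennreal ((l + \<epsilon>) * h x)" if "x \<in> cyl a" for x
    using assms l eigenfunction_pos[OF that] by (simp add: eps[OF that] distrib_right)
  moreover have "ennreal ((l - \<epsilon>) * h x) \<le> induced (\<lambda>x. \<phi> x + - (P + \<delta>)) a (\<lambda>x. ennreal (h x)) x" if "x \<in> cyl a" for x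
    using perturbed(2)[OF that, unfolded eigen[OF that]] assms eigenfunction_pos[OF that]
    by (simp add: eps[OF that] left_diff_distrib ennreal_minus[symmetric] ennreal_minus_le_iff add.commute)
  ultimately show ?thesis using \<delta> perturbed(1) eigen by (intro exI[of _ \<delta>]) simp
qed

lemma eigenvalue_ge_1: "1 \<le> l"
proof (rule ccontr)
  assume "\<not> 1 \<le> l"
  then obtain \<delta> where \<delta>: "\<delta> > 0" "\<And>x. x \<in> cyl a \<Longrightarrow>
      induced (\<lambda>x. \<phi> x + - (P - \<delta>)) a (\<lambda>x. ennreal (h x)) x \<le> ennreal (h x)"
    using perturbed_eigenfunction[of "1 - l"] by auto
  have "1 \<le> ennreal C * ennreal (h x) \<and> ennreal (h x) \<noteq> top" if "x \<in> cyl a" for x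
    using bounds[OF that] C eigenfunction_pos[OF that] by (simp add: ennreal_mult[symmetric] flip: ennreal_1)
  then have "regular_superharmonic (\<lambda>x. \<phi> x + - (P - \<delta>)) (induced (\<lambda>x. \<phi> x + - (P - \<delta>)) a (\<lambda>x. ennreal (h x)))"
    by (intro regular_superharmonic_induced[OF wholder_add_const[OF phi(1)] phi(2) lip _ \<delta>(2)])
  then show False using pressure_le_of_superharmonic[OF phi, of "P - \<delta>" _ a] press \<delta>(1) by auto
qed

lemma eigenvalue_le_1: "l \<le> 1"
proof (rule ccontr)
  assume "\<not> l \<le> 1"
  then obtain \<delta> where \<delta>: "\<delta> > 0" "\<And>x. x \<in> cyl a \<Longrightarrow>
      ennreal (h x) \<le> induced (\<lambda>x. \<phi> x + - (P + \<delta>)) a (\<lambda>x. ennreal (h x)) x"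
    using perturbed_eigenfunction[of "l - 1"] by auto
  obtain x where x: "x \<in> cyl a" using cyl_nonempty by blast
  have "green E (\<lambda>x. \<phi> x + - (P + \<delta>)) UNIV (starts_in {a}) x = top"
    using bounds eigenfunction_pos by (intro green_starts_in_infinite[OF _ \<delta>(2) x]) auto
  moreover have "green E (\<lambda>x. \<phi> x + - (P + \<delta>)) UNIV (starts_in {a}) x \<noteq> top"
    by (rule green_starts_in_finite[OF phi _ x]) (use press \<delta>(1) in auto)
  ultimately show False by blast
qed

end

theorem harmonic_function:
  obtains h where "\<And>x. x \<in> X \<Longrightarrow> h x > 0" "log_lip X (invariant_const B) (\<lambda>x. ennreal (h x))"
    "\<And>x. x \<in> X \<Longrightarrow> ruelle E \<phi>\<^sub>0 UNIV (\<lambda>x. ennreal (h x)) x = ennreal (h x)"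
    "\<And>x. x \<in> X \<Longrightarrow> induced \<phi>\<^sub>0 a (\<lambda>x. ennreal (h x)) x = ennreal (h x)"
proof -
  obtain l h C where l: "0 < l" and C: "0 < C" and bounds: "\<And>x. x \<in> cyl a \<Longrightarrow> 1 \<le> C * h x \<and> h x \<le> C"
    and lip: "log_lip (cyl a) (invariant_const B) (\<lambda>x. ennreal (h x))"
    and eigen: "\<And>x. x \<in> cyl a \<Longrightarrow> induced \<phi>\<^sub>0 a (\<lambda>x. ennreal (h x)) x = ennreal (l * h x)"
    by (rule induced_eigenfunction[OF wholder_phi0 phi(2) induced_1_finite], assumption) (rule that; assumption)
  have "l = 1" using eigenvalue_ge_1[OF C l bounds lip eigen] eigenvalue_le_1[OF C l bounds lip eigen] by simp
  define H where "H = induced \<phi>\<^sub>0 a (\<lambda>x. ennreal (h x))"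
  have H_cyl: "H x = ennreal (h x)" if "x \<in> cyl a" for x using eigen[OF that] by (simp add: H_def \<open>l = 1\<close>)
  have induced_H: "induced \<phi>\<^sub>0 a H x = H x" if "x \<in> X" for x
    using H_cyl that unfolding H_def by (intro induced_cong) auto
  have ruelle_H: "ruelle E \<phi>\<^sub>0 UNIV H x = H x" if "x \<in> X" for x
    unfolding H_def by (rule ruelle_induced[OF _ that]) (use H_cyl in \<open>simp add: H_def\<close>)
  have lip_H: "log_lip X (invariant_const B) H"
    using log_lip_induced[OF wholder_phi0 lip] by (simp add: H_def invariant_const)
  have "1 \<le> ennreal C * ennreal (h x) \<and> ennreal (h x) \<noteq> top" if "x \<in> cyl a" for x
    using bounds[OF that] C by (simp add: ennreal_mult'[symmetric] ennreal_leI flip: ennreal_1)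
  then have "regular_superharmonic \<phi>\<^sub>0 H"
    unfolding H_def using H_cyl
    by (intro regular_superharmonic_induced[OF wholder_phi0 phi(2) lip, of C]) (auto simp: H_def)
  then have fin: "H x \<noteq> top" "H x \<noteq> 0" if "x \<in> X" for x using that by (auto simp: regular_superharmonic_def)
  define k where "k x = enn2real (H x)" for x
  have k: "ennreal (k x) = H x" if "x \<in> X" for x using fin(1)[OF that] by (simp add: k_def less_top)
  show thesis
  proof (rule that[of k])
    show "k x > 0" if "x \<in> X" for x
      using fin[OF that] by (simp add: k_def enn2real_positive_iff less_top zero_less_iff_neq_zero)
    show "log_lip X (invariant_const B) (\<lambda>x. ennreal (k x))" by (rule log_lip_cong[OF lip_H]) (simp add: k)
    show "ruelle E \<phi>\<^sub>0 UNIV (\<lambda>x. ennreal (k x)) x = ennreal (k x)" if "x \<in> X" for x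
      using ruelle_cong[of E UNIV "\<lambda>x. ennreal (k x)" H x \<phi>\<^sub>0] k that ruelle_H by simp
    show "induced \<phi>\<^sub>0 a (\<lambda>x. ennreal (k x)) x = ennreal (k x)" if "x \<in> X" for x
      using induced_cong[of a "\<lambda>x. ennreal (k x)" H x \<phi>\<^sub>0] k that induced_H by simp
  qed
qed

end

section \<open>Entropy of finite partitions\<close>

lemma gibbs_inequality:
  fixes p q :: "'i \<Rightarrow> real"
  assumes p: "\<And>i. i \<in> I \<Longrightarrow> 0 \<le> p i" "(\<Sum>i\<in>I. p i) = 1"
    and q: "\<And>i. i \<in> I \<Longrightarrow> 0 \<le> q i" "\<And>i. i \<in> I \<Longrightarrow> 0 < p i \<Longrightarrow> 0 < q i" "(\<Sum>i\<in>I. q i) \<le> Z" "0 < Z"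
  shows "- (\<Sum>i\<in>I. p i * ln (p i)) \<le> - (\<Sum>i\<in>I. p i * ln (q i)) + ln Z"
proof -
  have "p i * ln (q i) - p i * ln (p i) \<le> q i / Z - p i + p i * ln Z" if i: "i \<in> I" for i
  proof (cases "p i = 0")
    case True
    then show ?thesis using q(1)[OF i] q(4) by simp
  next
    case False
    then have pos: "p i > 0" "q i > 0" using p(1)[OF i] q(2)[OF i] by (auto simp: less_eq_real_def)
    have "ln (q i / (p i * Z)) \<le> q i / (p i * Z) - 1" using pos q(4) by (intro ln_le_minus_one) auto
    moreover have "ln (q i / (p i * Z)) = ln (q i) - (ln (p i) + ln Z)"
      using pos q(4) by (simp add: ln_divide_pos ln_mult_pos)
    ultimately have "p i * (ln (q i) - (ln (p i) + ln Z)) \<le> p i * (q i / (p i * Z) - 1)"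
      using pos by (intro mult_left_mono) auto
    also have "... = q i / Z - p i" using pos by (simp add: right_diff_distrib)
    finally show ?thesis by (simp add: right_diff_distrib distrib_left)
  qed
  then have "(\<Sum>i\<in>I. p i * ln (q i) - p i * ln (p i)) \<le> (\<Sum>i\<in>I. q i / Z - p i + p i * ln Z)" by (rule sum_mono)
  also have "... = (\<Sum>i\<in>I. q i) / Z - 1 + ln Z"
    by (simp add: sum.distrib sum_subtractf p(2) sum_divide_distrib[symmetric] sum_distrib_right[symmetric])
  also have "... \<le> ln Z" using q(3,4) by simp
  finally show ?thesis by (simp add: sum_subtractf)
qed

lemma entropy_concave:
  fixes p :: "nat \<Rightarrow> 'i \<Rightarrow> real"
  assumes L: "0 < L" and p: "\<And>k i. i \<in> I \<Longrightarrow> 0 \<le> p k i" "\<And>k. k < L \<Longrightarrow> (\<Sum>i\<in>I. p k i) = 1"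
    and r: "\<And>i. i \<in> I \<Longrightarrow> real L * r i = (\<Sum>k<L. p k i)"
  shows "(\<Sum>k<L. - (\<Sum>i\<in>I. p k i * ln (p k i))) \<le> real L * - (\<Sum>i\<in>I. r i * ln (r i))"
proof -
  have "real L * (\<Sum>i\<in>I. r i) = (\<Sum>k<L. \<Sum>i\<in>I. p k i)"
    unfolding sum_distrib_left by (subst sum.swap) (simp add: r)
  then have r_sum: "(\<Sum>i\<in>I. r i) = 1" using p(2) L by simp
  have "0 \<le> real L * r i" if "i \<in> I" for i unfolding r[OF that] using p(1)[OF that] by (rule sum_nonneg)
  then have r_nonneg: "0 \<le> r i" if "i \<in> I" for i using that L by (simp add: zero_le_mult_iff)
  have "- (\<Sum>i\<in>I. p k i * ln (p k i)) \<le> - (\<Sum>i\<in>I. p k i * ln (r i)) + ln 1" if k: "k < L" for k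
  proof (rule gibbs_inequality[OF p(1) p(2)[OF k] r_nonneg])
    fix i assume i: "i \<in> I" "0 < p k i"
    then have "0 < real L * r i" unfolding r[OF i(1)] using k p(1) by (intro sum_pos2[of _ k]) auto
    then show "0 < r i" using L by (simp add: zero_less_mult_iff)
  qed (use r_sum in auto)
  then have "(\<Sum>k<L. - (\<Sum>i\<in>I. p k i * ln (p k i))) \<le> (\<Sum>k<L. - (\<Sum>i\<in>I. p k i * ln (r i)))"
    by (intro sum_mono) simp
  also have "... = - (\<Sum>i\<in>I. (\<Sum>k<L. p k i) * ln (r i))"
    by (simp add: sum_negf sum_distrib_right sum.swap[of _ I])
  also have "... = real L * - (\<Sum>i\<in>I. r i * ln (r i))"
    by (simp add: r[symmetric] sum_distrib_left mult.assoc)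
  finally show ?thesis .
qed

context prob_space
begin

interpretation information_space M "exp 1"
  by unfold_locales simp

abbreviation simple_entropy :: "('a \<Rightarrow> 'i) \<Rightarrow> real" where
  "simple_entropy X \<equiv> entropy (exp 1) (count_space (X ` space M)) X"

lemma simple_entropy_eq:
  assumes "simple_function M X"
  shows "simple_entropy X = - (\<Sum>i\<in>X ` space M. prob (X -` {i} \<inter> space M) * ln (prob (X -` {i} \<inter> space M)))"
  by (simp add: entropy_simple_distributed[OF simple_distributedI[OF assms measure_nonneg refl]] log_def)

lemma simple_entropy_eq_superset:
  assumes X: "simple_function M X" and I: "finite I" "X ` space M \<subseteq> I"
  shows "simple_entropy X = - (\<Sum>i\<in>I. prob (X -` {i} \<inter> space M) * ln (prob (X -` {i} \<inter> space M)))"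
proof -
  have "X -` {i} \<inter> space M = {}" if "i \<in> I - X ` space M" for i using that by auto
  then show ?thesis unfolding simple_entropy_eq[OF X] using I
    by (intro arg_cong[of _ _ uminus] sum.mono_neutral_left) auto
qed

lemma simple_entropy_nonneg:
  assumes "simple_function M X" shows "0 \<le> simple_entropy X"
proof -
  have "prob A * ln (prob A) \<le> 0" for A
    by (cases "prob A = 0") (auto simp: mult_le_0_iff zero_less_measure_iff)
  then have "(\<Sum>i\<in>X ` space M. prob (X -` {i} \<inter> space M) * ln (prob (X -` {i} \<inter> space M))) \<le> 0"
    by (intro sum_nonpos)
  then show ?thesis by (simp add: simple_entropy_eq[OF assms])
qed

lemma simple_entropy_subadditive:
  assumes "simple_function M X" "simple_function M Y"
  shows "simple_entropy (\<lambda>x. f (X x, Y x)) \<le> simple_entropy X + simple_entropy Y"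
  using entropy_data_processing[OF simple_function_Pair[OF assms], of f] entropy_chain_rule[OF assms]
    conditional_entropy_less_eq_entropy[OF assms(2,1)] by (simp add: comp_def)

lemma integral_simple_function:
  fixes c :: "'i \<Rightarrow> real"
  assumes X: "simple_function M X"
  shows "integrable M (\<lambda>x. c (X x))" "(\<integral>x. c (X x) \<partial>M) = (\<Sum>i\<in>X ` space M. prob (X -` {i} \<inter> space M) * c i)"
proof -
  let ?fibre = "\<lambda>i. X -` {i} \<inter> space M"
  have eq: "c (X x) = (\<Sum>i\<in>X ` space M. indicator (?fibre i) x * c i)" if x: "x \<in> space M" for x
  proof -
    have "(\<Sum>i\<in>X ` space M. indicator (?fibre i) x * c i) = (\<Sum>i\<in>X ` space M. if i = X x then c i else 0)"
      using x by (intro sum.cong) auto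
    then show ?thesis using x simple_functionD(1)[OF X] by simp
  qed
  have int: "integrable M (\<lambda>x. indicator (?fibre i) x * c i)" for i
    using simple_functionD(2)[OF X, of "{i}"] by (intro integrable_mult_left) (simp add: emeasure_eq_measure)
  show "integrable M (\<lambda>x. c (X x))"
    by (subst Bochner_Integration.integrable_cong[OF refl eq]) (auto intro: int)
  have "(\<integral>x. c (X x) \<partial>M) = (\<Sum>i\<in>X ` space M. (\<integral>x. indicator (?fibre i) x * c i \<partial>M))"
    by (subst Bochner_Integration.integral_cong[OF refl eq], assumption) (rule Bochner_Integration.integral_sum[OF int])
  then show "(\<integral>x. c (X x) \<partial>M) = (\<Sum>i\<in>X ` space M. prob (?fibre i) * c i)" by simp
qed

lemma simple_entropy_eq_integral:
  "simple_function M X \<Longrightarrow> simple_entropy X = (\<integral>x. - ln (prob (X -` {X x} \<inter> space M)) \<partial>M)"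
  by (simp add: simple_entropy_eq integral_simple_function(2)[where c="\<lambda>i. ln (prob (X -` {i} \<inter> space M))"])

lemma sum_prob_fibres:
  assumes X: "simple_function M X" and I: "finite I" "X ` space M \<subseteq> I"
  shows "(\<Sum>i\<in>I. prob (X -` {i} \<inter> space M)) = 1"
proof -
  have "X -` {i} \<inter> space M = {}" if "i \<in> I - X ` space M" for i using that by auto
  then have "(\<Sum>i\<in>I. prob (X -` {i} \<inter> space M)) = (\<Sum>i\<in>X ` space M. prob (X -` {i} \<inter> space M))"
    using I by (intro sum.mono_neutral_right) auto
  then show ?thesis using integral_simple_function(2)[OF X, of "\<lambda>_. 1"] prob_space by simp
qed

lemma simple_entropy_le_cost:
  assumes X: "simple_function M X" and R: "integrable M R" and q: "\<And>x. x \<in> space M \<Longrightarrow> exp (- R x) \<le> q (X x)"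
    and Z: "(\<Sum>i\<in>X ` space M. q i) \<le> Z" "0 < Z"
  shows "simple_entropy X \<le> (\<integral>x. R x \<partial>M) + ln Z"
proof -
  have q0: "0 < q i" if "i \<in> X ` space M" for i
    using that q by (auto intro: less_le_trans[OF exp_gt_zero])
  have "simple_entropy X \<le> - (\<Sum>i\<in>X ` space M. prob (X -` {i} \<inter> space M) * ln (q i)) + ln Z"
    unfolding simple_entropy_eq[OF X]
    by (rule gibbs_inequality[OF _ sum_prob_fibres[OF X simple_functionD(1)[OF X] order_refl] _ _ Z])
      (use q0 in \<open>auto intro: less_imp_le\<close>)
  also have "- (\<Sum>i\<in>X ` space M. prob (X -` {i} \<inter> space M) * ln (q i)) = (\<integral>x. - ln (q (X x)) \<partial>M)"
    by (simp add: integral_simple_function(2)[OF X, where c="\<lambda>i. ln (q i)"])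
  also have "... \<le> (\<integral>x. R x \<partial>M)"
  proof (rule integral_mono[OF integral_simple_function(1)[OF X, where c="\<lambda>i. - ln (q i)"] R])
    fix x assume x: "x \<in> space M"
    have "- R x \<le> ln (q (X x))" using q[OF x] q0 x by (subst ln_ge_iff) auto
    then show "- ln (q (X x)) \<le> R x" by simp
  qed
  finally show ?thesis by simp
qed

lemma simple_entropy_ge:
  assumes X: "simple_function M X" and W: "integrable M W"
    and le: "\<And>x. x \<in> space M \<Longrightarrow> prob (X -` {X x} \<inter> space M) \<le> exp (- W x)"
  shows "(\<integral>x. W x \<partial>M) \<le> simple_entropy X"
  unfolding simple_entropy_eq_integral[OF X]
proof (rule integral_mono_AE[OF W integral_simple_function(1)[OF X, where c="\<lambda>i. - ln (prob (X -` {i} \<inter> space M))"]])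
  have "(\<integral>x. indicator {i. prob (X -` {i} \<inter> space M) = 0} (X x) \<partial>M) = (0::real)"
    unfolding integral_simple_function(2)[OF X] by (intro sum.neutral) (auto simp: indicator_def)
  then have "AE x in M. indicator {i. prob (X -` {i} \<inter> space M) = 0} (X x) = (0::real)"
    by (subst (asm) integral_nonneg_eq_0_iff_AE[OF integral_simple_function(1)[OF X]]) auto
  then show "AE x in M. W x \<le> - ln (prob (X -` {X x} \<inter> space M))"
    using AE_space
  proof eventually_elim
    case (elim x)
    then have "0 < prob (X -` {X x} \<inter> space M)" by (auto simp: indicator_def zero_less_measure_iff split: if_splits)
    then have "ln (prob (X -` {X x} \<inter> space M)) \<le> - W x"
      using le[OF elim(2)] by (metis exp_gt_zero ln_exp ln_le_cancel_iff)
    then show ?case by simp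
  qed
qed

end

lemma subadditive_le_affine:
  fixes a :: "nat \<Rightarrow> real"
  assumes nn: "\<And>n. 0 \<le> a n" and sub: "\<And>n k. a (n + k) \<le> a n + a k" and N: "0 < N"
  shows "a n \<le> real n * (a N / real N) + (\<Sum>r<N. a r)"
proof -
  have mult: "a (q * N + r) \<le> real q * a N + a r" for q r
  proof (induction q)
    case (Suc q)
    have "a (Suc q * N + r) \<le> a N + a (q * N + r)" using sub[of N "q * N + r"] by (simp add: add.assoc)
    then show ?case using Suc by (simp add: distrib_right)
  qed simp
  have "a n \<le> real (n div N) * a N + a (n mod N)" using mult[of "n div N" "n mod N"] by simp
  also have "real (n div N) * a N = real (n div N * N) * (a N / real N)" using N by simp
  also have "... \<le> real n * (a N / real N)"
    using nn by (intro mult_right_mono) (auto simp: div_times_less_eq_dividend simp del: of_nat_mult)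
  also have "a (n mod N) \<le> (\<Sum>r<N. a r)" using nn N by (intro member_le_sum) auto
  finally show ?thesis by simp
qed

lemma fekete_convergent:
  fixes a :: "nat \<Rightarrow> real"
  assumes nn: "\<And>n. 0 \<le> a n" and sub: "\<And>n k. a (n + k) \<le> a n + a k"
  shows "convergent (\<lambda>n. a n / real n)"
proof -
  define L where "L = (INF n\<in>{1..}. a n / real n)"
  have bdd: "bdd_below ((\<lambda>n. a n / real n) ` {1..})" using nn by (intro bdd_belowI2[of _ 0]) auto
  have lower: "L \<le> a n / real n" if "n \<ge> 1" for n unfolding L_def using that by (intro cINF_lower bdd) simp
  have "(\<lambda>n. a n / real n) \<longlonglongrightarrow> L"
  proof (rule order_tendstoI)
    show "\<forall>\<^sub>F n in sequentially. c < a n / real n" if "c < L" for c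
      using less_le_trans[OF that lower] by (auto simp: eventually_sequentially)
    fix c assume "L < c"
    then obtain N where N: "N \<ge> 1" "a N / real N < c"
      unfolding L_def by (subst (asm) cINF_less_iff[OF _ bdd]) auto
    define M where "M = (\<Sum>r<N. a r)"
    have "(\<lambda>n. a N / real N + M / real n) \<longlonglongrightarrow> a N / real N + 0" by (intro tendsto_intros lim_const_over_n)
    then have "\<forall>\<^sub>F n in sequentially. a N / real N + M / real n < c" using N by (intro order_tendstoD) auto
    then show "\<forall>\<^sub>F n in sequentially. a n / real n < c"
      using eventually_gt_at_top[of 0]
    proof eventually_elim
      case (elim n)
      have "a n \<le> real n * (a N / real N) + M" unfolding M_def using N by (intro subadditive_le_affine nn sub) simp
      then have "a n / real n \<le> (real n * (a N / real N) + M) / real n" by (intro divide_right_mono) auto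
      also have "... = a N / real N + M / real n" using elim(2) by (simp add: add_divide_distrib)
      finally show ?case using elim(1) by simp
    qed
  qed
  then show ?thesis by (auto simp: convergent_def)
qed

definition part_of :: "'b set set \<Rightarrow> 'b \<Rightarrow> 'b set" where
  "part_of Q x = (THE A. A \<in> Q \<and> x \<in> A)"

definition itinerary :: "(nat \<Rightarrow> 'a) set set \<Rightarrow> nat \<Rightarrow> (nat \<Rightarrow> 'a) \<Rightarrow> nat \<Rightarrow> (nat \<Rightarrow> 'a) set" where
  "itinerary Q n x = (\<lambda>k\<in>{..<n}. part_of Q ((shift ^^ k) x))"

lemma itinerary_eq_iff: "itinerary Q n x = itinerary Q n y \<longleftrightarrow> (\<forall>k<n. part_of Q ((shift ^^ k) x) = part_of Q ((shift ^^ k) y))"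
  by (auto simp: itinerary_def restrict_def fun_eq_iff)

locale invariant_shift =
  fixes E :: "'a::countable \<Rightarrow> 'a \<Rightarrow> bool" and m :: "(nat \<Rightarrow> 'a) measure"
  assumes inv: "invariant_prob E m"
begin

lemma sets_m [measurable_cong]: "sets m = sets (shift_space E)"
  using inv by (simp add: invariant_prob_def)

lemma space_m [simp]: "space m = sigma_plus E"
  using sets_eq_imp_space_eq[OF sets_m] by simp

sublocale prob_space m
  using inv by (simp add: invariant_prob_def)

lemma measurable_m: "f \<in> borel_measurable m \<longleftrightarrow> f \<in> borel_measurable (shift_space E)"
  unfolding measurable_cong_sets[OF sets_m refl] ..

lemma measurable_shift_m [measurable]: "shift \<in> measurable m m"
  unfolding measurable_cong_sets[OF sets_m sets_m] by (rule measurable_shift)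

lemma measurable_funpow_m [measurable]: "(shift ^^ k) \<in> measurable m m"
  unfolding measurable_cong_sets[OF sets_m sets_m] by (rule measurable_funpow_shift)

lemma distr_shift: "distr m m shift = m"
proof (rule measure_eqI)
  fix A assume "A \<in> sets (distr m m shift)"
  then have A: "A \<in> sets m" by simp
  then show "emeasure (distr m m shift) A = emeasure m A"
    using inv by (subst emeasure_distr) (auto simp: invariant_prob_def)
qed simp

lemma distr_funpow_shift: "distr m m (shift ^^ k) = m"
proof (induction k)
  case (Suc k)
  have "distr m m (shift ^^ Suc k) = distr (distr m m (shift ^^ k)) m shift"
    by (subst distr_distr) (auto simp: comp_def)
  also have "... = m" using Suc distr_shift by simp
  finally show ?case .
qed (simp add: distr_id2)

lemma integral_funpow_shift:
  "u \<in> borel_measurable m \<Longrightarrow> (\<integral>x. u ((shift ^^ k) x) \<partial>m) = (\<integral>x. u x \<partial>m)" for u :: "_ \<Rightarrow> real"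
  using integral_distr[of "shift ^^ k" m m u] by (simp add: distr_funpow_shift)

lemma integrable_funpow_shift:
  "integrable m u \<Longrightarrow> integrable m (\<lambda>x. u ((shift ^^ k) x))" for u :: "_ \<Rightarrow> real"
  using integrable_distr[of "shift ^^ k" m m u] by (simp add: distr_funpow_shift)

lemma integral_birkhoff:
  assumes "integrable m u" shows "(\<integral>x. birkhoff u n x \<partial>m) = real n * (\<integral>x. u x \<partial>m)"
    and "integrable m (birkhoff u n)"
  using assms integral_funpow_shift[of u] integrable_funpow_shift[OF assms]
  unfolding birkhoff_def[abs_def] by (auto simp: Bochner_Integration.integral_sum)

lemma measure_funpow_shift:
  assumes "A \<in> sets m" shows "measure m (space m \<inter> (shift ^^ k) -` A) = measure m A"
proof -
  have "measure (distr m m (shift ^^ k)) A = measure m ((shift ^^ k) -` A \<inter> space m)"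
    using assms by (intro measure_distr) auto
  then show ?thesis by (simp only: distr_funpow_shift Int_commute)
qed

context
  fixes Q assumes Q: "finite_partition m Q"
begin

lemma finite_partitionD: "finite Q" "A \<in> Q \<Longrightarrow> A \<in> sets m" "\<Union>Q = sigma_plus E" "disjoint Q"
  using Q by (auto simp: finite_partition_def)

lemma part_of_eq: "A \<in> Q \<Longrightarrow> x \<in> A \<Longrightarrow> part_of Q x = A"
  unfolding part_of_def using finite_partitionD(4) by (intro the_equality) (auto simp: disjoint_def)

lemma part_of_mem: "x \<in> sigma_plus E \<Longrightarrow> part_of Q x \<in> Q \<and> x \<in> part_of Q x"
  using finite_partitionD(3) part_of_eq by blast

lemma part_of_eq_iff: "x \<in> sigma_plus E \<Longrightarrow> A \<in> Q \<Longrightarrow> part_of Q x = A \<longleftrightarrow> x \<in> A"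
  using part_of_eq part_of_mem by blast

lemma itinerary_in_PiE: "x \<in> sigma_plus E \<Longrightarrow> itinerary Q n x \<in> {..<n} \<rightarrow>\<^sub>E Q"
  by (auto simp: itinerary_def restrict_PiE_iff intro!: part_of_mem[THEN conjunct1])

lemma finite_itineraries: "finite ({..<n::nat} \<rightarrow>\<^sub>E Q)"
  using finite_partitionD(1) by (intro finite_PiE) auto

lemma itinerary_fibre:
  assumes "F \<in> {..<n} \<rightarrow>\<^sub>E Q"
  shows "itinerary Q n -` {F} \<inter> space m = space m \<inter> (\<Inter>k<n. (shift ^^ k) -` F k)"
proof -
  have "itinerary Q n x = F \<longleftrightarrow> (\<forall>k<n. (shift ^^ k) x \<in> F k)" if "x \<in> sigma_plus E" for x
  proof -
    have "itinerary Q n x = F \<longleftrightarrow> (\<forall>k<n. part_of Q ((shift ^^ k) x) = F k)"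
      using assms by (auto simp: itinerary_def fun_eq_iff restrict_def PiE_iff extensional_def)
    also have "... \<longleftrightarrow> (\<forall>k<n. (shift ^^ k) x \<in> F k)"
      using part_of_eq_iff[OF funpow_shift_in_sigma[OF that]] assms by (auto simp: PiE_iff)
    finally show ?thesis .
  qed
  then show ?thesis by auto
qed

lemma refine_eq_fibres: "refine m Q n = (\<lambda>F. itinerary Q n -` {F} \<inter> space m) ` ({..<n} \<rightarrow>\<^sub>E Q)"
proof (intro set_eqI iffI)
  fix A assume "A \<in> refine m Q n"
  then obtain F where F: "\<forall>k<n. F k \<in> Q" "A = space m \<inter> (\<Inter>k<n. (shift ^^ k) -` F k)" by (auto simp: refine_def)
  then have mem: "restrict F {..<n} \<in> {..<n} \<rightarrow>\<^sub>E Q" by auto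
  moreover have "A = itinerary Q n -` {restrict F {..<n}} \<inter> space m"
    unfolding itinerary_fibre[OF mem] F(2) by auto
  ultimately show "A \<in> (\<lambda>F. itinerary Q n -` {F} \<inter> space m) ` ({..<n} \<rightarrow>\<^sub>E Q)" by blast
next
  fix A assume "A \<in> (\<lambda>F. itinerary Q n -` {F} \<inter> space m) ` ({..<n} \<rightarrow>\<^sub>E Q)"
  then obtain F where "F \<in> {..<n} \<rightarrow>\<^sub>E Q" "A = space m \<inter> (\<Inter>k<n. (shift ^^ k) -` F k)"
    using itinerary_fibre by auto
  then show "A \<in> refine m Q n" unfolding refine_def by (blast dest: PiE_mem)
qed

lemma simple_function_itinerary: "simple_function m (itinerary Q n)"
  unfolding simple_function_def
proof (intro conjI ballI)
  show "finite (itinerary Q n ` space m)"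
    by (rule finite_subset[OF _ finite_itineraries[of n]]) (use itinerary_in_PiE in auto)
  fix F assume "F \<in> itinerary Q n ` space m"
  then have F: "F \<in> {..<n} \<rightarrow>\<^sub>E Q" using itinerary_in_PiE by auto
  have "{x \<in> space m. \<forall>k\<in>{..<n}. (shift ^^ k) x \<in> F k} \<in> sets m"
  proof (rule sets.sets_Collect_finite_All)
    fix k assume "k \<in> {..<n}"
    then have "F k \<in> sets m" using F finite_partitionD(2) by auto
    then show "{x \<in> space m. (shift ^^ k) x \<in> F k} \<in> sets m"
      using measurable_sets[OF measurable_funpow_m[of k]] by (simp add: vimage_def Int_def conj_commute)
  qed simp
  moreover have "{x \<in> space m. \<forall>k\<in>{..<n}. (shift ^^ k) x \<in> F k} = space m \<inter> (\<Inter>k<n. (shift ^^ k) -` F k)" by auto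
  ultimately show "itinerary Q n -` {F} \<inter> space m \<in> sets m" unfolding itinerary_fibre[OF F] by simp
qed

lemma part_entropy_refine: "part_entropy m (refine m Q n) = simple_entropy (itinerary Q n)"
proof -
  define fibre where "fibre F = itinerary Q n -` {F} \<inter> space m" for F
  have "inj_on fibre (itinerary Q n ` space m)" by (auto simp: inj_on_def fibre_def set_eq_iff)
  then have "simple_entropy (itinerary Q n) = - (\<Sum>A\<in>fibre ` itinerary Q n ` space m. measure m A * ln (measure m A))"
    unfolding simple_entropy_eq[OF simple_function_itinerary] by (subst sum.reindex) (simp_all add: fibre_def)
  also have "(\<Sum>A\<in>fibre ` itinerary Q n ` space m. measure m A * ln (measure m A)) =
      (\<Sum>A\<in>fibre ` ({..<n} \<rightarrow>\<^sub>E Q). measure m A * ln (measure m A))"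
  proof (rule sum.mono_neutral_left)
    show "\<forall>A\<in>fibre ` ({..<n} \<rightarrow>\<^sub>E Q) - fibre ` itinerary Q n ` space m. measure m A * ln (measure m A) = 0"
    proof
      fix A assume "A \<in> fibre ` ({..<n} \<rightarrow>\<^sub>E Q) - fibre ` itinerary Q n ` space m"
      then have "A = {}" by (auto simp: fibre_def)
      then show "measure m A * ln (measure m A) = 0" by simp
    qed
  qed (use finite_itineraries itinerary_in_PiE in auto)
  finally show ?thesis by (simp add: part_entropy_def refine_eq_fibres fibre_def)
qed

lemma simple_entropy_comp_shift:
  assumes Y: "simple_function m Y"
  shows "simple_function m (\<lambda>x. Y ((shift ^^ n) x))" "simple_entropy (\<lambda>x. Y ((shift ^^ n) x)) = simple_entropy Y"
proof -
  show sf: "simple_function m (\<lambda>x. Y ((shift ^^ n) x))"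
    using simple_function_comp[OF measurable_funpow_m[of n] Y] by (simp add: comp_def)
  define g where "g x = - ln (measure m (Y -` {Y x} \<inter> space m))" for x
  have "measure m ((\<lambda>x. Y ((shift ^^ n) x)) -` {i} \<inter> space m) = measure m (Y -` {i} \<inter> space m)" for i
  proof -
    have "(\<lambda>x. Y ((shift ^^ n) x)) -` {i} \<inter> space m = space m \<inter> (shift ^^ n) -` (Y -` {i} \<inter> space m)"
      using funpow_shift_in_sigma by auto
    then show ?thesis using measure_funpow_shift[OF simple_functionD(2)[OF Y]] by simp
  qed
  then have "simple_entropy (\<lambda>x. Y ((shift ^^ n) x)) = (\<integral>x. g ((shift ^^ n) x) \<partial>m)"
    unfolding simple_entropy_eq_integral[OF sf] g_def by simp
  also have "... = simple_entropy Y"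
    unfolding simple_entropy_eq_integral[OF Y] g_def
    using integral_simple_function(1)[OF Y, where c="\<lambda>i. - ln (measure m (Y -` {i} \<inter> space m))"]
    by (intro integral_funpow_shift borel_measurable_integrable)
  finally show "simple_entropy (\<lambda>x. Y ((shift ^^ n) x)) = simple_entropy Y" .
qed

lemma entropy_itinerary_subadditive:
  "simple_entropy (itinerary Q (n + k)) \<le> simple_entropy (itinerary Q n) + simple_entropy (itinerary Q k)"
proof -
  define glue :: "(nat \<Rightarrow> (nat \<Rightarrow> 'a) set) \<times> (nat \<Rightarrow> (nat \<Rightarrow> 'a) set) \<Rightarrow> nat \<Rightarrow> (nat \<Rightarrow> 'a) set" where
    "glue = (\<lambda>(F, G). \<lambda>i\<in>{..<n + k}. if i < n then F i else G (i - n))"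
  have "itinerary Q (n + k) x = glue (itinerary Q n x, itinerary Q k ((shift ^^ n) x))" for x
    by (auto simp: glue_def itinerary_def restrict_def fun_eq_iff funpow_shift_add)
  then have "simple_entropy (itinerary Q (n + k)) = simple_entropy (\<lambda>x. glue (itinerary Q n x, itinerary Q k ((shift ^^ n) x)))"
    by presburger
  also have "... \<le> simple_entropy (itinerary Q n) + simple_entropy (\<lambda>x. itinerary Q k ((shift ^^ n) x))"
    by (intro simple_entropy_subadditive simple_entropy_comp_shift simple_function_itinerary)
  finally show ?thesis unfolding simple_entropy_comp_shift(2)[OF simple_function_itinerary] .
qed

lemma entropy_wrt_LIMSEQ: "(\<lambda>n. simple_entropy (itinerary Q n) / real n) \<longlonglongrightarrow> entropy_wrt m Q"
  unfolding entropy_wrt_def part_entropy_refine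
  using fekete_convergent[of "\<lambda>n. simple_entropy (itinerary Q n)",
      OF simple_entropy_nonneg[OF simple_function_itinerary] entropy_itinerary_subadditive]
  by (simp add: convergent_LIMSEQ_iff)

end

definition determined :: "nat \<Rightarrow> (nat \<Rightarrow> 'a) set \<Rightarrow> bool" where
  "determined l A \<longleftrightarrow> A \<subseteq> sigma_plus E \<and>
    (\<forall>x\<in>sigma_plus E. \<forall>y\<in>sigma_plus E. agree l x y \<longrightarrow> x \<in> A \<longrightarrow> y \<in> A)"

lemma determined_iff: "determined l A \<Longrightarrow> x \<in> sigma_plus E \<Longrightarrow> y \<in> sigma_plus E \<Longrightarrow> agree l x y \<Longrightarrow> x \<in> A \<longleftrightarrow> y \<in> A"
  using agree_sym unfolding determined_def by blast

lemma determined_mono: "determined l A \<Longrightarrow> l \<le> l' \<Longrightarrow> determined l' A"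
  using agree_mono unfolding determined_def by blast

lemma determined_sets: "determined l A \<Longrightarrow> A \<in> sets m"
  unfolding sets_m determined_def by (rule cyl_open_in_sets) (auto simp: eventually_cyl_nhds)

lemma determined_Diff: "determined l A \<Longrightarrow> determined l (sigma_plus E - A)"
  using agree_sym unfolding determined_def by blast

lemma determined_UN: "(\<And>i. i \<in> I \<Longrightarrow> determined l (A i)) \<Longrightarrow> determined l (\<Union>i\<in>I. A i)"
  unfolding determined_def by blast

lemma approx_UN_by_determined:
  fixes a :: "nat \<Rightarrow> (nat \<Rightarrow> 'a) set"
  assumes a: "\<And>i. a i \<in> sets m" and approx: "\<And>i \<epsilon>. 0 < \<epsilon> \<Longrightarrow> \<exists>l A. determined l A \<and> measure m (sym_diff (a i) A) < \<epsilon>"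
    and \<epsilon>: "0 < \<epsilon>"
  shows "\<exists>l A. determined l A \<and> measure m (sym_diff (\<Union>i. a i) A) < \<epsilon>"
proof -
  have "(\<lambda>n. measure m (\<Union>i<n. a i)) \<longlonglongrightarrow> measure m (\<Union>n. \<Union>i<n. a i)"
    using a by (intro finite_Lim_measure_incseq) (auto simp: incseq_def intro: less_le_trans)
  moreover have "(\<Union>n. \<Union>i<n. a i) = (\<Union>i. a i)" by blast
  ultimately have "\<forall>\<^sub>F n in sequentially. measure m (\<Union>i. a i) - \<epsilon> / 2 < measure m (\<Union>i<n. a i)"
    using \<epsilon> by (intro order_tendstoD) auto
  then obtain N where N: "measure m (\<Union>i. a i) - \<epsilon> / 2 < measure m (\<Union>i<N. a i)" by (auto simp: eventually_sequentially)
  have "\<forall>i. \<exists>l A. determined l A \<and> measure m (sym_diff (a i) A) < \<epsilon> / (2 * (real N + 1))" using approx \<epsilon> by auto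
  then obtain l A where A: "\<And>i. determined (l i) (A i)" "\<And>i. measure m (sym_diff (a i) (A i)) < \<epsilon> / (2 * (real N + 1))"
    by metis
  note sets = a determined_sets[OF A(1)]
  have "determined (\<Sum>i<N. l i) (\<Union>i<N. A i)"
    by (intro determined_UN determined_mono[OF A(1)] member_le_sum) auto
  moreover have "measure m (sym_diff (\<Union>i. a i) (\<Union>i<N. A i)) < \<epsilon>"
  proof -
    have "sym_diff (\<Union>i. a i) (\<Union>i<N. A i) \<subseteq> ((\<Union>i. a i) - (\<Union>i<N. a i)) \<union> (\<Union>i<N. sym_diff (a i) (A i))" by auto
    then have "measure m (sym_diff (\<Union>i. a i) (\<Union>i<N. A i)) \<le>
        measure m (((\<Union>i. a i) - (\<Union>i<N. a i)) \<union> (\<Union>i<N. sym_diff (a i) (A i)))"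
      using sets by (intro finite_measure_mono) auto
    also have "... \<le> measure m ((\<Union>i. a i) - (\<Union>i<N. a i)) + measure m (\<Union>i<N. sym_diff (a i) (A i))"
      using sets by (intro measure_Un_le) auto
    also have "measure m ((\<Union>i. a i) - (\<Union>i<N. a i)) = measure m (\<Union>i. a i) - measure m (\<Union>i<N. a i)"
      using a by (intro finite_measure_Diff) auto
    also have "measure m (\<Union>i<N. sym_diff (a i) (A i)) \<le> (\<Sum>i<N. measure m (sym_diff (a i) (A i)))"
      using sets by (intro finite_measure_subadditive_finite) auto
    also have "... \<le> (\<Sum>i<N. \<epsilon> / (2 * (real N + 1)))" using A(2) by (intro sum_mono less_imp_le)
    also have "... \<le> \<epsilon> / 2" using \<epsilon> by (simp add: field_simps)
    finally show ?thesis using N by simp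
  qed
  ultimately show ?thesis by blast
qed

lemma approx_by_determined:
  assumes A: "A \<in> sets m" and \<epsilon>: "0 < \<epsilon>"
  shows "\<exists>l A'. determined l A' \<and> measure m (sym_diff A A') < \<epsilon>"
proof -
  have "A \<in> sigma_sets (sigma_plus E) {{x \<in> sigma_plus E. \<forall>i<n. x i = w i} |n w. True}"
    using A unfolding sets_m shift_space_def by (subst (asm) sets_measure_of) auto
  then have "\<forall>\<epsilon>>0. \<exists>l A'. determined l A' \<and> measure m (sym_diff A A') < \<epsilon>"
  proof (induction rule: sigma_sets.induct)
    case (Basic C)
    then obtain n w where "C = {x \<in> sigma_plus E. \<forall>i<n. x i = w i}" by blast
    then have "determined n C" by (auto simp: determined_def agree_def)
    then show ?case by (intro allI impI exI[of _ n] exI[of _ C]) auto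
  next
    case Empty
    then show ?case by (intro allI impI exI[of _ 0] exI[of _ "{}"]) (auto simp: determined_def)
  next
    case (Compl C)
    show ?case
    proof (intro allI impI)
      fix \<epsilon> :: real assume "\<epsilon> > 0"
      then obtain l A' where A': "determined l A'" "measure m (sym_diff C A') < \<epsilon>" using Compl by blast
      have "C \<in> sets m" using Compl(1) unfolding sets_m shift_space_def by (subst sets_measure_of) auto
      then have "sym_diff C A' \<in> sets m" using determined_sets[OF A'(1)] by auto
      moreover have "sym_diff (sigma_plus E - C) (sigma_plus E - A') \<subseteq> sym_diff C A'" by auto
      ultimately show "\<exists>l A'. determined l A' \<and> measure m (sym_diff (sigma_plus E - C) A') < \<epsilon>"
        using determined_Diff[OF A'(1)] A'(2) finite_measure_mono le_less_trans by blast
    qed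
  next
    case (Union C)
    have "C i \<in> sets m" for i
      using Union(1)[of i] unfolding sets_m shift_space_def by (subst sets_measure_of) auto
    then show ?case using Union(2) by (intro allI impI approx_UN_by_determined) auto
  qed
  then show ?thesis using \<epsilon> by blast
qed

lemma determined_selector:
  assumes Q: "Q \<noteq> {}" and A': "\<And>A. A \<in> Q \<Longrightarrow> determined l (A' A)"
  shows "\<exists>s. (\<forall>x. s x \<in> Q \<and> (x \<in> A' (s x) \<or> x \<notin> (\<Union>A\<in>Q. A' A))) \<and>
    (\<forall>x\<in>sigma_plus E. \<forall>y\<in>sigma_plus E. agree l x y \<longrightarrow> s x = s y)"
proof -
  define R where "R x A \<longleftrightarrow> A \<in> Q \<and> (x \<in> A' A \<or> x \<notin> (\<Union>A\<in>Q. A' A))" for x A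
  define s where "s x = (SOME A. R x A)" for x
  have "\<exists>A. R x A" for x using Q unfolding R_def by blast
  then have "R x (s x)" for x unfolding s_def by (rule someI_ex)
  moreover have "s x = s y" if "x \<in> sigma_plus E" "y \<in> sigma_plus E" "agree l x y" for x y
  proof -
    have "x \<in> A' A \<longleftrightarrow> y \<in> A' A" if "A \<in> Q" for A
      using determined_iff[OF A'[OF that]] \<open>x \<in> _\<close> \<open>y \<in> _\<close> \<open>agree l x y\<close> .
    then have "R x = R y" unfolding R_def by blast
    then show ?thesis by (simp add: s_def)
  qed
  ultimately show ?thesis unfolding R_def by blast
qed

lemma approx_partition:
  assumes Q: "finite_partition m Q" and \<epsilon>: "0 < \<epsilon>"
  obtains l s where "\<And>x y. x \<in> sigma_plus E \<Longrightarrow> y \<in> sigma_plus E \<Longrightarrow> agree l x y \<Longrightarrow> s x = s y"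
    "{x \<in> sigma_plus E. x \<notin> s x} \<in> sets m" "measure m {x \<in> sigma_plus E. x \<notin> s x} \<le> \<epsilon>"
    "\<And>x. s x \<in> Q"
proof -
  note partition = finite_partitionD[OF Q]
  have "\<forall>A\<in>Q. \<exists>l A'. determined l A' \<and> measure m (sym_diff A A') < \<epsilon> / (real (card Q) + 1)"
    using partition \<epsilon> by (intro ballI approx_by_determined) auto
  then obtain l A' where A': "\<And>A. A \<in> Q \<Longrightarrow> determined (l A) (A' A)"
    "\<And>A. A \<in> Q \<Longrightarrow> measure m (sym_diff A (A' A)) < \<epsilon> / (real (card Q) + 1)" by metis
  define L where "L = (\<Sum>A\<in>Q. l A)"
  have det: "determined L (A' A)" if "A \<in> Q" for A
    using that partition(1) unfolding L_def by (intro determined_mono[OF A'(1)] member_le_sum) auto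
  have "Q \<noteq> {}" using partition(3) not_empty by auto
  then have "\<exists>s. (\<forall>x. s x \<in> Q \<and> (x \<in> A' (s x) \<or> x \<notin> (\<Union>A\<in>Q. A' A))) \<and>
      (\<forall>x\<in>sigma_plus E. \<forall>y\<in>sigma_plus E. agree L x y \<longrightarrow> s x = s y)"
    using det by (rule determined_selector)
  then obtain s where selects: "\<forall>x. s x \<in> Q \<and> (x \<in> A' (s x) \<or> x \<notin> (\<Union>A\<in>Q. A' A))"
    and s_cong: "\<forall>x\<in>sigma_plus E. \<forall>y\<in>sigma_plus E. agree L x y \<longrightarrow> s x = s y"
    by (elim exE conjE)
  have s: "s x \<in> Q \<and> (x \<in> A' (s x) \<or> x \<notin> (\<Union>A\<in>Q. A' A))" for x using selects ..
  have "determined L {x \<in> sigma_plus E. s x = A}" for A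
    unfolding determined_def using s_cong by blast
  then have s_sets: "{x \<in> sigma_plus E. s x = A} \<in> sets m" for A by (rule determined_sets)
  have "{x \<in> sigma_plus E. x \<notin> s x} = space m - (\<Union>A\<in>Q. A \<inter> {x \<in> sigma_plus E. s x = A})" using s by auto
  then have err_sets: "{x \<in> sigma_plus E. x \<notin> s x} \<in> sets m"
    using partition(1,2) s_sets by (metis (no_types, lifting) sets.Diff sets.Int sets.finite_UN sets.top)
  have diff_sets: "sym_diff A (A' A) \<in> sets m" if "A \<in> Q" for A
    using partition(2)[OF that] determined_sets[OF det[OF that]] by (intro sets.Un sets.Diff)
  have "{x \<in> sigma_plus E. x \<notin> s x} \<subseteq> (\<Union>A\<in>Q. sym_diff A (A' A))"
  proof
    fix x assume x: "x \<in> {x \<in> sigma_plus E. x \<notin> s x}"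
    then obtain A where A: "A \<in> Q" "x \<in> A" using partition(3) by blast
    then show "x \<in> (\<Union>A\<in>Q. sym_diff A (A' A))" using s[of x] x by (cases "x \<in> A' A") blast+
  qed
  then have "measure m {x \<in> sigma_plus E. x \<notin> s x} \<le> measure m (\<Union>A\<in>Q. sym_diff A (A' A))"
    by (intro finite_measure_mono sets.finite_UN partition(1) diff_sets)
  also have "... \<le> (\<Sum>A\<in>Q. measure m (sym_diff A (A' A)))"
    using diff_sets by (intro finite_measure_subadditive_finite partition(1)) blast
  also have "... \<le> (\<Sum>A\<in>Q. \<epsilon> / (real (card Q) + 1))" using A'(2) by (intro sum_mono less_imp_le)
  also have "... \<le> \<epsilon>" using \<epsilon> by (simp add: field_simps)
  finally show thesis using that[of L s] s_cong err_sets s by blast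
qed

end

section \<open>The variational upper bound\<close>

locale markov_measure = markov_shift E \<theta> + invariant_shift E m
  for E :: "'a::countable \<Rightarrow> 'a \<Rightarrow> bool" and \<theta> m
begin

lemma prob_X [simp]: "measure m X = 1"
  using prob_space by simp

lemma letter_set_in_sets: "{x \<in> X. x 0 \<in> F} \<in> sets m"
  unfolding sets_m by (rule finitely_determined_in_sets[of 1]) (simp add: agree_def)

lemma finite_letters_approx:
  assumes "\<epsilon> > 0" obtains F where "finite F" "measure m {x \<in> X. x 0 \<notin> F} \<le> \<epsilon>"
proof -
  define F where "F n = {b::'a. to_nat b < n}" for n
  have fin: "finite (F n)" for n
    unfolding F_def using finite_vimageI[OF finite_lessThan[of n] inj_to_nat] by (simp add: vimage_def lessThan_def)
  have "(\<lambda>n. measure m {x \<in> X. x 0 \<notin> F n}) \<longlonglongrightarrow> measure m (\<Inter>n. {x \<in> X. x 0 \<notin> F n})"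
    using letter_set_in_sets[of "- F _"] by (intro finite_Lim_measure_decseq) (auto simp: decseq_def F_def)
  moreover have "(\<Inter>n. {x \<in> X. x 0 \<notin> F n}) = {}" by (auto simp: F_def intro: lessI)
  ultimately have "\<forall>\<^sub>F n in sequentially. measure m {x \<in> X. x 0 \<notin> F n} < \<epsilon>"
    using assms by (intro order_tendstoD(2)[of _ 0]) auto
  then obtain n where "measure m {x \<in> X. x 0 \<notin> F n} < \<epsilon>" by (auto simp: eventually_sequentially)
  then show thesis using that[of "F n"] fin by simp
qed

lemma card_partition_ge_1:
  assumes "finite_partition m Q" shows "1 \<le> real (card Q)"
proof -
  have "Q \<noteq> {}" using finite_partitionD(3)[OF assms] cyl_nonempty by fastforce
  then show ?thesis using finite_partitionD(1)[OF assms] by (simp add: Suc_leI card_gt_0_iff)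
qed

text \<open>A point is coded by its first and last visit \<open>I\<close>, \<open>J\<close> to a finite set \<open>F\<close> of letters within
  the time window and by the word in between, which is given the weight of the potential.  The symbols
  of the partition are guessed from that word inside \<open>[I, J]\<close> and coded uniformly outside.\<close>

context
  fixes Q :: "(nat \<Rightarrow> 'a) set set" and n :: nat and f :: "(nat \<Rightarrow> 'a) \<Rightarrow> real" and B K :: real
    and F :: "'a set" and z :: "'a \<Rightarrow> nat \<Rightarrow> 'a" and C :: real
    and l :: nat and s :: "(nat \<Rightarrow> 'a) \<Rightarrow> (nat \<Rightarrow> 'a) set" and \<delta> :: real
  assumes Q: "finite_partition m Q" and n: "n \<ge> 1"
    and f: "wholder B f" "0 \<le> B" "integrable m f" "\<And>x. x \<in> X \<Longrightarrow> f x \<le> K" "0 \<le> K"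
    and F: "finite F" and z: "\<And>c. z c \<in> cyl c"
    and C: "0 \<le> C" "\<And>k c. c \<in> F \<Longrightarrow> (ruelle E f UNIV ^^ k) (starts_in F) (z c) \<le> ennreal C"
    and s: "\<And>x y. x \<in> X \<Longrightarrow> y \<in> X \<Longrightarrow> agree l x y \<Longrightarrow> s x = s y" "{x \<in> X. x \<notin> s x} \<in> sets m" "\<And>x. s x \<in> Q"
    and \<delta>: "0 < \<delta>" "\<delta> < 1"
begin

abbreviation parts :: real where "parts \<equiv> real (card Q)"

lemma parts_ge_1: "1 \<le> parts"
  by (rule card_partition_ge_1[OF Q])

lemma ln_parts_nonneg: "0 \<le> ln parts"
  using parts_ge_1 by simp

definition guess_weight :: "(nat \<Rightarrow> 'a) set \<Rightarrow> (nat \<Rightarrow> 'a) set \<Rightarrow> real" where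
  "guess_weight A A' = (if A' = A then 1 - \<delta> else \<delta> / parts)"

lemma sum_guess_weight: "A \<in> Q \<Longrightarrow> (\<Sum>A'\<in>Q. guess_weight A A') \<le> 1"
proof -
  assume A: "A \<in> Q"
  have "(\<Sum>A'\<in>Q. guess_weight A A') = guess_weight A A + (\<Sum>A'\<in>Q - {A}. guess_weight A A')"
    using A finite_partitionD(1)[OF Q] by (simp add: sum.remove)
  also have "(\<Sum>A'\<in>Q - {A}. guess_weight A A') = (\<Sum>A'\<in>Q - {A}. \<delta> / parts)"
    by (intro sum.cong) (auto simp: guess_weight_def)
  also have "... = (parts - 1) * (\<delta> / parts)"
    using A finite_partitionD(1)[OF Q] parts_ge_1 by (simp add: of_nat_diff card_gt_0_iff Suc_leI)
  also have "guess_weight A A + (parts - 1) * (\<delta> / parts) \<le> 1" using parts_ge_1 \<delta> by (simp add: guess_weight_def field_simps)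
  finally show ?thesis .
qed

definition symbol_weight :: "nat \<Rightarrow> nat \<Rightarrow> (nat \<Rightarrow> 'a) \<Rightarrow> nat \<Rightarrow> (nat \<Rightarrow> 'a) set \<Rightarrow> real" where
  "symbol_weight i j y k A = (if i \<le> k \<and> k + l \<le> j then guess_weight (s ((shift ^^ (k - i)) y)) A else 1 / parts)"

lemma symbol_weight_nonneg: "0 \<le> symbol_weight i j y k A"
  using \<delta> by (simp add: symbol_weight_def guess_weight_def)

lemma sum_symbol_weight: "(\<Sum>A\<in>Q. symbol_weight i j y k A) \<le> 1"
proof (cases "i \<le> k \<and> k + l \<le> j")
  case True
  then show ?thesis using sum_guess_weight[OF s(3)] by (simp add: symbol_weight_def)
next
  case False
  then have "(\<Sum>A\<in>Q. symbol_weight i j y k A) = (\<Sum>A\<in>Q. 1 / parts)"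
    unfolding symbol_weight_def by (simp only: if_False)
  then show ?thesis using parts_ge_1 by simp
qed

definition word_set :: "nat \<Rightarrow> (nat \<Rightarrow> 'a) set" where
  "word_set k = {y \<in> X. (\<exists>c\<in>F. (shift ^^ k) y = z c) \<and> y 0 \<in> F}"

lemma sum_word_set: "(\<integral>\<^sup>+y. ennreal (exp (birkhoff f k y)) \<partial>count_space (word_set k)) \<le> ennreal (real (card F) * C)"
proof -
  define w where "w c y = (ennreal (exp (birkhoff f k y)) * starts_in F y) * indicator (preimages E UNIV k (z c)) y" for c y
  have "(\<integral>\<^sup>+y. ennreal (exp (birkhoff f k y)) \<partial>count_space (word_set k)) =
      (\<integral>\<^sup>+y. ennreal (exp (birkhoff f k y)) * indicator (word_set k) y \<partial>count_space UNIV)"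
    by (simp add: nn_integral_count_space_indicator)
  also have "... \<le> (\<integral>\<^sup>+y. (\<Sum>c\<in>F. w c y) \<partial>count_space UNIV)"
  proof (intro nn_integral_mono)
    fix y
    show "ennreal (exp (birkhoff f k y)) * indicator (word_set k) y \<le> (\<Sum>c\<in>F. w c y)"
    proof (cases "y \<in> word_set k")
      case True
      then obtain c where c: "c \<in> F" "(shift ^^ k) y = z c" "y \<in> X" "y 0 \<in> F" by (auto simp: word_set_def)
      then have "ennreal (exp (birkhoff f k y)) * indicator (word_set k) y = w c y"
        using True by (simp add: w_def preimages_def)
      also have "... \<le> (\<Sum>c\<in>F. w c y)" using c F by (intro member_le_sum) auto
      finally show ?thesis .
    qed simp
  qed
  also have "... = (\<Sum>c\<in>F. \<integral>\<^sup>+y. w c y \<partial>count_space UNIV)" by (rule nn_integral_sum) simp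
  also have "... = (\<Sum>c\<in>F. (ruelle E f UNIV ^^ k) (starts_in F) (z c))"
    using z by (intro sum.cong refl) (auto simp: ruelle_funpow_preimages nn_integral_count_space_indicator w_def)
  also have "... \<le> (\<Sum>c\<in>F. ennreal C)" using C by (intro sum_mono) auto
  also have "... = ennreal (real (card F) * C)" using C(1) by (simp add: ennreal_mult ennreal_of_nat_eq_real_of_nat)
  finally show ?thesis .
qed

definition word_weight :: "nat \<Rightarrow> nat \<Rightarrow> (nat \<Rightarrow> 'a) \<Rightarrow> (nat \<Rightarrow> (nat \<Rightarrow> 'a) set) \<Rightarrow> real" where
  "word_weight i j y G = exp (B / (1 - \<theta>)) * exp (birkhoff f (j - i) y) * (\<Prod>k<n. symbol_weight i j y k (G k))"

lemma sum_word_weight: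
  "(\<Sum>G\<in>{..<n} \<rightarrow>\<^sub>E Q. ennreal (word_weight i j y G)) \<le> ennreal (exp (B / (1 - \<theta>))) * ennreal (exp (birkhoff f (j - i) y))"
proof -
  have "(\<Sum>G\<in>{..<n} \<rightarrow>\<^sub>E Q. word_weight i j y G) =
      exp (B / (1 - \<theta>)) * exp (birkhoff f (j - i) y) * (\<Prod>k<n. \<Sum>A\<in>Q. symbol_weight i j y k A)"
    unfolding word_weight_def sum_distrib_left[symmetric]
    using finite_partitionD(1)[OF Q] by (subst prod_sum_PiE) auto
  also have "... \<le> exp (B / (1 - \<theta>)) * exp (birkhoff f (j - i) y) * 1"
    using sum_symbol_weight symbol_weight_nonneg by (intro mult_left_mono prod_le_1) (auto intro!: sum_nonneg)
  finally have "ennreal (\<Sum>G\<in>{..<n} \<rightarrow>\<^sub>E Q. word_weight i j y G) \<le>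
      ennreal (exp (B / (1 - \<theta>)) * exp (birkhoff f (j - i) y))" by (simp add: ennreal_leI)
  moreover have "0 \<le> word_weight i j y G" for G
    unfolding word_weight_def using symbol_weight_nonneg by (intro mult_nonneg_nonneg prod_nonneg) auto
  ultimately show ?thesis by (simp add: sum_ennreal ennreal_mult)
qed

definition coding_weight :: "(nat \<Rightarrow> (nat \<Rightarrow> 'a) set) \<Rightarrow> ennreal" where
  "coding_weight G = ennreal (1 / parts ^ n) + (\<Sum>i<n. \<Sum>j<n. \<integral>\<^sup>+y. ennreal (word_weight i j y G) \<partial>count_space (word_set (j - i)))"

lemma sum_coding_weight:
  "(\<Sum>G\<in>{..<n} \<rightarrow>\<^sub>E Q. coding_weight G) \<le> ennreal ((1 + exp (B / (1 - \<theta>)) * (real (card F) * C)) * (real n)\<^sup>2)"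
proof -
  define b where "b = exp (B / (1 - \<theta>)) * (real (card F) * C)"
  have b: "0 \<le> b" using C(1) by (simp add: b_def)
  have "(\<Sum>G\<in>{..<n} \<rightarrow>\<^sub>E Q. ennreal (1 / parts ^ n)) = ennreal (real (card ({..<n} \<rightarrow>\<^sub>E Q)) * (1 / parts ^ n))"
    by (simp add: ennreal_of_nat_eq_real_of_nat ennreal_mult'[symmetric])
  also have "... = 1" using parts_ge_1 card_PiE[of "{..<n}" "\<lambda>_. Q"] by simp
  finally have uniform: "(\<Sum>G\<in>{..<n} \<rightarrow>\<^sub>E Q. ennreal (1 / parts ^ n)) = 1" .
  have words: "(\<Sum>G\<in>{..<n} \<rightarrow>\<^sub>E Q. \<integral>\<^sup>+y. ennreal (word_weight i j y G) \<partial>count_space (word_set (j - i))) \<le> ennreal b" for i j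
  proof -
    have "(\<Sum>G\<in>{..<n} \<rightarrow>\<^sub>E Q. \<integral>\<^sup>+y. ennreal (word_weight i j y G) \<partial>count_space (word_set (j - i))) =
        (\<integral>\<^sup>+y. (\<Sum>G\<in>{..<n} \<rightarrow>\<^sub>E Q. ennreal (word_weight i j y G)) \<partial>count_space (word_set (j - i)))"
      by (rule nn_integral_sum[symmetric]) simp
    also have "... \<le> (\<integral>\<^sup>+y. ennreal (exp (B / (1 - \<theta>))) * ennreal (exp (birkhoff f (j - i) y)) \<partial>count_space (word_set (j - i)))"
      by (intro nn_integral_mono sum_word_weight)
    also have "... \<le> ennreal (exp (B / (1 - \<theta>))) * ennreal (real (card F) * C)"
      by (subst nn_integral_cmult) (auto intro: mult_left_mono sum_word_set)
    also have "... = ennreal b" using C(1) by (simp add: b_def ennreal_mult)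
    finally show ?thesis .
  qed
  have "(\<Sum>G\<in>{..<n} \<rightarrow>\<^sub>E Q. \<Sum>i<n. \<Sum>j<n. \<integral>\<^sup>+y. ennreal (word_weight i j y G) \<partial>count_space (word_set (j - i))) =
      (\<Sum>i<n. \<Sum>j<n. \<Sum>G\<in>{..<n} \<rightarrow>\<^sub>E Q. \<integral>\<^sup>+y. ennreal (word_weight i j y G) \<partial>count_space (word_set (j - i)))"
    by (subst sum.swap) (intro sum.cong refl sum.swap)
  also have "... \<le> (\<Sum>i<n. \<Sum>j<n. ennreal b)" by (intro sum_mono words)
  also have "... = ennreal ((real n)\<^sup>2 * b)"
    using b by (simp add: ennreal_of_nat_eq_real_of_nat ennreal_mult[symmetric] power2_eq_square mult.assoc)
  finally have "(\<Sum>G\<in>{..<n} \<rightarrow>\<^sub>E Q. coding_weight G) \<le> 1 + ennreal ((real n)\<^sup>2 * b)"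
    unfolding coding_weight_def sum.distrib uniform by (rule add_left_mono)
  also have "... = ennreal (1 + (real n)\<^sup>2 * b)" using b by (subst ennreal_plus) auto
  also have "... \<le> ennreal ((1 + b) * (real n)\<^sup>2)"
    using n by (intro ennreal_leI) (simp add: distrib_right mult.commute)
  finally show ?thesis unfolding b_def .
qed

definition guess_error :: "(nat \<Rightarrow> 'a) \<Rightarrow> real" where
  "guess_error x = - ln (1 - \<delta>) + ln (parts / \<delta>) * indicator {x \<in> X. x \<notin> s x} x"

definition coding_cost :: "(nat \<Rightarrow> 'a) \<Rightarrow> real" where
  "coding_cost x = - birkhoff f n x + (K + ln parts) * (birkhoff (indicator {x \<in> X. x 0 \<notin> F}) n x + 1) +
    real l * ln parts + birkhoff guess_error n x"

lemma ln_parts_div_nonneg: "0 \<le> ln (parts / \<delta>)"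
  using parts_ge_1 \<delta> by (simp add: ln_ge_zero_iff pos_le_divide_eq)

lemma guess_error_nonneg: "0 \<le> guess_error x"
  unfolding guess_error_def using \<delta> ln_parts_div_nonneg by (intro add_nonneg_nonneg mult_nonneg_nonneg) auto

lemma coding_cost_integral:
  shows "integrable m coding_cost"
    and "(\<integral>x. coding_cost x \<partial>m) = - real n * (\<integral>x. f x \<partial>m) + (K + ln parts) * (real n * measure m {x \<in> X. x 0 \<notin> F} + 1) +
      real l * ln parts + real n * (- ln (1 - \<delta>) + ln (parts / \<delta>) * measure m {x \<in> X. x \<notin> s x})"
proof -
  have sets: "{x \<in> X. x 0 \<notin> F} \<in> sets m" using letter_set_in_sets[of "- F"] by simp
  have int: "integrable m (indicator {x \<in> X. x 0 \<notin> F} :: _ \<Rightarrow> real)" "integrable m (indicator {x \<in> X. x \<notin> s x} :: _ \<Rightarrow> real)"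
    using sets s(2) by (auto intro!: integrable_real_indicator simp: emeasure_eq_measure)
  have int_error: "integrable m guess_error" unfolding guess_error_def[abs_def] using int(2) by auto
  note birkhoff_int = integral_birkhoff(2)[OF f(3), of n] integral_birkhoff(2)[OF int(1), of n] integral_birkhoff(2)[OF int_error, of n]
  show "integrable m coding_cost" unfolding coding_cost_def[abs_def] using birkhoff_int by auto
  have inter: "{x \<in> X. R x} \<inter> X = {x \<in> X. R x}" for R by auto
  have "(\<integral>x. coding_cost x \<partial>m) = - (\<integral>x. birkhoff f n x \<partial>m) +
      (K + ln parts) * ((\<integral>x. birkhoff (indicator {x \<in> X. x 0 \<notin> F}) n x \<partial>m) + 1) + real l * ln parts + (\<integral>x. birkhoff guess_error n x \<partial>m)"
    unfolding coding_cost_def using birkhoff_int by (simp add: prob_space)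
  also have "... = - real n * (\<integral>x. f x \<partial>m) + (K + ln parts) * (real n * measure m {x \<in> X. x 0 \<notin> F} + 1) +
      real l * ln parts + real n * (- ln (1 - \<delta>) + ln (parts / \<delta>) * measure m {x \<in> X. x \<notin> s x})"
    unfolding integral_birkhoff(1)[OF f(3)] integral_birkhoff(1)[OF int(1)] integral_birkhoff(1)[OF int_error]
    using sets s(2) int(2) by (simp add: guess_error_def[abs_def] inter)
  finally show "(\<integral>x. coding_cost x \<partial>m) = ..." .
qed

lemma birkhoff_outside:
  assumes "x \<in> X"
  shows "birkhoff (indicator {x \<in> X. x 0 \<notin> F}) n x = real (card {k. k < n \<and> x k \<notin> F})"
proof -
  have "birkhoff (indicator {x \<in> X. x 0 \<notin> F}) n x = (\<Sum>k<n. if x k \<notin> F then 1 else 0)"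
    unfolding birkhoff_def using funpow_shift_in_sigma[OF assms]
    by (intro sum.cong refl) (auto simp: indicator_def, auto simp: funpow_shift)
  then show ?thesis by (simp add: sum.If_cases Int_def)
qed

lemma coding_cost_no_visit:
  assumes x: "x \<in> X" and none: "\<And>k. k < n \<Longrightarrow> x k \<notin> F"
  shows "exp (- coding_cost x) \<le> 1 / parts ^ n"
proof -
  have "{k. k < n \<and> x k \<notin> F} = {..<n}" using none by auto
  then have outside: "birkhoff (indicator {x \<in> X. x 0 \<notin> F}) n x = real n" using birkhoff_outside[OF x] by simp
  have "birkhoff f n x \<le> real n * K"
    unfolding birkhoff_def using f(4) x sum_bounded_above[of "{..<n}" "\<lambda>k. f ((shift ^^ k) x)" K] by auto
  moreover have "real n * K + real n * ln parts \<le> (K + ln parts) * (real n + 1)"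
    using f(5) ln_parts_nonneg by (simp add: algebra_simps)
  moreover have "0 \<le> real l * ln parts" using ln_parts_nonneg by simp
  moreover have "0 \<le> birkhoff guess_error n x" unfolding birkhoff_def by (intro sum_nonneg guess_error_nonneg)
  ultimately have "- coding_cost x \<le> - (real n * ln parts)" unfolding coding_cost_def outside by linarith
  then have "exp (- coding_cost x) \<le> exp (- (real n * ln parts))" by simp
  also have "... = 1 / parts ^ n" using parts_ge_1 by (simp add: exp_minus exp_of_nat_mult inverse_eq_divide)
  finally show ?thesis .
qed

context
  fixes x :: "nat \<Rightarrow> 'a" and I J :: nat
  assumes x: "x \<in> X" and IJ: "I \<le> J" "J < n" "x I \<in> F" "x J \<in> F"
    and visits: "\<And>k. k < n \<Longrightarrow> x k \<in> F \<Longrightarrow> I \<le> k \<and> k \<le> J"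
begin

definition completed_word :: "nat \<Rightarrow> 'a" where
  "completed_word = splice (J - I) ((shift ^^ I) x) (z (x J))"

lemma completed_word: "completed_word \<in> X" "agree (Suc (J - I)) ((shift ^^ I) x) completed_word"
    "completed_word \<in> word_set (J - I)"
proof -
  have last: "(shift ^^ I) x (J - I) = z (x J) 0" using IJ z[of "x J"] by (simp add: funpow_shift)
  then show mem: "completed_word \<in> X"
    unfolding completed_word_def using x z[of "x J"] by (intro splice_in_sigma) auto
  show agr: "agree (Suc (J - I)) ((shift ^^ I) x) completed_word"
    unfolding completed_word_def by (rule agree_Suc_splice) (rule last)
  have "completed_word 0 = x I" using agr[unfolded agree_def, rule_format, of 0] by (simp add: funpow_shift)
  then show "completed_word \<in> word_set (J - I)"
    using mem IJ by (auto simp: word_set_def completed_word_def)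
qed

lemma birkhoff_between_visits:
  "birkhoff f n x \<le> birkhoff f (J - I) ((shift ^^ I) x) + K * (real (card {k. k < n \<and> x k \<notin> F}) + 1)"
proof -
  define g where "g k = f ((shift ^^ k) x)" for k
  have "birkhoff f (J - I) ((shift ^^ I) x) = (\<Sum>k\<in>{0 + I..<J - I + I}. g k)"
    unfolding sum.shift_bounds_nat_ivl by (simp add: birkhoff_def g_def funpow_shift_add lessThan_atLeast0)
  then have inner: "birkhoff f (J - I) ((shift ^^ I) x) = (\<Sum>k\<in>{I..<J}. g k)" using IJ by simp
  have "birkhoff f n x = (\<Sum>k\<in>{I..<J}. g k) + (\<Sum>k\<in>{..<n} - {I..<J}. g k)"
    unfolding birkhoff_def g_def[symmetric] using IJ
    by (subst sum.subset_diff[of "{I..<J}" "{..<n}"]) (auto simp: add.commute)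
  moreover have "(\<Sum>k\<in>{..<n} - {I..<J}. g k) \<le> real (card ({..<n} - {I..<J})) * K"
    using f(4) x by (intro sum_bounded_above) (auto simp: g_def)
  moreover have "{..<n} - {I..<J} \<subseteq> insert J {k. k < n \<and> x k \<notin> F}"
    using visits by (auto simp: not_less) (meson antisym_conv linorder_not_le)+
  then have "card ({..<n} - {I..<J}) \<le> card (insert J {k. k < n \<and> x k \<notin> F})" by (intro card_mono) auto
  then have "real (card ({..<n} - {I..<J})) \<le> real (card {k. k < n \<and> x k \<notin> F}) + 1"
    by (simp add: card_insert_if split: if_splits)
  then have "real (card ({..<n} - {I..<J})) * K \<le> (real (card {k. k < n \<and> x k \<notin> F}) + 1) * K"
    using f(5) by (intro mult_right_mono) auto
  ultimately show ?thesis unfolding inner by (simp add: mult.commute)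
qed

definition unguessed :: "nat set" where
  "unguessed = {k. k < n \<and> \<not> (I \<le> k \<and> k + l \<le> J)}"

lemma card_unguessed: "real (card unguessed) \<le> real (card {k. k < n \<and> x k \<notin> F}) + real l"
proof -
  have "unguessed \<subseteq> {k. k < n \<and> x k \<notin> F} \<union> {Suc J - l..<Suc J}"
  proof
    fix k assume "k \<in> unguessed"
    then show "k \<in> {k. k < n \<and> x k \<notin> F} \<union> {Suc J - l..<Suc J}"
      using visits[of k] by (cases "x k \<in> F") (auto simp: unguessed_def)
  qed
  then have "card unguessed \<le> card ({k. k < n \<and> x k \<notin> F} \<union> {Suc J - l..<Suc J})" by (intro card_mono) auto
  also have "... \<le> card {k. k < n \<and> x k \<notin> F} + card {Suc J - l..<Suc J}" by (rule card_Un_le)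
  finally show ?thesis by simp
qed

lemma symbol_weight_ge:
  assumes k: "k < n"
  shows "exp (- (guess_error ((shift ^^ k) x) + (if k \<in> unguessed then ln parts else 0))) \<le>
    symbol_weight I J completed_word k (part_of Q ((shift ^^ k) x))"
proof (cases "k \<in> unguessed")
  case True
  then have "symbol_weight I J completed_word k (part_of Q ((shift ^^ k) x)) = 1 / parts"
    by (auto simp: symbol_weight_def unguessed_def)
  also have "1 / parts = exp (- ln parts)" using parts_ge_1 by (simp add: exp_minus inverse_eq_divide)
  finally show ?thesis using True guess_error_nonneg[of "(shift ^^ k) x"] by simp
next
  case False
  then have kIJ: "I \<le> k" "k + l \<le> J" using k by (auto simp: unguessed_def)
  define v where "v = (shift ^^ k) x"
  have v: "v \<in> X" "v \<in> part_of Q v" "part_of Q v \<in> Q" using x part_of_mem[OF Q] by (auto simp: v_def)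
  have "v = (shift ^^ (k - I)) ((shift ^^ I) x)" using kIJ by (simp add: v_def funpow_shift_add)
  then have "agree (Suc (J - I) - (k - I)) v ((shift ^^ (k - I)) completed_word)"
    using agree_funpow_shift[OF completed_word(2)] by simp
  then have "agree l v ((shift ^^ (k - I)) completed_word)" by (rule agree_mono) (use kIJ in simp)
  then have "s ((shift ^^ (k - I)) completed_word) = s v"
    using s(1)[OF v(1) funpow_shift_in_sigma[OF completed_word(1)]] by simp
  then have eq: "symbol_weight I J completed_word k (part_of Q v) = guess_weight (s v) (part_of Q v)"
    using kIJ by (simp add: symbol_weight_def)
  have "exp (- guess_error v) \<le> guess_weight (s v) (part_of Q v)"
  proof (cases "v \<in> s v")
    case True
    then have "part_of Q v = s v" using part_of_eq[OF Q s(3)] by blast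
    then show ?thesis using True \<delta> by (simp add: guess_weight_def guess_error_def)
  next
    case False
    then have "part_of Q v \<noteq> s v" using v(2) by auto
    moreover have "exp (- guess_error v) \<le> exp (- ln (parts / \<delta>))" using \<delta> False v(1) by (simp add: guess_error_def)
    moreover have "exp (- ln (parts / \<delta>)) = \<delta> / parts" using parts_ge_1 \<delta> by (simp add: exp_minus)
    ultimately show ?thesis by (simp add: guess_weight_def)
  qed
  then show ?thesis using False eq by (simp add: v_def)
qed

lemma exp_coding_cost_le_word_weight: "exp (- coding_cost x) \<le> word_weight I J completed_word (itinerary Q n x)"
proof -
  let ?v = "\<lambda>k. (shift ^^ k) x" and ?d = "J - I" and ?outside = "real (card {k. k < n \<and> x k \<notin> F})"
  have "{..<n} \<inter> unguessed = unguessed" by (auto simp: unguessed_def)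
  then have "(\<Sum>k<n. guess_error (?v k) + (if k \<in> unguessed then ln parts else 0)) =
      birkhoff guess_error n x + ln parts * real (card unguessed)"
    by (simp add: birkhoff_def sum.distrib sum.If_cases)
  then have "exp (- (birkhoff guess_error n x + ln parts * real (card unguessed))) =
      (\<Prod>k<n. exp (- (guess_error (?v k) + (if k \<in> unguessed then ln parts else 0))))"
    by (simp only: exp_sum[symmetric] finite_lessThan sum_negf)
  also have "... \<le> (\<Prod>k<n. symbol_weight I J completed_word k (itinerary Q n x k))"
    using symbol_weight_ge by (intro prod_mono) (auto simp: itinerary_def)
  finally have symbols: "exp (- (birkhoff guess_error n x + ln parts * real (card unguessed))) \<le>
    (\<Prod>k<n. symbol_weight I J completed_word k (itinerary Q n x k))" .
  have "birkhoff f ?d (?v I) \<le> B / (1 - \<theta>) + birkhoff f ?d completed_word"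
    using wholder_birkhoff[OF f(1,2) funpow_shift_in_sigma[OF x] completed_word(1,2)] by linarith
  moreover have "ln parts * real (card unguessed) \<le> ln parts * (?outside + real l)"
    using card_unguessed ln_parts_nonneg by (intro mult_left_mono) auto
  ultimately have "- coding_cost x \<le> B / (1 - \<theta>) + birkhoff f ?d completed_word +
      (- (birkhoff guess_error n x + ln parts * real (card unguessed)))"
    using birkhoff_between_visits ln_parts_nonneg unfolding coding_cost_def birkhoff_outside[OF x]
    by (simp add: algebra_simps)
  then have "exp (- coding_cost x) \<le> exp (B / (1 - \<theta>) + birkhoff f ?d completed_word +
      (- (birkhoff guess_error n x + ln parts * real (card unguessed))))" by simp
  also have "... = exp (B / (1 - \<theta>)) * exp (birkhoff f ?d completed_word) *
      exp (- (birkhoff guess_error n x + ln parts * real (card unguessed)))" by (simp only: exp_add)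
  also have "... \<le> word_weight I J completed_word (itinerary Q n x)"
    unfolding word_weight_def using symbols by (intro mult_left_mono) auto
  finally show ?thesis .
qed

end

lemma exp_coding_cost_le_coding_weight:
  assumes x: "x \<in> X"
  shows "ennreal (exp (- coding_cost x)) \<le> coding_weight (itinerary Q n x)"
proof (cases "\<exists>k<n. x k \<in> F")
  case False
  then have "ennreal (exp (- coding_cost x)) \<le> ennreal (1 / parts ^ n)"
    using coding_cost_no_visit[OF x] by (intro ennreal_leI) auto
  also have "... \<le> coding_weight (itinerary Q n x)" by (simp add: coding_weight_def)
  finally show ?thesis .
next
  case True
  define V where "V = {k. k < n \<and> x k \<in> F}"
  define I J where "I = Min V" and "J = Max V"
  have V: "finite V" "V \<noteq> {}" using True by (auto simp: V_def)
  then have "I \<in> V" "J \<in> V" by (auto simp: I_def J_def)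
  then have IJ: "I \<le> J" "J < n" "x I \<in> F" "x J \<in> F" using V by (auto simp: V_def I_def)
  have visits: "I \<le> k \<and> k \<le> J" if "k < n" "x k \<in> F" for k
    using that V(1) by (auto simp: I_def J_def V_def)
  let ?w = "\<lambda>i j. \<integral>\<^sup>+y. ennreal (word_weight i j y (itinerary Q n x)) \<partial>count_space (word_set (j - i))"
  have "ennreal (exp (- coding_cost x)) \<le> ennreal (word_weight I J (completed_word x I J) (itinerary Q n x))"
    using exp_coding_cost_le_word_weight[OF x IJ visits] by (rule ennreal_leI)
  also have "... \<le> ?w I J" using completed_word(3)[OF x IJ visits] by (rule nn_integral_ge_point)
  also have "... \<le> (\<Sum>j<n. ?w I j)" using IJ by (intro member_le_sum[of J]) auto
  also have "... \<le> (\<Sum>i<n. \<Sum>j<n. ?w i j)" using IJ by (intro member_le_sum[of I "{..<n}" "\<lambda>i. \<Sum>j<n. ?w i j"]) auto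
  also have "... \<le> coding_weight (itinerary Q n x)" by (simp add: coding_weight_def)
  finally show ?thesis .
qed

lemma simple_entropy_itinerary_le:
  "simple_entropy (itinerary Q n) \<le> - real n * (\<integral>x. f x \<partial>m) +
    (K + ln parts) * (real n * measure m {x \<in> X. x 0 \<notin> F} + 1) + real l * ln parts +
    real n * (- ln (1 - \<delta>) + ln (parts / \<delta>) * measure m {x \<in> X. x \<notin> s x}) +
    ln ((1 + exp (B / (1 - \<theta>)) * (real (card F) * C)) * (real n)\<^sup>2)"
  unfolding coding_cost_integral(2)[symmetric]
proof (rule simple_entropy_le_cost[OF simple_function_itinerary[OF Q] coding_cost_integral(1)])
  let ?Z = "(1 + exp (B / (1 - \<theta>)) * (real (card F) * C)) * (real n)\<^sup>2" and ?q = "\<lambda>G. enn2real (coding_weight G)"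
  show Z: "0 < ?Z" using C(1) n by (intro mult_pos_pos add_pos_nonneg) auto
  have fin: "coding_weight G \<noteq> top" if "G \<in> {..<n} \<rightarrow>\<^sub>E Q" for G
  proof -
    have "coding_weight G \<le> (\<Sum>G\<in>{..<n} \<rightarrow>\<^sub>E Q. coding_weight G)"
      using that finite_itineraries[OF Q] by (intro member_le_sum) auto
    then show ?thesis using sum_coding_weight by (auto simp: top_unique)
  qed
  show "exp (- coding_cost x) \<le> ?q (itinerary Q n x)" if "x \<in> space m" for x
    using that enn2real_mono[OF exp_coding_cost_le_coding_weight] fin[OF itinerary_in_PiE[OF Q]]
    by (simp add: less_top)
  have "(\<Sum>G\<in>itinerary Q n ` space m. ?q G) \<le> (\<Sum>G\<in>{..<n} \<rightarrow>\<^sub>E Q. ?q G)"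
    using itinerary_in_PiE[OF Q] by (intro sum_mono2 finite_itineraries[OF Q]) auto
  also have "ennreal (\<Sum>G\<in>{..<n} \<rightarrow>\<^sub>E Q. ?q G) = (\<Sum>G\<in>{..<n} \<rightarrow>\<^sub>E Q. coding_weight G)"
    using fin by (subst sum_ennreal[symmetric]) (auto intro!: sum.cong simp: less_top)
  then have "(\<Sum>G\<in>{..<n} \<rightarrow>\<^sub>E Q. ?q G) \<le> ?Z" using sum_coding_weight Z by (metis ennreal_le_iff less_imp_le)
  finally show "(\<Sum>G\<in>itinerary Q n ` space m. ?q G) \<le> ?Z" .
qed

end

lemma entropy_wrt_le_coding:
  assumes Q: "finite_partition m Q" and f: "wholder B f" "0 \<le> B" "integrable m f" "\<And>x. x \<in> X \<Longrightarrow> f x \<le> K" "0 \<le> K"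
    and H: "regular_superharmonic f H" and F: "finite F"
    and s: "\<And>x y. x \<in> X \<Longrightarrow> y \<in> X \<Longrightarrow> agree l x y \<Longrightarrow> s x = s y" "{x \<in> X. x \<notin> s x} \<in> sets m" "\<And>x. s x \<in> Q"
    and \<delta>: "0 < \<delta>" "\<delta> < 1"
  shows "entropy_wrt m Q \<le> - (\<integral>x. f x \<partial>m) + (K + ln (real (card Q))) * measure m {x \<in> X. x 0 \<notin> F} +
    (- ln (1 - \<delta>) + ln (real (card Q) / \<delta>) * measure m {x \<in> X. x \<notin> s x})" (is "_ \<le> ?A")
proof -
  obtain C where C: "0 \<le> C" "\<And>n z. z \<in> X \<Longrightarrow> z 0 \<in> F \<Longrightarrow> (ruelle E f UNIV ^^ n) (starts_in F) z \<le> ennreal C"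
    using ruelle_funpow_starts_in_bounded[OF H F] by blast
  have "\<forall>c. \<exists>z. z \<in> cyl c" using cyl_nonempty by blast
  then obtain z where z: "\<And>c. z c \<in> cyl c" by metis
  have bounded: "(ruelle E f UNIV ^^ k) (starts_in F) (z c) \<le> ennreal C" if "c \<in> F" for k c
    using C(2)[of "z c" k] z[of c] that by auto
  define p where "p = real (card Q)"
  define c where "c = 1 + exp (B / (1 - \<theta>)) * (real (card F) * C)"
  have c: "c > 0" unfolding c_def using C(1) by (intro add_pos_nonneg) auto
  define b where "b = (K + ln p) + real l * ln p + ln c"
  have "simple_entropy (itinerary Q n) / real n \<le> ?A + b / real n + 2 * (ln (real n) / real n)" if n: "n \<ge> 1" for n
  proof -
    have "simple_entropy (itinerary Q n) \<le> - real n * (\<integral>x. f x \<partial>m) +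
        (K + ln p) * (real n * measure m {x \<in> X. x 0 \<notin> F} + 1) + real l * ln p +
        real n * (- ln (1 - \<delta>) + ln (p / \<delta>) * measure m {x \<in> X. x \<notin> s x}) + ln (c * (real n)\<^sup>2)"
      unfolding c_def p_def by (rule simple_entropy_itinerary_le[OF Q n f(1-3)]; fact)
    also have "ln (c * (real n)\<^sup>2) = ln c + 2 * ln (real n)"
      using c n by (simp add: ln_mult_pos ln_realpow)
    finally have "simple_entropy (itinerary Q n) \<le> real n * ?A + b + 2 * ln (real n)"
      unfolding b_def p_def by (simp add: algebra_simps)
    then have "simple_entropy (itinerary Q n) / real n \<le> (real n * ?A + b + 2 * ln (real n)) / real n"
      by (rule divide_right_mono) simp
    also have "... = ?A + b / real n + 2 * (ln (real n) / real n)" using n by (simp add: add_divide_distrib)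
    finally show ?thesis .
  qed
  moreover have "(\<lambda>n. ?A + b / real n + 2 * (ln (real n) / real n)) \<longlonglongrightarrow> ?A + 0 + 2 * 0"
    by (intro tendsto_intros lim_const_over_n lim_ln_over_n)
  ultimately have "entropy_wrt m Q \<le> ?A + 0 + 2 * 0"
    by (intro LIMSEQ_le[OF entropy_wrt_LIMSEQ[OF Q]]) auto
  then show ?thesis by simp
qed

theorem variational_upper_bound:
  assumes Q: "finite_partition m Q" and f: "wholder B f" "0 \<le> B" "integrable m f" "\<And>x. x \<in> X \<Longrightarrow> f x \<le> K" "0 \<le> K"
    and H: "regular_superharmonic f H"
  shows "entropy_wrt m Q + (\<integral>x. f x \<partial>m) \<le> 0"
proof (rule field_le_epsilon)
  fix \<epsilon> :: real assume \<epsilon>: "\<epsilon> > 0"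
  have small: "\<exists>t>0. \<forall>u. u \<le> t \<longrightarrow> c * u \<le> \<epsilon> / 3" if "0 \<le> c" for c :: real
  proof (intro exI conjI allI impI)
    show "0 < \<epsilon> / (3 * (c + 1))" using \<epsilon> that by simp
    fix u assume "u \<le> \<epsilon> / (3 * (c + 1))"
    then have "c * u \<le> c * (\<epsilon> / (3 * (c + 1)))" using that by (rule mult_left_mono)
    also have "... \<le> \<epsilon> / 3" using \<epsilon> that by (simp add: field_simps)
    finally show "c * u \<le> \<epsilon> / 3" .
  qed
  have p: "1 \<le> real (card Q)" by (rule card_partition_ge_1[OF Q])
  define \<delta> where "\<delta> = 1 - exp (- \<epsilon> / 3)"
  have \<delta>: "0 < \<delta>" "\<delta> < 1" "- ln (1 - \<delta>) = \<epsilon> / 3" using \<epsilon> by (auto simp: \<delta>_def)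
  obtain t where t: "t > 0" "\<And>u. u \<le> t \<Longrightarrow> (K + ln (real (card Q))) * u \<le> \<epsilon> / 3"
    using small[of "K + ln (real (card Q))"] p f(5) by auto
  obtain F where F: "finite F" "measure m {x \<in> X. x 0 \<notin> F} \<le> t" using finite_letters_approx[OF t(1)] .
  have "1 \<le> real (card Q) / \<delta>" using p \<delta> by (simp add: pos_le_divide_eq)
  then obtain t' where t': "t' > 0" "\<And>u. u \<le> t' \<Longrightarrow> ln (real (card Q) / \<delta>) * u \<le> \<epsilon> / 3"
    using small[of "ln (real (card Q) / \<delta>)"] by auto
  obtain l s where s: "\<And>x y. x \<in> X \<Longrightarrow> y \<in> X \<Longrightarrow> agree l x y \<Longrightarrow> s x = s y" "{x \<in> X. x \<notin> s x} \<in> sets m"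
      "\<And>x. s x \<in> Q" "measure m {x \<in> X. x \<notin> s x} \<le> t'"
    by (rule approx_partition[OF Q t'(1)]) (rule that; assumption)
  have "entropy_wrt m Q \<le> - (\<integral>x. f x \<partial>m) + (K + ln (real (card Q))) * measure m {x \<in> X. x 0 \<notin> F} +
      (- ln (1 - \<delta>) + ln (real (card Q) / \<delta>) * measure m {x \<in> X. x \<notin> s x})"
    by (rule entropy_wrt_le_coding[OF Q f(1-3)]; fact)
  then show "entropy_wrt m Q + (\<integral>x. f x \<partial>m) \<le> 0 + \<epsilon>"
    using t(2)[OF F(2)] t'(2)[OF s(4)] \<delta>(3) by linarith
qed

end

section \<open>The variational lower bound\<close>

lemma ext_integral_integrable:
  assumes "integrable M f" shows "ext_integral M f = ereal (\<integral>x. f x \<partial>M)"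
proof -
  have p: "(\<integral>\<^sup>+x. ennreal (f x) \<partial>M) = ennreal (\<integral>x. max 0 (f x) \<partial>M)"
    using assms by (subst nn_integral_eq_integral[symmetric]) (auto simp: ennreal_max_0 intro!: nn_integral_cong)
  have n: "(\<integral>\<^sup>+x. ennreal (- f x) \<partial>M) = ennreal (\<integral>x. max 0 (- f x) \<partial>M)"
    using assms by (subst nn_integral_eq_integral[symmetric]) (auto simp: ennreal_max_0 intro!: nn_integral_cong)
  have "(\<integral>x. f x \<partial>M) = (\<integral>x. max 0 (f x) - max 0 (- f x) \<partial>M)" by (rule Bochner_Integration.integral_cong) auto
  also have "... = (\<integral>x. max 0 (f x) \<partial>M) - (\<integral>x. max 0 (- f x) \<partial>M)" using assms by (intro Bochner_Integration.integral_diff) auto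
  finally show ?thesis unfolding ext_integral_def p n by (simp add: enn2ereal_ennreal)
qed

text \<open>Bernoulli measures over finitely many periodic points of the same period \<open>L\<close>, viewed as
  blocks, with all \<open>L\<close> starting phases averaged.\<close>

locale block_bernoulli = markov_shift E \<theta> for E :: "'a::countable \<Rightarrow> 'a \<Rightarrow> bool" and \<theta> +
  fixes a :: 'a and L :: nat and blocks :: "(nat \<Rightarrow> 'a) set" and w :: "(nat \<Rightarrow> 'a) \<Rightarrow> real"
  assumes L: "L \<ge> 1" and blocks: "finite blocks" "blocks \<subseteq> {x \<in> sigma_plus E. (shift ^^ L) x = x \<and> x 0 = a}"
    and w: "\<And>x. x \<in> blocks \<Longrightarrow> 0 < w x" "(\<Sum>x\<in>blocks. w x) = 1"
begin

abbreviation block_distr :: "(nat \<Rightarrow> 'a) measure" where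
  "block_distr \<equiv> point_measure blocks (\<lambda>x. ennreal (w x))"

definition block_seq :: "(nat \<Rightarrow> nat \<Rightarrow> 'a) measure" where
  "block_seq = PiM UNIV (\<lambda>_. block_distr)"

lemma prob_block_distr: "prob_space block_distr"
proof (rule prob_space_point_measure)
  have "(\<Sum>x\<in>blocks. ennreal (w x)) = ennreal (\<Sum>x\<in>blocks. w x)"
    using w(1) by (intro sum_ennreal) (auto intro: less_imp_le)
  then show "(\<Sum>x\<in>blocks. ennreal (w x)) = 1" using w(2) by simp
qed (use blocks in auto)

sublocale blocks: product_prob_space "\<lambda>_::nat. block_distr" UNIV
proof -
  interpret prob_space block_distr by (rule prob_block_distr)
  show "product_prob_space (\<lambda>_::nat. block_distr)" by unfold_locales
qed

sublocale seq: prob_space block_seq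
  unfolding block_seq_def by (rule prob_space_PiM) (rule prob_block_distr)

lemma space_block_seq: "y \<in> space block_seq \<longleftrightarrow> (\<forall>j. y j \<in> blocks)"
  by (auto simp: block_seq_def space_PiM PiE_iff space_point_measure)

lemma blockD:
  assumes "x \<in> blocks" shows "x \<in> X" "(shift ^^ L) x = x" "x 0 = a" "x L = a"
proof -
  show "x \<in> X" "(shift ^^ L) x = x" "x 0 = a" using assms blocks by auto
  then have "(shift ^^ L) x 0 = a" by simp
  then show "x L = a" by (simp add: funpow_shift)
qed

definition concatenation :: "(nat \<Rightarrow> nat \<Rightarrow> 'a) \<Rightarrow> nat \<Rightarrow> 'a" where
  "concatenation y = (\<lambda>i. y (i div L) (i mod L))"

lemma concatenation_in_X:
  assumes y: "y \<in> space block_seq" shows "concatenation y \<in> X"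
proof -
  have "E (concatenation y i) (concatenation y (Suc i))" for i
  proof -
    have yi: "y (i div L) \<in> blocks" "y (Suc (i div L)) \<in> blocks" using y space_block_seq by auto
    have step: "E (y (i div L) (i mod L)) (y (i div L) (Suc (i mod L)))"
      using blockD(1)[OF yi(1)] by (simp add: sigma_plus_def)
    show ?thesis
    proof (cases "Suc (i mod L) = L")
      case True
      then have "Suc i mod L = 0" "Suc i div L = Suc (i div L)" by (auto simp: mod_Suc div_Suc)
      then show ?thesis using step True blockD(4)[OF yi(1)] blockD(3)[OF yi(2)] by (simp add: concatenation_def)
    next
      case False
      then have "Suc i mod L = Suc (i mod L)" "Suc i div L = i div L" by (auto simp: mod_Suc div_Suc)
      then show ?thesis using step by (simp add: concatenation_def)
    qed
  qed
  then show ?thesis by (simp add: sigma_plus_def)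
qed

lemma agree_concatenation:
  assumes y: "y \<in> space block_seq" shows "agree (Suc L) (concatenation y) (y 0)"
  unfolding agree_def
proof (intro allI impI)
  fix i assume i: "i < Suc L"
  have y_blocks: "y 0 \<in> blocks" "y 1 \<in> blocks" using y space_block_seq by auto
  show "concatenation y i = y 0 i"
    using L i blockD(4)[OF y_blocks(1)] blockD(3)[OF y_blocks(2)] by (cases "i = L") (auto simp: concatenation_def)
qed

lemma shift_concatenation: "(shift ^^ L) (concatenation y) = concatenation (\<lambda>j. y (Suc j))"
  using L by (simp add: concatenation_def funpow_shift)

lemma measurable_component: "(\<lambda>y. g (y j)) \<in> measurable block_seq (count_space UNIV)" for g :: "(nat \<Rightarrow> 'a) \<Rightarrow> 'b"
proof -
  have "(\<lambda>y. y j) \<in> measurable block_seq block_distr"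
    unfolding block_seq_def by (rule measurable_component_singleton) simp
  moreover have "g \<in> measurable block_distr (count_space UNIV)"
    by (auto simp: measurable_def sets_point_measure space_point_measure)
  ultimately show ?thesis by (rule measurable_compose)
qed

lemma component_set_in_sets: "{y \<in> space block_seq. g (y j) \<in> A} \<in> sets block_seq" for g :: "(nat \<Rightarrow> 'a) \<Rightarrow> 'b"
  using measurable_sets[OF measurable_component[of g j], of A] by (simp add: vimage_def Int_def conj_commute)

lemma concatenation_measurable [measurable]: "concatenation \<in> measurable block_seq (shift_space E)"
proof (rule measurable_to_shift_space)
  fix n and v :: "nat \<Rightarrow> 'a"
  have "{y \<in> space block_seq. \<forall>i\<in>{..<n}. y (i div L) (i mod L) = v i} \<in> sets block_seq"
    using component_set_in_sets[of "\<lambda>x. x (_ mod L)" _ "{v _}"] by (intro sets.sets_Collect_finite_All) auto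
  then show "{y \<in> space block_seq. \<forall>i<n. concatenation y i = v i} \<in> sets block_seq"
    unfolding concatenation_def Ball_def lessThan_iff .
qed (rule concatenation_in_X)

definition orbit :: "nat \<Rightarrow> (nat \<Rightarrow> nat \<Rightarrow> 'a) \<Rightarrow> nat \<Rightarrow> 'a" where
  "orbit k y = (shift ^^ k) (concatenation y)"

lemma orbit_measurable [measurable]: "orbit k \<in> measurable block_seq (shift_space E)"
  unfolding orbit_def[abs_def] by measurable

lemma orbit_in_X: "y \<in> space block_seq \<Longrightarrow> orbit k y \<in> X"
  unfolding orbit_def using concatenation_in_X by auto

definition phased :: "(nat \<times> (nat \<Rightarrow> nat \<Rightarrow> 'a)) measure" where
  "phased = measure_pmf (pmf_of_set {..<L}) \<Otimes>\<^sub>M block_seq"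

text \<open>The phase is reduced modulo \<open>L\<close> because the space of \<open>phased\<close> contains all natural numbers
  as first components.\<close>

definition stationary :: "(nat \<Rightarrow> 'a) measure" where
  "stationary = distr phased (shift_space E) (\<lambda>p. orbit (fst p mod L) (snd p))"

lemma phases_nonempty: "{..<L} \<noteq> {}"
  using L by (simp add: lessThan_empty_iff)

lemma orbit_phased_measurable [measurable]:
  "(\<lambda>p. orbit (fst p mod L) (snd p)) \<in> measurable phased (shift_space E)"
proof -
  have "(\<lambda>p. orbit (fst p mod L) (snd p)) \<in> measurable (count_space UNIV \<Otimes>\<^sub>M block_seq) (shift_space E)"
    by (rule measurable_compose_countable'[where I=UNIV and g=fst and f="\<lambda>k p. orbit (k mod L) (snd p)"])
      (auto intro: measurable_compose[OF measurable_snd])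
  moreover have "sets phased = sets (count_space UNIV \<Otimes>\<^sub>M block_seq)"
    unfolding phased_def by (intro sets_pair_measure_cong) auto
  ultimately show ?thesis by (simp cong: measurable_cong_sets)
qed

interpretation phased: pair_prob_space "measure_pmf (pmf_of_set {..<L})" block_seq
  by unfold_locales

lemma prob_phased: "prob_space phased"
  unfolding phased_def by (rule phased.prob_space_axioms)

lemma prob_stationary: "prob_space stationary"
  unfolding stationary_def by (rule prob_space.prob_space_distr[OF prob_phased]) measurable

lemma sets_stationary [simp]: "sets stationary = sets (shift_space E)"
  by (simp add: stationary_def)

lemma space_stationary [simp]: "space stationary = X"
  by (simp add: stationary_def)

lemma emeasure_stationary:
  assumes A: "A \<in> sets (shift_space E)"
  shows "emeasure stationary A = (\<Sum>k<L. emeasure block_seq (orbit k -` A \<inter> space block_seq)) / of_nat L"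
proof -
  let ?A = "(\<lambda>p. orbit (fst p mod L) (snd p)) -` A \<inter> space phased"
  have meas: "?A \<in> sets phased" using A by measurable
  have "emeasure stationary A = emeasure phased ?A"
    unfolding stationary_def using A by (intro emeasure_distr) auto
  also have "... = (\<integral>\<^sup>+k. emeasure block_seq (Pair k -` ?A) \<partial>measure_pmf (pmf_of_set {..<L}))"
    using meas unfolding phased_def by (intro seq.emeasure_pair_measure_alt)
  also have "... = (\<Sum>k<L. emeasure block_seq (Pair k -` ?A)) / of_nat L"
    using nn_integral_pmf_of_set[OF phases_nonempty, of "\<lambda>k. emeasure block_seq (Pair k -` ?A)"]
    by (simp add: ennreal_of_nat_eq_real_of_nat)
  also have "(\<Sum>k<L. emeasure block_seq (Pair k -` ?A)) = (\<Sum>k<L. emeasure block_seq (orbit k -` A \<inter> space block_seq))"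
    by (intro sum.cong refl arg_cong[where f="emeasure block_seq"]) (auto simp: phased_def space_pair_measure)
  finally show ?thesis .
qed

lemma measure_stationary:
  assumes A: "A \<in> sets (shift_space E)"
  shows "real L * measure stationary A = (\<Sum>k<L. measure block_seq (orbit k -` A \<inter> space block_seq))"
proof -
  have "ennreal (measure stationary A) = (\<Sum>k<L. ennreal (measure block_seq (orbit k -` A \<inter> space block_seq))) / ennreal (real L)"
    using emeasure_stationary[OF A] finite_measure.emeasure_eq_measure[OF prob_space.finite_measure[OF prob_stationary]]
    by (simp add: ennreal_of_nat_eq_real_of_nat seq.emeasure_eq_measure)
  also have "... = ennreal ((\<Sum>k<L. measure block_seq (orbit k -` A \<inter> space block_seq)) / real L)"
    using L by (simp add: sum_ennreal divide_ennreal sum_nonneg)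
  finally show ?thesis using L by (simp add: sum_nonneg)
qed

lemma distr_block_seq_shift: "distr block_seq block_seq (\<lambda>y j. y (Suc j)) = block_seq"
  unfolding block_seq_def
  using distr_PiM_reindex[of UNIV "\<lambda>_::nat. block_distr" Suc UNIV, OF prob_block_distr] by (simp add: restrict_UNIV)

lemma emeasure_orbit_L:
  assumes A: "A \<in> sets (shift_space E)"
  shows "emeasure block_seq (orbit L -` A \<inter> space block_seq) = emeasure block_seq (orbit 0 -` A \<inter> space block_seq)"
proof -
  have m: "(\<lambda>y j. y (Suc j)) \<in> measurable block_seq block_seq"
    unfolding block_seq_def by (rule measurable_PiM_single') (auto simp: space_PiM PiE_iff)
  have "orbit 0 -` A \<inter> space block_seq \<in> sets block_seq" using A by measurable
  then have "emeasure (distr block_seq block_seq (\<lambda>y j. y (Suc j))) (orbit 0 -` A \<inter> space block_seq) =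
      emeasure block_seq ((\<lambda>y j. y (Suc j)) -` (orbit 0 -` A \<inter> space block_seq) \<inter> space block_seq)"
    by (rule emeasure_distr[OF m])
  also have "(\<lambda>y j. y (Suc j)) -` (orbit 0 -` A \<inter> space block_seq) \<inter> space block_seq = orbit L -` A \<inter> space block_seq"
    by (auto simp: orbit_def shift_concatenation space_block_seq)
  finally show ?thesis by (simp add: distr_block_seq_shift)
qed

lemma invariant_stationary: "invariant_prob E stationary"
  unfolding invariant_prob_def
proof (intro conjI ballI)
  fix A assume "A \<in> sets stationary"
  then have A: "A \<in> sets (shift_space E)" by simp
  then have shift_A: "shift -` A \<inter> X \<in> sets (shift_space E)"
    using measurable_sets[OF measurable_shift A] by simp
  define e where "e k = emeasure block_seq (orbit k -` A \<inter> space block_seq)" for k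
  have "orbit k -` (shift -` A \<inter> X) \<inter> space block_seq = orbit (Suc k) -` A \<inter> space block_seq" for k
    using orbit_in_X by (auto simp: orbit_def)
  moreover have "(\<Sum>k<L. e (Suc k)) = (\<Sum>k<L. e k)"
  proof -
    have "e 0 + (\<Sum>k<L. e (Suc k)) = e 0 + (\<Sum>k<L. e k)"
      using sum.lessThan_Suc_shift[of e L] emeasure_orbit_L[OF A] by (simp add: e_def add.commute)
    moreover have "e 0 \<noteq> top" by (simp add: e_def)
    ultimately show ?thesis by (simp add: ennreal_add_left_cancel)
  qed
  ultimately show "emeasure stationary (shift -` A \<inter> space stationary) = emeasure stationary A"
    unfolding space_stationary emeasure_stationary[OF A] emeasure_stationary[OF shift_A] e_def by simp
qed (use prob_stationary in auto)

sublocale stationary: invariant_shift E stationary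
  by unfold_locales (rule invariant_stationary)

lemma integral_component:
  fixes g :: "(nat \<Rightarrow> 'a) \<Rightarrow> real"
  shows "integrable block_seq (\<lambda>y. g (y j))" "(\<integral>y. g (y j) \<partial>block_seq) = (\<Sum>x\<in>blocks. w x * g x)"
proof -
  have "(\<lambda>y. g (y j)) \<in> borel_measurable block_seq"
    by (rule measurable_compose[OF measurable_component[of g j], of id, simplified]) simp
  moreover have "AE y in block_seq. norm (g (y j)) \<le> (\<Sum>x\<in>blocks. \<bar>g x\<bar>)"
    using blocks(1) space_block_seq by (intro AE_I2) (auto intro: member_le_sum)
  ultimately show "integrable block_seq (\<lambda>y. g (y j))" by (intro seq.integrable_const_bound)
  have "(\<integral>x. g x \<partial>block_distr) = (\<integral>x. g x \<partial>distr block_seq block_distr (\<lambda>y. y j))"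
    unfolding block_seq_def by (subst distr_PiM_component) (auto simp: prob_block_distr)
  also have "... = (\<integral>y. g (y j) \<partial>block_seq)"
  proof (rule integral_distr)
    show "(\<lambda>y. y j) \<in> measurable block_seq block_distr"
      unfolding block_seq_def by (rule measurable_component_singleton) simp
    show "g \<in> borel_measurable block_distr" by (auto simp: measurable_def sets_point_measure space_point_measure)
  qed
  finally show "(\<integral>y. g (y j) \<partial>block_seq) = (\<Sum>x\<in>blocks. w x * g x)"
    using blocks w(1) by (simp add: lebesgue_integral_point_measure_finite less_imp_le)
qed

context
  fixes f B assumes f: "wholder B f" "0 \<le> B"
begin

lemma orbit_bounded: "\<exists>K. \<forall>y\<in>space block_seq. \<forall>k<L. \<bar>f (orbit k y)\<bar> \<le> K"
proof (intro exI ballI allI impI)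
  fix y k assume y: "y \<in> space block_seq" and k: "k < L"
  have y0: "y 0 \<in> blocks" using y space_block_seq by auto
  have "agree (Suc L - k) (orbit k y) ((shift ^^ k) (y 0))"
    unfolding orbit_def by (rule agree_funpow_shift[OF agree_concatenation[OF y]])
  then have "agree 2 (orbit k y) ((shift ^^ k) (y 0))" by (rule agree_mono) (use k in simp)
  then have "\<bar>f (orbit k y) - f ((shift ^^ k) (y 0))\<bar> \<le> B * \<theta> ^ 2"
    using f(1)[unfolded wholder_def, rule_format, of 2] orbit_in_X[OF y] blockD(1)[OF y0] funpow_shift_in_sigma by blast
  also have "... \<le> B" using theta_pow(2)[of 2] f(2) by (rule mult_left_le)
  finally have "\<bar>f (orbit k y)\<bar> \<le> B + \<bar>f ((shift ^^ k) (y 0))\<bar>" by linarith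
  also have "\<bar>f ((shift ^^ k) (y 0))\<bar> \<le> (\<Sum>k<L. \<bar>f ((shift ^^ k) (y 0))\<bar>)" using k by (intro member_le_sum) auto
  also have "... \<le> (\<Sum>x\<in>blocks. \<Sum>k<L. \<bar>f ((shift ^^ k) x)\<bar>)"
    using y0 blocks(1) by (intro member_le_sum[of _ _ "\<lambda>x. \<Sum>k<L. \<bar>f ((shift ^^ k) x)\<bar>"]) (auto intro: sum_nonneg)
  finally show "\<bar>f (orbit k y)\<bar> \<le> B + (\<Sum>x\<in>blocks. \<Sum>k<L. \<bar>f ((shift ^^ k) x)\<bar>)" by simp
qed

lemma integrable_orbit:
  shows "integrable phased (\<lambda>p. f (orbit (fst p mod L) (snd p)))" "k < L \<Longrightarrow> integrable block_seq (\<lambda>y. f (orbit k y))"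
proof -
  have [measurable]: "f \<in> borel_measurable (shift_space E)" by (rule wholder_measurable[OF f(1)])
  obtain K where K: "\<And>y k. y \<in> space block_seq \<Longrightarrow> k < L \<Longrightarrow> \<bar>f (orbit k y)\<bar> \<le> K" using orbit_bounded by blast
  have "norm (f (orbit (fst p mod L) (snd p))) \<le> K" if "p \<in> space phased" for p
    using that K[of "snd p" "fst p mod L"] L by (auto simp: phased_def space_pair_measure)
  then show "integrable phased (\<lambda>p. f (orbit (fst p mod L) (snd p)))"
    by (intro finite_measure.integrable_const_bound[OF prob_space.finite_measure[OF prob_phased], of _ K])
      (auto intro: AE_I2)
  show "integrable block_seq (\<lambda>y. f (orbit k y))" if "k < L"
    using K that by (intro seq.integrable_const_bound[of _ K]) (auto intro: AE_I2)
qed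

lemma integrable_stationary: "integrable stationary f"
proof -
  have [measurable]: "f \<in> borel_measurable (shift_space E)" by (rule wholder_measurable[OF f(1)])
  show ?thesis unfolding stationary_def using integrable_orbit(1) by (subst integrable_distr_eq) auto
qed

lemma integral_stationary: "real L * (\<integral>x. f x \<partial>stationary) = (\<integral>y. birkhoff f L (concatenation y) \<partial>block_seq)"
proof -
  have [measurable]: "f \<in> borel_measurable (shift_space E)" by (rule wholder_measurable[OF f(1)])
  have "(\<integral>x. f x \<partial>stationary) = (\<integral>p. f (orbit (fst p mod L) (snd p)) \<partial>phased)"
    unfolding stationary_def by (subst integral_distr) auto
  also have "... = (\<integral>k. (\<integral>y. f (orbit (k mod L) y) \<partial>block_seq) \<partial>measure_pmf (pmf_of_set {..<L}))"
    using phased.integral_fst'[of "\<lambda>p. f (orbit (fst p mod L) (snd p))"] integrable_orbit(1) by (simp add: phased_def)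
  also have "... = (\<Sum>k<L. (\<integral>y. f (orbit k y) \<partial>block_seq)) / real L"
    using integral_pmf_of_set[OF phases_nonempty, of "\<lambda>k. (\<integral>y. f (orbit (k mod L) y) \<partial>block_seq)"] by simp
  also have "(\<Sum>k<L. (\<integral>y. f (orbit k y) \<partial>block_seq)) = (\<integral>y. birkhoff f L (concatenation y) \<partial>block_seq)"
    unfolding birkhoff_def orbit_def[symmetric] using integrable_orbit(2)
    by (subst Bochner_Integration.integral_sum) auto
  finally show ?thesis using L by simp
qed

lemma integral_stationary_ge:
  "(\<Sum>x\<in>blocks. w x * birkhoff f L x) - B / (1 - \<theta>) \<le> real L * (\<integral>x. f x \<partial>stationary)"
proof -
  have "(\<Sum>x\<in>blocks. w x * birkhoff f L x) - B / (1 - \<theta>) = (\<integral>y. birkhoff f L (y 0) - B / (1 - \<theta>) \<partial>block_seq)"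
    using integral_component[of "birkhoff f L" 0] by (simp add: seq.prob_space)
  also have "... \<le> (\<integral>y. birkhoff f L (concatenation y) \<partial>block_seq)"
  proof (rule integral_mono)
    show "integrable block_seq (\<lambda>y. birkhoff f L (y 0) - B / (1 - \<theta>))"
      using integral_component(1)[of "birkhoff f L" 0] by auto
    show "integrable block_seq (\<lambda>y. birkhoff f L (concatenation y))"
      unfolding birkhoff_def orbit_def[symmetric] using integrable_orbit(2) by auto
    fix y assume y: "y \<in> space block_seq"
    then have "\<bar>birkhoff f L (concatenation y) - birkhoff f L (y 0)\<bar> \<le> B / (1 - \<theta>)"
      using space_block_seq blockD(1) by (intro wholder_birkhoff[OF f concatenation_in_X _ agree_concatenation]) auto
    then show "birkhoff f L (y 0) - B / (1 - \<theta>) \<le> birkhoff f L (concatenation y)" by linarith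
  qed
  finally show ?thesis using integral_stationary by simp
qed

end

definition letters :: "'a set" where
  "letters = (\<lambda>(x, i). x i) ` (blocks \<times> {..<L})"

definition letter_partition :: "(nat \<Rightarrow> 'a) set set" where
  "letter_partition = insert {x \<in> X. x 0 \<notin> letters} (cyl ` letters)"

lemma letter_partition: "finite_partition stationary letter_partition"
proof -
  have "finite letters" using blocks(1) by (simp add: letters_def)
  moreover have "{x \<in> X. x 0 \<in> S} \<in> sets (shift_space E)" for S
    by (rule finitely_determined_in_sets[of 1]) (simp add: agree_def)
  from this[of "- letters"] this[of "{c}" for c] have "letter_partition \<subseteq> sets (shift_space E)"
    by (auto simp: letter_partition_def)
  ultimately show ?thesis
    by (auto simp: finite_partition_def letter_partition_def disjoint_def)
qed

lemma part_of_orbit: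
  assumes "y \<in> space block_seq"
  shows "part_of letter_partition (orbit k y) = cyl (concatenation y k)"
proof (rule stationary.part_of_eq[OF letter_partition])
  have "concatenation y k \<in> letters" using assms L space_block_seq by (force simp: concatenation_def letters_def)
  then show "cyl (concatenation y k) \<in> letter_partition" by (simp add: letter_partition_def)
  show "orbit k y \<in> cyl (concatenation y k)" using orbit_in_X[OF assms] by (simp add: orbit_def funpow_shift)
qed

lemma itinerary_orbit_eqD:
  assumes eq: "itinerary letter_partition n (orbit k y) = itinerary letter_partition n (orbit k y')"
    and y: "y \<in> space block_seq" "y' \<in> space block_seq" and i: "k \<le> i" "i < n + k"
  shows "concatenation y i = concatenation y' i"
proof -
  have "(shift ^^ (i - k)) (orbit k v) = orbit i v" for v using i by (simp add: orbit_def funpow_shift_add)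
  then have "part_of letter_partition (orbit i y) = part_of letter_partition (orbit i y')"
    using eq i unfolding itinerary_eq_iff by (metis less_diff_conv2)
  then have "cyl (concatenation y i) = cyl (concatenation y' i)" using part_of_orbit y by simp
  moreover obtain z where z: "z \<in> cyl (concatenation y i)" using cyl_nonempty by blast
  ultimately have "z \<in> cyl (concatenation y' i)" by simp
  then show ?thesis using z by simp
qed

lemma simple_function_itinerary_orbit: "simple_function block_seq (\<lambda>y. itinerary letter_partition n (orbit k y))"
proof -
  have "orbit k \<in> measurable block_seq stationary"
    using measurable_cong_sets[OF refl sets_stationary] orbit_measurable by blast
  from simple_function_comp[OF this stationary.simple_function_itinerary[OF letter_partition]]
  show ?thesis by (simp add: comp_def)
qed

lemma prob_itinerary_orbit_le:
  assumes k: "k < L" and y: "y \<in> space block_seq"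
  shows "measure block_seq ((\<lambda>y. itinerary letter_partition (q * L) (orbit k y)) -`
      {itinerary letter_partition (q * L) (orbit k y)} \<inter> space block_seq) \<le> (\<Prod>j\<in>{1..<q}. w (y j))"
    (is "measure block_seq ?A \<le> _")
proof -
  let ?S = "{y' \<in> space block_seq. \<forall>j\<in>{1..<q}. y' j \<in> {y j}}"
  have sub: "?A \<subseteq> ?S"
  proof
    fix y' assume "y' \<in> ?A"
    then have y': "y' \<in> space block_seq"
      "itinerary letter_partition (q * L) (orbit k y') = itinerary letter_partition (q * L) (orbit k y)" by auto
    have "y' j = y j" if j: "j \<in> {1..<q}" for j
    proof (rule periodic_eqI[of L])
      have "concatenation y' (j * L + i) = concatenation y (j * L + i)" if i: "i < L" for i
      proof (rule itinerary_orbit_eqD[OF y'(2,1) y])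
        have "1 * L \<le> j * L" using j by (intro mult_right_mono) auto
        then show "k \<le> j * L + i" using k by linarith
        have "Suc j * L \<le> q * L" using j by (intro mult_right_mono) auto
        then show "j * L + i < q * L + k" using i by simp
      qed
      then show "agree L (y' j) (y j)" by (simp add: concatenation_def agree_def)
    qed (use L y y' space_block_seq blockD(2) in auto)
    then show "y' \<in> ?S" using y'(1) by simp
  qed
  have S: "?S \<in> sets block_seq"
    using component_set_in_sets[of "\<lambda>x. x" _ "{y _}"] by (intro sets.sets_Collect_finite_All) auto
  have yj: "y j \<in> blocks" for j using y space_block_seq by auto
  have "emeasure block_seq ?S = (\<Prod>j\<in>{1..<q}. emeasure block_distr {y j})"
    unfolding block_seq_def using yj by (intro blocks.emeasure_PiM_Collect) (auto simp: sets_point_measure)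
  also have "... = (\<Prod>j\<in>{1..<q}. ennreal (w (y j)))"
    using yj blocks(1) by (intro prod.cong refl) (simp add: emeasure_point_measure_finite)
  also have "... = ennreal (\<Prod>j\<in>{1..<q}. w (y j))" using w(1) yj by (intro prod_ennreal) (auto intro: less_imp_le)
  finally have "emeasure block_seq ?A \<le> ennreal (\<Prod>j\<in>{1..<q}. w (y j))" using emeasure_mono[OF sub S] by simp
  then show ?thesis using w(1) yj by (simp add: seq.emeasure_eq_measure prod_nonneg less_imp_le)
qed

definition block_entropy :: real where
  "block_entropy = - (\<Sum>x\<in>blocks. w x * ln (w x))"

lemma block_entropy_nonneg: "0 \<le> block_entropy"
proof -
  have "w x \<le> 1" if "x \<in> blocks" for x
    using member_le_sum[OF that _ blocks(1), of w] w by (auto intro: less_imp_le)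
  then have "(\<Sum>x\<in>blocks. w x * ln (w x)) \<le> 0" using w(1) by (intro sum_nonpos mult_nonneg_nonpos) (auto intro: less_imp_le)
  then show ?thesis by (simp add: block_entropy_def)
qed

lemma simple_entropy_orbit_ge:
  assumes k: "k < L"
  shows "(real q - 1) * block_entropy \<le> seq.simple_entropy (\<lambda>y. itinerary letter_partition (q * L) (orbit k y))"
proof -
  define W where "W y = (\<Sum>j\<in>{1..<q}. - ln (w (y j)))" for y :: "nat \<Rightarrow> nat \<Rightarrow> 'a"
  have W: "integrable block_seq W"
    unfolding W_def[abs_def] by (intro Bochner_Integration.integrable_sum integral_component(1)[of "\<lambda>x. - ln (w x)"])
  have "(\<integral>y. W y \<partial>block_seq) = real (q - 1) * block_entropy"
    unfolding W_def using integral_component[of "\<lambda>x. - ln (w x)"]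
    by (subst Bochner_Integration.integral_sum) (simp_all add: block_entropy_def sum_negf)
  then have "(real q - 1) * block_entropy \<le> (\<integral>y. W y \<partial>block_seq)"
    using block_entropy_nonneg by (auto intro!: mult_right_mono)
  also have "... \<le> seq.simple_entropy (\<lambda>y. itinerary letter_partition (q * L) (orbit k y))"
  proof (rule seq.simple_entropy_ge[OF simple_function_itinerary_orbit W])
    fix y assume y: "y \<in> space block_seq"
    have "exp (- W y) = (\<Prod>j\<in>{1..<q}. exp (ln (w (y j))))" unfolding W_def by (simp add: sum_negf exp_sum)
    also have "... = (\<Prod>j\<in>{1..<q}. w (y j))" using w(1) y space_block_seq by (intro prod.cong refl) auto
    finally show "measure block_seq ((\<lambda>y. itinerary letter_partition (q * L) (orbit k y)) -`
        {itinerary letter_partition (q * L) (orbit k y)} \<inter> space block_seq) \<le> exp (- W y)"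
      using prob_itinerary_orbit_le[OF k y] by simp
  qed
  finally show ?thesis .
qed

lemma simple_entropy_stationary_ge:
  "(real q - 1) * block_entropy \<le> stationary.simple_entropy (itinerary letter_partition (q * L))"
proof -
  define I where "I = ({..<q * L} \<rightarrow>\<^sub>E letter_partition)"
  let ?it = "itinerary letter_partition (q * L)"
  have I: "finite I" "\<And>x. x \<in> X \<Longrightarrow> ?it x \<in> I"
    using stationary.finite_itineraries[OF letter_partition] stationary.itinerary_in_PiE[OF letter_partition]
    by (auto simp: I_def)
  then have image: "(\<lambda>y. ?it (orbit k y)) ` space block_seq \<subseteq> I" "?it ` space stationary \<subseteq> I" for k
    using orbit_in_X by auto
  define p where "p k F = measure block_seq ((\<lambda>y. ?it (orbit k y)) -` {F} \<inter> space block_seq)" for k F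
  define r where "r F = measure stationary (?it -` {F} \<inter> space stationary)" for F
  have p_sum: "(\<Sum>F\<in>I. p k F) = 1" for k
    unfolding p_def by (rule seq.sum_prob_fibres[OF simple_function_itinerary_orbit I(1) image(1)])
  have "real L * r F = (\<Sum>k<L. p k F)" for F
  proof -
    have "orbit k -` (?it -` {F} \<inter> X) \<inter> space block_seq = (\<lambda>y. ?it (orbit k y)) -` {F} \<inter> space block_seq" for k
      using orbit_in_X by auto
    then show ?thesis
      using measure_stationary[of "?it -` {F} \<inter> X"]
        simple_functionD(2)[OF stationary.simple_function_itinerary[OF letter_partition, of "q * L"], of "{F}"]
      by (simp add: r_def p_def)
  qed
  then have "(\<Sum>k<L. - (\<Sum>F\<in>I. p k F * ln (p k F))) \<le> real L * - (\<Sum>F\<in>I. r F * ln (r F))"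
    using L p_sum by (intro entropy_concave) (auto simp: p_def)
  moreover have "- (\<Sum>F\<in>I. p k F * ln (p k F)) = seq.simple_entropy (\<lambda>y. ?it (orbit k y))" for k
    unfolding p_def by (rule seq.simple_entropy_eq_superset[OF simple_function_itinerary_orbit I(1) image(1), symmetric])
  moreover have "- (\<Sum>F\<in>I. r F * ln (r F)) = stationary.simple_entropy ?it"
    unfolding r_def
    by (rule stationary.simple_entropy_eq_superset[OF stationary.simple_function_itinerary[OF letter_partition] I(1) image(2), symmetric])
  moreover have "(\<Sum>k<L. (real q - 1) * block_entropy) \<le> (\<Sum>k<L. seq.simple_entropy (\<lambda>y. ?it (orbit k y)))"
    by (intro sum_mono simple_entropy_orbit_ge) auto
  ultimately have "real L * ((real q - 1) * block_entropy) \<le> real L * stationary.simple_entropy ?it" by simp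
  then show ?thesis using L by simp
qed

lemma block_entropy_le: "block_entropy / real L \<le> entropy_wrt stationary letter_partition"
proof -
  let ?H = "\<lambda>q. stationary.simple_entropy (itinerary letter_partition (q * L))"
  have "strict_mono (\<lambda>q. q * L)" using L by (auto simp: strict_mono_def)
  then have lim: "(\<lambda>q. ?H q / real (q * L)) \<longlonglongrightarrow> entropy_wrt stationary letter_partition"
    using LIMSEQ_subseq_LIMSEQ[OF stationary.entropy_wrt_LIMSEQ[OF letter_partition], of "\<lambda>q. q * L"]
    unfolding comp_def by blast
  have "(\<lambda>q. block_entropy / real L - block_entropy / real L * (1 / real q)) \<longlonglongrightarrow> block_entropy / real L - block_entropy / real L * 0"
    by (intro tendsto_intros lim_const_over_n)
  moreover have "block_entropy / real L - block_entropy / real L * (1 / real q) \<le> ?H q / real (q * L)" if q: "q \<ge> 1" for q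
  proof -
    have "block_entropy / real L - block_entropy / real L * (1 / real q) = (real q - 1) * block_entropy / real (q * L)"
      using q L by (simp add: field_simps)
    also have "... \<le> ?H q / real (q * L)" by (intro divide_right_mono simple_entropy_stationary_ge) auto
    finally show ?thesis .
  qed
  ultimately have "block_entropy / real L - block_entropy / real L * 0 \<le> entropy_wrt stationary letter_partition"
    by (intro LIMSEQ_le[OF _ lim]) auto
  then show ?thesis by simp
qed

lemma block_free_energy_le:
  assumes f: "wholder B f" "0 \<le> B"
  shows "ereal (((\<Sum>x\<in>blocks. w x * birkhoff f L x) + block_entropy - B / (1 - \<theta>)) / real L) \<le>
    ks_entropy stationary + ext_integral stationary f"
proof -
  have "((\<Sum>x\<in>blocks. w x * birkhoff f L x) + block_entropy - B / (1 - \<theta>)) / real L \<le>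
      (block_entropy + real L * (\<integral>x. f x \<partial>stationary)) / real L"
    using integral_stationary_ge[OF f] by (intro divide_right_mono) auto
  also have "... = block_entropy / real L + (\<integral>x. f x \<partial>stationary)" using L by (simp add: add_divide_distrib)
  also have "... \<le> entropy_wrt stationary letter_partition + (\<integral>x. f x \<partial>stationary)"
    using block_entropy_le by simp
  finally have "ereal (((\<Sum>x\<in>blocks. w x * birkhoff f L x) + block_entropy - B / (1 - \<theta>)) / real L) \<le>
      ereal (entropy_wrt stationary letter_partition) + ereal (\<integral>x. f x \<partial>stationary)" by simp
  also have "ereal (entropy_wrt stationary letter_partition) \<le> ks_entropy stationary"
    unfolding ks_entropy_def by (rule SUP_upper) (simp add: letter_partition)
  finally show ?thesis
    unfolding ext_integral_integrable[OF integrable_stationary[OF f]] by (simp add: add_right_mono)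
qed

end

context markov_shift
begin

theorem variational_lower_bound:
  assumes f: "wholder B f" "0 \<le> B" and q: "ereal q < gurevich_pressure E f a" and \<epsilon>: "\<epsilon> > 0"
  shows "\<exists>\<nu>. invariant_prob E \<nu> \<and> ereal (q - \<epsilon>) \<le> ks_entropy \<nu> + ext_integral \<nu> f"
proof -
  define D where "D = B / (1 - \<theta>)"
  obtain N :: nat where N: "real N > D / \<epsilon>" using reals_Archimedean2 by blast
  obtain L where period: "L \<ge> N" "L \<ge> 1" "ennreal (exp (real L * q)) < Zn E f a L"
    using limsup_eln_frequently[OF q[unfolded gurevich_pressure_def], of N] by blast
  have "Zn E f a L = (SUP F\<in>{F. finite F \<and> F \<subseteq> {x \<in> X. (shift ^^ L) x = x \<and> x 0 = a}}. (\<Sum>x\<in>F. ennreal (exp (birkhoff f L x))))"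
    unfolding Zn_def by (rule nonneg_infsum_complete) simp
  then obtain blocks where blocks: "finite blocks" "blocks \<subseteq> {x \<in> X. (shift ^^ L) x = x \<and> x 0 = a}"
    "ennreal (exp (real L * q)) < (\<Sum>x\<in>blocks. ennreal (exp (birkhoff f L x)))"
    using period(3) by (auto simp: less_SUP_iff)
  define S where "S = (\<Sum>x\<in>blocks. exp (birkhoff f L x))"
  have S: "exp (real L * q) < S" using blocks(3) by (simp add: S_def sum_ennreal ennreal_less_iff)
  then have S0: "0 < S" by (meson exp_gt_zero less_trans)
  define w where "w x = exp (birkhoff f L x) / S" for x
  interpret block_bernoulli E \<theta> a L blocks w
    by unfold_locales (use period blocks S0 in \<open>auto simp: w_def S_def sum_divide_distrib[symmetric]\<close>)
  have "w x * birkhoff f L x - w x * ln (w x) = w x * ln S" for x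
    using S0 by (simp add: w_def ln_divide_pos right_diff_distrib)
  then have "(\<Sum>x\<in>blocks. w x * birkhoff f L x) + block_entropy = ln S"
    using w(2) by (simp add: block_entropy_def sum_subtractf[symmetric] sum_distrib_right[symmetric])
  moreover have "real L * q \<le> ln S" using S S0 by (subst ln_ge_iff) auto
  ultimately have "(real L * q - D) / real L \<le>
      ((\<Sum>x\<in>blocks. w x * birkhoff f L x) + block_entropy - B / (1 - \<theta>)) / real L"
    unfolding D_def by (intro divide_right_mono) auto
  moreover have "q - \<epsilon> \<le> (real L * q - D) / real L"
  proof -
    have "D / \<epsilon> < real L" using N period(1) by linarith
    then show ?thesis using \<epsilon> period(2) by (simp add: field_simps)
  qed
  ultimately have "ereal (q - \<epsilon>) \<le> ks_entropy stationary + ext_integral stationary f"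
    by (intro order_trans[OF _ block_free_energy_le[OF f]]) simp
  then show ?thesis using invariant_stationary by blast
qed

end

section \<open>Equilibrium measures are invariant under the normalised transfer operator\<close>

lemma shift_measure_eqI:
  fixes E :: "'a::countable \<Rightarrow> 'a \<Rightarrow> bool"
  assumes sets: "sets M = sets (shift_space E)" "sets N = sets (shift_space E)" and fin: "emeasure M (sigma_plus E) \<noteq> \<infinity>"
    and eq: "\<And>n w. emeasure M {x \<in> sigma_plus E. \<forall>i<n. x i = w i} = emeasure N {x \<in> sigma_plus E. \<forall>i<n. x i = w i}"
  shows "M = N"
proof -
  define G where "G = insert {} {{x \<in> sigma_plus E. \<forall>i<n. x i = w i} |n w. True}"
  have "Int_stable G"
  proof (rule Int_stableI)
    fix A A' assume A: "A \<in> G" "A' \<in> G"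
    show "A \<inter> A' \<in> G"
    proof (cases "A \<inter> A' = {}")
      case False
      then obtain x where x: "x \<in> A" "x \<in> A'" by blast
      obtain n w where w: "A = {x \<in> sigma_plus E. \<forall>i<n. x i = w i}" using A x by (auto simp: G_def)
      obtain n' w' where w': "A' = {x \<in> sigma_plus E. \<forall>i<n'. x i = w' i}" using A x by (auto simp: G_def)
      have "A \<inter> A' = {y \<in> sigma_plus E. \<forall>i<max n n'. y i = x i}"
        using x unfolding w w' by (auto simp: less_max_iff_disj)
      then show ?thesis unfolding G_def by blast
    qed (simp add: G_def)
  qed
  moreover have "sets (shift_space E) = sigma_sets (sigma_plus E) G"
  proof -
    have "sets (shift_space E) = sigma_sets (sigma_plus E) {{x \<in> sigma_plus E. \<forall>i<n. x i = w i} |n w. True}"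
      unfolding shift_space_def by (subst sets_measure_of) auto
    also have "... = sigma_sets (sigma_plus E) G"
      unfolding G_def by (intro sigma_sets_eqI) (auto intro: sigma_sets.intros)
    finally show ?thesis .
  qed
  moreover have "{x \<in> sigma_plus E. \<forall>i<0. x i = undefined i} \<in> G" unfolding G_def by blast
  ultimately show ?thesis
    using fin eq sets by (intro measure_eqI_generator_eq[where E=G and A="\<lambda>_. sigma_plus E" and \<Omega>="sigma_plus E"]) (auto simp: G_def)
qed

lemma (in markov_shift) ruelle_cohomologous:
  assumes k: "\<And>x. x \<in> X \<Longrightarrow> 0 < k x" and k': "\<And>x. x \<in> X \<Longrightarrow> 0 < k' x" and x: "x \<in> X"
  shows "ruelle E (\<lambda>x. f x + ln (k x) + - ln (k' (shift x))) S u x =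
    ennreal (1 / k' x) * ruelle E f S (\<lambda>y. ennreal (k y) * u y) x"
proof -
  have "ennreal (exp (f y + ln (k y) + - ln (k' (shift y)))) * u y =
      ennreal (1 / k' x) * (ennreal (exp (f y)) * (ennreal (k y) * u y))"
    if b: "E b (x 0)" and y: "y = case_nat b x" for b y
  proof -
    have pos: "0 < k y" "0 < k' x" using k k' x b unfolding y by auto
    have "exp (f y + ln (k y) + - ln (k' (shift y))) = 1 / k' x * (exp (f y) * k y)"
      using pos by (simp add: y exp_add exp_minus exp_diff field_simps)
    then have "ennreal (exp (f y + ln (k y) + - ln (k' (shift y)))) = ennreal (1 / k' x) * (ennreal (exp (f y)) * ennreal (k y))"
      using pos by (simp only:, subst ennreal_mult) (auto simp: ennreal_mult less_imp_le)
    then show ?thesis by (simp add: ac_simps)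
  qed
  then show ?thesis unfolding ruelle_def
    by (subst nn_integral_cmult[symmetric]) (auto intro!: nn_integral_cong)
qed

locale equilibrium_shift = spr_shift E \<theta> \<phi> a B P + markov_measure E \<theta> m
  for E :: "'a::countable \<Rightarrow> 'a \<Rightarrow> bool" and \<theta> \<phi> a B P m +
  assumes eqm: "equilibrium_measure E \<phi> m" and fin_ent: "\<exists>c. gurevich_pressure E (\<lambda>_. 0) c < \<infinity>"
    and supfin: "bdd_above (\<phi> ` sigma_plus E)"
begin

lemma entropy_bounded: "\<exists>c. ks_entropy m \<le> ereal c"
proof -
  obtain c where "gurevich_pressure E (\<lambda>_. 0) c < \<infinity>" using fin_ent by blast
  then obtain g H where H: "0 \<le> g" "regular_superharmonic (\<lambda>_. - g) H"
    by (rule finite_entropy_regular_superharmonic)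
  have "entropy_wrt m Q \<le> g" if "finite_partition m Q" for Q
    using variational_upper_bound[OF that wholder_const order_refl _ _ order_refl H(2)] H(1) by (simp add: prob_space)
  then have "ks_entropy m \<le> ereal g" unfolding ks_entropy_def by (intro SUP_least) auto
  then show ?thesis by blast
qed

lemma pressure_le: "ereal P \<le> ks_entropy m + ext_integral m \<phi>"
proof (rule ereal_le_epsilon2)
  fix \<epsilon> :: real assume \<epsilon>: "\<epsilon> > 0"
  have "ereal (P - \<epsilon> / 2) < gurevich_pressure E \<phi> a" using press \<epsilon> by simp
  then obtain \<nu> where "invariant_prob E \<nu>" "ereal (P - \<epsilon> / 2 - \<epsilon> / 2) \<le> ks_entropy \<nu> + ext_integral \<nu> \<phi>"
    using variational_lower_bound[OF phi, of "P - \<epsilon> / 2" a "\<epsilon> / 2"] \<epsilon> by auto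
  then have "ereal (P - \<epsilon>) \<le> ks_entropy m + ext_integral m \<phi>"
    using eqm unfolding equilibrium_measure_def by (auto intro: order_trans)
  then have "ereal (P - \<epsilon>) + ereal \<epsilon> \<le> ks_entropy m + ext_integral m \<phi> + ereal \<epsilon>" by (rule add_right_mono)
  then show "ereal P \<le> ks_entropy m + ext_integral m \<phi> + ereal \<epsilon>" by simp
qed

lemma phi_bounded_above: "\<exists>K\<ge>0. \<forall>x\<in>X. \<phi> x \<le> K"
proof -
  obtain K where "\<And>x. x \<in> X \<Longrightarrow> \<phi> x \<le> K" using supfin by (auto simp: bdd_above_def)
  then show ?thesis by (intro exI[of _ "max 0 K"]) (simp add: le_max_iff_disj)
qed

lemma phi_integrable: "integrable m \<phi>"
proof -
  have [measurable]: "\<phi> \<in> borel_measurable m"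
    unfolding measurable_m by (rule wholder_measurable[OF phi(1)])
  obtain K where K: "0 \<le> K" "\<And>x. x \<in> X \<Longrightarrow> \<phi> x \<le> K" using phi_bounded_above by blast
  have "(\<integral>\<^sup>+x. ennreal (\<phi> x) \<partial>m) \<le> (\<integral>\<^sup>+x. ennreal K \<partial>m)" using K by (intro nn_integral_mono ennreal_leI) auto
  also have "... < top" using emeasure_space_1 by simp
  finally have pos: "(\<integral>\<^sup>+x. ennreal (\<phi> x) \<partial>m) < top" .
  have neg: "(\<integral>\<^sup>+x. ennreal (- \<phi> x) \<partial>m) \<noteq> top"
  proof
    assume "(\<integral>\<^sup>+x. ennreal (- \<phi> x) \<partial>m) = top"
    moreover obtain r where "(\<integral>\<^sup>+x. ennreal (\<phi> x) \<partial>m) = ennreal r" "0 \<le> r"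
      using pos by (metis ennreal_cases less_irrefl)
    ultimately have "ext_integral m \<phi> = - \<infinity>" by (simp add: ext_integral_def enn2ereal_ennreal)
    then have eq: "ks_entropy m + ext_integral m \<phi> = - \<infinity>"
      using entropy_bounded by (cases "ks_entropy m") auto
    show False using pressure_le unfolding eq by simp
  qed
  show ?thesis by (rule real_integrable_def[THEN iffD2]) (use pos neg in auto)
qed

lemma equilibrium_inequality:
  assumes f: "wholder C f" "0 \<le> C" "integrable m f" "\<And>x. x \<in> X \<Longrightarrow> f x \<le> K" "0 \<le> K"
    and H: "regular_superharmonic f H"
  shows "P + (\<integral>x. f x \<partial>m) \<le> (\<integral>x. \<phi> x \<partial>m)"
proof -
  have "ks_entropy m \<le> ereal (- (\<integral>x. f x \<partial>m))"
    unfolding ks_entropy_def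
  proof (rule SUP_least)
    fix Q assume "Q \<in> {Q. finite_partition m Q}"
    then have "entropy_wrt m Q + (\<integral>x. f x \<partial>m) \<le> 0" by (intro variational_upper_bound[OF _ f H]) auto
    then show "ereal (entropy_wrt m Q) \<le> ereal (- (\<integral>x. f x \<partial>m))" by simp
  qed
  then have "ereal P \<le> ereal (- (\<integral>x. f x \<partial>m)) + ereal (\<integral>x. \<phi> x \<partial>m)"
    using pressure_le unfolding ext_integral_integrable[OF phi_integrable] by (meson add_right_mono order_trans)
  then show ?thesis by simp
qed

end

locale normalised_shift = equilibrium_shift E \<theta> \<phi> a B P m
  for E :: "'a::countable \<Rightarrow> 'a \<Rightarrow> bool" and \<theta> \<phi> a B P m +
  fixes h :: "(nat \<Rightarrow> 'a) \<Rightarrow> real"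
  assumes h_pos: "\<And>x. x \<in> sigma_plus E \<Longrightarrow> h x > 0"
    and log_lip_h: "log_lip X (invariant_const B) (\<lambda>x. ennreal (h x))"
    and ruelle_h: "\<And>x. x \<in> sigma_plus E \<Longrightarrow> ruelle E \<phi>\<^sub>0 UNIV (\<lambda>x. ennreal (h x)) x = ennreal (h x)"
    and induced_h: "\<And>x. x \<in> sigma_plus E \<Longrightarrow> induced \<phi>\<^sub>0 a (\<lambda>x. ennreal (h x)) x = ennreal (h x)"
begin

definition log_g :: "(nat \<Rightarrow> 'a) \<Rightarrow> real" where
  "log_g x = \<phi>\<^sub>0 x + ln (h x) + - ln (h (shift x))"

definition log_g_const :: real where
  "log_g_const = B + invariant_const B + invariant_const B / \<theta>"

lemma log_g_const_nonneg: "0 \<le> log_g_const"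
  using phi(2) invariant_const_nonneg[OF phi(2)] theta by (simp add: log_g_const_def)

lemma wholder_log_g: "wholder log_g_const log_g"
  unfolding log_g_def[abs_def] log_g_const_def
  by (intro wholder_add wholder_phi0 wholder_ln[OF log_lip_h h_pos] wholder_ln_shift[OF log_lip_h h_pos])

abbreviation T :: "((nat \<Rightarrow> 'a) \<Rightarrow> ennreal) \<Rightarrow> (nat \<Rightarrow> 'a) \<Rightarrow> ennreal" where "T \<equiv> ruelle E log_g UNIV"
abbreviation T_in :: "((nat \<Rightarrow> 'a) \<Rightarrow> ennreal) \<Rightarrow> (nat \<Rightarrow> 'a) \<Rightarrow> ennreal" where "T_in \<equiv> ruelle E log_g {a}"
abbreviation T_out :: "((nat \<Rightarrow> 'a) \<Rightarrow> ennreal) \<Rightarrow> (nat \<Rightarrow> 'a) \<Rightarrow> ennreal" where "T_out \<equiv> ruelle E log_g (- {a})"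

lemma h_inverse: "x \<in> X \<Longrightarrow> ennreal (h x) * ennreal (1 / h x) = 1"
  using h_pos[of x] by (subst ennreal_mult[symmetric]) (auto intro: less_imp_le)

lemma ruelle_log_g: "x \<in> X \<Longrightarrow> ruelle E log_g S u x = ennreal (1 / h x) * ruelle E \<phi>\<^sub>0 S (\<lambda>y. ennreal (h y) * u y) x"
  unfolding log_g_def[abs_def] by (rule ruelle_cohomologous) (use h_pos in auto)

lemma h_mult_ruelle_log_g:
  "x \<in> X \<Longrightarrow> ennreal (h x) * ruelle E log_g S u x = ruelle E \<phi>\<^sub>0 S (\<lambda>y. ennreal (h y) * u y) x"
  by (simp add: ruelle_log_g mult.assoc[symmetric] h_inverse)

lemma T_1: "x \<in> X \<Longrightarrow> T (\<lambda>_. 1) x = 1"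
  using ruelle_log_g[of x UNIV "\<lambda>_. 1"] ruelle_h[of x] h_inverse[of x] by (simp add: mult.commute)

lemma excursion_weight_log_g:
  assumes x: "x \<in> X"
  shows "excursion_weight log_g a u k x = ennreal (1 / h x) * excursion_weight \<phi>\<^sub>0 a (\<lambda>y. ennreal (h y) * u y) k x"
proof -
  have "ennreal (h x) * (T_out ^^ k) v x = (ruelle E \<phi>\<^sub>0 (- {a}) ^^ k) (\<lambda>y. ennreal (h y) * v y) x" if "x \<in> X" for v x
    using that
  proof (induction k arbitrary: x)
    case (Suc k)
    have "ennreal (h x) * T_out ((T_out ^^ k) v) x = ruelle E \<phi>\<^sub>0 (- {a}) (\<lambda>y. ennreal (h y) * (T_out ^^ k) v y) x"
      by (rule h_mult_ruelle_log_g[OF Suc.prems])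
    also have "... = ruelle E \<phi>\<^sub>0 (- {a}) ((ruelle E \<phi>\<^sub>0 (- {a}) ^^ k) (\<lambda>y. ennreal (h y) * v y)) x"
      using Suc by (intro ruelle_cong) auto
    finally show ?case by simp
  qed simp
  then have "ennreal (h x) * excursion_weight log_g a u k x =
      (ruelle E \<phi>\<^sub>0 (- {a}) ^^ k) (\<lambda>y. ennreal (h y) * T_in u y) x"
    using x by (simp add: excursion_weight_def)
  also have "... = excursion_weight \<phi>\<^sub>0 a (\<lambda>y. ennreal (h y) * u y) k x"
    unfolding excursion_weight_def using h_mult_ruelle_log_g by (intro ruelle_funpow_cong x) auto
  finally show ?thesis using h_inverse[OF x] by (metis mult.assoc mult.commute mult_1)
qed

lemma induced_log_g_1: "x \<in> X \<Longrightarrow> induced log_g a (\<lambda>_. 1) x = 1"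
  using induced_h[of x] h_inverse[of x]
  unfolding induced_eq_suminf by (simp add: excursion_weight_log_g ennreal_suminf_cmult mult.commute)

lemma excursion_weight_log_g_exp_decay: "exp_decay (cyl a) (excursion_weight log_g a (\<lambda>_. 1))"
proof -
  define D where "D = invariant_const B"
  obtain C \<rho> where C: "0 < C" "0 < \<rho>" "\<rho> < 1"
    "\<And>k x. x \<in> cyl a \<Longrightarrow> excursion_weight \<phi>\<^sub>0 a (\<lambda>_. 1) k x \<le> ennreal (C * \<rho> ^ k)"
    using excursion_weight_exp_decay unfolding exp_decay_def by blast
  have "excursion_weight log_g a (\<lambda>_. 1) k x \<le> ennreal (exp D * C * \<rho> ^ k)" if x: "x \<in> cyl a" for k x
  proof -
    have xX: "x \<in> X" using x by simp
    have "ennreal (h y) * 1 \<le> ennreal (exp D) * ennreal (h x) * 1" if "y \<in> cyl a" for y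
      using log_lip_same_letter[OF log_lip_h] that x invariant_const_nonneg[OF phi(2)] by (simp add: D_def)
    then have "excursion_weight log_g a (\<lambda>_. 1) k x \<le>
        ennreal (1 / h x) * excursion_weight \<phi>\<^sub>0 a (\<lambda>_. ennreal (exp D) * ennreal (h x) * 1) k x"
      unfolding excursion_weight_log_g[OF xX] by (intro mult_left_mono excursion_weight_mono xX) auto
    also have "... = (ennreal (h x) * ennreal (1 / h x)) * (ennreal (exp D) * excursion_weight \<phi>\<^sub>0 a (\<lambda>_. 1) k x)"
      unfolding excursion_weight_cmult by (simp only: ac_simps)
    also have "... \<le> ennreal (exp D) * ennreal (C * \<rho> ^ k)" using h_inverse[OF xX] C(4)[OF x] by (simp add: mult_left_mono)
    also have "... = ennreal (exp D * C * \<rho> ^ k)" using C by (simp add: ennreal_mult mult.assoc)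
    finally show ?thesis .
  qed
  then show ?thesis using C unfolding exp_decay_def by (intro exI[of _ "exp D * C"] exI[of _ \<rho>]) auto
qed

lemma ruelle_log_g_measurable: "u \<in> borel_measurable m \<Longrightarrow> ruelle E log_g S u \<in> borel_measurable m"
  using wholder_measurable[OF wholder_log_g] unfolding measurable_m by (rule ruelle_measurable)

lemma integrable_ln:
  assumes K: "log_lip X D (\<lambda>x. ennreal (K x))" "\<forall>x\<in>X. 1 \<le> K x \<and> K x \<le> 2"
  shows "integrable m (\<lambda>x. ln (K x))"
proof (rule integrable_const_bound[of _ 1])
  have "0 < K x" if "x \<in> X" for x using K(2) that by fastforce
  from wholder_ln[OF K(1) this] show "(\<lambda>x. ln (K x)) \<in> borel_measurable m"
    unfolding measurable_m by (rule wholder_measurable)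
  have "0 \<le> ln (K x) \<and> ln (K x) \<le> 1" if "x \<in> X" for x using bspec[OF K(2) that] ln_le_minus_one[of "K x"] by auto
  then show "AE x in m. norm (ln (K x)) \<le> 1" by (intro AE_I2) auto
qed

lemma regular_superharmonic_cohomologous:
  assumes F: "\<And>x. x \<in> X \<Longrightarrow> 0 < F x" and G: "\<And>x. x \<in> X \<Longrightarrow> 0 < G x"
    and TF: "\<And>x. x \<in> X \<Longrightarrow> T (\<lambda>x. ennreal (F x)) x = ennreal (G x)"
  shows "regular_superharmonic (\<lambda>x. \<phi>\<^sub>0 x + ln (F x) + - ln (G (shift x))) (\<lambda>x. ennreal (h x))"
proof -
  have "ruelle E (\<lambda>x. \<phi>\<^sub>0 x + ln (F x) + - ln (G (shift x))) UNIV (\<lambda>x. ennreal (h x)) x = ennreal (h x)" if x: "x \<in> X" for x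
  proof -
    have "ruelle E (\<lambda>x. \<phi>\<^sub>0 x + ln (F x) + - ln (G (shift x))) UNIV (\<lambda>x. ennreal (h x)) x =
        ennreal (1 / G x) * ruelle E \<phi>\<^sub>0 UNIV (\<lambda>y. ennreal (F y) * ennreal (h y)) x"
      by (rule ruelle_cohomologous[OF F G x])
    also have "ruelle E \<phi>\<^sub>0 UNIV (\<lambda>y. ennreal (F y) * ennreal (h y)) x = ennreal (h x) * ennreal (G x)"
      using h_mult_ruelle_log_g[OF x, of UNIV "\<lambda>x. ennreal (F x)"] by (simp add: TF[OF x] mult.commute)
    also have "ennreal (1 / G x) * (ennreal (h x) * ennreal (G x)) = ennreal (h x)"
      using G[OF x] h_pos[OF x] by (simp add: ennreal_mult[symmetric] less_imp_le)
    finally show ?thesis .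
  qed
  then show ?thesis
    unfolding regular_superharmonic_def superharmonic_def
    using log_lip_h invariant_const_nonneg[OF phi(2)] h_pos by (auto simp: ennreal_eq_0_iff not_le)
qed

text \<open>Since \<open>\<phi>\<^sub>0 + ln F - ln (T F) \<circ> shift\<close> has the same positive harmonic function as \<open>\<phi>\<^sub>0\<close>, maximality
  of \<open>m\<close> compares the integrals of \<open>ln F\<close> and \<open>ln (T F)\<close>.\<close>

lemma integral_ln_le:
  assumes C: "0 \<le> C" and F: "log_lip X C (\<lambda>x. ennreal (F x))" "\<forall>x\<in>X. 1 \<le> F x \<and> F x \<le> 2"
    and G: "\<forall>x\<in>X. T (\<lambda>x. ennreal (F x)) x = ennreal (G x)" "\<forall>x\<in>X. 1 \<le> G x \<and> G x \<le> 2"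
  shows "integrable m (\<lambda>x. ln (F x))" "integrable m (\<lambda>x. ln (G x))" "(\<integral>x. ln (F x) \<partial>m) \<le> (\<integral>x. ln (G x) \<partial>m)"
proof -
  have "log_lip X (\<theta> * (log_g_const + C)) (T (\<lambda>x. ennreal (F x)))" by (rule log_lip_ruelle[OF wholder_log_g F(1)]) auto
  then have G_lip: "log_lip X (\<theta> * (log_g_const + C)) (\<lambda>x. ennreal (G x))" by (rule log_lip_cong) (simp add: G(1))
  show int: "integrable m (\<lambda>x. ln (F x))" "integrable m (\<lambda>x. ln (G x))"
    using integrable_ln[OF F] integrable_ln[OF G_lip G(2)] .
  have F_pos: "0 < F x" and G_pos: "0 < G x" if "x \<in> X" for x using F(2) G(2) that by fastforce+
  define f where "f x = \<phi>\<^sub>0 x + ln (F x) + - ln (G (shift x))" for x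
  have wholder_f: "wholder (B + C + \<theta> * (log_g_const + C) / \<theta>) f"
    unfolding f_def[abs_def] by (intro wholder_add wholder_phi0 wholder_ln[OF F(1) F_pos] wholder_ln_shift[OF G_lip G_pos])
  have int_shift: "integrable m (\<lambda>x. ln (G (shift x)))" "(\<integral>x. ln (G (shift x)) \<partial>m) = (\<integral>x. ln (G x) \<partial>m)"
    using integrable_funpow_shift[OF int(2), of 1] integral_funpow_shift[OF borel_measurable_integrable[OF int(2)], of 1] by auto
  have int_f: "integrable m f" unfolding f_def[abs_def] using phi_integrable int(1) int_shift(1) by auto
  obtain K where K: "0 \<le> K" "\<And>x. x \<in> X \<Longrightarrow> \<phi> x \<le> K" using phi_bounded_above by blast
  have f_le: "f x \<le> K + \<bar>P\<bar> + 1" if x: "x \<in> X" for x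
  proof -
    have "ln (F x) \<le> 1" using bspec[OF F(2) x] ln_le_minus_one[of "F x"] by auto
    moreover have "0 \<le> ln (G (shift x))" using bspec[OF G(2), of "shift x"] x by (intro ln_ge_zero) auto
    ultimately show ?thesis using K(2)[OF x] unfolding f_def by linarith
  qed
  have "regular_superharmonic f (\<lambda>x. ennreal (h x))"
    unfolding f_def[abs_def] using G(1) by (intro regular_superharmonic_cohomologous F_pos G_pos) auto
  then have "P + (\<integral>x. f x \<partial>m) \<le> (\<integral>x. \<phi> x \<partial>m)"
    using phi(2) C log_g_const_nonneg theta K(1)
    by (intro equilibrium_inequality[OF wholder_f _ int_f f_le]) auto
  moreover have "(\<integral>x. f x \<partial>m) = (\<integral>x. \<phi> x \<partial>m) - P + (\<integral>x. ln (F x) \<partial>m) - (\<integral>x. ln (G x) \<partial>m)"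
    unfolding f_def using phi_integrable int int_shift by (simp add: prob_space)
  ultimately show "(\<integral>x. ln (F x) \<partial>m) \<le> (\<integral>x. ln (G x) \<partial>m)" by linarith
qed

text \<open>The previous inequality for \<open>F = 1 + s u\<close>, where \<open>ln F\<close> differs from \<open>s u\<close> by at most \<open>s\<^sup>2\<close>.\<close>

lemma integral_le_integral_T_approx:
  assumes u: "\<And>x. x \<in> X \<Longrightarrow> 0 \<le> u x \<and> u x \<le> 1" and C: "0 \<le> C"
    and lip: "\<And>n x y. n \<ge> 1 \<Longrightarrow> x \<in> X \<Longrightarrow> y \<in> X \<Longrightarrow> agree n x y \<Longrightarrow> \<bar>u x - u y\<bar> \<le> C * \<theta> ^ n"
    and w: "\<And>x. x \<in> X \<Longrightarrow> T (\<lambda>x. ennreal (u x)) x = ennreal (w x)" "\<And>x. x \<in> X \<Longrightarrow> 0 \<le> w x \<and> w x \<le> 1"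
    and int: "integrable m u" "integrable m w" and s: "0 < s" "s \<le> 1"
  shows "(\<integral>x. u x \<partial>m) - s \<le> (\<integral>x. w x \<partial>m)"
proof -
  have F: "\<forall>x\<in>X. 1 \<le> 1 + s * u x \<and> 1 + s * u x \<le> 2" and G: "\<forall>x\<in>X. 1 \<le> 1 + s * w x \<and> 1 + s * w x \<le> 2"
    using u w s mult_le_one[of s "u _"] mult_le_one[of s "w _"] by auto
  have TF: "\<forall>x\<in>X. T (\<lambda>x. ennreal (1 + s * u x)) x = ennreal (1 + s * w x)"
  proof
    fix x assume x: "x \<in> X"
    have "T (\<lambda>x. ennreal (1 + s * u x)) x = T (\<lambda>x. 1 + ennreal s * ennreal (u x)) x"
      using x u s by (intro ruelle_cong) (auto simp: ennreal_mult)
    also have "... = 1 + ennreal s * ennreal (w x)" unfolding ruelle_add ruelle_cmult using T_1[OF x] w[OF x] by simp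
    finally show "T (\<lambda>x. ennreal (1 + s * u x)) x = ennreal (1 + s * w x)" using s w(2)[OF x] by (simp add: ennreal_mult)
  qed
  have "\<bar>1 + s * u x - (1 + s * u y)\<bar> \<le> 1 * (C * \<theta> ^ n)" if "n \<ge> 1" "x \<in> X" "y \<in> X" "agree n x y" for n x y
  proof -
    have "\<bar>1 + s * u x - (1 + s * u y)\<bar> = s * \<bar>u x - u y\<bar>" using s by (simp add: right_diff_distrib[symmetric] abs_mult)
    also have "... \<le> 1 * (C * \<theta> ^ n)" using lip[OF that] s by (intro mult_mono) auto
    finally show ?thesis .
  qed
  then have "log_lip X C (\<lambda>x. ennreal (1 + s * u x))" using F by (intro log_lip_of_lipschitz[of 1]) auto
  note ln = integral_ln_le[OF C this F TF G]
  have "(\<integral>x. s * u x - s\<^sup>2 \<partial>m) \<le> (\<integral>x. ln (1 + s * u x) \<partial>m)"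
  proof (rule integral_mono[OF _ ln(1)])
    show "integrable m (\<lambda>x. s * u x - s\<^sup>2)" using int by auto
    fix x assume "x \<in> space m"
    then have su: "0 \<le> s * u x" "s * u x \<le> 1" "(s * u x)\<^sup>2 \<le> s\<^sup>2"
      using u[of x] s by (auto intro: mult_le_one power_mono mult_left_le)
    then show "s * u x - s\<^sup>2 \<le> ln (1 + s * u x)" using ln_one_plus_pos_lower_bound[OF su(1,2)] by simp
  qed
  also have "... \<le> (\<integral>x. ln (1 + s * w x) \<partial>m)" by (rule ln(3))
  also have "... \<le> (\<integral>x. s * w x \<partial>m)"
    using int w(2) s ln_add_one_self_le_self by (intro integral_mono[OF ln(2)]) auto
  finally have "s * ((\<integral>x. u x \<partial>m) - s) \<le> s * (\<integral>x. w x \<partial>m)"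
    using int by (simp add: prob_space right_diff_distrib power2_eq_square)
  then show ?thesis using s by simp
qed

lemma integral_le_integral_T:
  assumes u: "\<And>x. x \<in> X \<Longrightarrow> 0 \<le> u x \<and> u x \<le> 1" and C: "0 \<le> C"
    and lip: "\<And>n x y. n \<ge> 1 \<Longrightarrow> x \<in> X \<Longrightarrow> y \<in> X \<Longrightarrow> agree n x y \<Longrightarrow> \<bar>u x - u y\<bar> \<le> C * \<theta> ^ n"
  shows "(\<integral>\<^sup>+x. ennreal (u x) \<partial>m) \<le> (\<integral>\<^sup>+x. T (\<lambda>x. ennreal (u x)) x \<partial>m)"
proof -
  have [measurable]: "u \<in> borel_measurable m"
    unfolding measurable_m by (rule wholder_measurable[of C]) (use lip in \<open>auto simp: wholder_def\<close>)
  define w where "w x = enn2real (T (\<lambda>x. ennreal (u x)) x)" for x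
  have T_le: "T (\<lambda>x. ennreal (u x)) x \<le> 1" if x: "x \<in> X" for x
  proof -
    have "T (\<lambda>x. ennreal (u x)) x \<le> T (\<lambda>_. 1) x"
      using u x by (intro ruelle_mono) (auto simp flip: ennreal_1 intro!: ennreal_leI)
    then show ?thesis using T_1[OF x] by simp
  qed
  have w: "T (\<lambda>x. ennreal (u x)) x = ennreal (w x)" "0 \<le> w x \<and> w x \<le> 1" if x: "x \<in> X" for x
    using T_le[OF x] le_less_trans[OF T_le[OF x], of top] by (auto simp: w_def intro: enn2real_leI)
  have [measurable]: "w \<in> borel_measurable m"
    unfolding w_def[abs_def] using ruelle_log_g_measurable[of "\<lambda>x. ennreal (u x)" UNIV] by measurable
  have int: "integrable m u" "integrable m w" using u w by (auto intro!: integrable_const_bound[of _ 1])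
  have "(\<integral>x. u x \<partial>m) \<le> (\<integral>x. w x \<partial>m)"
  proof (rule field_le_epsilon)
    fix \<epsilon> :: real assume "0 < \<epsilon>"
    then have "(\<integral>x. u x \<partial>m) - min \<epsilon> 1 \<le> (\<integral>x. w x \<partial>m)"
      by (intro integral_le_integral_T_approx[OF u C lip w int]) auto
    then show "(\<integral>x. u x \<partial>m) \<le> (\<integral>x. w x \<partial>m) + \<epsilon>" by linarith
  qed
  moreover have "(\<integral>\<^sup>+x. ennreal (u x) \<partial>m) = ennreal (\<integral>x. u x \<partial>m)" using int u by (intro nn_integral_eq_integral) auto
  moreover have "(\<integral>\<^sup>+x. T (\<lambda>x. ennreal (u x)) x \<partial>m) = ennreal (\<integral>x. w x \<partial>m)"
    using int w by (subst nn_integral_eq_integral[symmetric]) (auto intro!: nn_integral_cong)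
  ultimately show ?thesis by (simp add: ennreal_leI)
qed

definition prepend :: "(nat \<Rightarrow> 'a) \<times> 'a \<Rightarrow> nat \<Rightarrow> 'a" where
  "prepend = (\<lambda>(x, b). if E b (x 0) then case_nat b x else x)"

definition dual_measure :: "(nat \<Rightarrow> 'a) measure" where
  "dual_measure = distr (density (m \<Otimes>\<^sub>M count_space UNIV)
      (\<lambda>p. of_bool (E (snd p) (fst p 0)) * ennreal (exp (log_g (prepend p))))) (shift_space E) prepend"

lemma sets_dual_measure [simp]: "sets dual_measure = sets (shift_space E)"
  by (simp add: dual_measure_def)

lemma nn_integral_dual_measure:
  assumes [measurable]: "u \<in> borel_measurable (shift_space E)"
  shows "(\<integral>\<^sup>+x. u x \<partial>dual_measure) = (\<integral>\<^sup>+x. T u x \<partial>m)"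
proof -
  interpret letters: sigma_finite_measure "count_space (UNIV :: 'a set)"
    by (rule sigma_finite_measure_count_space)
  have pair: "f \<in> measurable (m \<Otimes>\<^sub>M count_space UNIV) N" if f: "\<And>b. (\<lambda>x. f (x, b)) \<in> measurable m N"
    for f :: "(nat \<Rightarrow> 'a) \<times> 'a \<Rightarrow> 'c" and N
    using measurable_compose_countable'[where f="\<lambda>b p. f (fst p, b)",
        OF measurable_compose[OF measurable_fst f] measurable_snd countableI_type] by simp
  have [measurable]: "prepend \<in> measurable (m \<Otimes>\<^sub>M count_space UNIV) (shift_space E)"
    using measurable_case_nat[of E] by (intro pair) (simp add: prepend_def measurable_cong_sets[OF sets_m refl])
  have [measurable]: "log_g \<in> borel_measurable (shift_space E)" by (rule wholder_measurable[OF wholder_log_g])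
  have [measurable]: "(\<lambda>p. of_bool (E (snd p) (fst p 0)) :: ennreal) \<in> borel_measurable (m \<Otimes>\<^sub>M count_space UNIV)"
    by (rule pair, simp only: measurable_m snd_conv fst_conv, rule measurable_compose[OF measurable_coord[of 0]]) simp
  have "(\<integral>\<^sup>+x. u x \<partial>dual_measure) =
      (\<integral>\<^sup>+p. of_bool (E (snd p) (fst p 0)) * ennreal (exp (log_g (prepend p))) * u (prepend p) \<partial>(m \<Otimes>\<^sub>M count_space UNIV))"
    unfolding dual_measure_def by (subst nn_integral_distr) (simp_all add: nn_integral_density)
  also have "... = (\<integral>\<^sup>+x. (\<integral>\<^sup>+b. of_bool (E b (x 0)) * ennreal (exp (log_g (prepend (x, b)))) * u (prepend (x, b)) \<partial>count_space UNIV) \<partial>m)"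
    by (subst letters.nn_integral_fst[symmetric]) simp_all
  also have "... = (\<integral>\<^sup>+x. T u x \<partial>m)"
    unfolding ruelle_def by (intro nn_integral_cong) (auto simp: prepend_def)
  finally show ?thesis .
qed

lemma emeasure_dual_measure: "A \<in> sets m \<Longrightarrow> emeasure dual_measure A = (\<integral>\<^sup>+x. T (indicator A) x \<partial>m)"
  using nn_integral_dual_measure[of "indicator A"] by (simp add: sets_m)

lemma emeasure_le_dual_measure:
  assumes det: "determined l A" shows "emeasure m A \<le> emeasure dual_measure A"
proof -
  define u :: "(nat \<Rightarrow> 'a) \<Rightarrow> real" where "u = indicator A"
  have "\<bar>u x - u y\<bar> \<le> 1 / \<theta> ^ l * \<theta> ^ k" if k: "x \<in> X" "y \<in> X" "agree k x y" for k x y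
  proof (cases "l \<le> k")
    case True
    then have "x \<in> A \<longleftrightarrow> y \<in> A" using determined_iff[OF det] k agree_mono by blast
    then show ?thesis using theta by (simp add: u_def indicator_def)
  next
    case False
    then have "\<theta> ^ l \<le> \<theta> ^ k" using theta by (intro power_decreasing) auto
    then have "1 \<le> 1 / \<theta> ^ l * \<theta> ^ k" using theta_pow(1)[of l] by (simp add: field_simps)
    moreover have "\<bar>u x - u y\<bar> \<le> 1" by (simp add: u_def indicator_def)
    ultimately show ?thesis by linarith
  qed
  then have "(\<integral>\<^sup>+x. ennreal (u x) \<partial>m) \<le> (\<integral>\<^sup>+x. T (\<lambda>x. ennreal (u x)) x \<partial>m)"
    using theta by (intro integral_le_integral_T[of _ "1 / \<theta> ^ l"]) (auto simp: u_def indicator_def)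
  moreover have "ennreal (u x) = indicator A x" for x by (simp add: u_def indicator_def)
  ultimately show ?thesis using emeasure_dual_measure[OF determined_sets[OF det]] determined_sets[OF det] by simp
qed

lemma dual_measure_eq: "dual_measure = m"
proof (rule sym, rule shift_measure_eqI[OF sets_m])
  have "(\<integral>\<^sup>+x. T (indicator X) x \<partial>m) = (\<integral>\<^sup>+x. 1 \<partial>m)"
    using T_1 by (intro nn_integral_cong) (auto cong: ruelle_cong)
  then have total: "emeasure dual_measure X = 1"
    using emeasure_dual_measure[of X] sets.top[of m] emeasure_space_1 by simp
  fix n w
  define A where "A = {x \<in> X. \<forall>i<n. x i = w i}"
  have det: "determined n A" by (auto simp: determined_def A_def agree_def)
  have A: "A \<in> sets m" "X - A \<in> sets m" using determined_sets det determined_Diff by blast+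
  have split: "emeasure N A + emeasure N (X - A) = emeasure N X" if "sets N = sets m" for N
  proof -
    have "A \<union> (X - A) = X" by (auto simp: A_def)
    then show ?thesis using plus_emeasure[of A N "X - A"] A that by simp
  qed
  have "emeasure m (X - A) + emeasure dual_measure A \<le> emeasure dual_measure (X - A) + emeasure dual_measure A"
    by (intro add_right_mono emeasure_le_dual_measure[OF determined_Diff[OF det]])
  also have "... = emeasure m (X - A) + emeasure m A"
    using split[of m] split[of dual_measure] total emeasure_space_1 by (simp add: sets_m add.commute)
  finally have "emeasure dual_measure A \<le> emeasure m A"
    by (simp add: ennreal_add_left_cancel_le emeasure_eq_measure)
  then show "emeasure m A = emeasure dual_measure A" using emeasure_le_dual_measure[OF det] by (rule antisym[rotated])
qed (auto simp: emeasure_eq_measure)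

theorem nn_integral_T:
  assumes "u \<in> borel_measurable m"
  shows "(\<integral>\<^sup>+x. T u x \<partial>m) = (\<integral>\<^sup>+x. u x \<partial>m)"
  using nn_integral_dual_measure[of u] assms by (simp add: dual_measure_eq measurable_m)

end

section \<open>Full support\<close>

context normalised_shift
begin

lemma nn_integral_T_funpow: "u \<in> borel_measurable m \<Longrightarrow> (\<integral>\<^sup>+x. (T ^^ k) u x \<partial>m) = (\<integral>\<^sup>+x. u x \<partial>m)"
proof (induction k)
  case (Suc k)
  have "(T ^^ k) u \<in> borel_measurable m"
    using wholder_measurable[OF wholder_log_g] Suc.prems unfolding measurable_m by (rule ruelle_funpow_measurable)
  then show ?case using nn_integral_T Suc by simp
qed simp

lemma full_support:
  assumes z: "z \<in> X"
  shows "emeasure m {y \<in> X. agree (Suc n) z y} \<noteq> 0"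
proof
  define A where "A = {y \<in> X. agree (Suc n) z y}"
  assume "emeasure m {y \<in> X. agree (Suc n) z y} = 0"
  then have null: "emeasure m A = 0" by (simp add: A_def)
  have A: "A \<in> sets m" unfolding A_def sets_m by (rule finitely_determined_in_sets[of "Suc n"]) (auto simp: agree_def)
  have "AE x in m. (T ^^ k) (indicator A) x = 0" for k
  proof -
    have "(\<integral>\<^sup>+x. (T ^^ k) (indicator A) x \<partial>m) = 0"
      using nn_integral_T_funpow[of "indicator A" k] A null by simp
    moreover have "(T ^^ k) (indicator A) \<in> borel_measurable m"
      using wholder_measurable[OF wholder_log_g] A unfolding measurable_m sets_m by (intro ruelle_funpow_measurable) auto
    ultimately show ?thesis by (simp add: nn_integral_0_iff_AE)
  qed
  then have "AE x in m. \<forall>k. (T ^^ k) (indicator A) x = 0" by (simp add: AE_all_countable)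
  moreover have "\<exists>k. (T ^^ k) (indicator A) x \<noteq> 0" if "x \<in> space m" for x
  proof -
    have "x \<in> X" using that by simp
    then obtain k y where y: "y \<in> X" "agree (Suc n) z y" "(shift ^^ k) y = x" using cylinder_path[OF _ z] by blast
    then have "(T ^^ k) (indicator A) ((shift ^^ k) y) \<noteq> 0" by (intro ruelle_funpow_pos) (auto simp: A_def)
    then show ?thesis using y(3) by blast
  qed
  ultimately have "AE x in m. False" by (elim AE_mp) (intro AE_I2, blast)
  then show False by simp
qed

lemma AE_imp_exists_nearby:
  assumes Q: "AE x in m. Q x" and x: "x \<in> X"
  shows "\<exists>y\<in>X. agree n x y \<and> Q y"
proof (rule ccontr)
  assume none: "\<not> (\<exists>y\<in>X. agree n x y \<and> Q y)"
  define A where "A = {y \<in> X. agree (Suc n) x y}"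
  have A: "A \<in> sets m" unfolding A_def sets_m by (rule finitely_determined_in_sets[of "Suc n"]) (auto simp: agree_def)
  have not_in: "y \<notin> A" if "Q y" for y using that none agree_mono[of "Suc n" x y n] by (auto simp: A_def)
  have "AE y in m. y \<notin> A" using Q by eventually_elim (rule not_in)
  then have "emeasure m A = 0" using A by (subst (asm) AE_iff_measurable[OF A]) (auto simp: A_def)
  then show False using full_support[OF x, of n] by (simp add: A_def)
qed

lemma AE_zero_continuous:
  assumes c: "shift_continuous E f" and zero: "AE x in m. f x = 0" and x: "x \<in> X"
  shows "f x = 0"
proof (rule ccontr)
  assume "f x \<noteq> 0"
  moreover have "(f \<longlongrightarrow> f x) (cyl_nhds E x)" using c x unfolding shift_continuous_iff_tendsto by blast
  ultimately have "\<forall>\<^sub>F y in cyl_nhds E x. f y \<noteq> 0" by (rule tendsto_imp_eventually_ne[rotated])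
  then obtain n where "\<forall>y\<in>X. agree n x y \<longrightarrow> f y \<noteq> 0" unfolding eventually_cyl_nhds by blast
  then show False using AE_imp_exists_nearby[OF zero x, of n] by blast
qed

end

section \<open>Square integrability of the Green function\<close>

text \<open>If \<open>W = \<Sum> s\<^sup>-\<^sup>2\<^sup>k p\<^sub>k\<close> with \<open>p\<^sub>k \<le> 1\<close> then \<open>p\<^sub>k\<^sup>2 \<le> p\<^sub>k \<le> s\<^sup>2\<^sup>k W\<close>, so \<open>\<Sum> p\<^sub>k\<close> is at most a multiple of the square
  root of \<open>W\<close>.\<close>

lemma suminf_square_le:
  fixes p :: "nat \<Rightarrow> ennreal"
  assumes s: "0 < s" "s < 1" and p: "\<And>k. p k \<le> 1"
  shows "(\<Sum>k. p k)\<^sup>2 \<le> ennreal (1 / (1 - s)\<^sup>2) * (\<Sum>k. ennreal (1 / s\<^sup>2 ^ k) * p k)"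
proof -
  define W where "W = (\<Sum>k. ennreal (1 / s\<^sup>2 ^ k) * p k)"
  define r where "r k = enn2real (p k)" for k
  have r: "p k = ennreal (r k)" "0 \<le> r k" "r k \<le> 1" for k
    using p[of k] le_less_trans[OF p[of k] ennreal_one_less_top] by (auto simp: r_def intro: enn2real_leI)
  show ?thesis
  proof (cases "W = top")
    case True
    then show ?thesis using s unfolding W_def[symmetric] by (simp add: ennreal_mult_top)
  next
    case False
    then obtain w where w: "W = ennreal w" "0 \<le> w" by (metis ennreal_cases)
    have "r k \<le> sqrt w * s ^ k" for k
    proof -
      have "ennreal (1 / s\<^sup>2 ^ k) * p k \<le> W"
        unfolding W_def using sum_le_suminf[of "\<lambda>k. ennreal (1 / s\<^sup>2 ^ k) * p k" "{k}"] by simp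
      then have "ennreal (1 / s\<^sup>2 ^ k * r k) \<le> ennreal w"
        unfolding r(1) w(1) using r(2)[of k] s by (subst ennreal_mult) auto
      then have "1 / s\<^sup>2 ^ k * r k \<le> w" using w(2) by simp
      then have "r k \<le> w * s\<^sup>2 ^ k" using s by (simp add: field_simps)
      moreover have "(r k)\<^sup>2 \<le> r k" using r(2,3)[of k] by (simp add: power2_eq_square mult_left_le)
      moreover have "(sqrt w * s ^ k)\<^sup>2 = w * s\<^sup>2 ^ k"
        using w(2) by (simp add: power_mult_distrib power_mult[symmetric] mult.commute)
      ultimately have "(r k)\<^sup>2 \<le> (sqrt w * s ^ k)\<^sup>2" by linarith
      then show ?thesis by (rule power2_le_imp_le) (use w s in simp)
    qed
    then have "(\<Sum>k. p k) \<le> (\<Sum>k. ennreal (sqrt w * s ^ k))"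
      unfolding r(1) by (intro suminf_le allI ennreal_leI) auto
    also have "... = ennreal (sqrt w / (1 - s))" using s w by (intro suminf_geometric_ennreal) auto
    finally have "(\<Sum>k. p k)\<^sup>2 \<le> (ennreal (sqrt w / (1 - s)))\<^sup>2" by (intro power_mono) auto
    also have "... = ennreal (1 / (1 - s)\<^sup>2 * w)" using w s by (simp add: ennreal_power power_divide)
    also have "... = ennreal (1 / (1 - s)\<^sup>2) * ennreal w" using w by (intro ennreal_mult) auto
    finally show ?thesis unfolding W_def[symmetric] w(1) .
  qed
qed

lemma exp_decay_of_small_decrements:
  fixes q :: "nat \<Rightarrow> ennreal"
  assumes C: "0 \<le> C" and \<rho>: "0 \<le> \<rho>" "\<rho> < 1" and step: "\<And>k. q k \<le> q (Suc k) + ennreal (C * \<rho> ^ k)" and lim: "q \<longlonglongrightarrow> 0"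
  shows "q k \<le> ennreal (C / (1 - \<rho>) * \<rho> ^ k)"
proof -
  have iter: "q k \<le> q (k + n) + ennreal (\<Sum>j<n. C * \<rho> ^ (k + j))" for n
  proof (induction n)
    case (Suc n)
    have "q k \<le> (q (Suc (k + n)) + ennreal (C * \<rho> ^ (k + n))) + ennreal (\<Sum>j<n. C * \<rho> ^ (k + j))"
      by (rule order_trans[OF Suc add_right_mono[OF step]])
    also have "... = q (k + Suc n) + ennreal (\<Sum>j<Suc n. C * \<rho> ^ (k + j))"
      using C \<rho> by (simp add: ac_simps sum_nonneg flip: ennreal_plus)
    finally show ?case .
  qed simp
  have geometric: "(\<Sum>j<n. C * \<rho> ^ (k + j)) \<le> C / (1 - \<rho>) * \<rho> ^ k" for n
  proof -
    have sums: "(\<lambda>j. (C * \<rho> ^ k) * \<rho> ^ j) sums ((C * \<rho> ^ k) * (1 / (1 - \<rho>)))"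
      using \<rho> by (intro sums_mult geometric_sums) auto
    have "(\<Sum>j<n. (C * \<rho> ^ k) * \<rho> ^ j) \<le> (\<Sum>j. (C * \<rho> ^ k) * \<rho> ^ j)"
      using C \<rho> by (intro sum_le_suminf sums_summable[OF sums]) auto
    then show ?thesis using sums_unique[OF sums] by (simp add: power_add mult.assoc)
  qed
  have "q k \<le> q (n + k) + ennreal (C / (1 - \<rho>) * \<rho> ^ k)" for n
    unfolding add.commute[of n k] by (rule order_trans[OF iter add_left_mono[OF ennreal_leI[OF geometric]]])
  moreover have "(\<lambda>n. q (n + k) + ennreal (C / (1 - \<rho>) * \<rho> ^ k)) \<longlonglongrightarrow> 0 + ennreal (C / (1 - \<rho>) * \<rho> ^ k)"
    by (rule tendsto_add[OF LIMSEQ_ignore_initial_segment[OF lim, of k] tendsto_const])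
  ultimately have "q k \<le> 0 + ennreal (C / (1 - \<rho>) * \<rho> ^ k)" by (intro LIMSEQ_le_const) auto
  then show ?thesis by simp
qed

context normalised_shift
begin

definition away :: "nat \<Rightarrow> (nat \<Rightarrow> 'a) \<Rightarrow> ennreal" where
  "away k = (T_out ^^ k) (\<lambda>_. 1)"

abbreviation excursion :: "nat \<Rightarrow> (nat \<Rightarrow> 'a) \<Rightarrow> ennreal" where
  "excursion \<equiv> excursion_weight log_g a (\<lambda>_. 1)"

lemma away_step:
  assumes "x \<in> X" shows "away k x = excursion k x + away (Suc k) x"
proof -
  have "(T_out ^^ k) (\<lambda>_. 1) x = (T_out ^^ k) (\<lambda>y. T_in (\<lambda>_. 1) y + T_out (\<lambda>_. 1) y) x"
    using T_1 by (intro ruelle_funpow_cong assms) (simp add: ruelle_split[symmetric])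
  then show ?thesis
    by (simp add: ruelle_funpow_add away_def excursion_weight_def funpow_Suc_right del: funpow.simps)
qed

lemma sum_excursion_away: "x \<in> X \<Longrightarrow> (\<Sum>j<k. excursion j x) + away k x = 1"
  by (induction k) (simp_all add: away_step[symmetric] add.assoc, simp add: away_def)

lemma sum_excursion_finite: "x \<in> X \<Longrightarrow> (\<Sum>j<k. excursion j x) \<noteq> top"
  using sum_excursion_away[of x k] ennreal_one_neq_top by (metis ennreal_add_eq_top)

lemma away_le_1: "x \<in> X \<Longrightarrow> away k x \<le> 1"
  using sum_excursion_away[of x k] by (metis add.commute le_iff_add)

lemma away_eq_tail:
  assumes x: "x \<in> X" shows "away k x = (\<Sum>j. excursion (j + k) x)"
proof -
  define S where "S = (\<Sum>j<k. excursion j x)"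
  have "(\<Sum>j. excursion j x) = (\<Sum>j. excursion (j + k) x) + S"
    unfolding S_def by (rule suminf_offset) simp
  then have "S + (\<Sum>j. excursion (j + k) x) = S + away k x"
    using induced_log_g_1[OF x] sum_excursion_away[OF x, of k] by (simp add: S_def induced_eq_suminf add.commute)
  moreover have "S \<noteq> top" using sum_excursion_finite[OF x, of k] unfolding S_def .
  ultimately show ?thesis by (simp add: ennreal_add_left_cancel)
qed

lemma away_exp_decay: "exp_decay (cyl a) away"
  using exp_decay_tail[OF excursion_weight_log_g_exp_decay] by (simp add: exp_decay_def away_eq_tail)

lemma away_tendsto_0:
  assumes x: "x \<in> X" shows "(\<lambda>k. away k x) \<longlonglongrightarrow> 0"
proof -
  have "(\<lambda>k. \<Sum>j<k. excursion j x) \<longlonglongrightarrow> 1"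
    using summable_LIMSEQ[of "\<lambda>j. excursion j x"] induced_log_g_1[OF x] by (simp add: induced_eq_suminf)
  then have "(\<lambda>k. 1 - (\<Sum>j<k. excursion j x)) \<longlonglongrightarrow> 1 - 1"
    by (intro tendsto_diff_ennreal_general tendsto_const) auto
  moreover have "1 - (\<Sum>j<k. excursion j x) = away k x" for k
  proof -
    have "(\<Sum>j<k. excursion j x) + away k x - (\<Sum>j<k. excursion j x) = away k x"
      by (rule ennreal_add_diff_cancel_left[OF sum_excursion_finite[OF x]])
    then show ?thesis unfolding sum_excursion_away[OF x] .
  qed
  ultimately show ?thesis by simp
qed

lemma away_measurable: "away k \<in> borel_measurable m"
  unfolding away_def measurable_m using wholder_measurable[OF wholder_log_g] by (intro ruelle_funpow_measurable) auto

lemma nn_integral_away_step: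
  assumes c: "\<And>x. x \<in> cyl a \<Longrightarrow> away k x \<le> c"
  shows "(\<integral>\<^sup>+x. away k x \<partial>m) \<le> (\<integral>\<^sup>+x. away (Suc k) x \<partial>m) + c"
proof -
  define w where "w y = indicator (- {a}) (y 0) * away k y" for y
  have "(\<lambda>y. indicator (- {a}) (y 0) :: ennreal) \<in> borel_measurable m"
    unfolding measurable_m by (rule measurable_compose[OF measurable_coord]) simp
  then have w: "w \<in> borel_measurable m"
    unfolding w_def[abs_def] using away_measurable[of k] by (rule borel_measurable_times_ennreal)
  have "away k x \<le> w x + c" if "x \<in> X" for x
    using c[of x] that by (cases "x 0 = a") (auto simp: w_def intro: order_trans)
  then have "(\<integral>\<^sup>+x. away k x \<partial>m) \<le> (\<integral>\<^sup>+x. w x + c \<partial>m)" by (intro nn_integral_mono) auto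
  also have "... = (\<integral>\<^sup>+x. w x \<partial>m) + c" using w by (subst nn_integral_add) (auto simp: emeasure_space_1[simplified])
  also have "(\<integral>\<^sup>+x. w x \<partial>m) = (\<integral>\<^sup>+x. away (Suc k) x \<partial>m)"
    unfolding nn_integral_T[OF w, symmetric] by (simp add: away_def ruelle_restrict[of E log_g "- {a}"] w_def[abs_def])
  finally show ?thesis .
qed

lemma nn_integral_away_exp_decay:
  "\<exists>C \<rho>. 0 < C \<and> 0 < \<rho> \<and> \<rho> < 1 \<and> (\<forall>k. (\<integral>\<^sup>+x. away k x \<partial>m) \<le> ennreal (C * \<rho> ^ k))"
proof -
  obtain C \<rho> where C: "0 < C" and \<rho>: "0 < \<rho>" "\<rho> < 1" and away: "\<And>k x. x \<in> cyl a \<Longrightarrow> away k x \<le> ennreal (C * \<rho> ^ k)"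
    using away_exp_decay unfolding exp_decay_def by blast
  have "(\<lambda>k. \<integral>\<^sup>+x. away k x \<partial>m) \<longlonglongrightarrow> (\<integral>\<^sup>+x. 0 \<partial>m)"
  proof (rule nn_integral_dominated_convergence[where w="\<lambda>_. 1"])
    show "(\<integral>\<^sup>+x. 1 \<partial>m) < \<infinity>" using emeasure_space_1 by simp
    show "AE x in m. away k x \<le> 1" for k using away_le_1 by (intro AE_I2) auto
    show "AE x in m. (\<lambda>k. away k x) \<longlonglongrightarrow> 0" using away_tendsto_0 by (intro AE_I2) auto
  qed (use away_measurable in auto)
  then have "(\<integral>\<^sup>+x. away k x \<partial>m) \<le> ennreal (C / (1 - \<rho>) * \<rho> ^ k)" for k
    using C \<rho> by (intro exp_decay_of_small_decrements[OF _ _ _ nn_integral_away_step[OF away]]) auto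
  then show ?thesis using C \<rho> by (intro exI[of _ "C / (1 - \<rho>)"] exI[of _ \<rho>]) auto
qed

abbreviation green_away :: "(nat \<Rightarrow> 'a) \<Rightarrow> ennreal" where
  "green_away \<equiv> green E log_g (- {a}) (\<lambda>_. 1)"

lemma green_away_eq: "green_away x = (\<Sum>k. away k x)"
  by (simp add: green_def away_def)

lemma log_lip_green_away: "log_lip X (invariant_const log_g_const) green_away"
  by (intro log_lip_green[OF wholder_log_g] log_lip_const) (auto simp: invariant_const invariant_const_nonneg[OF log_g_const_nonneg])

lemma green_away_square_integrable: "(\<integral>\<^sup>+x. (green_away x)\<^sup>2 \<partial>m) < \<infinity>"
proof -
  obtain C \<rho> where C: "0 < C" and \<rho>: "0 < \<rho>" "\<rho> < 1" and away: "\<And>k. (\<integral>\<^sup>+x. away k x \<partial>m) \<le> ennreal (C * \<rho> ^ k)"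
    using nn_integral_away_exp_decay by blast
  define s where "s = sqrt (sqrt \<rho>)"
  have s: "0 < s" "s < 1" "0 < s\<^sup>2" "s\<^sup>2 < 1" "\<rho> = s\<^sup>2 * s\<^sup>2" using \<rho> by (auto simp: s_def)
  have [measurable]: "(\<lambda>x. ennreal (1 / s\<^sup>2 ^ k) * away k x) \<in> borel_measurable m" for k
    using away_measurable by measurable
  have "(\<integral>\<^sup>+x. (green_away x)\<^sup>2 \<partial>m) \<le> (\<integral>\<^sup>+x. ennreal (1 / (1 - s)\<^sup>2) * (\<Sum>k. ennreal (1 / s\<^sup>2 ^ k) * away k x) \<partial>m)"
    unfolding green_away_eq using suminf_square_le[OF s(1,2)] away_le_1 by (intro nn_integral_mono) auto
  also have "... = ennreal (1 / (1 - s)\<^sup>2) * (\<Sum>k. \<integral>\<^sup>+x. ennreal (1 / s\<^sup>2 ^ k) * away k x \<partial>m)"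
    by (simp add: nn_integral_cmult nn_integral_suminf)
  also have "(\<Sum>k. \<integral>\<^sup>+x. ennreal (1 / s\<^sup>2 ^ k) * away k x \<partial>m) \<le> (\<Sum>k. ennreal (C * s\<^sup>2 ^ k))"
  proof (intro suminf_le allI)
    fix k
    have "(\<integral>\<^sup>+x. ennreal (1 / s\<^sup>2 ^ k) * away k x \<partial>m) = ennreal (1 / s\<^sup>2 ^ k) * (\<integral>\<^sup>+x. away k x \<partial>m)"
      by (rule nn_integral_cmult[OF away_measurable])
    also have "... \<le> ennreal (1 / s\<^sup>2 ^ k) * ennreal (C * \<rho> ^ k)" by (intro mult_left_mono away) simp
    also have "... = ennreal (1 / s\<^sup>2 ^ k * (C * \<rho> ^ k))" using C \<rho> s by (intro ennreal_mult[symmetric]) auto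
    also have "1 / s\<^sup>2 ^ k * (C * \<rho> ^ k) = C * s\<^sup>2 ^ k" unfolding s(5) power_mult_distrib using s(3) by simp
    finally show "(\<integral>\<^sup>+x. ennreal (1 / s\<^sup>2 ^ k) * away k x \<partial>m) \<le> ennreal (C * s\<^sup>2 ^ k)" .
  qed auto
  also have "(\<Sum>k. ennreal (C * s\<^sup>2 ^ k)) = ennreal (C / (1 - s\<^sup>2))" using C s by (intro suminf_geometric_ennreal) auto
  also have "ennreal (1 / (1 - s)\<^sup>2) * ennreal (C / (1 - s\<^sup>2)) < \<infinity>" by (simp add: ennreal_mult_less_top)
  finally show ?thesis by (simp add: mult_left_mono)
qed

lemma green_away_finite:
  assumes x: "x \<in> X" shows "green_away x \<noteq> top"
proof -
  have [measurable]: "green_away \<in> borel_measurable m"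
    unfolding measurable_m by (rule log_lip_measurable[OF log_lip_green_away])
  have "AE x in m. (green_away x)\<^sup>2 \<noteq> \<infinity>"
    using green_away_square_integrable by (intro nn_integral_PInf_AE) auto
  then obtain y where y: "y \<in> X" "agree 1 x y" "(green_away y)\<^sup>2 \<noteq> \<infinity>"
    using AE_imp_exists_nearby[OF _ x, of _ 1] by blast
  then have "green_away y \<noteq> top" by (auto simp: power2_eq_square ennreal_mult_top)
  then show ?thesis using log_lipD[OF log_lip_green_away _ x y(1,2)] by (auto simp: top_unique ennreal_mult_eq_top_iff)
qed

definition weight :: "(nat \<Rightarrow> 'a) \<Rightarrow> real" where
  "weight x = enn2real (green_away x)"

lemma weight: "x \<in> X \<Longrightarrow> green_away x = ennreal (weight x)"
  using green_away_finite[of x] by (simp add: weight_def less_top)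

lemma weight_ge_1:
  assumes x: "x \<in> X" shows "1 \<le> weight x"
proof -
  have "ennreal 1 \<le> ennreal (weight x)" using green_ge(1)[of "\<lambda>_. 1" x E log_g "- {a}"] weight[OF x] by simp
  then show ?thesis by (subst (asm) ennreal_le_iff2) auto
qed

lemma weight_measurable: "weight \<in> borel_measurable m"
  unfolding weight_def[abs_def] measurable_m using log_lip_measurable[OF log_lip_green_away] by measurable

lemma weight_square_integrable: "integrable m (\<lambda>x. (weight x)\<^sup>2)"
proof (rule integrableI_nonneg)
  have "(\<integral>\<^sup>+x. ennreal ((weight x)\<^sup>2) \<partial>m) = (\<integral>\<^sup>+x. (green_away x)\<^sup>2 \<partial>m)"
    using weight by (intro nn_integral_cong) (auto simp: ennreal_power[symmetric] weight_def)
  then show "(\<integral>\<^sup>+x. ennreal ((weight x)\<^sup>2) \<partial>m) < \<infinity>" using green_away_square_integrable by simp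
qed (use weight_measurable in auto)

lemma weight_bounded: "\<exists>C\<ge>0. \<forall>x\<in>cyl a. weight x \<le> C"
proof -
  obtain C where C: "0 \<le> C" "\<forall>x\<in>cyl a. (\<Sum>k. away k x) \<le> ennreal C"
    using exp_decay_suminf_bounded[OF away_exp_decay] by blast
  then have "weight x \<le> C" if "x \<in> cyl a" for x
    unfolding weight_def green_away_eq using that C by (intro enn2real_leI) auto
  then show ?thesis using C(1) by blast
qed

section \<open>Continuous coboundaries\<close>

lemma coboundary_iterate_le:
  fixes r :: "(nat \<Rightarrow> 'a) \<Rightarrow> real"
  assumes r: "\<And>x. x \<in> X \<Longrightarrow> \<bar>r x - r (shift x)\<bar> \<le> K" and x: "x \<in> X"
  shows "\<bar>r x - r ((shift ^^ k) x)\<bar> \<le> real k * K"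
proof (induction k)
  case (Suc k)
  have "\<bar>r ((shift ^^ k) x) - r (shift ((shift ^^ k) x))\<bar> \<le> K" using x by (intro r) auto
  then have "\<bar>r x - r ((shift ^^ Suc k) x)\<bar> \<le> real k * K + K" using Suc by simp
  then show ?case by (simp add: distrib_right)
qed simp

lemma coboundary_bounded_on_cylinder:
  assumes cont: "shift_continuous E r" and r: "\<And>x. x \<in> X \<Longrightarrow> \<bar>r x - r (shift x)\<bar> \<le> K"
  shows "\<exists>C\<ge>0. \<forall>x\<in>cyl a. \<bar>r x\<bar> \<le> C"
proof -
  obtain z where z: "z \<in> X" "z 0 = a" using cyl_nonempty[of a] by blast
  have "(r \<longlongrightarrow> r z) (cyl_nhds E z)" using cont z unfolding shift_continuous_iff_tendsto by blast
  then have "\<forall>\<^sub>F y in cyl_nhds E z. dist (r y) (r z) < 1" by (rule tendstoD) simp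
  then obtain n where n: "\<And>y. y \<in> X \<Longrightarrow> agree n z y \<Longrightarrow> \<bar>r y - r z\<bar> < 1"
    unfolding eventually_cyl_nhds dist_real_def by blast
  obtain k y where y: "Suc n \<le> k" "y \<in> X" "agree (Suc n) z y" "(shift ^^ k) y = z"
    using cylinder_path[OF z(1) z(1), of n] by blast
  have "\<bar>r x\<bar> \<le> \<bar>r z\<bar> + 1 + real k * K" if x: "x \<in> cyl a" for x
  proof -
    have "(shift ^^ k) y 0 = x 0" using y(4) z(2) x by simp
    then have "splice k y x \<in> X" using y(2) x by (intro splice_in_sigma) (auto simp: funpow_shift)
    moreover have "agree n z (splice k y x)" using y(1,3) by (auto simp: agree_def splice_def)
    ultimately have "\<bar>r (splice k y x) - r z\<bar> < 1" "\<bar>r (splice k y x) - r x\<bar> \<le> real k * K"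
      using n coboundary_iterate_le[of r K "splice k y x" k, OF r] by auto
    then show ?thesis by linarith
  qed
  moreover have "0 \<le> \<bar>r z\<bar> + 1 + real k * K" using r[OF z(1)] by simp
  ultimately show ?thesis by blast
qed

lemma away_eq_1:
  assumes "x \<in> X" "\<And>j y. 1 \<le> j \<Longrightarrow> j \<le> k \<Longrightarrow> y \<in> cyl a \<Longrightarrow> (shift ^^ j) y \<noteq> x"
  shows "away k x = 1"
  using assms
proof (induction k arbitrary: x)
  case (Suc k)
  have "away k (case_nat c x) = 1" if c: "E c (x 0)" for c
  proof (rule Suc.IH)
    show "case_nat c x \<in> X" using c Suc.prems(1) by simp
    fix j y assume j: "1 \<le> j" "j \<le> k" "y \<in> cyl a"
    show "(shift ^^ j) y \<noteq> case_nat c x"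
    proof
      assume "(shift ^^ j) y = case_nat c x"
      then show False using Suc.prems(2)[of "Suc j" y] j by simp
    qed
  qed
  moreover have "\<not> E a (x 0)" using Suc.prems(2)[of 1 "case_nat a x"] Suc.prems(1) by auto
  ultimately have "T_out (away k) x = T (\<lambda>_. 1) x"
    unfolding ruelle_def by (intro nn_integral_cong) auto
  then show ?case using T_1[OF Suc.prems(1)] by (simp add: away_def)
qed (simp add: away_def)

text \<open>If no path of length at most \<open>k\<close> leads from \<open>a\<close> to \<open>x\<close> then \<open>away k x = 1\<close>, so \<open>weight x\<close> is at least the
  length of a shortest path.\<close>

lemma path_length_le_weight:
  assumes x: "x \<in> X"
  shows "\<exists>N y. y \<in> cyl a \<and> (shift ^^ N) y = x \<and> real N \<le> weight x"
proof -
  define N where "N = (LEAST N. 1 \<le> N \<and> (\<exists>y\<in>cyl a. (shift ^^ N) y = x))"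
  obtain n y where "n \<ge> 1" "y \<in> X" "y 0 = a" "(shift ^^ n) y = x" using path_to[OF x, of a] by blast
  then have "\<exists>n. 1 \<le> n \<and> (\<exists>y\<in>cyl a. (shift ^^ n) y = x)" by auto
  then have N: "1 \<le> N \<and> (\<exists>y\<in>cyl a. (shift ^^ N) y = x)" unfolding N_def by (rule LeastI_ex)
  have "away k x = 1" if k: "k < N" for k
  proof (rule away_eq_1[OF x])
    fix j y assume "1 \<le> j" "j \<le> k" "y \<in> cyl a"
    then show "(shift ^^ j) y \<noteq> x" using not_less_Least[of j "\<lambda>N. 1 \<le> N \<and> (\<exists>y\<in>cyl a. (shift ^^ N) y = x)"] k
      unfolding N_def[symmetric] by auto
  qed
  then have "ennreal (real N) = (\<Sum>k<N. away k x)" by (simp add: ennreal_of_nat_eq_real_of_nat)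
  also have "... \<le> ennreal (weight x)" unfolding weight[OF x, symmetric] green_away_eq by (rule sum_le_suminf) auto
  finally have "real N \<le> weight x" using weight_ge_1[OF x] by (subst (asm) ennreal_le_iff) auto
  then show ?thesis using N by blast
qed

lemma coboundary_le_weight:
  assumes cont: "shift_continuous E r" and r: "\<And>x. x \<in> X \<Longrightarrow> \<bar>r x - r (shift x)\<bar> \<le> K"
  shows "\<exists>C\<ge>0. \<forall>x\<in>X. \<bar>r x\<bar> \<le> C * weight x"
proof -
  obtain C where C: "0 \<le> C" "\<And>x. x \<in> cyl a \<Longrightarrow> \<bar>r x\<bar> \<le> C" using coboundary_bounded_on_cylinder[OF cont r] by blast
  obtain z where "z \<in> X" using cyl_nonempty[of a] by blast
  then have K: "0 \<le> K" using r[of z] by linarith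
  have "\<bar>r x\<bar> \<le> (C + K) * weight x" if x: "x \<in> X" for x
  proof -
    obtain N y where y: "y \<in> cyl a" "(shift ^^ N) y = x" "real N \<le> weight x" using path_length_le_weight[OF x] by blast
    have "\<bar>r y - r x\<bar> \<le> real N * K" using coboundary_iterate_le[of r K y N, OF r] y by auto
    then have "\<bar>r x\<bar> \<le> C + real N * K" using C(2)[OF y(1)] by linarith
    also have "... \<le> C * weight x + weight x * K"
      using mult_left_mono[OF weight_ge_1[OF x] C(1)] mult_right_mono[OF y(3) K] by simp
    finally show ?thesis by (simp add: algebra_simps)
  qed
  then show ?thesis using C(1) K by (intro exI[of _ "C + K"]) auto
qed

end

section \<open>The transfer operator on real functions\<close>

lemma enn2real_integral:
  assumes u: "u \<in> borel_measurable M" "(\<integral>\<^sup>+x. u x \<partial>M) \<noteq> top"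
  shows "integrable M (\<lambda>x. enn2real (u x))" "(\<integral>x. enn2real (u x) \<partial>M) = enn2real (\<integral>\<^sup>+x. u x \<partial>M)"
proof -
  have "AE x in M. u x \<noteq> top" using nn_integral_PInf_AE[OF u(1)] u(2) by simp
  then have eq: "(\<integral>\<^sup>+x. ennreal (enn2real (u x)) \<partial>M) = (\<integral>\<^sup>+x. u x \<partial>M)"
    by (intro nn_integral_cong_AE) (auto simp: less_top)
  show "integrable M (\<lambda>x. enn2real (u x))"
    using u eq by (intro integrableI_nonneg) (auto simp: less_top)
  show "(\<integral>x. enn2real (u x) \<partial>M) = enn2real (\<integral>\<^sup>+x. u x \<partial>M)"
    using u(1) eq by (subst integral_eq_nn_integral) auto
qed

lemma enn2real_dist_le_iff:
  assumes "0 \<le> c" "0 \<le> r"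
  shows "t \<noteq> top \<and> \<bar>enn2real t - c\<bar> \<le> r \<longleftrightarrow> ennreal (c - r) \<le> t \<and> t \<le> ennreal (c + r)"
proof (cases t)
  case (real s)
  then show ?thesis using assms by (auto simp: ennreal_le_iff2 simp del: ennreal_plus)
next
  case top
  then show ?thesis by (auto simp: top_unique)
qed

context normalised_shift
begin

definition branch :: "(nat \<Rightarrow> 'a) \<Rightarrow> 'a measure" where
  "branch x = density (count_space UNIV) (\<lambda>b. if E b (x 0) then ennreal (exp (log_g (case_nat b x))) else 0)"

abbreviation transferable :: "'a set \<Rightarrow> ((nat \<Rightarrow> 'a) \<Rightarrow> real) \<Rightarrow> (nat \<Rightarrow> 'a) \<Rightarrow> bool" where
  "transferable S u x \<equiv> set_integrable (branch x) S (\<lambda>b. u (case_nat b x))"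

abbreviation transfer :: "'a set \<Rightarrow> ((nat \<Rightarrow> 'a) \<Rightarrow> real) \<Rightarrow> (nat \<Rightarrow> 'a) \<Rightarrow> real" where
  "transfer S u x \<equiv> (LINT b:S|branch x. u (case_nat b x))"

lemma borel_measurable_branch [measurable]: "f \<in> borel_measurable (branch x)"
  by (simp add: branch_def)

lemma AE_branch: "x \<in> X \<Longrightarrow> (\<And>b. case_nat b x \<in> X \<Longrightarrow> Q b) \<Longrightarrow> AE b in branch x. Q b"
  unfolding branch_def by (subst AE_density) (auto simp: AE_count_space)

lemma nn_integral_branch: "(\<integral>\<^sup>+b. indicator S b * u (case_nat b x) \<partial>branch x) = ruelle E log_g S u x"
  unfolding branch_def ruelle_def
  by (subst nn_integral_density) (auto intro!: nn_integral_cong split: split_indicator)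

lemma prob_space_branch:
  assumes x: "x \<in> X" shows "prob_space (branch x)"
proof
  show "emeasure (branch x) (space (branch x)) = 1"
    using nn_integral_branch[where S=UNIV and u="\<lambda>_. 1"] T_1[OF x] by simp
qed

lemma transfer_enn2real:
  assumes x: "x \<in> X" and u: "\<And>y. y \<in> X \<Longrightarrow> u y \<noteq> top" and fin: "ruelle E log_g S u x \<noteq> top"
  shows "transferable S (\<lambda>y. enn2real (u y)) x"
    and "transfer S (\<lambda>y. enn2real (u y)) x = enn2real (ruelle E log_g S u x)"
proof -
  have "indicator S b *\<^sub>R enn2real (u (case_nat b x)) = enn2real (indicator S b * u (case_nat b x))" for b
    by (simp split: split_indicator)
  then show "transferable S (\<lambda>y. enn2real (u y)) x" "transfer S (\<lambda>y. enn2real (u y)) x = enn2real (ruelle E log_g S u x)"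
    using enn2real_integral[of "\<lambda>b. indicator S b * u (case_nat b x)" "branch x"] fin
    unfolding set_integrable_def set_lebesgue_integral_def nn_integral_branch by auto
qed

lemma transfer_linear:
  assumes "transferable S u x" "transferable S v x"
  shows "transferable S (\<lambda>y. u y + c * v y) x"
    and "transfer S (\<lambda>y. u y + c * v y) x = transfer S u x + c * transfer S v x"
  using assms by auto

lemma transfer_split:
  assumes "transferable S u x" "transferable (- S) u x"
  shows "transferable UNIV u x" "transfer UNIV u x = transfer S u x + transfer (- S) u x"
  using set_integrable_Un[of "branch x" S "\<lambda>b. u (case_nat b x)" "- S"]
    set_integral_Un[of S "- S" "branch x" "\<lambda>b. u (case_nat b x)"] assms
  by (auto simp: branch_def)

lemma transferable_bounded:
  assumes x: "x \<in> X" and u: "\<And>y. y \<in> X \<Longrightarrow> \<bar>u y\<bar> \<le> C"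
  shows "transferable S u x"
proof -
  interpret branch: prob_space "branch x" by (rule prob_space_branch[OF x])
  have "AE b in branch x. norm (indicator S b *\<^sub>R u (case_nat b x)) \<le> max 0 C"
  proof (rule AE_branch[OF x])
    fix b assume "case_nat b x \<in> X"
    from u[OF this] show "norm (indicator S b *\<^sub>R u (case_nat b x)) \<le> max 0 C"
      by (auto split: split_indicator)
  qed
  then show ?thesis unfolding set_integrable_def by (rule branch.integrable_const_bound) simp
qed

lemma transfer_suminf:
  assumes x: "x \<in> X" and f: "\<And>n y. y \<in> X \<Longrightarrow> \<bar>f n y\<bar> \<le> e n" and e: "summable e"
  shows "(\<lambda>n. transfer S (f n) x) sums transfer S (\<lambda>y. \<Sum>n. f n y) x"
proof -
  interpret branch: prob_space "branch x" by (rule prob_space_branch[OF x])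
  define F where "F n b = indicator S b *\<^sub>R f n (case_nat b x)" for n b
  have e0: "0 \<le> e n" for n using f[OF x, of n] by linarith
  have F_le: "norm (F n b) \<le> e n" if "case_nat b x \<in> X" for n b
    using f[OF that, of n] e0[of n] by (simp add: F_def split: split_indicator)
  have F: "integrable (branch x) (F n)" for n
    using transferable_bounded[OF x f] unfolding F_def set_integrable_def .
  have "(\<integral>b. norm (F n b) \<partial>branch x) \<le> (\<integral>b. e n \<partial>branch x)" for n
    using F F_le by (intro integral_mono_AE integrable_norm AE_branch[OF x]) auto
  then have "summable (\<lambda>n. \<integral>b. norm (F n b) \<partial>branch x)"
    by (intro summable_comparison_test'[OF e]) (auto simp: branch.prob_space)
  moreover have "AE b in branch x. summable (\<lambda>n. norm (F n b))"
    using F_le by (intro AE_branch[OF x] summable_comparison_test'[OF e, of 0]) auto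
  ultimately have "(\<lambda>n. integral\<^sup>L (branch x) (F n)) sums (\<integral>b. (\<Sum>n. F n b) \<partial>branch x)"
    using F by (intro sums_integral)
  moreover have "(\<integral>b. (\<Sum>n. F n b) \<partial>branch x) = transfer S (\<lambda>y. \<Sum>n. f n y) x"
    unfolding set_lebesgue_integral_def F_def
    by (rule Bochner_Integration.integral_cong) (auto split: split_indicator)
  ultimately show ?thesis by (simp add: F_def[abs_def] set_lebesgue_integral_def)
qed

lemma transfer_mult_shift: "transfer UNIV (\<lambda>y. v y * F (shift y)) x = transfer UNIV v x * F x"
  unfolding set_lebesgue_integral_def by simp

lemma integral_transfer:
  assumes f: "integrable m f" and g: "g \<in> borel_measurable m" "\<And>x. x \<in> X \<Longrightarrow> transfer UNIV f x = g x"
  shows "(\<integral>x. g x \<partial>m) = (\<integral>x. f x \<partial>m)"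
proof -
  have T_part: "integrable m (\<lambda>x. enn2real (T (\<lambda>y. ennreal (u y)) x))"
      "(\<integral>x. enn2real (T (\<lambda>y. ennreal (u y)) x) \<partial>m) = enn2real (\<integral>\<^sup>+x. ennreal (u x) \<partial>m)"
      "AE x in m. T (\<lambda>y. ennreal (u y)) x \<noteq> top" if u: "integrable m u" for u
  proof -
    have meas: "(\<lambda>y. ennreal (u y)) \<in> borel_measurable m" using borel_measurable_integrable[OF u] by measurable
    note T_meas = ruelle_log_g_measurable[OF meas]
    have fin: "(\<integral>\<^sup>+x. T (\<lambda>y. ennreal (u y)) x \<partial>m) \<noteq> top"
      using u unfolding nn_integral_T[OF meas] real_integrable_def by simp
    show "integrable m (\<lambda>x. enn2real (T (\<lambda>y. ennreal (u y)) x))"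
      "(\<integral>x. enn2real (T (\<lambda>y. ennreal (u y)) x) \<partial>m) = enn2real (\<integral>\<^sup>+x. ennreal (u x) \<partial>m)"
      using enn2real_integral[OF T_meas fin] by (simp_all add: nn_integral_T[OF meas])
    show "AE x in m. T (\<lambda>y. ennreal (u y)) x \<noteq> top"
      using nn_integral_PInf_AE[OF T_meas] fin by simp
  qed
  note pos = T_part[OF f] and neg = T_part[OF integrable_minus[OF f]]
  have "AE x in m. g x = enn2real (T (\<lambda>y. ennreal (f y)) x) - enn2real (T (\<lambda>y. ennreal (- f y)) x)"
    using pos(3) neg(3) AE_space
  proof eventually_elim
    case (elim x)
    have "(\<integral>\<^sup>+b. ennreal (u (case_nat b x)) \<partial>branch x) = T (\<lambda>y. ennreal (u y)) x" for u
      using nn_integral_branch[where S=UNIV and u="\<lambda>y. ennreal (u y)"] by simp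
    from this[of f] this[of "\<lambda>y. - f y"] show ?case
      using elim g(2)[of x] real_lebesgue_integral_def[of "branch x" "\<lambda>b. f (case_nat b x)"]
      by (simp add: real_integrable_def set_lebesgue_integral_def)
  qed
  then have "(\<integral>x. g x \<partial>m) =
      (\<integral>x. enn2real (T (\<lambda>y. ennreal (f y)) x) - enn2real (T (\<lambda>y. ennreal (- f y)) x) \<partial>m)"
    using pos(1) neg(1) g(1) by (intro integral_cong_AE) auto
  also have "... = (\<integral>x. f x \<partial>m)"
    using pos(1,2) neg(1,2) real_lebesgue_integral_def[OF f] by simp
  finally show ?thesis .
qed

end

section \<open>The Poisson equation\<close>

lemma (in markov_shift) log_lip_real_continuous:
  assumes "log_lip X D u" "\<And>x. x \<in> X \<Longrightarrow> u x \<noteq> top"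
  shows "shift_continuous E (\<lambda>x. enn2real (u x))"
  using assms by (intro log_lip_continuous[of D]) (auto intro: log_lip_cong simp: less_top)

lemma shift_continuous_linear:
  "shift_continuous E f \<Longrightarrow> shift_continuous E g \<Longrightarrow> shift_continuous E (\<lambda>x. f x + c * g x)"
  unfolding shift_continuous_iff_tendsto by (auto intro!: tendsto_add tendsto_mult_left)

context markov_shift
begin

definition holder :: "real \<Rightarrow> ((nat \<Rightarrow> 'a) \<Rightarrow> real) \<Rightarrow> bool" where
  "holder K \<psi> \<longleftrightarrow> (\<forall>x\<in>X. \<bar>\<psi> x\<bar> \<le> K) \<and> (\<forall>n\<ge>1. \<forall>x\<in>X. \<forall>y\<in>X. agree n x y \<longrightarrow> \<bar>\<psi> x - \<psi> y\<bar> \<le> K * \<theta> ^ n)"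

lemma holder_bound: "holder K \<psi> \<Longrightarrow> x \<in> X \<Longrightarrow> \<bar>\<psi> x\<bar> \<le> K"
  by (simp add: holder_def)

lemma wholder_holder: "holder K \<psi> \<Longrightarrow> wholder K \<psi>"
  by (auto simp: holder_def wholder_def)

lemma holder_mono: "holder K \<psi> \<Longrightarrow> K \<le> K' \<Longrightarrow> holder K' \<psi>"
  unfolding holder_def by (meson less_imp_le mult_right_mono order_trans theta_pow(1))

end

context normalised_shift
begin

abbreviation return_op :: "((nat \<Rightarrow> 'a) \<Rightarrow> ennreal) \<Rightarrow> (nat \<Rightarrow> 'a) \<Rightarrow> ennreal" where
  "return_op \<equiv> induced log_g a"

abbreviation lip_const :: real where
  "lip_const \<equiv> invariant_const log_g_const + 1"

lemma lip_const: "0 \<le> lip_const" "1 \<le> lip_const" "0 \<le> \<theta> * (log_g_const + lip_const)"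
    "\<theta> * (log_g_const + lip_const) < lip_const"
proof -
  have "\<theta> * (log_g_const + lip_const) = invariant_const log_g_const + \<theta>"
    using invariant_const[of log_g_const] by (simp add: distrib_left)
  then show "0 \<le> \<theta> * (log_g_const + lip_const)" "\<theta> * (log_g_const + lip_const) < lip_const"
    using theta invariant_const_nonneg[OF log_g_const_nonneg] by auto
qed (use invariant_const_nonneg[OF log_g_const_nonneg] in auto)

definition rate :: real where
  "rate = contraction_rate lip_const (\<theta> * (log_g_const + lip_const))"

lemma rate: "0 \<le> rate" "rate < 1"
  unfolding rate_def using contraction_rate_bounds[OF lip_const(3,4)] by auto

lemma return_op_const: "x \<in> X \<Longrightarrow> return_op (\<lambda>_. c) x = c"
  using induced_cmult[of log_g a c "\<lambda>_. 1" x] induced_log_g_1[of x] by simp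

lemma averaging_return_op: "averaging a return_op"
  unfolding averaging_def by (auto simp: induced_add return_op_const intro: induced_mono)

lemma return_op_iterates_converge:
  assumes u: "log_lip X lip_const u" and S: "\<And>x. x \<in> cyl a \<Longrightarrow> u x \<le> ennreal S" "0 \<le> S"
  shows "\<exists>c\<ge>0. \<forall>n. \<forall>x\<in>X. (return_op ^^ Suc n) u x \<noteq> top \<and> \<bar>enn2real ((return_op ^^ Suc n) u x) - c\<bar> \<le> rate ^ n * S"
proof -
  have "log_lip (cyl a) (\<theta> * (log_g_const + lip_const)) (return_op v)" if "log_lip (cyl a) lip_const v" for v
    using lip_const by (intro log_lip_subset[OF log_lip_induced[OF wholder_log_g that]]) auto
  then obtain c where c: "0 \<le> c" "\<And>n x. x \<in> cyl a \<Longrightarrow>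
      (return_op ^^ n) u x \<noteq> top \<and> \<bar>enn2real ((return_op ^^ n) u x) - c\<bar> \<le> rate ^ n * S"
    using averaging_iterates_converge[of a "\<lambda>_. return_op" lip_const "\<theta> * (log_g_const + lip_const)" "\<lambda>n. (return_op ^^ n) u" S]
      averaging_return_op lip_const S log_lip_subset[OF u] unfolding rate_def by auto
  have "(return_op ^^ Suc n) u x \<noteq> top \<and> \<bar>enn2real ((return_op ^^ Suc n) u x) - c\<bar> \<le> rate ^ n * S"
    if x: "x \<in> X" for n x
  proof -
    have r: "0 \<le> rate ^ n * S" using rate S(2) by simp
    have "ennreal (c - rate ^ n * S) \<le> (return_op ^^ n) u y \<and> (return_op ^^ n) u y \<le> ennreal (c + rate ^ n * S)"
      if "y \<in> cyl a" for y
      using c(2)[OF that, of n] enn2real_dist_le_iff[OF c(1) r] by blast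
    then have "return_op (\<lambda>_. ennreal (c - rate ^ n * S)) x \<le> (return_op ^^ Suc n) u x"
      "(return_op ^^ Suc n) u x \<le> return_op (\<lambda>_. ennreal (c + rate ^ n * S)) x"
      using x by (auto intro!: induced_mono)
    then show ?thesis unfolding return_op_const[OF x] using enn2real_dist_le_iff[OF c(1) r] by blast
  qed
  then show ?thesis using c(1) by blast
qed

definition real_iterate :: "((nat \<Rightarrow> 'a) \<Rightarrow> ennreal) \<Rightarrow> nat \<Rightarrow> (nat \<Rightarrow> 'a) \<Rightarrow> real" where
  "real_iterate u n x = enn2real ((return_op ^^ n) u x)"

lemma real_iterate_Suc:
  assumes fin: "\<And>n x. x \<in> X \<Longrightarrow> (return_op ^^ n) u x \<noteq> top" and x: "x \<in> X"
  shows "transferable {a} (real_iterate u n) x" "transferable (- {a}) (real_iterate u (Suc n)) x"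
    and "real_iterate u (Suc n) x = transfer {a} (real_iterate u n) x + transfer (- {a}) (real_iterate u (Suc n)) x"
proof -
  have unfold: "(return_op ^^ Suc n) u x = T_in ((return_op ^^ n) u) x + T_out ((return_op ^^ Suc n) u) x"
    using induced_unfold[of log_g a "(return_op ^^ n) u" x] by simp
  then have fin': "T_in ((return_op ^^ n) u) x \<noteq> top" "T_out ((return_op ^^ Suc n) u) x \<noteq> top"
    using fin[OF x, of "Suc n"] by auto
  then have eq: "real_iterate u (Suc n) x = enn2real (T_in ((return_op ^^ n) u) x) + enn2real (T_out ((return_op ^^ Suc n) u) x)"
    unfolding real_iterate_def unfold by (simp only: enn2real_plus less_top)
  show "transferable {a} (real_iterate u n) x" "transferable (- {a}) (real_iterate u (Suc n)) x"
    unfolding real_iterate_def[abs_def] using fin fin' by (intro transfer_enn2real x; blast)+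
  show "real_iterate u (Suc n) x = transfer {a} (real_iterate u n) x + transfer (- {a}) (real_iterate u (Suc n)) x"
    unfolding eq unfolding real_iterate_def[abs_def] using fin fin'
    by (intro arg_cong2[where f="(+)"] transfer_enn2real(2)[symmetric] x; blast)
qed

lemma real_iterate_continuous:
  assumes u: "log_lip X lip_const u" and fin: "\<And>x. x \<in> X \<Longrightarrow> (return_op ^^ n) u x \<noteq> top"
  shows "shift_continuous E (real_iterate u n)"
  unfolding real_iterate_def[abs_def]
  using lip_const by (intro log_lip_real_continuous[OF log_lip_induced_funpow[OF wholder_log_g u]] fin) auto

lemma real_iterate_green:
  assumes fin: "\<And>x. x \<in> X \<Longrightarrow> green E log_g (- {a}) (\<lambda>x. ennreal (w x)) x \<noteq> top" and w: "0 \<le> w x" and x: "x \<in> X"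
  defines "u \<equiv> green E log_g (- {a}) (\<lambda>x. ennreal (w x))"
  shows "transferable (- {a}) (real_iterate u 0) x"
    and "real_iterate u 0 x = w x + transfer (- {a}) (real_iterate u 0) x"
proof -
  have unfold: "u x = ennreal (w x) + T_out u x" unfolding u_def by (rule green_unfold)
  then have "T_out u x \<noteq> top" using fin[OF x] unfolding u_def by auto
  then show "transferable (- {a}) (real_iterate u 0) x" "real_iterate u 0 x = w x + transfer (- {a}) (real_iterate u 0) x"
    using transfer_enn2real[OF x, of u "- {a}"] fin unfold w
    unfolding real_iterate_def[abs_def] by (auto simp: u_def enn2real_plus less_top)
qed

text \<open>The recursion is summed over \<open>n\<close>; the unbounded term \<open>d 0\<close> enters the sum only through its values on
  the cylinder of \<open>a\<close>.\<close>

lemma poisson_of_iterates: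
  assumes x: "x \<in> X"
    and w: "transferable (- {a}) (d 0) x" "d 0 x = f x + transfer (- {a}) (d 0) x"
    and d: "\<And>n. transferable {a} (d n) x" "\<And>n. d (Suc n) x = transfer {a} (d n) x + transfer (- {a}) (d (Suc n)) x"
    and e: "\<And>n y. y \<in> X \<Longrightarrow> \<bar>d (Suc n) y\<bar> \<le> e n" "summable e"
  defines "v \<equiv> \<lambda>y. d 0 y + (\<Sum>n. d (Suc n) y)"
  shows "transfer UNIV v x = v x - f x"
proof -
  define s where "s y = (\<Sum>n. d (Suc n) y)" for y
  have "\<bar>s y\<bar> \<le> suminf e" if y: "y \<in> X" for y
    unfolding s_def using norm_suminf_le[of "\<lambda>n. d (Suc n) y" e] e y by simp
  then have s: "transferable S s x" for S by (rule transferable_bounded[OF x])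
  have sums: "(\<lambda>n. transfer S (d (Suc n)) x) sums transfer S s x" for S
    unfolding s_def using e by (rule transfer_suminf[OF x])
  have "(\<lambda>n. transfer {a} (d n) x) sums (transfer {a} s x + transfer {a} (d 0) x)"
    using sums[of "{a}"] by (rule sums_Suc)
  from sums_add[OF this sums[of "- {a}"]]
  have "s x = transfer {a} s x + transfer {a} (d 0) x + transfer (- {a}) s x"
    unfolding s_def d(2)[symmetric] by (rule sums_unique[symmetric])
  then show ?thesis
    using transfer_linear[OF d(1)[of 0] s, of 1] transfer_linear[OF w(1) s, of 1] w(2)
      transfer_split[where S="{a}" and u=v and x=x]
    unfolding v_def s_def[symmetric] by simp
qed

context
  fixes K :: real and \<psi> :: "(nat \<Rightarrow> 'a) \<Rightarrow> real" and C :: real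
  assumes K: "0 < K" and psi: "holder K \<psi>" and C: "0 \<le> C" "\<And>x. x \<in> cyl a \<Longrightarrow> weight x \<le> C"
begin

definition source :: "(nat \<Rightarrow> 'a) \<Rightarrow> real" where
  "source x = \<psi> x + 2 * K"

lemma source: "x \<in> X \<Longrightarrow> K \<le> source x" "x \<in> X \<Longrightarrow> source x \<le> 3 * K"
  using holder_bound[OF psi, of x] by (auto simp: source_def abs_le_iff)

abbreviation green_source :: "(nat \<Rightarrow> 'a) \<Rightarrow> ennreal" where
  "green_source \<equiv> green E log_g (- {a}) (\<lambda>x. ennreal (source x))"

lemma log_lip_source: "log_lip X lip_const (\<lambda>x. ennreal (source x))"
proof -
  have "log_lip X 1 (\<lambda>x. ennreal (source x))"
  proof (rule log_lip_of_lipschitz[OF K source(1)])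
    fix n x y assume "1 \<le> n" "x \<in> X" "y \<in> X" "agree n x y"
    then show "\<bar>source x - source y\<bar> \<le> K * (1 * \<theta> ^ n)" using psi by (simp add: holder_def source_def)
  qed
  then show ?thesis using lip_const(2) by (rule log_lip_mono)
qed

lemma log_lip_green_source: "log_lip X lip_const green_source"
  using lip_const by (intro log_lip_green[OF wholder_log_g log_lip_source]) auto

lemma log_lip_green_away_lip_const: "log_lip X lip_const green_away"
  by (rule log_lip_mono[OF log_lip_green_away]) simp

lemma green_source_iterate_le:
  "x \<in> X \<Longrightarrow> (return_op ^^ n) green_source x \<le> ennreal (3 * K) * (return_op ^^ n) green_away x"
proof (induction n arbitrary: x)
  case 0
  have "green_source x \<le> green E log_g (- {a}) (\<lambda>_. ennreal (3 * K) * 1) x"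
    using source(2) 0 by (intro green_mono) (auto intro: ennreal_leI)
  then show ?case by (simp only: green_cmult funpow_0)
next
  case (Suc n)
  have "return_op ((return_op ^^ n) green_source) x \<le> return_op (\<lambda>y. ennreal (3 * K) * (return_op ^^ n) green_away y) x"
    using Suc by (intro induced_mono) auto
  then show ?case by (simp add: induced_cmult)
qed

lemma green_away_le: "x \<in> cyl a \<Longrightarrow> green_away x \<le> ennreal C"
  using C(2)[of x] weight[of x] by (simp add: ennreal_leI)

lemma green_source_le: "x \<in> cyl a \<Longrightarrow> green_source x \<le> ennreal (3 * K * C)"
  using green_source_iterate_le[of x 0] mult_left_mono[OF green_away_le[of x], of "ennreal (3 * K)"] K C(1)
  by (simp add: ennreal_mult[symmetric] order_trans)

lemma iterate_green_away_finite: "x \<in> X \<Longrightarrow> (return_op ^^ n) green_away x \<noteq> top"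
  using return_op_iterates_converge[OF log_lip_green_away_lip_const green_away_le C(1)] green_away_finite
  by (cases n) auto

lemma iterate_green_source_finite: "x \<in> X \<Longrightarrow> (return_op ^^ n) green_source x \<noteq> top"
  using green_source_iterate_le[of x n] iterate_green_away_finite[of x n]
  by (auto simp: top_unique ennreal_mult_eq_top_iff)

lemma real_iterate_green_source_le: "x \<in> X \<Longrightarrow> real_iterate green_source n x \<le> 3 * K * real_iterate green_away n x"
  using enn2real_mono[OF green_source_iterate_le[of x n]] iterate_green_away_finite[of x n] K
  unfolding real_iterate_def by (simp add: enn2real_mult ennreal_mult_less_top less_top)

lemma one_le_iterate_green_away: "x \<in> X \<Longrightarrow> 1 \<le> (return_op ^^ n) green_away x"
proof (induction n arbitrary: x)
  case 0
  then show ?case using green_ge(1)[of "\<lambda>_. 1"] by simp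
next
  case (Suc n)
  have "return_op (\<lambda>_. 1) x \<le> return_op ((return_op ^^ n) green_away) x"
    using Suc by (intro induced_mono) auto
  then show ?case using return_op_const[OF Suc.prems, of 1] by simp
qed
lemma iterates_nearly_proportional:
  "\<exists>\<kappa>\<ge>0. \<kappa> \<le> 3 * K \<and> (\<forall>n. \<forall>x\<in>X.
    \<bar>real_iterate green_source (Suc n) x + (- \<kappa>) * real_iterate green_away (Suc n) x\<bar> \<le> 6 * K * C * rate ^ n)"
proof -
  obtain p where p: "0 \<le> p" "\<And>n x. x \<in> X \<Longrightarrow> \<bar>real_iterate green_source (Suc n) x - p\<bar> \<le> rate ^ n * (3 * K * C)"
    using return_op_iterates_converge[OF log_lip_green_source green_source_le] K C(1) unfolding real_iterate_def by auto
  obtain q where q: "0 \<le> q" "\<And>n x. x \<in> X \<Longrightarrow> \<bar>real_iterate green_away (Suc n) x - q\<bar> \<le> rate ^ n * C"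
    using return_op_iterates_converge[OF log_lip_green_away_lip_const green_away_le C(1)] unfolding real_iterate_def by auto
  obtain z where z: "z \<in> X" using cyl_nonempty[of a] by blast
  have lim: "t \<longlonglongrightarrow> l" if "\<And>n. \<bar>t n - l\<bar> \<le> rate ^ n * S" for t l S
  proof (rule LIM_zero_cancel[OF Lim_null_comparison])
    show "\<forall>\<^sub>F n in sequentially. norm (t n - l) \<le> rate ^ n * S" using that by simp
    show "(\<lambda>n. rate ^ n * S) \<longlonglongrightarrow> 0" using rate by (intro tendsto_mult_left_zero LIMSEQ_power_zero) simp
  qed
  have p_lim: "(\<lambda>n. real_iterate green_source (Suc n) z) \<longlonglongrightarrow> p" by (rule lim[OF p(2)[OF z]])
  have q_lim: "(\<lambda>n. real_iterate green_away (Suc n) z) \<longlonglongrightarrow> q" by (rule lim[OF q(2)[OF z]])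
  have "1 \<le> real_iterate green_away (Suc n) z" for n
    using enn2real_mono[OF one_le_iterate_green_away[OF z, of "Suc n"]] iterate_green_away_finite[OF z, of "Suc n"]
    by (simp add: real_iterate_def less_top)
  then have q_ge_1: "1 \<le> q" using q_lim by (intro LIMSEQ_le_const) auto
  have pq: "p \<le> 3 * K * q"
    using real_iterate_green_source_le[OF z] by (intro LIMSEQ_le[OF p_lim tendsto_mult_left[OF q_lim]]) auto
  define \<kappa> where "\<kappa> = p / q"
  have \<kappa>: "0 \<le> \<kappa>" "\<kappa> \<le> 3 * K" "\<kappa> * q = p" using p(1) q_ge_1 pq by (auto simp: \<kappa>_def field_simps)
  have "\<bar>real_iterate green_source (Suc n) x + (- \<kappa>) * real_iterate green_away (Suc n) x\<bar> \<le> 6 * K * C * rate ^ n"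
    if x: "x \<in> X" for n x
  proof -
    have "\<kappa> * \<bar>real_iterate green_away (Suc n) x - q\<bar> \<le> (3 * K) * (rate ^ n * C)"
      using \<kappa> q(2)[OF x, of n] K by (intro mult_mono) auto
    moreover have "\<kappa> * \<bar>real_iterate green_away (Suc n) x - q\<bar> = \<bar>\<kappa> * real_iterate green_away (Suc n) x - p\<bar>"
      unfolding \<kappa>(3)[symmetric] right_diff_distrib[symmetric] using \<kappa>(1) by (simp add: abs_mult)
    ultimately show ?thesis using p(2)[OF x, of n] by (simp add: abs_le_iff ac_simps)
  qed
  then show ?thesis using \<kappa> by blast
qed

context
  fixes \<kappa> :: real
  assumes \<kappa>: "0 \<le> \<kappa>" "\<kappa> \<le> 3 * K"
    and nearly_proportional: "\<And>n x. x \<in> X \<Longrightarrow>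
      \<bar>real_iterate green_source (Suc n) x + (- \<kappa>) * real_iterate green_away (Suc n) x\<bar> \<le> 6 * K * C * rate ^ n"
begin

definition fluctuation :: "nat \<Rightarrow> (nat \<Rightarrow> 'a) \<Rightarrow> real" where
  "fluctuation n x = real_iterate green_source n x + (- \<kappa>) * real_iterate green_away n x"

definition poisson_solution :: "(nat \<Rightarrow> 'a) \<Rightarrow> real" where
  "poisson_solution x = fluctuation 0 x + (\<Sum>n. fluctuation (Suc n) x)"

lemma fluctuation_le: "x \<in> X \<Longrightarrow> \<bar>fluctuation (Suc n) x\<bar> \<le> 6 * K * C * rate ^ n"
  unfolding fluctuation_def by (rule nearly_proportional)

lemma fluctuation_bound_sums: "(\<lambda>n. 6 * K * C * rate ^ n) sums (6 * K * C * (1 / (1 - rate)))"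
  using rate by (intro sums_mult geometric_sums) auto

lemma poisson_solution_continuous: "shift_continuous E poisson_solution"
proof -
  have cont: "shift_continuous E (fluctuation n)" for n
    unfolding fluctuation_def[abs_def]
    by (intro shift_continuous_linear real_iterate_continuous log_lip_green_source log_lip_green_away_lip_const
        iterate_green_source_finite iterate_green_away_finite)
  have "shift_continuous E (\<lambda>x. \<Sum>n<N. fluctuation (Suc n) x)" for N
    using cont unfolding shift_continuous_iff_tendsto by (auto intro!: tendsto_sum)
  moreover have "uniform_limit X (\<lambda>N x. \<Sum>n<N. fluctuation (Suc n) x) (\<lambda>x. \<Sum>n. fluctuation (Suc n) x) sequentially"
    using fluctuation_le by (intro Weierstrass_m_test[OF _ sums_summable[OF fluctuation_bound_sums]]) auto
  ultimately have "shift_continuous E (\<lambda>x. \<Sum>n. fluctuation (Suc n) x)"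
    by (rule shift_continuous_uniform_limit)
  from shift_continuous_linear[OF cont[of 0] this, of 1] show ?thesis by (simp add: poisson_solution_def[abs_def])
qed

lemma poisson_solution_le:
  assumes x: "x \<in> X"
  shows "\<bar>poisson_solution x\<bar> \<le> (3 + 6 * C / (1 - rate)) * K * weight x"
proof -
  have "\<bar>\<Sum>n. fluctuation (Suc n) x\<bar> \<le> 6 * K * C * (1 / (1 - rate))"
    using norm_suminf_le[of "\<lambda>n. fluctuation (Suc n) x" "\<lambda>n. 6 * K * C * rate ^ n"] fluctuation_le[OF x]
      sums_summable[OF fluctuation_bound_sums] sums_unique[OF fluctuation_bound_sums] by simp
  also have "... \<le> 6 * K * C * (1 / (1 - rate)) * weight x"
    using mult_left_mono[OF weight_ge_1[OF x], of "6 * K * C * (1 / (1 - rate))"] K C(1) rate by simp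
  finally have tail: "\<bar>\<Sum>n. fluctuation (Suc n) x\<bar> \<le> 6 * K * C * (1 / (1 - rate)) * weight x" .
  have "real_iterate green_away 0 x = weight x" by (simp add: real_iterate_def weight_def)
  moreover have "0 \<le> \<kappa> * weight x" "\<kappa> * weight x \<le> 3 * K * weight x"
    using \<kappa> weight_ge_1[OF x] by (auto intro: mult_right_mono)
  moreover have "0 \<le> real_iterate green_source 0 x" by (simp add: real_iterate_def)
  ultimately have "\<bar>fluctuation 0 x\<bar> \<le> 3 * K * weight x"
    using real_iterate_green_source_le[OF x, of 0] by (simp add: fluctuation_def abs_le_iff)
  then have "\<bar>poisson_solution x\<bar> \<le> 3 * K * weight x + 6 * K * C * (1 / (1 - rate)) * weight x"
    using tail by (simp add: poisson_solution_def)
  then show ?thesis by (simp add: algebra_simps)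
qed

lemma transfer_poisson_solution:
  assumes x: "x \<in> X"
  shows "transfer UNIV poisson_solution x = poisson_solution x - (\<psi> x - (\<kappa> - 2 * K))"
proof -
  have "0 \<le> source x" using source(1)[OF x] K by simp
  note source_green = real_iterate_green[OF iterate_green_source_finite[of _ 0, simplified] this x]
  note away_green = real_iterate_green[of "\<lambda>_. 1" x, simplified, OF green_away_finite x]
  note source_iterate = real_iterate_Suc[OF iterate_green_source_finite x]
  note away_iterate = real_iterate_Suc[OF iterate_green_away_finite x]
  have "transfer UNIV poisson_solution x = poisson_solution x - (source x + (- \<kappa>) * 1)"
    unfolding poisson_solution_def[abs_def]
  proof (rule poisson_of_iterates[OF x])
    show "transferable (- {a}) (fluctuation 0) x"
      "fluctuation 0 x = source x + (- \<kappa>) * 1 + transfer (- {a}) (fluctuation 0) x"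
      using transfer_linear[OF source_green(1) away_green(1), where c="- \<kappa>"] source_green(2) away_green(2)
      unfolding fluctuation_def[abs_def] by (simp_all add: algebra_simps)
    show "transferable {a} (fluctuation n) x"
      "fluctuation (Suc n) x = transfer {a} (fluctuation n) x + transfer (- {a}) (fluctuation (Suc n)) x" for n
      using transfer_linear[OF source_iterate(1)[of n] away_iterate(1)[of n], where c="- \<kappa>"]
        transfer_linear[OF source_iterate(2)[of n] away_iterate(2)[of n], where c="- \<kappa>"] source_iterate(3)[of n] away_iterate(3)[of n]
      unfolding fluctuation_def[abs_def] by (simp_all add: algebra_simps)
  qed (rule fluctuation_le sums_summable[OF fluctuation_bound_sums], assumption?)+
  then show ?thesis by (simp add: source_def)
qed

end

lemma poisson_equation_holder:
  "\<exists>v \<kappa>. shift_continuous E v \<and> (\<forall>x\<in>X. \<bar>v x\<bar> \<le> (3 + 6 * C / (1 - rate)) * K * weight x) \<and> \<bar>\<kappa>\<bar> \<le> 2 * K \<and>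
    (\<forall>x\<in>X. transfer UNIV v x = v x - (\<psi> x - \<kappa>))"
proof -
  obtain \<kappa> where \<kappa>: "0 \<le> \<kappa>" "\<kappa> \<le> 3 * K" "\<And>n x. x \<in> X \<Longrightarrow>
      \<bar>real_iterate green_source (Suc n) x + (- \<kappa>) * real_iterate green_away (Suc n) x\<bar> \<le> 6 * K * C * rate ^ n"
    using iterates_nearly_proportional by blast
  have "\<bar>\<kappa> - 2 * K\<bar> \<le> 2 * K" using \<kappa>(1,2) K by (simp add: abs_le_iff)
  then show ?thesis
    using poisson_solution_continuous[OF \<kappa>] poisson_solution_le[OF \<kappa>] transfer_poisson_solution[OF \<kappa>] by blast
qed

end

theorem poisson_equation:
  "\<exists>C\<ge>0. \<forall>K>0. \<forall>\<psi>. holder K \<psi> \<longrightarrow> (\<exists>v \<kappa>. shift_continuous E v \<and> (\<forall>x\<in>X. \<bar>v x\<bar> \<le> C * K * weight x) \<and> \<bar>\<kappa>\<bar> \<le> 2 * K \<and>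
    (\<forall>x\<in>X. transfer UNIV v x = v x - (\<psi> x - \<kappa>)))"
proof -
  obtain C where C: "0 \<le> C" "\<And>x. x \<in> cyl a \<Longrightarrow> weight x \<le> C" using weight_bounded by blast
  have "0 \<le> 3 + 6 * C / (1 - rate)" using C(1) rate by simp
  then show ?thesis using poisson_equation_holder[OF _ _ C] by blast
qed

end

section \<open>Asymptotic variance\<close>

definition square_integrable :: "'b measure \<Rightarrow> ('b \<Rightarrow> real) \<Rightarrow> bool" where
  "square_integrable M f \<longleftrightarrow> f \<in> borel_measurable M \<and> integrable M (\<lambda>x. (f x)\<^sup>2)"

lemma square_integrableD:
  assumes "square_integrable M f" shows "f \<in> borel_measurable M" "integrable M (\<lambda>x. (f x)\<^sup>2)"
  using assms by (auto simp: square_integrable_def)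

lemma square_integrable_bound:
  assumes f: "square_integrable M f" and g: "g \<in> borel_measurable M" "\<And>x. x \<in> space M \<Longrightarrow> \<bar>g x\<bar> \<le> \<bar>f x\<bar>"
  shows "square_integrable M g"
proof -
  have "integrable M (\<lambda>x. (g x)\<^sup>2)"
    using g by (intro Bochner_Integration.integrable_bound[OF square_integrableD(2)[OF f]])
      (auto simp: abs_le_square_iff[symmetric] intro: AE_I2)
  then show ?thesis using g(1) by (simp add: square_integrable_def)
qed

lemma square_integrable_mult:
  assumes f: "square_integrable M f" and g: "square_integrable M g"
  shows "integrable M (\<lambda>x. f x * g x)"
proof (rule Bochner_Integration.integrable_bound[where f="\<lambda>x. (f x)\<^sup>2 + (g x)\<^sup>2"])
  have "\<bar>p * q\<bar> \<le> p\<^sup>2 + q\<^sup>2" for p q :: real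
  proof -
    have "0 \<le> \<bar>p\<bar> * \<bar>q\<bar>" by simp
    moreover have "2 * (\<bar>p\<bar> * \<bar>q\<bar>) \<le> p\<^sup>2 + q\<^sup>2" using sum_squares_bound[of "\<bar>p\<bar>" "\<bar>q\<bar>"] by (simp add: mult.assoc)
    ultimately show ?thesis unfolding abs_mult by linarith
  qed
  then show "AE x in M. norm (f x * g x) \<le> norm ((f x)\<^sup>2 + (g x)\<^sup>2)" by (intro AE_I2) simp
  show "(\<lambda>x. f x * g x) \<in> borel_measurable M"
    using square_integrableD(1)[OF f] square_integrableD(1)[OF g] by (rule borel_measurable_times)
qed (use f g in \<open>simp add: square_integrable_def\<close>)

lemma square_integrable_cmult: "square_integrable M f \<Longrightarrow> square_integrable M (\<lambda>x. c * f x)"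
  unfolding square_integrable_def by (auto simp: power_mult_distrib)

lemma square_integrable_add:
  assumes f: "square_integrable M f" and g: "square_integrable M g"
  shows "square_integrable M (\<lambda>x. f x + g x)"
  using square_integrableD[OF f] square_integrableD[OF g] square_integrable_mult[OF f g]
  unfolding square_integrable_def power2_sum by (auto simp: mult.assoc)

lemma square_integrable_diff:
  "square_integrable M f \<Longrightarrow> square_integrable M g \<Longrightarrow> square_integrable M (\<lambda>x. f x - g x)"
  using square_integrable_add[of M f "\<lambda>x. - 1 * g x"] square_integrable_cmult[of M g "- 1"] by simp

lemma (in finite_measure) square_integrable_const: "square_integrable M (\<lambda>_. c)"
  by (simp add: square_integrable_def)

lemma (in finite_measure) square_integrable_imp_integrable: "square_integrable M f \<Longrightarrow> integrable M f"
  using square_integrable_mult[OF _ square_integrable_const[of 1], of f] by simp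

lemma square_add_le: "(p + q)\<^sup>2 \<le> 2 * p\<^sup>2 + 2 * q\<^sup>2" for p q :: real
  using zero_le_power2[of "p - q"] by (simp add: power2_sum power2_diff)

lemma integral_square_add_le:
  assumes f: "square_integrable M f" and g: "square_integrable M g"
  shows "(\<integral>x. (f x + g x)\<^sup>2 \<partial>M) \<le> 2 * (\<integral>x. (f x)\<^sup>2 \<partial>M) + 2 * (\<integral>x. (g x)\<^sup>2 \<partial>M)"
proof -
  have "(\<integral>x. (f x + g x)\<^sup>2 \<partial>M) \<le> (\<integral>x. 2 * (f x)\<^sup>2 + 2 * (g x)\<^sup>2 \<partial>M)"
    using square_integrableD(2)[OF square_integrable_add[OF f g]] square_integrableD(2)[OF f] square_integrableD(2)[OF g]
    by (intro integral_mono square_add_le) auto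
  then show ?thesis using square_integrableD(2)[OF f] square_integrableD(2)[OF g] by simp
qed

lemma square_perturbation:
  fixes p q t :: real
  assumes t: "0 < t"
  shows "\<bar>(p + q)\<^sup>2 - p\<^sup>2\<bar> \<le> t * p\<^sup>2 + (1 / t + 1) * q\<^sup>2"
proof -
  have "2 * t * (\<bar>p\<bar> * \<bar>q\<bar>) \<le> t\<^sup>2 * p\<^sup>2 + q\<^sup>2"
    using zero_le_power2[of "t * \<bar>p\<bar> - \<bar>q\<bar>"] by (simp add: power2_diff power_mult_distrib algebra_simps)
  then have "2 * \<bar>p * q\<bar> \<le> t * p\<^sup>2 + 1 / t * q\<^sup>2"
    using t by (simp add: abs_mult field_simps power2_eq_square)
  moreover have "\<bar>(p + q)\<^sup>2 - p\<^sup>2\<bar> \<le> 2 * \<bar>p * q\<bar> + q\<^sup>2"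
    using abs_triangle_ineq[of "2 * (p * q)" "q\<^sup>2"] by (simp add: power2_sum abs_mult)
  ultimately show ?thesis by (simp add: distrib_right)
qed

lemma integral_square_perturbation:
  assumes g: "square_integrable M g" and d: "square_integrable M d" and t: "0 < t"
  shows "\<bar>(\<integral>x. (g x + d x)\<^sup>2 \<partial>M) - (\<integral>x. (g x)\<^sup>2 \<partial>M)\<bar> \<le> t * (\<integral>x. (g x)\<^sup>2 \<partial>M) + (1 / t + 1) * (\<integral>x. (d x)\<^sup>2 \<partial>M)"
proof -
  note int = square_integrableD(2)[OF g] square_integrableD(2)[OF d] square_integrableD(2)[OF square_integrable_add[OF g d]]
  have "\<bar>(\<integral>x. (g x + d x)\<^sup>2 \<partial>M) - (\<integral>x. (g x)\<^sup>2 \<partial>M)\<bar> \<le> (\<integral>x. \<bar>(g x + d x)\<^sup>2 - (g x)\<^sup>2\<bar> \<partial>M)"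
    using integral_abs_bound[of M "\<lambda>x. (g x + d x)\<^sup>2 - (g x)\<^sup>2"] int by simp
  also have "... \<le> (\<integral>x. t * (g x)\<^sup>2 + (1 / t + 1) * (d x)\<^sup>2 \<partial>M)"
    using int square_perturbation[OF t] by (intro integral_mono) auto
  finally show ?thesis using int by simp
qed

lemma mean_square_perturbation:
  assumes g: "\<And>n. square_integrable M (g n)" and d: "\<And>n. square_integrable M (d n)" and C: "\<And>n. (\<integral>x. (d n x)\<^sup>2 \<partial>M) \<le> C"
    and lim: "(\<lambda>n. 1 / real n * (\<integral>x. (g n x)\<^sup>2 \<partial>M)) \<longlonglongrightarrow> s"
  shows "(\<lambda>n. 1 / real n * (\<integral>x. (g n x + d n x)\<^sup>2 \<partial>M)) \<longlonglongrightarrow> s"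
proof -
  define A where "A n = 1 / real n * (\<integral>x. (g n x + d n x)\<^sup>2 \<partial>M)" for n
  define Q where "Q n = 1 / real n * (\<integral>x. (g n x)\<^sup>2 \<partial>M)" for n
  define t where "t n = sqrt (1 / real n)" for n
  have "norm (A n - Q n) \<le> t n * Q n + (t n + 1 / real n) * C" if n: "n \<ge> 1" for n
  proof -
    have t: "0 < t n" "1 / real n = t n * t n" using n by (auto simp: t_def)
    have "(1 / t n + 1) * (\<integral>x. (d n x)\<^sup>2 \<partial>M) \<le> (1 / t n + 1) * C" using C[of n] t(1) by (intro mult_left_mono) auto
    then have "\<bar>(\<integral>x. (g n x + d n x)\<^sup>2 \<partial>M) - (\<integral>x. (g n x)\<^sup>2 \<partial>M)\<bar> \<le> t n * (\<integral>x. (g n x)\<^sup>2 \<partial>M) + (1 / t n + 1) * C"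
      using integral_square_perturbation[OF g[of n] d[of n] t(1)] by linarith
    then have "1 / real n * \<bar>(\<integral>x. (g n x + d n x)\<^sup>2 \<partial>M) - (\<integral>x. (g n x)\<^sup>2 \<partial>M)\<bar> \<le>
        1 / real n * (t n * (\<integral>x. (g n x)\<^sup>2 \<partial>M) + (1 / t n + 1) * C)" by (rule mult_left_mono) simp
    also have "... = t n * Q n + (t n + 1 / real n) * C"
      unfolding Q_def distrib_left using t by (simp add: algebra_simps)
    finally show ?thesis unfolding A_def Q_def right_diff_distrib[symmetric] by (simp add: abs_mult)
  qed
  then have bound: "\<forall>\<^sub>F n in sequentially. norm (A n - Q n) \<le> t n * Q n + (t n + 1 / real n) * C"
    by (auto simp: eventually_sequentially)
  have "t \<longlonglongrightarrow> 0" using tendsto_real_sqrt[OF lim_1_over_n] unfolding t_def[abs_def] by simp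
  then have "(\<lambda>n. t n * Q n + (t n + 1 / real n) * C) \<longlonglongrightarrow> 0 * s + (0 + 0) * C"
    using lim unfolding Q_def[abs_def, symmetric] by (intro tendsto_intros lim_1_over_n)
  then have "(\<lambda>n. A n - Q n) \<longlonglongrightarrow> 0" by (intro Lim_null_comparison[OF bound]) simp
  then have "(\<lambda>n. (A n - Q n) + Q n) \<longlonglongrightarrow> 0 + s" using lim unfolding Q_def[abs_def, symmetric] by (rule tendsto_add)
  then show ?thesis unfolding A_def[abs_def] by simp
qed

context invariant_shift
begin

lemma square_integrable_funpow_shift:
  assumes f: "square_integrable m f"
  shows "square_integrable m (\<lambda>x. f ((shift ^^ k) x))"
    and "(\<integral>x. (f ((shift ^^ k) x))\<^sup>2 \<partial>m) = (\<integral>x. (f x)\<^sup>2 \<partial>m)"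
proof -
  have "(\<lambda>x. f ((shift ^^ k) x)) \<in> borel_measurable m"
    using borel_measurable_integrable[OF integrable_funpow_shift[OF square_integrable_imp_integrable[OF f]]] .
  then show "square_integrable m (\<lambda>x. f ((shift ^^ k) x))"
    using integrable_funpow_shift[OF square_integrableD(2)[OF f], of k] by (simp add: square_integrable_def)
  show "(\<integral>x. (f ((shift ^^ k) x))\<^sup>2 \<partial>m) = (\<integral>x. (f x)\<^sup>2 \<partial>m)"
    by (rule integral_funpow_shift[OF borel_measurable_integrable[OF square_integrableD(2)[OF f]]])
qed

lemmas square_integrable_shift = square_integrable_funpow_shift[of _ 1, simplified]

lemma square_integrable_birkhoff: "square_integrable m f \<Longrightarrow> square_integrable m (birkhoff f n)"
proof (induction n)
  case (Suc n)
  then show ?case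
    using square_integrable_add[OF Suc.IH[OF Suc.prems] square_integrable_funpow_shift(1)[OF Suc.prems]]
    by (simp add: birkhoff_Suc[abs_def])
qed (simp add: birkhoff_0[abs_def] square_integrable_const)

definition martingale_difference :: "((nat \<Rightarrow> 'a) \<Rightarrow> real) \<Rightarrow> bool" where
  "martingale_difference M \<longleftrightarrow> square_integrable m M \<and>
    (\<forall>F. square_integrable m F \<longrightarrow> (\<integral>x. M x * F (shift x) \<partial>m) = 0)"

lemma integral_martingale_difference: "martingale_difference M \<Longrightarrow> (\<integral>x. M x \<partial>m) = 0"
  unfolding martingale_difference_def using square_integrable_const[of 1] by fastforce

lemma integral_square_birkhoff:
  assumes M: "martingale_difference M"
  shows "(\<integral>x. (birkhoff M n x)\<^sup>2 \<partial>m) = real n * (\<integral>x. (M x)\<^sup>2 \<partial>m)"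
proof (induction n)
  case (Suc n)
  have sq: "square_integrable m M" using M by (simp add: martingale_difference_def)
  note birkhoff_sq = square_integrable_birkhoff[OF sq, of n]
  note shifted = square_integrable_shift[OF birkhoff_sq]
  have "(\<integral>x. (birkhoff M (Suc n) x)\<^sup>2 \<partial>m) =
      (\<integral>x. (M x)\<^sup>2 + (birkhoff M n (shift x))\<^sup>2 + 2 * (M x * birkhoff M n (shift x)) \<partial>m)"
    unfolding birkhoff_Suc_shift power2_sum by (simp add: mult.assoc)
  also have "... = (\<integral>x. (M x)\<^sup>2 \<partial>m) + (\<integral>x. (birkhoff M n (shift x))\<^sup>2 \<partial>m) + 2 * (\<integral>x. M x * birkhoff M n (shift x) \<partial>m)"
    using square_integrableD(2)[OF sq] square_integrableD(2)[OF shifted(1)] square_integrable_mult[OF sq shifted(1)] by simp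
  also have "(\<integral>x. M x * birkhoff M n (shift x) \<partial>m) = 0"
    using M birkhoff_sq by (simp add: martingale_difference_def)
  finally show ?case using shifted(2) Suc by (simp add: distrib_right)
qed simp

lemma integral_square_coboundary_le:
  assumes r: "square_integrable m r"
  shows "(\<integral>x. (r x - r ((shift ^^ n) x))\<^sup>2 \<partial>m) \<le> 4 * (\<integral>x. (r x)\<^sup>2 \<partial>m)"
  using integral_square_add_le[OF r square_integrable_cmult[OF square_integrable_funpow_shift(1)[OF r, of n], of "- 1"]]
    square_integrable_funpow_shift(2)[OF r, of n] by simp

lemma birkhoff_cohomologous:
  assumes f: "\<And>x. x \<in> sigma_plus E \<Longrightarrow> f x = g x + c + (r x - r (shift x))" and x: "x \<in> sigma_plus E"
  shows "birkhoff f n x = birkhoff g n x + real n * c + (r x - r ((shift ^^ n) x))"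
proof (induction n)
  case (Suc n)
  have "(shift ^^ n) x \<in> sigma_plus E" using x by auto
  from f[OF this] show ?case using Suc by (simp add: birkhoff_Suc distrib_right)
qed simp

lemma asymp_var_martingale_coboundary:
  assumes M: "martingale_difference M" and r: "square_integrable m r"
    and f: "\<And>x. x \<in> sigma_plus E \<Longrightarrow> f x = M x + c + (r x - r (shift x))"
  shows "asymp_var m f = (\<integral>x. (M x)\<^sup>2 \<partial>m)"
proof -
  have sq: "square_integrable m M" using M by (simp add: martingale_difference_def)
  define d where "d n x = r x - r ((shift ^^ n) x)" for n x
  have d: "square_integrable m (d n)" for n
    unfolding d_def[abs_def] by (intro square_integrable_diff r square_integrable_funpow_shift(1))
  have "(\<integral>x. d n x \<partial>m) = 0" for n
    unfolding d_def using integral_funpow_shift[of r n] square_integrableD(1)[OF r] r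
      square_integrable_funpow_shift(1)[OF r, of n] by (simp add: square_integrable_imp_integrable)
  note birkhoff_f = birkhoff_cohomologous[of f M c r, OF f]
  have mean: "(\<integral>x. birkhoff f n x \<partial>m) = real n * c" for n
  proof -
    have "(\<integral>x. birkhoff f n x \<partial>m) = (\<integral>x. birkhoff M n x + real n * c + d n x \<partial>m)"
      using birkhoff_f by (intro Bochner_Integration.integral_cong) (auto simp: d_def)
    also have "... = real n * (\<integral>x. M x \<partial>m) + real n * c + (\<integral>x. d n x \<partial>m)"
      using integral_birkhoff[OF square_integrable_imp_integrable[OF sq], of n] square_integrable_imp_integrable[OF d[of n]]
        prob_space by simp
    finally show ?thesis using \<open>\<And>n. (\<integral>x. d n x \<partial>m) = 0\<close> integral_martingale_difference[OF M] by simp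
  qed
  have "(\<integral>x. (birkhoff f n x - (\<integral>y. birkhoff f n y \<partial>m))\<^sup>2 \<partial>m) = (\<integral>x. (birkhoff M n x + d n x)\<^sup>2 \<partial>m)" for n
    unfolding mean by (intro Bochner_Integration.integral_cong) (simp_all add: birkhoff_f d_def)
  moreover have "(\<lambda>n. 1 / real n * (\<integral>x. (birkhoff M n x + d n x)\<^sup>2 \<partial>m)) \<longlonglongrightarrow> (\<integral>x. (M x)\<^sup>2 \<partial>m)"
  proof (rule mean_square_perturbation[OF square_integrable_birkhoff[OF sq] d])
    show "(\<integral>x. (d n x)\<^sup>2 \<partial>m) \<le> 4 * (\<integral>x. (r x)\<^sup>2 \<partial>m)" for n
      unfolding d_def by (rule integral_square_coboundary_le[OF r])
    have "\<forall>\<^sub>F n in sequentially. (\<integral>x. (M x)\<^sup>2 \<partial>m) = 1 / real n * (\<integral>x. (birkhoff M n x)\<^sup>2 \<partial>m)"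
      using eventually_gt_at_top[of 0] by eventually_elim (simp add: integral_square_birkhoff[OF M])
    then show "(\<lambda>n. 1 / real n * (\<integral>x. (birkhoff M n x)\<^sup>2 \<partial>m)) \<longlonglongrightarrow> (\<integral>x. (M x)\<^sup>2 \<partial>m)"
      by (rule Lim_transform_eventually[OF tendsto_const])
  qed
  ultimately show ?thesis unfolding asymp_var_def by (simp add: limI)
qed

end

context normalised_shift
begin

lemma square_integrable_weight: "square_integrable m weight"
  using weight_measurable weight_square_integrable by (simp add: square_integrable_def)

lemma square_integrable_le_weight:
  assumes f: "shift_continuous E f" and C: "0 \<le> C" "\<And>x. x \<in> X \<Longrightarrow> \<bar>f x\<bar> \<le> C * weight x"
  shows "square_integrable m f" "(\<integral>x. (f x)\<^sup>2 \<partial>m) \<le> C\<^sup>2 * (\<integral>x. (weight x)\<^sup>2 \<partial>m)"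
proof -
  have le: "\<bar>f x\<bar> \<le> \<bar>C * weight x\<bar>" if "x \<in> X" for x using C(2)[OF that] by linarith
  have "f \<in> borel_measurable m"
    unfolding measurable_m by (rule borel_measurable_shift_continuous[OF f])
  then show square_f: "square_integrable m f"
    using le by (intro square_integrable_bound[OF square_integrable_cmult[OF square_integrable_weight]]) auto
  have "(\<integral>x. (f x)\<^sup>2 \<partial>m) \<le> (\<integral>x. (C * weight x)\<^sup>2 \<partial>m)"
    using le square_integrableD(2)[OF square_f] square_integrableD(2)[OF square_integrable_cmult[OF square_integrable_weight]]
    by (intro integral_mono) (auto simp: abs_le_square_iff)
  then show "(\<integral>x. (f x)\<^sup>2 \<partial>m) \<le> C\<^sup>2 * (\<integral>x. (weight x)\<^sup>2 \<partial>m)" by (simp add: power_mult_distrib)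
qed

lemma martingale_difference_transfer:
  assumes v: "square_integrable m v" and u: "square_integrable m u" and Tv: "\<And>x. x \<in> X \<Longrightarrow> transfer UNIV v x = u x"
  shows "martingale_difference (\<lambda>x. v x - u (shift x))"
  unfolding martingale_difference_def
proof (intro conjI allI impI)
  show "square_integrable m (\<lambda>x. v x - u (shift x))"
    by (intro square_integrable_diff v square_integrable_shift(1)[OF u])
  fix F assume F: "square_integrable m F"
  note vF = square_integrable_mult[OF v square_integrable_shift(1)[OF F]]
  note uF = square_integrable_mult[OF u F]
  have "(\<integral>x. v x * F (shift x) \<partial>m) = (\<integral>x. u x * F x \<partial>m)"
    using Tv transfer_mult_shift[where v=v and F=F] by (intro integral_transfer[symmetric] vF borel_measurable_integrable[OF uF]) simp
  moreover have "(\<integral>x. u (shift x) * F (shift x) \<partial>m) = (\<integral>x. u x * F x \<partial>m)"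
    using integral_funpow_shift[OF borel_measurable_integrable[OF uF], of 1] by simp
  ultimately show "(\<integral>x. (v x - u (shift x)) * F (shift x) \<partial>m) = 0"
    unfolding left_diff_distrib using vF integrable_funpow_shift[OF uF, of 1] by simp
qed

lemma martingale_decomposition_of_poisson:
  assumes psi: "holder K \<psi>" and K: "0 \<le> K" and C: "0 \<le> C" and v: "shift_continuous E v" "\<And>x. x \<in> X \<Longrightarrow> \<bar>v x\<bar> \<le> C * K * weight x"
    and \<kappa>: "\<bar>\<kappa>\<bar> \<le> 2 * K" and Tv: "\<And>x. x \<in> X \<Longrightarrow> transfer UNIV v x = v x - (\<psi> x - \<kappa>)"
  shows "\<exists>u M. shift_continuous E u \<and> shift_continuous E M \<and> square_integrable m u \<and> martingale_difference M \<and>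
    (\<forall>x\<in>X. \<psi> x = M x + \<kappa> + (u x - u (shift x))) \<and>
    (\<integral>x. (M x)\<^sup>2 \<partial>m) \<le> 4 * (C + 3)\<^sup>2 * (\<integral>x. (weight x)\<^sup>2 \<partial>m) * K\<^sup>2"
proof -
  define u where "u x = \<psi> x + (- \<kappa>) + (- 1) * v x" for x
  define M where "M x = v x + u (shift x)" for x
  have u: "shift_continuous E u"
    unfolding u_def[abs_def]
    by (intro shift_continuous_linear v(1) wholder_continuous[OF wholder_add_const[OF wholder_holder[OF psi]]])
  have v_le: "\<bar>v x\<bar> \<le> (C + 3) * K * weight x" and u_le: "\<bar>u x\<bar> \<le> (C + 3) * K * weight x" if x: "x \<in> X" for x
  proof -
    have "K \<le> K * weight x" using mult_left_mono[OF weight_ge_1[OF x] K] by simp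
    moreover have "(C + 3) * K * weight x = C * K * weight x + 3 * (K * weight x)" by (simp add: algebra_simps)
    ultimately show "\<bar>v x\<bar> \<le> (C + 3) * K * weight x" "\<bar>u x\<bar> \<le> (C + 3) * K * weight x"
      using v(2)[OF x] holder_bound[OF psi x] \<kappa> K unfolding u_def by linarith+
  qed
  have CK: "0 \<le> (C + 3) * K" using C K by simp
  note v_sq = square_integrable_le_weight[OF v(1) CK v_le] and u_sq = square_integrable_le_weight[OF u CK u_le]
  have "transfer UNIV v x = - 1 * u x" if "x \<in> X" for x
    unfolding Tv[OF that] by (simp add: u_def)
  then have "martingale_difference (\<lambda>x. v x - (- 1) * u (shift x))"
    by (intro martingale_difference_transfer v_sq(1) square_integrable_cmult u_sq(1))
  then have "martingale_difference M" by (simp add: M_def[abs_def])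
  moreover have "shift_continuous E M"
    using shift_continuous_linear[OF v(1) shift_continuous_shift[OF u], of 1] by (simp add: M_def[abs_def])
  moreover have "\<psi> x = M x + \<kappa> + (u x - u (shift x))" for x by (simp add: M_def u_def)
  moreover have "(\<integral>x. (M x)\<^sup>2 \<partial>m) \<le> 4 * (((C + 3) * K)\<^sup>2 * (\<integral>x. (weight x)\<^sup>2 \<partial>m))"
    using integral_square_add_le[OF v_sq(1) square_integrable_shift(1)[OF u_sq(1)]] v_sq(2) u_sq(2)
      square_integrable_shift(2)[OF u_sq(1)] unfolding M_def by linarith
  then have "(\<integral>x. (M x)\<^sup>2 \<partial>m) \<le> 4 * (C + 3)\<^sup>2 * (\<integral>x. (weight x)\<^sup>2 \<partial>m) * K\<^sup>2"
    by (simp only: power_mult_distrib ac_simps)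
  ultimately show ?thesis using u u_sq(1) by blast
qed

theorem martingale_decomposition:
  "\<exists>C\<ge>0. \<forall>K>0. \<forall>\<psi>. holder K \<psi> \<longrightarrow> (\<exists>u c M. shift_continuous E u \<and> shift_continuous E M \<and> square_integrable m u \<and>
    martingale_difference M \<and> (\<forall>x\<in>X. \<psi> x = M x + c + (u x - u (shift x))) \<and> (\<integral>x. (M x)\<^sup>2 \<partial>m) \<le> C * K\<^sup>2)"
proof -
  obtain C where C: "0 \<le> C" and poisson: "\<And>K \<psi>. 0 < K \<Longrightarrow> holder K \<psi> \<Longrightarrow> \<exists>v \<kappa>. shift_continuous E v \<and>
      (\<forall>x\<in>X. \<bar>v x\<bar> \<le> C * K * weight x) \<and> \<bar>\<kappa>\<bar> \<le> 2 * K \<and> (\<forall>x\<in>X. transfer UNIV v x = v x - (\<psi> x - \<kappa>))"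
    using poisson_equation by blast
  have "\<exists>u c M. shift_continuous E u \<and> shift_continuous E M \<and> square_integrable m u \<and>
      martingale_difference M \<and> (\<forall>x\<in>X. \<psi> x = M x + c + (u x - u (shift x))) \<and>
      (\<integral>x. (M x)\<^sup>2 \<partial>m) \<le> 4 * (C + 3)\<^sup>2 * (\<integral>x. (weight x)\<^sup>2 \<partial>m) * K\<^sup>2"
    if K: "0 < K" and psi: "holder K \<psi>" for K \<psi>
  proof -
    obtain v \<kappa> where "shift_continuous E v" "\<And>x. x \<in> X \<Longrightarrow> \<bar>v x\<bar> \<le> C * K * weight x" "\<bar>\<kappa>\<bar> \<le> 2 * K"
      "\<And>x. x \<in> X \<Longrightarrow> transfer UNIV v x = v x - (\<psi> x - \<kappa>)"
      using poisson[OF K psi] by blast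
    from martingale_decomposition_of_poisson[OF psi less_imp_le[OF K] C this] show ?thesis by blast
  qed
  moreover have "0 \<le> 4 * (C + 3)\<^sup>2 * (\<integral>x. (weight x)\<^sup>2 \<partial>m)"
    by (intro mult_nonneg_nonneg Bochner_Integration.integral_nonneg) auto
  ultimately show ?thesis by blast
qed

lemma square_integrable_transfer_function:
  assumes r: "shift_continuous E r" and bounded: "\<And>x. x \<in> X \<Longrightarrow> \<bar>r x - r (shift x)\<bar> \<le> K"
  shows "square_integrable m r"
proof -
  obtain C where "0 \<le> C" "\<And>x. x \<in> X \<Longrightarrow> \<bar>r x\<bar> \<le> C * weight x" using coboundary_le_weight[OF r bounded] by blast
  then show ?thesis by (rule square_integrable_le_weight(1)[OF r])
qed

theorem asymp_sd_coboundary: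
  assumes psi: "holder K \<psi>" and r: "shift_continuous E r" and eq: "\<And>x. x \<in> X \<Longrightarrow> \<psi> x = r x - r (shift x) + c"
  shows "asymp_sd m \<psi> = 0"
proof -
  have "\<bar>r x - r (shift x)\<bar> \<le> K + \<bar>c\<bar>" if "x \<in> X" for x using holder_bound[OF psi that] eq[OF that] by linarith
  then have "square_integrable m r" by (rule square_integrable_transfer_function[OF r])
  moreover have "martingale_difference (\<lambda>_. 0)" by (simp add: martingale_difference_def square_integrable_const)
  ultimately have "asymp_var m \<psi> = (\<integral>x. 0\<^sup>2 \<partial>m)" using eq by (intro asymp_var_martingale_coboundary[of _ r _ c]) auto
  then show ?thesis by (simp add: asymp_sd_def)
qed

theorem asymp_sd_zero_imp_coboundary:
  assumes psi: "holder K \<psi>" and zero: "asymp_sd m \<psi> = 0"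
  shows "\<exists>r c. shift_continuous E r \<and> (\<forall>x\<in>X. \<psi> x = r x - r (shift x) + c)"
proof -
  have "holder (max 1 K) \<psi>" by (rule holder_mono[OF psi]) simp
  moreover have "0 < max 1 K" by simp
  ultimately obtain u c M where u: "shift_continuous E u" "square_integrable m u"
    and M: "shift_continuous E M" "martingale_difference M" and eq: "\<And>x. x \<in> X \<Longrightarrow> \<psi> x = M x + c + (u x - u (shift x))"
    using martingale_decomposition by blast
  have "(\<integral>x. (M x)\<^sup>2 \<partial>m) = 0"
    using zero asymp_var_martingale_coboundary[OF M(2) u(2) eq] by (simp add: asymp_sd_def)
  moreover have "integrable m (\<lambda>x. (M x)\<^sup>2)" using M(2) by (simp add: martingale_difference_def square_integrable_def)
  ultimately have "AE x in m. M x = 0" by (subst (asm) integral_nonneg_eq_0_iff_AE) auto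
  then have "M x = 0" if "x \<in> X" for x using AE_zero_continuous[OF M(1) _ that] by blast
  then show ?thesis using eq u(1) by (intro exI[of _ u] exI[of _ c]) auto
qed

theorem asymp_sd_cohomologous:
  assumes psi: "holder K \<psi>" and psi': "holder K' \<psi>'" and r: "shift_continuous E r"
    and eq: "\<And>x. x \<in> X \<Longrightarrow> \<psi> x - \<psi>' x = r x - r (shift x) + c"
  shows "asymp_sd m \<psi> = asymp_sd m \<psi>'"
proof -
  have "holder (max 1 K') \<psi>'" by (rule holder_mono[OF psi']) simp
  moreover have "0 < max 1 K'" by simp
  ultimately obtain u c' M where u: "square_integrable m u" and M: "martingale_difference M"
    and eq': "\<And>x. x \<in> X \<Longrightarrow> \<psi>' x = M x + c' + (u x - u (shift x))"
    using martingale_decomposition by blast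
  have "\<bar>r x - r (shift x)\<bar> \<le> K + K' + \<bar>c\<bar>" if "x \<in> X" for x
    using holder_bound[OF psi that] holder_bound[OF psi' that] eq[OF that] by linarith
  then have "square_integrable m r" by (rule square_integrable_transfer_function[OF r])
  from square_integrable_add[OF u this] have "asymp_var m \<psi> = (\<integral>x. (M x)\<^sup>2 \<partial>m)"
  proof (rule asymp_var_martingale_coboundary[OF M])
    show "\<psi> x = M x + (c' + c) + ((u x + r x) - (u (shift x) + r (shift x)))" if "x \<in> X" for x
      using eq[OF that] eq'[OF that] by linarith
  qed
  then show ?thesis using asymp_var_martingale_coboundary[OF M u eq'] by (simp add: asymp_sd_def)
qed

theorem asymp_sd_bounded: "\<exists>C\<ge>0. \<forall>K\<ge>0. \<forall>\<psi>. holder K \<psi> \<longrightarrow> asymp_sd m \<psi> \<le> C * K"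
proof -
  obtain C where C: "0 \<le> C" and decomposition: "\<And>K \<psi>. 0 < K \<Longrightarrow> holder K \<psi> \<Longrightarrow> \<exists>u c M. square_integrable m u \<and>
      martingale_difference M \<and> (\<forall>x\<in>X. \<psi> x = M x + c + (u x - u (shift x))) \<and> (\<integral>x. (M x)\<^sup>2 \<partial>m) \<le> C * K\<^sup>2"
    using martingale_decomposition by meson
  have bound: "asymp_sd m \<psi> \<le> sqrt C * K" if K: "0 < K" and psi: "holder K \<psi>" for K \<psi>
  proof -
    obtain u c M where "square_integrable m u" "martingale_difference M" "\<And>x. x \<in> X \<Longrightarrow> \<psi> x = M x + c + (u x - u (shift x))"
      and "(\<integral>x. (M x)\<^sup>2 \<partial>m) \<le> C * K\<^sup>2" using decomposition[OF K psi] by blast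
    then have "asymp_var m \<psi> \<le> C * K\<^sup>2" using asymp_var_martingale_coboundary[of M u \<psi> c] by simp
    then have "asymp_sd m \<psi> \<le> sqrt (C * K\<^sup>2)" by (simp add: asymp_sd_def)
    then show ?thesis using K by (simp add: real_sqrt_mult)
  qed
  have "asymp_sd m \<psi> \<le> sqrt C * K" if K: "0 \<le> K" and psi: "holder K \<psi>" for K \<psi>
  proof (rule LIMSEQ_le_const)
    have "(\<lambda>n. sqrt C * (K + 1 / real n)) \<longlonglongrightarrow> sqrt C * (K + 0)" by (intro tendsto_intros lim_1_over_n)
    then show "(\<lambda>n. sqrt C * (K + 1 / real n)) \<longlonglongrightarrow> sqrt C * K" by simp
    have "asymp_sd m \<psi> \<le> sqrt C * (K + 1 / real n)" if "1 \<le> n" for n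
      using K that holder_mono[OF psi, of "K + 1 / real n"] by (intro bound) (auto intro: add_nonneg_pos)
    then show "\<exists>N. \<forall>n\<ge>N. asymp_sd m \<psi> \<le> sqrt C * (K + 1 / real n)" by blast
  qed
  then show ?thesis using C by (intro exI[of _ "sqrt C"]) auto
qed

end

lemma (in markov_shift) in_H_imp_holder:
  assumes H: "in_H E \<beta> \<psi>" and \<beta>: "0 < \<beta>" "exp (- \<beta>) \<le> \<theta>"
  shows "holder (H_norm E \<beta> \<psi>) \<psi>" "0 \<le> H_norm E \<beta> \<psi>"
proof -
  define S where "S = Sup (insert 0 (sup_part E \<psi>))"
  define L where "L = Sup (insert 0 (hol_part E \<beta> \<psi>))"
  have bdd: "bdd_above (insert 0 (sup_part E \<psi>))" "bdd_above (insert 0 (hol_part E \<beta> \<psi>))"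
    using H by (auto simp: in_H_def)
  have nonneg: "0 \<le> S" "0 \<le> L" unfolding S_def L_def using bdd by (auto intro: cSup_upper)
  have S: "\<bar>\<psi> x\<bar> \<le> S" if "x \<in> X" for x
    unfolding S_def using bdd(1) that by (intro cSup_upper) (auto simp: sup_part_def)
  have L: "\<bar>\<psi> x - \<psi> y\<bar> \<le> L * \<theta> ^ n" if xy: "x \<in> X" "y \<in> X" "agree n x y" for x y n
  proof (cases "x = y")
    case False
    define t where "t = sep_time x y"
    have t: "n \<le> t" unfolding t_def by (rule le_sep_time_of_agree[OF False xy(3)])
    have "\<bar>\<psi> x - \<psi> y\<bar> * exp (\<beta> * real t) \<le> L"
      unfolding L_def t_def using bdd(2) xy False by (intro cSup_upper) (auto simp: hol_part_def)
    then have "\<bar>\<psi> x - \<psi> y\<bar> \<le> L * exp (- \<beta>) ^ t"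
      by (simp add: exp_of_nat_mult[symmetric] exp_minus field_simps)
    also have "... \<le> L * \<theta> ^ t" using \<beta> nonneg by (intro mult_left_mono power_mono) auto
    also have "... \<le> L * \<theta> ^ n" using t theta nonneg by (intro mult_left_mono power_decreasing) auto
    finally show ?thesis .
  qed (use nonneg theta in simp)
  have norm: "H_norm E \<beta> \<psi> = S + L" by (simp add: H_norm_def S_def L_def)
  have "\<bar>\<psi> x - \<psi> y\<bar> \<le> (S + L) * \<theta> ^ n" if "x \<in> X" "y \<in> X" "agree n x y" for x y n
    using L[OF that] nonneg(1) theta_pow(1)[of n] by (simp add: distrib_right add_increasing)
  then show "holder (H_norm E \<beta> \<psi>) \<psi>"
    unfolding holder_def norm using S nonneg(2) by (auto intro: add_increasing2)
  show "0 \<le> H_norm E \<beta> \<psi>" unfolding norm using nonneg by simp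
qed

section \<open>Asymptotic variance of equilibrium measures\<close>

lemma (in markov_shift) weakly_holder_imp_wholder:
  assumes "weakly_holder E \<theta> f" shows "\<exists>B\<ge>0. wholder B f"
proof -
  obtain A where "wholder A f" using assms unfolding weakly_holder_def wholder_def agree_def by blast
  then show ?thesis by (intro exI[of _ "max A 0"]) (auto intro: wholder_mono)
qed

lemma (in equilibrium_shift) normalised_shift_exists: "\<exists>h. normalised_shift E \<theta> \<phi> a B P m h"
proof (rule harmonic_function)
  fix h
  assume "\<And>x. x \<in> X \<Longrightarrow> h x > 0" "log_lip X (invariant_const B) (\<lambda>x. ennreal (h x))"
    "\<And>x. x \<in> X \<Longrightarrow> ruelle E \<phi>\<^sub>0 UNIV (\<lambda>x. ennreal (h x)) x = ennreal (h x)"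
    "\<And>x. x \<in> X \<Longrightarrow> induced \<phi>\<^sub>0 a (\<lambda>x. ennreal (h x)) x = ennreal (h x)"
  then have "normalised_shift E \<theta> \<phi> a B P m h" by unfold_locales auto
  then show ?thesis by blast
qed

theorem SPR_equilibrium_normalised_shift:
  assumes mix: "mixing E" and fin_ent: "\<exists>a. gurevich_pressure E (\<lambda>_. 0) a < \<infinity>" and theta: "0 < \<theta>" "\<theta> < 1"
    and hol: "weakly_holder E \<theta> \<phi>" and spr: "SPR E \<phi>" and supfin: "bdd_above (\<phi> ` sigma_plus E)"
    and eq: "equilibrium_measure E \<phi> m"
  shows "\<exists>a B P h. normalised_shift E \<theta> \<phi> a B P m h"
proof -
  interpret markov_shift E \<theta> using mix theta by unfold_locales (auto simp: mixing_def)
  obtain B where phi: "0 \<le> B" "wholder B \<phi>" using weakly_holder_imp_wholder[OF hol] by blast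
  obtain a where a: "limsup (\<lambda>n. eln (Zn_star E \<phi> a n) / ereal (real n)) < gurevich_pressure E \<phi> a"
    using spr unfolding SPR_def by blast
  obtain K where "\<And>x. x \<in> X \<Longrightarrow> \<phi> x \<le> K" using supfin unfolding bdd_above_def by blast
  then have "gurevich_pressure E \<phi> a < \<infinity>" using gurevich_pressure_less_infinity[OF phi(2,1)] fin_ent by blast
  then obtain P where P: "gurevich_pressure E \<phi> a = ereal P" using a by (cases "gurevich_pressure E \<phi> a") auto
  have "invariant_prob E m" using eq by (simp add: equilibrium_measure_def)
  then have "equilibrium_shift E \<theta> \<phi> a B P m" using phi P a eq fin_ent supfin by unfold_locales auto
  then show ?thesis using equilibrium_shift.normalised_shift_exists by blast
qed

theorem theorem3p4:
  fixes E :: "'a::countable \<Rightarrow> 'a \<Rightarrow> bool"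
    and \<phi> :: "(nat \<Rightarrow> 'a) \<Rightarrow> real"
    and \<theta> :: real
    and m :: "(nat \<Rightarrow> 'a) measure"
  assumes mix: "mixing E"
    and fin_ent: "\<exists>a. gurevich_pressure E (\<lambda>_. 0) a < \<infinity>"
    and theta: "0 < \<theta>" "\<theta> < 1"
    and hol: "weakly_holder E \<theta> \<phi>"
    and spr: "SPR E \<phi>"
    and supfin: "bdd_above (\<phi> ` sigma_plus E)"
    and eq: "equilibrium_measure E \<phi> m"
  shows
   "(\<forall>\<beta>>0. exp (- \<beta>) \<le> \<theta> \<longrightarrow>
      (\<forall>\<psi>. in_H E \<beta> \<psi> \<longrightarrow>
         (asymp_sd m \<psi> = 0 \<longleftrightarrow>
          (\<exists>r c. shift_continuous E r \<and>
                 (\<forall>x\<in>sigma_plus E. \<psi> x = r x - r (shift x) + c)))) \<and>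
      (\<forall>\<psi> \<phi>'. in_H E \<beta> \<psi> \<and> in_H E \<beta> \<phi>' \<and>
         (\<exists>r c. shift_continuous E r \<and>
                (\<forall>x\<in>sigma_plus E. \<psi> x - \<phi>' x = r x - r (shift x) + c))
         \<longrightarrow> asymp_sd m \<psi> = asymp_sd m \<phi>')) \<and>
    (\<exists>M>1. \<forall>\<beta>>0. exp (- \<beta>) \<le> \<theta> \<longrightarrow>
       (\<forall>\<psi>. in_H E \<beta> \<psi> \<longrightarrow> asymp_sd m \<psi> \<le> M * H_norm E \<beta> \<psi>))"
proof -
  obtain a B P h where "normalised_shift E \<theta> \<phi> a B P m h"
    using SPR_equilibrium_normalised_shift[OF mix fin_ent theta hol spr supfin eq] by blast
  then interpret normalised_shift E \<theta> \<phi> a B P m h .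
  have "asymp_sd m \<psi> = 0 \<longleftrightarrow> (\<exists>r c. shift_continuous E r \<and> (\<forall>x\<in>X. \<psi> x = r x - r (shift x) + c))"
    if "0 < \<beta>" "exp (- \<beta>) \<le> \<theta>" "in_H E \<beta> \<psi>" for \<beta> \<psi>
    using asymp_sd_zero_imp_coboundary[of _ \<psi>] asymp_sd_coboundary[of _ \<psi>] in_H_imp_holder(1)[OF that(3,1,2)] by blast
  moreover have "asymp_sd m \<psi> = asymp_sd m \<phi>'"
    if "0 < \<beta>" "exp (- \<beta>) \<le> \<theta>" "in_H E \<beta> \<psi>" "in_H E \<beta> \<phi>'"
      "shift_continuous E r" "\<forall>x\<in>X. \<psi> x - \<phi>' x = r x - r (shift x) + c" for \<beta> \<psi> \<phi>' r c
    using asymp_sd_cohomologous[of _ \<psi> _ \<phi>' r c] in_H_imp_holder(1)[of \<beta>, OF _ that(1,2)] that by blast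
  moreover have "\<exists>M>1. \<forall>\<beta>>0. exp (- \<beta>) \<le> \<theta> \<longrightarrow> (\<forall>\<psi>. in_H E \<beta> \<psi> \<longrightarrow> asymp_sd m \<psi> \<le> M * H_norm E \<beta> \<psi>)"
  proof -
    obtain C where C: "0 \<le> C" "\<And>K \<psi>. 0 \<le> K \<Longrightarrow> holder K \<psi> \<Longrightarrow> asymp_sd m \<psi> \<le> C * K"
      using asymp_sd_bounded by blast
    have "asymp_sd m \<psi> \<le> (C + 2) * H_norm E \<beta> \<psi>" if "0 < \<beta>" "exp (- \<beta>) \<le> \<theta>" "in_H E \<beta> \<psi>" for \<beta> \<psi>
      using C(2)[OF in_H_imp_holder(2,1)[OF that(3,1,2)]] in_H_imp_holder(2)[OF that(3,1,2)] by (simp add: distrib_right)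
    then show ?thesis using C(1) by (intro exI[of _ "C + 2"]) auto
  qed
  ultimately show ?thesis by blast
qed

end
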